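(* Let $k$ be a commutative ring and $\beta\in k$. The reduced affine Brauer algebra $aBr_m(\beta)$ is generated by $\tau^{\pm1}$, by $e_i,s_i$ ($1\le i\le m-1$), and by $t_i$ ($1\le i\le m$), subject to the following list of defining relations, where (a)–(d) are the relations of the Brauer algebra $Br_m(\beta)$: (a) $s_i^2=1$; $s_is_j=s_js_i$ for $|i-j|>1$; $s_is_{i+1}s_i=s_{i+1}s_is_{i+1}$; (b) $e_i^2=\beta e_i$; $e_ie_{i\pm1}e_i=e_i$; (c) $e_ie_j=e_je_i$ and $s_ie_j=e_js_i$ for $|i-j|>1$; (d) $s_is_{i\pm1}e_i=e_{i\pm1}e_i$; $e_is_{i\pm1}s_i=e_ie_{i\pm1}$; $s_ie_i=e_is_i=e_i$; (e) $s_it_j=t_js_i$ for $|i-j|>1$; (f) $e_it_j=t_je_i$ for $|i-j|>1$; (g) $t_it_j=t_jt_i$; (h) $s_it_i=t_{i+1}s_i$; (i) $e_it_it_{i+1}=e_i=t_it_{i+1}e_i$; (j) $e_it_i^ae_i=\beta e_i$ for $a\in\mathbb Z$.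
   Context: A reduced affine Brauer $m$-diagram is a partition of the vertex set $\mathbb Z\times\{0,1\}$ (bottom vertices at height $0$, top vertices at height $1$) into blocks of size two, invariant under left and right translation by $m$, and drawn in the strip $\mathbb R\times[0,1]$ without non-contractible loops (horizontal lines). Such a diagram may be viewed as drawn on the cylinder obtained by quotienting the strip by translation by $m$. The algebra $aBr_m(\beta)$ is the $k$-algebra with basis these diagrams; the product $D\cdot D'$ is obtained by stacking $D$ on top of $D'$, identifying the middle vertices, and removing all closed components and all non-contractible loops that arise, each with a factor $\beta$. The generators correspond to the following diagrams (all taken up to translation by $m$; for $s_i,e_i,t_i$ the remaining strands are vertical lines): $s_i$ is the crossing of strands $i$ and $i+1$; $e_i$ joins the two top vertices $i,i+1$ and the two bottom vertices $i,i+1$; $t_i$ joins the bottom vertex $i$ to the top vertex $i+m$, so it increases the winding number of the $i$-th strand by one, and it is an invertible diagram; $\tau$ is the global twist, the invertible diagram joining the bottom vertex $j$ to the top vertex $j+1$ for every $j\in\mathbb Z$.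
   Formalization: The printed list has no relation for τ, so τ would be free (for m=1 this gives k[ℤ∗ℤ] instead of k[ℤ]); the relation τ = t_1 s_1⋯s_{m-1} is added, and the invertibility of τ and of the t_i is written as explicit relations. *)

theory Defs
  imports
    "HOL-Library.Disjoint_Sets"
    "HOL-Library.Poly_Mapping"
    "HOL-Algebra.QuotRing"
    "HOL-Algebra.Module"
begin

section \<open>Reduced affine Brauer diagrams\<close>

text \<open>
  The vertex \<open>(j, h)\<close> has horizontal position \<open>j\<close> and height \<open>h\<close>. Height \<open>0\<close> is the bottom
  and height \<open>1\<close> the top of a diagram; stacked diagrams use the heights \<open>0, 1, 2\<close>.
\<close>

type_synonym vertex = "int \<times> nat"
type_synonym diagram = "vertex set set"

definition translate :: "int \<Rightarrow> vertex \<Rightarrow> vertex" where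
  "translate d = (\<lambda>(j, h). (j + d, h))"

definition affine_diagrams :: "nat \<Rightarrow> diagram set" where
  "affine_diagrams m =
    {D. partition_on (UNIV \<times> {0, 1}) D \<and> (\<forall>B\<in>D. card B = 2) \<and>
        (\<forall>B\<in>D. translate (int m) ` B \<in> D \<and> translate (- int m) ` B \<in> D)}"

definition strand_diagram :: "(int \<Rightarrow> int) \<Rightarrow> diagram" where
  "strand_diagram p = {{(j, 0), (p j, 1)} | j. True}"

definition s_diagram :: "nat \<Rightarrow> nat \<Rightarrow> diagram" where
  "s_diagram m i = strand_diagram (\<lambda>j.
     if int m dvd j - int i then j + 1
     else if int m dvd j - (int i + 1) then j - 1
     else j)"

definition t_diagram :: "nat \<Rightarrow> nat \<Rightarrow> diagram" where
  "t_diagram m i = strand_diagram (\<lambda>j. if int m dvd j - int i then j + int m else j)"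

definition t_inv_diagram :: "nat \<Rightarrow> nat \<Rightarrow> diagram" where
  "t_inv_diagram m i = strand_diagram (\<lambda>j. if int m dvd j - int i then j - int m else j)"

definition tau_diagram :: diagram where
  "tau_diagram = strand_diagram (\<lambda>j. j + 1)"

definition tau_inv_diagram :: diagram where
  "tau_inv_diagram = strand_diagram (\<lambda>j. j - 1)"

definition e_diagram :: "nat \<Rightarrow> nat \<Rightarrow> diagram" where
  "e_diagram m i =
    {{(j, h), (j + 1, h)} | j h. int m dvd j - int i \<and> h \<in> {0, 1}} \<union>
    {{(j, 0), (j, 1)} | j. \<not> int m dvd j - int i \<and> \<not> int m dvd j - (int i + 1)}"

section \<open>Composition of diagrams\<close>

text \<open>
  In the product of \<open>D\<close> and \<open>D'\<close> the diagram \<open>D\<close> is on top: it occupies the heights \<open>1, 2\<close> and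
  \<open>D'\<close> the heights \<open>0, 1\<close>.
\<close>

definition stack :: "diagram \<Rightarrow> diagram \<Rightarrow> diagram" where
  "stack D D' = D' \<union> (\<lambda>B. (\<lambda>(j, h). (j, Suc h)) ` B) ` D"

definition connected_rel :: "diagram \<Rightarrow> diagram \<Rightarrow> (vertex \<times> vertex) set" where
  "connected_rel D D' = {(u, v). \<exists>B\<in>stack D D'. u \<in> B \<and> v \<in> B}\<^sup>*"

definition components :: "diagram \<Rightarrow> diagram \<Rightarrow> vertex set set" where
  "components D D' = {connected_rel D D' `` {v} | v. v \<in> UNIV \<times> {0, 1, 2}}"

definition composite :: "diagram \<Rightarrow> diagram \<Rightarrow> diagram" where
  "composite D D' =
    (\<lambda>C. (\<lambda>(j, h). (j, h div 2)) ` (C \<inter> UNIV \<times> {0, 2})) ` components D D' - {{}}"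

text \<open>
  Components of the stack in the strip that meet only middle vertices cover the loops on the
  cylinder. A loop on the cylinder is an orbit of such components under translation by multiples
  of \<open>m\<close>: a contractible loop is covered by infinitely many closed curves, and a
  non-contractible one by finitely many infinite lines.
\<close>

definition loops :: "nat \<Rightarrow> diagram \<Rightarrow> diagram \<Rightarrow> vertex set set set" where
  "loops m D D' =
    {{translate (d * int m) ` C | d. True} | C. C \<in> components D D' \<and> C \<subseteq> UNIV \<times> {1}}"

section \<open>The reduced affine Brauer algebra\<close>

definition scale :: "'k \<Rightarrow> ('a \<Rightarrow>\<^sub>0 'k) \<Rightarrow> 'a \<Rightarrow>\<^sub>0 'k::comm_ring_1" where
  "scale c x = Poly_Mapping.map ((*) c) x"

definition diagram_mult ::
  "nat \<Rightarrow> 'k \<Rightarrow> (diagram \<Rightarrow>\<^sub>0 'k) \<Rightarrow> (diagram \<Rightarrow>\<^sub>0 'k) \<Rightarrow> diagram \<Rightarrow>\<^sub>0 'k::comm_ring_1" where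
  "diagram_mult m \<beta> x y =
    (\<Sum>D\<in>Poly_Mapping.keys x. \<Sum>D'\<in>Poly_Mapping.keys y.
      Poly_Mapping.single (composite D D')
        (\<beta> ^ card (loops m D D') * Poly_Mapping.lookup x D * Poly_Mapping.lookup y D'))"

definition aBr :: "nat \<Rightarrow> 'k \<Rightarrow> ('k::comm_ring_1, diagram \<Rightarrow>\<^sub>0 'k) module" where
  "aBr m \<beta> =
    \<lparr>carrier = {x. Poly_Mapping.keys x \<subseteq> affine_diagrams m},
     monoid.mult = diagram_mult m \<beta>,
     one = Poly_Mapping.single (strand_diagram (\<lambda>j. j)) 1,
     zero = 0, add = (+), smult = scale\<rparr>"

section \<open>Free associative algebras\<close>

text \<open>
  Words form a monoid under concatenation, written additively so that the product of \<open>\<Rightarrow>\<^sub>0\<close>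
  becomes the product of noncommutative polynomials.
\<close>

instantiation list :: (type) monoid_add
begin

definition zero_list :: "'a list" where "zero_list = []"

definition plus_list :: "'a list \<Rightarrow> 'a list \<Rightarrow> 'a list" where "plus_list xs ys = xs @ ys"

instance by standard (simp_all add: zero_list_def plus_list_def)

end

definition free_algebra :: "'g set \<Rightarrow> ('k::comm_ring_1, 'g list \<Rightarrow>\<^sub>0 'k) module" where
  "free_algebra X =
    \<lparr>carrier = {x. Poly_Mapping.keys x \<subseteq> lists X},
     monoid.mult = (*), one = 1, zero = 0, add = (+), smult = scale\<rparr>"

definition var :: "'g \<Rightarrow> 'g list \<Rightarrow>\<^sub>0 'k::comm_ring_1" where
  "var g = Poly_Mapping.single [g] 1"

section \<open>Generators and relations\<close>

datatype generator =
  Gen_tau | Gen_tau_inv | Gen_e nat | Gen_s nat | Gen_t nat | Gen_t_inv nat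

definition generators :: "nat \<Rightarrow> generator set" where
  "generators m =
    {Gen_tau, Gen_tau_inv} \<union> Gen_e ` {1..<m} \<union> Gen_s ` {1..<m} \<union>
    Gen_t ` {1..m} \<union> Gen_t_inv ` {1..m}"

primrec generator_diagram :: "nat \<Rightarrow> generator \<Rightarrow> diagram" where
  "generator_diagram m Gen_tau = tau_diagram"
| "generator_diagram m Gen_tau_inv = tau_inv_diagram"
| "generator_diagram m (Gen_e i) = e_diagram m i"
| "generator_diagram m (Gen_s i) = s_diagram m i"
| "generator_diagram m (Gen_t i) = t_diagram m i"
| "generator_diagram m (Gen_t_inv i) = t_inv_diagram m i"

type_synonym 'k words = "generator list \<Rightarrow>\<^sub>0 'k"

abbreviation gtau :: "'k::comm_ring_1 words" where "gtau \<equiv> var Gen_tau"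
abbreviation gtau_inv :: "'k::comm_ring_1 words" where "gtau_inv \<equiv> var Gen_tau_inv"
abbreviation ge :: "nat \<Rightarrow> 'k::comm_ring_1 words" where "ge i \<equiv> var (Gen_e i)"
abbreviation gs :: "nat \<Rightarrow> 'k::comm_ring_1 words" where "gs i \<equiv> var (Gen_s i)"
abbreviation gt :: "nat \<Rightarrow> 'k::comm_ring_1 words" where "gt i \<equiv> var (Gen_t i)"
abbreviation gt_inv :: "nat \<Rightarrow> 'k::comm_ring_1 words" where "gt_inv i \<equiv> var (Gen_t_inv i)"

definition gt_powi :: "nat \<Rightarrow> int \<Rightarrow> 'k::comm_ring_1 words" where
  "gt_powi i a = (if a \<ge> 0 then gt i ^ nat a else gt_inv i ^ nat (- a))"

text \<open>
  \<open>far i j\<close> and \<open>adj i j\<close> are the side conditions \<open>|i - j| > 1\<close> and \<open>j = i \<plusminus> 1\<close>. The relations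
  \<open>tau_inv\<close>, \<open>t_inv\<close> say that the generators written as inverses are inverses, and \<open>tau_word\<close>
  expresses the global twist through the other generators; no other relation involves \<open>\<tau>\<close>.
\<close>

abbreviation far :: "nat \<Rightarrow> nat \<Rightarrow> bool" where "far i j \<equiv> \<bar>int i - int j\<bar> > 1"
abbreviation adj :: "nat \<Rightarrow> nat \<Rightarrow> bool" where "adj i j \<equiv> \<bar>int i - int j\<bar> = 1"

inductive relation :: "nat \<Rightarrow> 'k \<Rightarrow> 'k words \<Rightarrow> 'k::comm_ring_1 words \<Rightarrow> bool"
  for m :: nat and \<beta> :: 'k where
  tau_inv_right: "relation m \<beta> (gtau * gtau_inv) 1"
| tau_inv_left: "relation m \<beta> (gtau_inv * gtau) 1"
| t_inv_right: "i \<in> {1..m} \<Longrightarrow> relation m \<beta> (gt i * gt_inv i) 1"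
| t_inv_left: "i \<in> {1..m} \<Longrightarrow> relation m \<beta> (gt_inv i * gt i) 1"
| tau_word: "relation m \<beta> gtau (gt 1 * prod_list (map gs [1..<m]))"
| a_square: "i \<in> {1..<m} \<Longrightarrow> relation m \<beta> (gs i ^ 2) 1"
| a_comm: "i \<in> {1..<m} \<Longrightarrow> j \<in> {1..<m} \<Longrightarrow> far i j \<Longrightarrow> relation m \<beta> (gs i * gs j) (gs j * gs i)"
| a_braid: "i \<in> {1..<m} \<Longrightarrow> i + 1 \<in> {1..<m} \<Longrightarrow>
    relation m \<beta> (gs i * gs (i + 1) * gs i) (gs (i + 1) * gs i * gs (i + 1))"
| b_square: "i \<in> {1..<m} \<Longrightarrow> relation m \<beta> (ge i ^ 2) (scale \<beta> (ge i))"
| b_adj: "i \<in> {1..<m} \<Longrightarrow> j \<in> {1..<m} \<Longrightarrow> adj i j \<Longrightarrow> relation m \<beta> (ge i * ge j * ge i) (ge i)"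
| c_ee: "i \<in> {1..<m} \<Longrightarrow> j \<in> {1..<m} \<Longrightarrow> far i j \<Longrightarrow> relation m \<beta> (ge i * ge j) (ge j * ge i)"
| c_se: "i \<in> {1..<m} \<Longrightarrow> j \<in> {1..<m} \<Longrightarrow> far i j \<Longrightarrow> relation m \<beta> (gs i * ge j) (ge j * gs i)"
| d_left: "i \<in> {1..<m} \<Longrightarrow> j \<in> {1..<m} \<Longrightarrow> adj i j \<Longrightarrow>
    relation m \<beta> (gs i * gs j * ge i) (ge j * ge i)"
| d_right: "i \<in> {1..<m} \<Longrightarrow> j \<in> {1..<m} \<Longrightarrow> adj i j \<Longrightarrow>
    relation m \<beta> (ge i * gs j * gs i) (ge i * ge j)"
| d_se: "i \<in> {1..<m} \<Longrightarrow> relation m \<beta> (gs i * ge i) (ge i)"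
| d_es: "i \<in> {1..<m} \<Longrightarrow> relation m \<beta> (ge i * gs i) (ge i)"
| e_st: "i \<in> {1..<m} \<Longrightarrow> j \<in> {1..m} \<Longrightarrow> far i j \<Longrightarrow> relation m \<beta> (gs i * gt j) (gt j * gs i)"
| f_et: "i \<in> {1..<m} \<Longrightarrow> j \<in> {1..m} \<Longrightarrow> far i j \<Longrightarrow> relation m \<beta> (ge i * gt j) (gt j * ge i)"
| g_tt: "i \<in> {1..m} \<Longrightarrow> j \<in> {1..m} \<Longrightarrow> relation m \<beta> (gt i * gt j) (gt j * gt i)"
| h_st: "i \<in> {1..<m} \<Longrightarrow> relation m \<beta> (gs i * gt i) (gt (i + 1) * gs i)"
| i_ett: "i \<in> {1..<m} \<Longrightarrow> relation m \<beta> (ge i * gt i * gt (i + 1)) (ge i)"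
| i_tte: "i \<in> {1..<m} \<Longrightarrow> relation m \<beta> (gt i * gt (i + 1) * ge i) (ge i)"
| j_ete: "i \<in> {1..<m} \<Longrightarrow> relation m \<beta> (ge i * gt_powi i a * ge i) (scale \<beta> (ge i))"

definition relation_ideal :: "nat \<Rightarrow> 'k \<Rightarrow> 'k::comm_ring_1 words set" where
  "relation_ideal m \<beta> = Idl\<^bsub>free_algebra (generators m)\<^esub> {l - r | l r. relation m \<beta> l r}"

end

theory Submission
  imports Defs
begin

text \<open>
  Two facts about products make diagrams computable. Stacking a strand diagram on top of
  \<open>D\<close> permutes the top vertices of \<open>D\<close>, and stacking
  \<open>e\<^sub>i\<close> on top of \<open>D\<close> exchanges, periodically, the partner
  \<open>u\<close> of the top vertex \<open>i\<close> with the top vertex \<open>i + 1\<close>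
  (\<open>composite_strand\<close>, \<open>composite_e\<close>). A loop arises only in the
  second case and only when \<open>u\<close> is a translate of the top vertex \<open>i +
  1\<close>; it is then the only one on the cylinder (\<open>card_loops_e\<close>). Such steps
  lead from strand diagrams to every diagram (\<open>affine_diagram_induct\<close>).

  Stacking is associative and the numbers of loops add up, because both bracketings of three
  diagrams describe the components of the same triple stack (\<open>composite_assoc\<close>,
  \<open>card_loops_assoc\<close>). Hence the evaluation of words at diagrams, with a factor
  \<open>\<beta>\<close> for every loop, is a homomorphism from the free algebra
  (\<open>evaluate_hom\<close>). It is onto, and the relations hold for diagrams
  (\<open>relation_words\<close>).

  For injectivity, two words with the same diagram have to agree modulo the relations, up to the
  powers of \<open>\<beta>\<close> that their loops contribute. This is shown in an arbitrary
  monoid in which the relations hold, with a central element \<open>b\<close> in the role of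
  \<open>\<beta>\<close>. There a word in the \<open>s\<^sub>i\<close> and
  \<open>t\<^sub>i\<close> depends only on the periodic permutation of the integers that it
  describes: it can be rewritten as a coset representative \<open>t\<^sub>k\<^sup>a s\<^sub>k
  \<dots> s\<^sub>n\<^sub>-\<^sub>1\<close> followed by a word on fewer strands, and the image
  of \<open>n\<close> determines the representative (\<open>represents_unique\<close>). So the
  monoid contains an element \<open>rho p\<close> for every periodic permutation
  \<open>p\<close>. The conjugate \<open>E a c\<close> of the last cup-cap depends only on the
  strands \<open>a\<close> and \<open>c\<close> to which that cup-cap is moved.

  A diagram with an arc between the top vertices \<open>a\<close> and \<open>c\<close> also has
  an arc at the bottom. It arises from a diagram with fewer arcs by joining two through strands
  that end in \<open>a\<close> and \<open>c\<close>; if \<open>z\<close> belongs to the smaller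
  diagram, then \<open>E a c * z\<close> belongs to the larger one (\<open>normal\<close>). The
  element does not depend on the choices, since any top arc and any bottom arc can be split off
  first (\<open>normal_factor\<close>): disjoint cup-caps commute, and their product absorbs the
  permutation that interchanges them. Thus a diagram determines its element
  (\<open>normal_unique\<close>), and left multiplication by a generator follows the product of
  diagrams (\<open>normal_relabel\<close>, \<open>normal_e\<close>).

  The quotient of the free algebra, acting on itself by left multiplication, is such a monoid.
  Therefore an element of the free algebra is determined by its evaluation modulo the relations
  (\<open>reduce_to_words\<close>), and the kernel of the evaluation is the ideal of the
  relations.
\<close>

(* Equations between vertices are used as a whole; splitting quantified vertices into
   coordinates would hide them. *)
declare split_paired_All [simp del] split_paired_Ex [simp del]

section \<open>Periodic permutations\<close>

definition periodic_perms :: "nat \<Rightarrow> (int \<Rightarrow> int) set" where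
  "periodic_perms m = {p. bij p \<and> (\<forall>j d. int m dvd d \<longrightarrow> p (j + d) = p j + d)}"

text \<open>
  A transposition of two classes modulo \<open>m\<close>. When \<open>a\<close> and
  \<open>b\<close> lie in one class, it translates that class by \<open>b - a\<close>, so that
  \<open>t\<^sub>i\<close> and its inverse are instances, like \<open>s\<^sub>i\<close>.
\<close>

definition exch :: "nat \<Rightarrow> int \<Rightarrow> int \<Rightarrow> int \<Rightarrow> int" where
  "exch m a b j = (if j mod int m = a mod int m then j - a + b
     else if j mod int m = b mod int m then j - b + a else j)"

lemma mod_shift_eq:
  fixes j a b k :: int
  assumes "j mod k = a mod k"
  shows "(j - a + b) mod k = b mod k"
  using assms by (metis add.commute diff_add_cancel mod_add_left_eq mod_diff_eq cancel_comm_monoid_add_class.diff_cancel add_0)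

lemma exch_inverse: "exch m b a (exch m a b j) = j"
  by (simp add: exch_def mod_shift_eq)

lemma exch_self [simp]: "exch m a b a = b"
  by (simp add: exch_def)

lemma exch_snd [simp]: "b mod int m \<noteq> a mod int m \<Longrightarrow> exch m a b b = a"
  by (simp add: exch_def)

lemma exch_other [simp]:
  "j mod int m \<noteq> a mod int m \<Longrightarrow> j mod int m \<noteq> b mod int m \<Longrightarrow> exch m a b j = j"
  by (simp add: exch_def)

lemma exch_commute: "a mod int m \<noteq> b mod int m \<Longrightarrow> exch m b a = exch m a b"
  by (auto simp: exch_def)

lemma periodic_permsI:
  assumes "\<And>j. q (p j) = j" "\<And>j. p (q j) = j" "\<And>j d. int m dvd d \<Longrightarrow> p (j + d) = p j + d"
  shows "p \<in> periodic_perms m"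
  using assms o_bij[of q p] by (auto simp: periodic_perms_def fun_eq_iff)

lemma mod_add_dvd: "int m dvd d \<Longrightarrow> (j + d) mod int m = j mod int m"
  by (auto simp: dvd_def)

lemma exch_periodic [simp]: "exch m a b \<in> periodic_perms m"
  by (rule periodic_permsI[of "exch m b a"]) (auto simp: exch_inverse, auto simp: exch_def mod_add_dvd)

lemma id_periodic [simp]: "id \<in> periodic_perms m" "(\<lambda>j. j) \<in> periodic_perms m"
  by (auto simp: periodic_perms_def bij_def)

lemma comp_periodic [simp]:
  "p \<in> periodic_perms m \<Longrightarrow> q \<in> periodic_perms m \<Longrightarrow> p \<circ> q \<in> periodic_perms m"
  by (auto simp: periodic_perms_def bij_comp)

lemma periodic_bij: "p \<in> periodic_perms m \<Longrightarrow> bij p"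
  by (simp add: periodic_perms_def)

lemma periodic_add: "p \<in> periodic_perms m \<Longrightarrow> int m dvd d \<Longrightarrow> p (j + d) = p j + d"
  by (simp add: periodic_perms_def)

abbreviation perm_inv :: "(int \<Rightarrow> int) \<Rightarrow> int \<Rightarrow> int" where
  "perm_inv p \<equiv> inv_into UNIV p"

lemma periodic_inv_simps:
  assumes "p \<in> periodic_perms m"
  shows "perm_inv p (p j) = j" "p (perm_inv p j) = j"
  using periodic_bij[OF assms] by (auto simp: bij_def surj_f_inv_f)

lemma inv_periodic [simp]: "p \<in> periodic_perms m \<Longrightarrow> perm_inv p \<in> periodic_perms m"
  by (rule periodic_permsI[of p])
    (auto simp: periodic_inv_simps, metis periodic_add periodic_inv_simps)

lemma periodic_mod:
  assumes "p \<in> periodic_perms m"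
  shows "p i mod int m = p j mod int m \<longleftrightarrow> i mod int m = j mod int m"
proof -
  have *: "q i mod int m = q j mod int m" if "q \<in> periodic_perms m" "i mod int m = j mod int m" for q i j
    using that periodic_add[OF that(1), of "j - i" i]
    by (metis add.commute diff_add_cancel mod_add_dvd mod_eq_dvd_iff)
  show ?thesis using *[OF assms] *[OF inv_periodic[OF assms]] periodic_inv_simps[OF assms] by metis
qed

lemma periodic_diff:
  assumes "p \<in> periodic_perms m" "i mod int m = j mod int m"
  shows "p i - p j = i - j"
  using periodic_add[OF assms(1), of "i - j" j] assms(2) by (simp add: mod_eq_dvd_iff)

lemma periodic_exch:
  assumes "p \<in> periodic_perms m"
  shows "p (exch m a b j) = exch m (p a) (p b) (p j)"
proof -
  have "p (j - a + b) = p j - p a + p b" if "j mod int m = a mod int m" for a b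
    using periodic_add[OF assms, of "j - a" b] periodic_diff[OF assms that] that
    by (simp add: mod_eq_dvd_iff algebra_simps)
  then show ?thesis by (auto simp: exch_def periodic_mod[OF assms])
qed

text \<open>An injection that commutes with the translation permutes the finitely many classes.\<close>

lemma periodic_inj_surj:
  fixes p :: "int \<Rightarrow> int"
  assumes m: "m \<ge> 1" and per: "\<And>j d. int m dvd d \<Longrightarrow> p (j + d) = p j + d" and inj: "inj p"
  shows "surj p"
proof -
  let ?R = "{0..<int m}" and ?f = "\<lambda>j. p j mod int m"
  have "inj_on ?f ?R"
  proof (rule inj_onI)
    fix i j assume ij: "i \<in> ?R" "j \<in> ?R" "?f i = ?f j"
    then have "int m dvd p i - p j" by (simp add: mod_eq_dvd_iff)
    from per[OF this, of j] have "p (j + (p i - p j)) = p i" by simp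
    then have "j + (p i - p j) = i" using inj by (simp add: inj_eq)
    then have "int m dvd i - j" using \<open>int m dvd p i - p j\<close> by (metis add_diff_cancel_left')
    then have "i mod int m = j mod int m" by (simp add: mod_eq_dvd_iff)
    then show "i = j" using ij by simp
  qed
  moreover have "?f ` ?R \<subseteq> ?R" using m by auto
  ultimately have surj: "?f ` ?R = ?R" by (simp add: endo_inj_surj)
  show ?thesis
    unfolding surj_def
  proof
    fix y
    have "y mod int m \<in> ?f ` ?R" unfolding surj using m by simp
    then obtain j where "y mod int m = p j mod int m" by auto
    then have "p (j + (y - p j)) = y" using per[of "y - p j" j] by (simp add: mod_eq_dvd_iff)
    then show "\<exists>j. y = p j" by metis
  qed
qed

section \<open>Periodic permutations of the vertices\<close>

text \<open>The vertex of the cylinder that \<open>v\<close> lies above.\<close>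

definition cls :: "nat \<Rightarrow> vertex \<Rightarrow> int \<times> nat" where
  "cls m v = (fst v mod int m, snd v)"

text \<open>
  The condition on heights makes these permutations act on diagrams; vertices at other heights
  belong to stacks.
\<close>

definition vertex_perms :: "nat \<Rightarrow> (vertex \<Rightarrow> vertex) set" where
  "vertex_perms m = {\<sigma>. bij \<sigma> \<and> (\<forall>v d. int m dvd d \<longrightarrow> \<sigma> (translate d v) = translate d (\<sigma> v)) \<and>
     (\<forall>v. snd (\<sigma> v) \<in> {0, 1} \<longleftrightarrow> snd v \<in> {0, 1})}"

text \<open>
  As for integers, the exchange of two vertices of one class is a translation of that class.
\<close>

definition vexch :: "nat \<Rightarrow> vertex \<Rightarrow> vertex \<Rightarrow> vertex \<Rightarrow> vertex" where
  "vexch m u w v = (if cls m v = cls m u then (fst v - fst u + fst w, snd w)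
     else if cls m v = cls m w then (fst v - fst w + fst u, snd u) else v)"

definition on_top :: "(int \<Rightarrow> int) \<Rightarrow> vertex \<Rightarrow> vertex" where
  "on_top p v = (if snd v = 1 then (p (fst v), 1) else v)"

definition act :: "(vertex \<Rightarrow> vertex) \<Rightarrow> diagram \<Rightarrow> diagram" where
  "act \<sigma> D = (\<lambda>B. \<sigma> ` B) ` D"

lemma translate_simps [simp]: "fst (translate d v) = fst v + d" "snd (translate d v) = snd v"
  "translate d (translate d' v) = translate (d + d') v" "translate 0 v = v"
  "translate d (j, h) = (j + d, h)"
  by (auto simp: translate_def split: prod.splits)

lemma translate_image_simps [simp]:
  "translate d ` translate d' ` K = translate (d + d') ` K" "translate 0 ` K = K"
  by (auto simp: image_image)

lemma cls_translate [simp]: "int m dvd d \<Longrightarrow> cls m (translate d v) = cls m v"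
  by (simp add: cls_def mod_add_dvd)

lemma cls_eqE:
  assumes "cls m v = cls m u"
  obtains d where "int m dvd d" "v = translate d u" "d = fst v - fst u"
proof (rule that)
  show "int m dvd fst v - fst u" using assms by (simp add: cls_def mod_eq_dvd_iff)
  show "v = translate (fst v - fst u) u" using assms by (intro prod_eqI) (simp_all add: cls_def)
qed (rule refl)

lemma vexch_inverse: "vexch m w u (vexch m u w v) = v"
  by (auto simp: vexch_def cls_def mod_shift_eq intro: prod_eqI)

lemma vexch_self [simp]: "vexch m u w u = w"
  by (simp add: vexch_def)

lemma vexch_snd [simp]: "cls m w \<noteq> cls m u \<Longrightarrow> vexch m u w w = u"
  by (simp add: vexch_def)

lemma vexch_other [simp]: "cls m v \<noteq> cls m u \<Longrightarrow> cls m v \<noteq> cls m w \<Longrightarrow> vexch m u w v = v"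
  by (simp add: vexch_def)

lemma vexch_commute: "cls m u \<noteq> cls m w \<Longrightarrow> vexch m w u = vexch m u w"
  by (auto simp: vexch_def)

lemma vexch_translate: "int m dvd d \<Longrightarrow> vexch m (translate d u) (translate d w) = vexch m u w"
  by (auto simp: vexch_def)

lemma vertex_permsI:
  assumes "\<And>v. \<tau> (\<sigma> v) = v" "\<And>v. \<sigma> (\<tau> v) = v"
    "\<And>v d. int m dvd d \<Longrightarrow> \<sigma> (translate d v) = translate d (\<sigma> v)"
    "\<And>v. snd (\<sigma> v) \<in> {0, 1} \<longleftrightarrow> snd v \<in> {0, 1}"
  shows "\<sigma> \<in> vertex_perms m"
  using assms o_bij[of \<tau> \<sigma>] by (auto simp: vertex_perms_def fun_eq_iff)

lemma vexch_perm [simp]: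
  "snd u \<in> {0, 1} \<Longrightarrow> snd w \<in> {0, 1} \<Longrightarrow> vexch m u w \<in> vertex_perms m"
  by (rule vertex_permsI[of "vexch m w u"])
    (simp add: vexch_inverse, simp add: vexch_inverse,
      auto simp: vexch_def prod_eq_iff, auto simp: cls_def)

lemma on_top_perm [simp]: "p \<in> periodic_perms m \<Longrightarrow> on_top p \<in> vertex_perms m"
  by (rule vertex_permsI[of "on_top (perm_inv p)"])
    (auto simp: on_top_def periodic_inv_simps prod_eq_iff periodic_add)

lemma comp_perm [simp]: "\<sigma> \<in> vertex_perms m \<Longrightarrow> \<tau> \<in> vertex_perms m \<Longrightarrow> \<sigma> \<circ> \<tau> \<in> vertex_perms m"
  by (simp add: vertex_perms_def bij_comp)

lemma on_top_comp: "on_top p \<circ> on_top q = on_top (p \<circ> q)"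
  by (auto simp: on_top_def)

lemma on_top_exch: "on_top (exch m a b) = vexch m (a, 1) (b, 1)"
  by (auto simp: on_top_def vexch_def exch_def cls_def)

lemma on_top_simps [simp]: "on_top p (j, 0) = (j, 0)" "on_top p (j, Suc 0) = (p j, 1)"
  by (auto simp: on_top_def)

lemma vperm_inj: "\<sigma> \<in> vertex_perms m \<Longrightarrow> \<sigma> u = \<sigma> v \<longleftrightarrow> u = v"
  unfolding vertex_perms_def bij_def inj_def by blast

lemma vperm_translate: "\<sigma> \<in> vertex_perms m \<Longrightarrow> int m dvd d \<Longrightarrow> \<sigma> (translate d v) = translate d (\<sigma> v)"
  unfolding vertex_perms_def by blast

lemma vperm_cls:
  assumes "\<sigma> \<in> vertex_perms m"
  shows "cls m (\<sigma> u) = cls m (\<sigma> v) \<longleftrightarrow> cls m u = cls m v"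
proof
  assume "cls m (\<sigma> u) = cls m (\<sigma> v)"
  then obtain d where "int m dvd d" "\<sigma> u = translate d (\<sigma> v)" by (elim cls_eqE)
  then have "\<sigma> u = \<sigma> (translate d v)" using vperm_translate[OF assms] by simp
  then show "cls m u = cls m v" using vperm_inj[OF assms] \<open>int m dvd d\<close> by simp
next
  assume "cls m u = cls m v"
  then obtain d where "int m dvd d" "u = translate d v" by (elim cls_eqE)
  then show "cls m (\<sigma> u) = cls m (\<sigma> v)" using vperm_translate[OF assms] by simp
qed

lemma vperm_vexch:
  assumes "\<sigma> \<in> vertex_perms m"
  shows "\<sigma> (vexch m u w v) = vexch m (\<sigma> u) (\<sigma> w) (\<sigma> v)"
proof -
  have "\<sigma> (fst v - fst u + fst w, snd w) = (fst (\<sigma> v) - fst (\<sigma> u) + fst (\<sigma> w), snd (\<sigma> w))"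
    if "cls m v = cls m u" for u w
  proof -
    from that obtain d where d: "int m dvd d" "v = translate d u" by (elim cls_eqE)
    have "\<sigma> (translate d w) = translate d (\<sigma> w)" using d vperm_translate[OF assms] by simp
    moreover have "translate d w = (fst v - fst u + fst w, snd w)"
      using d(2) by (simp add: prod_eq_iff)
    moreover have "\<sigma> v = translate d (\<sigma> u)" using d vperm_translate[OF assms] by simp
    ultimately show ?thesis by (simp add: prod_eq_iff)
  qed
  then show ?thesis by (auto simp: vexch_def vperm_cls[OF assms])
qed

lemma act_act: "act \<sigma> (act \<tau> D) = act (\<sigma> \<circ> \<tau>) D"
  by (auto simp: act_def image_image image_comp)

lemma act_id [simp]: "act id D = D" "act (\<lambda>v. v) D = D"
  by (auto simp: act_def)

lemma act_vexch:
  "\<sigma> \<in> vertex_perms m \<Longrightarrow> act \<sigma> (act (vexch m u w) D) = act (vexch m (\<sigma> u) (\<sigma> w)) (act \<sigma> D)"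
  by (simp add: act_act) (rule arg_cong[of _ _ "\<lambda>f. act f D"], auto simp: vperm_vexch)

lemma act_vexch_inverse: "act (vexch m w u) (act (vexch m u w) D) = D"
  by (simp add: act_act comp_def vexch_inverse)

section \<open>Arcs of affine diagrams\<close>

context
  fixes m :: nat and D :: diagram
  assumes D: "D \<in> affine_diagrams m"
begin

lemma affine_block:
  assumes "B \<in> D"
  shows "\<exists>u v. u \<noteq> v \<and> B = {u, v}"
proof -
  have "card B = 2" using D assms by (simp add: affine_diagrams_def)
  then show ?thesis by (metis card_2_iff)
qed

lemma arc_neq: "{u, v} \<in> D \<Longrightarrow> u \<noteq> v"
  using D by (force simp: affine_diagrams_def)

lemma arc_height: "{u, v} \<in> D \<Longrightarrow> snd u \<in> {0, 1} \<and> snd v \<in> {0, 1}"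
proof -
  assume "{u, v} \<in> D"
  then have "{u, v} \<subseteq> UNIV \<times> {0, 1}" using D by (auto simp: affine_diagrams_def partition_on_def)
  then show ?thesis by (cases u; cases v) auto
qed

lemma arc_exists:
  assumes "snd u \<in> {0, 1}"
  shows "\<exists>v. {u, v} \<in> D"
proof -
  have "u \<in> \<Union>D" using D assms by (cases u) (auto simp: affine_diagrams_def partition_on_def)
  then obtain B where B: "B \<in> D" "u \<in> B" by blast
  from affine_block[OF B(1)] B show ?thesis by (metis insert_commute insert_iff singletonD)
qed

lemma block_unique: "B \<in> D \<Longrightarrow> C \<in> D \<Longrightarrow> v \<in> B \<Longrightarrow> v \<in> C \<Longrightarrow> B = C"
  using D unfolding affine_diagrams_def partition_on_def disjoint_def by blast

lemma arc_unique: "{u, v} \<in> D \<Longrightarrow> {u, w} \<in> D \<Longrightarrow> v = w"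
  using block_unique[of "{u, v}" "{u, w}" u] by (simp add: doubleton_eq_iff) blast

lemma block_translate:
  assumes "int m dvd d" "B \<in> D"
  shows "translate d ` B \<in> D"
proof -
  have 1: "translate (int n * int m) ` B \<in> D \<and> translate (- (int n * int m)) ` B \<in> D" for n
  proof (induction n)
    case (Suc n)
    have "translate (int (Suc n) * int m) ` B = translate (int m) ` translate (int n * int m) ` B"
      "translate (- (int (Suc n) * int m)) ` B = translate (- int m) ` translate (- (int n * int m)) ` B"
      by (simp_all add: algebra_simps)
    then show ?case using Suc D by (auto simp: affine_diagrams_def)
  qed (use assms in auto)
  from assms(1) obtain k where k: "d = k * int m" by (auto simp: dvd_def mult.commute)
  show ?thesis using 1[of "nat \<bar>k\<bar>"] k by (cases "k \<ge> 0") auto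
qed

lemma arc_translate: "int m dvd d \<Longrightarrow> {u, v} \<in> D \<Longrightarrow> {translate d u, translate d v} \<in> D"
  using block_translate[of d "{u, v}"] by simp

text \<open>
  A diagram has one arc at each vertex, so by periodicity one arc of a class determines the
  others.
\<close>

lemma arc_same_cls:
  assumes "{u, v} \<in> D" "{u', v'} \<in> D" "cls m u' = cls m u"
  shows "v' = translate (fst u' - fst u) v"
proof -
  from assms(3) obtain d where d: "int m dvd d" "u' = translate d u" "d = fst u' - fst u"
    by (elim cls_eqE)
  have "{u', translate d v} \<in> D" using arc_translate[OF d(1) assms(1)] d(2) by simp
  then show ?thesis using arc_unique[OF assms(2)] d(3) by simp
qed

text \<open>
  An arc between translates of one vertex, translated along itself, would give a second arc at
  its end.
\<close>

lemma arc_cls_neq: "{u, v} \<in> D \<Longrightarrow> cls m u \<noteq> cls m v"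
proof
  assume uv: "{u, v} \<in> D" and c: "cls m u = cls m v"
  then have vu: "{v, u} \<in> D" by (simp add: insert_commute)
  have "fst u = fst v + (fst v - fst u)"
    using arg_cong[OF arc_same_cls[OF uv vu], of fst] c by simp
  then have "fst u = fst v" by simp
  then show False using arc_neq[OF uv] c by (simp add: cls_def prod_eq_iff)
qed

lemma arc_cls_iff:
  assumes "{u, v} \<in> D" "{u', v'} \<in> D"
  shows "cls m u' = cls m u \<longleftrightarrow> cls m v' = cls m v"
proof -
  have *: "cls m v' = cls m v" if "{u, v} \<in> D" "{u', v'} \<in> D" "cls m u' = cls m u" for u v u' v'
  proof -
    have "int m dvd fst u' - fst u" using that(3) by (simp add: cls_def mod_eq_dvd_iff)
    then show ?thesis using arc_same_cls[OF that] by simp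
  qed
  show ?thesis using *[OF assms] *[of v u v' u'] assms by (auto simp: insert_commute)
qed

lemma act_affine:
  assumes \<sigma>: "\<sigma> \<in> vertex_perms m"
  shows "act \<sigma> D \<in> affine_diagrams m"
proof -
  have bij: "bij \<sigma>" and h: "\<And>v. snd (\<sigma> v) \<in> {0, 1} \<longleftrightarrow> snd v \<in> {0, 1}"
    using \<sigma> unfolding vertex_perms_def by blast+
  let ?V = "UNIV \<times> {0, 1} :: vertex set"
  have V: "v \<in> ?V \<longleftrightarrow> snd v \<in> {0, 1}" for v by (cases v) auto
  have img: "\<sigma> ` ?V = ?V"
  proof
    show "\<sigma> ` ?V \<subseteq> ?V" using h V by blast
    show "?V \<subseteq> \<sigma> ` ?V"
    proof
      fix v assume v: "v \<in> ?V"
      define w where "w = inv_into UNIV \<sigma> v"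
      have w: "\<sigma> w = v" unfolding w_def by (rule surj_f_inv_f[OF bij_is_surj[OF bij]])
      then have "w \<in> ?V" using v h[of w] V[of v] V[of w] by (simp only:)
      then show "v \<in> \<sigma> ` ?V" using w by (metis imageI)
    qed
  qed
  have inj: "inj_on \<sigma> X" for X by (rule inj_on_subset[OF bij_is_inj[OF bij] subset_UNIV])
  have "partition_on (\<sigma> ` ?V) ((`) \<sigma> ` D)"
  proof (rule partition_onI)
    have "\<Union> D = ?V" using D by (simp add: affine_diagrams_def partition_on_def)
    then show "\<Union> ((`) \<sigma> ` D) = \<sigma> ` ?V" by (simp only: image_Union[symmetric])
    have "{} \<notin> D" using D by (simp add: affine_diagrams_def partition_on_def)
    then show "{} \<notin> (`) \<sigma> ` D" by (simp add: image_iff)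
    show "disjnt p p'" if "p \<in> (`) \<sigma> ` D" "p' \<in> (`) \<sigma> ` D" "p \<noteq> p'" for p p'
    proof -
      from that obtain B B' where B: "B \<in> D" "B' \<in> D" "p = \<sigma> ` B" "p' = \<sigma> ` B'" by blast
      then have "B \<inter> B' = {}" using block_unique[of B B'] that(3) by blast
      then have "p \<inter> p' = {}" using B image_Int[OF inj[of UNIV], of B B'] by simp
      then show ?thesis by (simp add: disjnt_def)
    qed
  qed
  moreover have "card B = 2" if "B \<in> act \<sigma> D" for B
    using that D inj by (auto simp: act_def affine_diagrams_def card_image)
  moreover have "translate d ` B \<in> act \<sigma> D" if "B \<in> act \<sigma> D" "int m dvd d" for B d
  proof -
    from that obtain C where C: "C \<in> D" "B = \<sigma> ` C" by (auto simp: act_def)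
    have "translate d ` B = \<sigma> ` translate d ` C"
      by (simp add: C(2) image_image vperm_translate[OF \<sigma> that(2)])
    then show ?thesis using block_translate[OF that(2) C(1)] by (simp add: act_def)
  qed
  moreover have "int m dvd int m" "int m dvd - int m" by simp_all
  ultimately show ?thesis
    unfolding img affine_diagrams_def act_def[symmetric] by blast
qed

lemma act_arc: "{u, v} \<in> D \<Longrightarrow> {\<sigma> u, \<sigma> v} \<in> act \<sigma> D"
  using imageI[of "{u, v}" D "\<lambda>B. \<sigma> ` B"] by (simp add: act_def)

end

lemma act_arc_iff:
  assumes "D \<in> affine_diagrams m" "\<sigma> \<in> vertex_perms m"
  shows "{\<sigma> u, \<sigma> v} \<in> act \<sigma> D \<longleftrightarrow> {u, v} \<in> D"
proof
  assume "{\<sigma> u, \<sigma> v} \<in> act \<sigma> D"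
  then obtain B where B: "B \<in> D" "\<sigma> ` {u, v} = \<sigma> ` B" by (simp add: act_def image_iff) blast
  have "inj \<sigma>" using assms(2) by (simp add: vertex_perms_def bij_is_inj)
  then have "B = {u, v}" using B(2) by (simp only: inj_image_eq_iff)
  then show "{u, v} \<in> D" using B by simp
qed (rule act_arc[OF assms(1)])

lemma diagram_eqI:
  assumes "D \<in> affine_diagrams m" "D' \<in> affine_diagrams m" "\<And>u v. {u, v} \<in> D \<Longrightarrow> {u, v} \<in> D'"
  shows "D = D'"
proof -
  have "D \<subseteq> D'"
  proof
    fix B assume B: "B \<in> D"
    then obtain u v where "B = {u, v}" using affine_block[OF assms(1)] by blast
    then show "B \<in> D'" using B assms(3)[of u v] by simp
  qed
  moreover have "D' \<subseteq> D"
  proof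
    fix B assume B: "B \<in> D'"
    then obtain u v where uv: "B = {u, v}" using affine_block[OF assms(2)] by blast
    then have "snd u \<in> {0, 1}" using arc_height[OF assms(2), of u v] B by simp
    then obtain w where w: "{u, w} \<in> D" using arc_exists[OF assms(1)] by blast
    have "w = v" using arc_unique[OF assms(2) assms(3)[OF w], of v] B uv by simp
    then show "B \<in> D" using w uv by simp
  qed
  ultimately show ?thesis by blast
qed

text \<open>
  The set \<open>K\<close> lists representatives of the arcs that \<open>\<sigma>\<close> moves. Periodicity takes care of their
  translates, and the other arcs are fixed pointwise.
\<close>

lemma act_stabilizes:
  assumes D: "D \<in> affine_diagrams m" and \<sigma>: "\<sigma> \<in> vertex_perms m"
    and K: "\<And>u v. (u, v) \<in> K \<Longrightarrow> {u, v} \<in> D \<and> {\<sigma> u, \<sigma> v} \<in> D"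
    and fixed: "\<And>w. (\<And>u v. (u, v) \<in> K \<Longrightarrow> cls m w \<noteq> cls m u \<and> cls m w \<noteq> cls m v) \<Longrightarrow> \<sigma> w = w"
  shows "act \<sigma> D = D"
proof (rule diagram_eqI[OF act_affine[OF D \<sigma>] D])
  fix p q assume "{p, q} \<in> act \<sigma> D"
  then obtain B where B: "B \<in> D" "{p, q} = \<sigma> ` B" unfolding act_def by (rule imageE)
  obtain x y where xy: "B = {x, y}" using affine_block[OF D B(1)] by blast
  have tr: "{\<sigma> x, \<sigma> y} \<in> D" if a: "{x, y} \<in> D" "{u, v} \<in> D" "{\<sigma> u, \<sigma> v} \<in> D" "cls m x = cls m u" for x y u v
  proof -
    let ?d = "fst x - fst u"
    obtain d where d': "int m dvd d" "x = translate d u" "d = ?d" using a(4) by (rule cls_eqE)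
    then have d: "int m dvd ?d" "x = translate ?d u" by metis+
    have "y = translate ?d v" using arc_same_cls[OF D a(2,1,4)] .
    then have y: "\<sigma> y = translate ?d (\<sigma> v)"
      using vperm_translate[OF \<sigma> d(1), of v] by simp
    have x: "\<sigma> x = translate ?d (\<sigma> u)"
      using vperm_translate[OF \<sigma> d(1), of u] arg_cong[OF d(2), of \<sigma>] by simp
    show ?thesis unfolding x y using arc_translate[OF D d(1) a(3)] .
  qed
  have "{\<sigma> x, \<sigma> y} \<in> D"
  proof (cases "\<exists>u v. (u, v) \<in> K \<and> (cls m x = cls m u \<or> cls m x = cls m v)")
    case True
    then obtain u v where uv: "(u, v) \<in> K" "cls m x = cls m u \<or> cls m x = cls m v" by blast
    then show ?thesis using tr[of x y u v] tr[of x y v u] K[OF uv(1)] B(1) xy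
      insert_commute[of u v] insert_commute[of "\<sigma> u" "\<sigma> v"] by metis
  next
    case False
    have y: "(u, v) \<in> K \<Longrightarrow> cls m y \<noteq> cls m u \<and> cls m y \<noteq> cls m v" for u v
      using False K[of u v] B(1) xy arc_cls_iff[OF D, of u v x y] arc_cls_iff[OF D, of v u x y]
        insert_commute[of u v] by metis
    have "\<sigma> x = x" using fixed[of x] False by blast
    moreover have "\<sigma> y = y" using fixed[of y] y by blast
    ultimately show ?thesis using B xy by simp
  qed
  then show "{p, q} \<in> D" using B xy by simp
qed

section \<open>Associativity of stacking\<close>

definition edges :: "diagram \<Rightarrow> (vertex \<times> vertex) set" where
  "edges D = {(u, v). \<exists>B\<in>D. u \<in> B \<and> v \<in> B}"

text \<open>
  In a stack the upper diagram is raised by one; the boundary of the stack has the heights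
  \<open>0\<close> and \<open>2\<close>.
\<close>

definition lift :: "vertex \<Rightarrow> vertex" where
  "lift v = (fst v, Suc (snd v))"

definition outer :: "vertex \<Rightarrow> vertex" where
  "outer v = (fst v, 2 * snd v)"

text \<open>
  Inserting an empty layer at height \<open>k\<close> embeds a stack of two diagrams into a
  stack of three.
\<close>

definition skip :: "nat \<Rightarrow> vertex \<Rightarrow> vertex" where
  "skip k v = (fst v, if snd v < k then snd v else Suc (snd v))"

definition relab :: "(vertex \<Rightarrow> vertex) \<Rightarrow> (vertex \<times> vertex) set \<Rightarrow> (vertex \<times> vertex) set" where
  "relab f E = map_prod f f ` E"

definition stack_edges :: "diagram \<Rightarrow> diagram \<Rightarrow> (vertex \<times> vertex) set" where
  "stack_edges D D' = edges D' \<union> relab lift (edges D)"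

lemma relabI: "(u, v) \<in> E \<Longrightarrow> (f u, f v) \<in> relab f E"
  by (force simp: relab_def)

lemma relabE:
  assumes "(x, y) \<in> relab f E"
  obtains u v where "x = f u" "y = f v" "(u, v) \<in> E"
  using assms by (auto simp: relab_def)

lemma connected_rel_eq: "connected_rel D D' = (stack_edges D D')\<^sup>*"
proof -
  have l: "(\<lambda>(j, h). (j, Suc h)) = lift" by (auto simp: lift_def fun_eq_iff)
  have "(\<exists>B\<in>(`) lift ` D. u \<in> B \<and> v \<in> B) \<longleftrightarrow> (u, v) \<in> relab lift (edges D)" for u v
  proof
    assume "\<exists>B\<in>(`) lift ` D. u \<in> B \<and> v \<in> B"
    then obtain C p q where C: "C \<in> D" "p \<in> C" "q \<in> C" "u = lift p" "v = lift q" by blast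
    then have "(p, q) \<in> edges D" unfolding edges_def by blast
    then show "(u, v) \<in> relab lift (edges D)" unfolding C(4,5) by (rule relabI)
  next
    assume "(u, v) \<in> relab lift (edges D)"
    then obtain p q where "u = lift p" "v = lift q" "(p, q) \<in> edges D" by (rule relabE)
    then show "\<exists>B\<in>(`) lift ` D. u \<in> B \<and> v \<in> B" unfolding edges_def by blast
  qed
  then have "(\<exists>B\<in>stack D D'. u \<in> B \<and> v \<in> B) \<longleftrightarrow> (u, v) \<in> stack_edges D D'" for u v
    unfolding stack_def stack_edges_def l bex_Un by (simp add: edges_def[of D'])
  then have "{(u, v). \<exists>B\<in>stack D D'. u \<in> B \<and> v \<in> B} = stack_edges D D'"
    by (simp add: Set.set_eq_iff split_paired_All)
  then show ?thesis by (simp add: connected_rel_def)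
qed

lemma sym_edges: "sym (edges D)"
  by (auto simp: edges_def sym_def)

lemma sym_relab: "sym E \<Longrightarrow> sym (relab f E)"
  unfolding sym_def by (metis relabE relabI)

lemma sym_stack: "sym (stack_edges D D')"
  by (simp add: stack_edges_def sym_Un sym_edges sym_relab)

lemma rtrancl_class_eq:
  assumes "sym E" "(u, v) \<in> E\<^sup>*"
  shows "E\<^sup>* `` {u} = E\<^sup>* `` {v}"
proof -
  have "(v, u) \<in> E\<^sup>*" using assms sym_rtrancl[OF assms(1)] by (meson symD)
  then show ?thesis using assms(2) by (auto intro: rtrancl_trans)
qed

lemma connected_sym: "(u, v) \<in> connected_rel D D' \<Longrightarrow> (v, u) \<in> connected_rel D D'"
  unfolding connected_rel_eq using sym_rtrancl[OF sym_stack] by (meson symD)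

lemma connected_trans:
  "(u, v) \<in> connected_rel D D' \<Longrightarrow> (v, w) \<in> connected_rel D D' \<Longrightarrow> (u, w) \<in> connected_rel D D'"
  unfolding connected_rel_eq by (rule rtrancl_trans)

lemma mem_trace:
  "x \<in> (\<lambda>(j, h). (j, h div 2)) ` (C \<inter> UNIV \<times> {0, 2}) \<longleftrightarrow> snd x \<in> {0, 1} \<and> outer x \<in> C"
proof
  assume "x \<in> (\<lambda>(j, h). (j, h div 2)) ` (C \<inter> UNIV \<times> {0, 2})"
  then show "snd x \<in> {0, 1} \<and> outer x \<in> C" by (auto simp: outer_def)
next
  assume x: "snd x \<in> {0, 1} \<and> outer x \<in> C"
  then have "outer x \<in> C \<inter> UNIV \<times> {0, 2}" by (auto simp: outer_def)
  moreover have "x = (\<lambda>(j, h). (j, h div 2)) (outer x)" by (simp add: outer_def)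
  ultimately show "x \<in> (\<lambda>(j, h). (j, h div 2)) ` (C \<inter> UNIV \<times> {0, 2})" by (rule image_eqI[rotated])
qed

lemma composite_eq_classes:
  "composite D D' = {{y. snd y \<in> {0, 1} \<and> (outer x, outer y) \<in> connected_rel D D'} | x. snd x \<in> {0, 1}}"
  (is "?L = ?R")
proof -
  define R where "R = connected_rel D D'"
  define tr where "tr C = (\<lambda>(j, h). (j, h div 2)) ` (C \<inter> UNIV \<times> {0, 2})" for C :: "vertex set"
  have tr: "x \<in> tr C \<longleftrightarrow> snd x \<in> {0, 1} \<and> outer x \<in> C" for x C
    unfolding tr_def by (rule mem_trace)
  have L: "?L = tr ` {R `` {v} | v. v \<in> UNIV \<times> {0, 1, 2}} - {{}}"
    by (simp add: composite_def components_def tr_def R_def)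
  have cls: "{y. snd y \<in> {0, 1} \<and> (outer x, outer y) \<in> R} = tr (R `` {outer x})" for x
    by (rule Set.set_eqI) (simp add: tr)
  show ?thesis
  proof
    show "?L \<subseteq> ?R"
    proof
      fix B assume "B \<in> ?L"
      then obtain v where B: "B = tr (R `` {v})" "B \<noteq> {}" unfolding L by blast
      then obtain x where "x \<in> B" by blast
      then have x: "snd x \<in> {0, 1}" "(v, outer x) \<in> R" using B tr by auto
      then have "R `` {v} = R `` {outer x}"
        using rtrancl_class_eq[OF sym_stack] unfolding R_def connected_rel_eq by blast
      then show "B \<in> ?R" using B x cls[of x] unfolding R_def[symmetric] by auto
    qed
    show "?R \<subseteq> ?L"
    proof
      fix B assume "B \<in> ?R"
      then obtain x where x: "snd x \<in> {0, 1}" "B = tr (R `` {outer x})"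
        unfolding R_def[symmetric] cls by blast
      have "(outer x, outer x) \<in> R" by (simp add: R_def connected_rel_eq)
      then have "x \<in> B" using x tr by auto
      have "outer x \<in> UNIV \<times> {0, 1, 2}" using x by (auto simp: outer_def)
      then have "B \<in> tr ` {R `` {v} | v. v \<in> UNIV \<times> {0, 1, 2}}" unfolding x(2)
        by (intro imageI CollectI exI[of _ "outer x"] conjI refl)
      moreover have "B \<noteq> {}" using \<open>x \<in> B\<close> by blast
      ultimately show "B \<in> ?L" unfolding L by simp
    qed
  qed
qed

lemma edges_composite:
  "(x, y) \<in> edges (composite D D') \<longleftrightarrow>
     snd x \<in> {0, 1} \<and> snd y \<in> {0, 1} \<and> (outer x, outer y) \<in> connected_rel D D'"
proof
  assume "(x, y) \<in> edges (composite D D')"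
  then obtain z where "(outer z, outer x) \<in> connected_rel D D'" "(outer z, outer y) \<in> connected_rel D D'"
    "snd x \<in> {0, 1}" "snd y \<in> {0, 1}"
    unfolding edges_def composite_eq_classes by blast
  then show "snd x \<in> {0, 1} \<and> snd y \<in> {0, 1} \<and> (outer x, outer y) \<in> connected_rel D D'"
    using connected_sym connected_trans by blast
next
  assume a: "snd x \<in> {0, 1} \<and> snd y \<in> {0, 1} \<and> (outer x, outer y) \<in> connected_rel D D'"
  have "(outer x, outer x) \<in> connected_rel D D'" by (simp add: connected_rel_eq)
  let ?C = "{y. snd y \<in> {0, 1} \<and> (outer x, outer y) \<in> connected_rel D D'}"
  have "?C \<in> composite D D'" unfolding composite_eq_classes
    by (intro CollectI exI[of _ x] conjI refl) (use a in simp)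
  moreover have "x \<in> ?C \<and> y \<in> ?C"
    using a \<open>(outer x, outer x) \<in> connected_rel D D'\<close> by (simp_all only: mem_Collect_eq)
  ultimately have "\<exists>B\<in>composite D D'. x \<in> B \<and> y \<in> B" by (rule bexI[rotated])
  then show "(x, y) \<in> edges (composite D D')" by (simp add: edges_def)
qed

text \<open>
  Cut a path between points of \<open>Z\<close> at its edges in \<open>B\<close>. These have
  both ends in \<open>Z\<close>, so the pieces in between are paths of \<open>A\<close> with
  both ends in \<open>Z\<close>.
\<close>

lemma contract:
  assumes B: "B \<subseteq> Z \<times> Z" and u: "u \<in> Z" and v: "v \<in> Z"
  shows "(u, v) \<in> (A \<union> B)\<^sup>* \<longleftrightarrow> (u, v) \<in> ((A\<^sup>* \<inter> Z \<times> Z) \<union> B)\<^sup>*"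
proof
  let ?N = "(A\<^sup>* \<inter> Z \<times> Z) \<union> B"
  assume "(u, v) \<in> (A \<union> B)\<^sup>*"
  then have "\<exists>w\<in>Z. (u, w) \<in> ?N\<^sup>* \<and> (w, v) \<in> A\<^sup>*"
  proof (induction rule: rtrancl_induct)
    case base
    then show ?case using u by blast
  next
    case (step x y)
    then obtain w where w: "w \<in> Z" "(u, w) \<in> ?N\<^sup>*" "(w, x) \<in> A\<^sup>*" by blast
    show ?case
    proof (cases "(x, y) \<in> A")
      case True
      then show ?thesis using w by (meson rtrancl.rtrancl_into_rtrancl)
    next
      case False
      then have xy: "(x, y) \<in> B" using step by blast
      then have "(w, x) \<in> ?N" "(x, y) \<in> ?N" "y \<in> Z" using w B by auto
      then have "(u, y) \<in> ?N\<^sup>*" using w(2) by (meson rtrancl.rtrancl_into_rtrancl)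
      then show ?thesis using \<open>y \<in> Z\<close> by blast
    qed
  qed
  then obtain w where w: "w \<in> Z" "(u, w) \<in> ?N\<^sup>*" "(w, v) \<in> A\<^sup>*" by blast
  then have "(w, v) \<in> ?N" using v by blast
  then show "(u, v) \<in> ?N\<^sup>*" using w(2) by (rule rtrancl.rtrancl_into_rtrancl[rotated])
next
  have "(A\<^sup>* \<inter> Z \<times> Z) \<union> B \<subseteq> (A \<union> B)\<^sup>*"
    using rtrancl_mono[of A "A \<union> B"] by auto
  then have "((A\<^sup>* \<inter> Z \<times> Z) \<union> B)\<^sup>* \<subseteq> (A \<union> B)\<^sup>*"
    by (metis rtrancl_idemp rtrancl_mono)
  then show "(u, v) \<in> ((A\<^sup>* \<inter> Z \<times> Z) \<union> B)\<^sup>* \<Longrightarrow> (u, v) \<in> (A \<union> B)\<^sup>*" by blast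
qed

lemma relab_rtranclE:
  assumes "inj f" "(f u, y) \<in> (relab f E)\<^sup>*"
  shows "\<exists>v. y = f v \<and> (u, v) \<in> E\<^sup>*"
  using assms(2)
proof (induction rule: rtrancl_induct)
  case (step y z)
  then obtain v where v: "y = f v" "(u, v) \<in> E\<^sup>*" by blast
  obtain v' w where w: "y = f v'" "z = f w" "(v', w) \<in> E" using step(2) by (rule relabE)
  have "v' = v" using v(1) w(1) assms(1) by (simp add: inj_eq)
  then have "(u, w) \<in> E\<^sup>*" using v(2) w(3) by (meson rtrancl.rtrancl_into_rtrancl)
  then show ?case using w(2) by blast
qed blast

lemma relab_rtranclI:
  assumes "(u, v) \<in> E\<^sup>*"
  shows "(f u, f v) \<in> (relab f E)\<^sup>*"
  using assms
proof (induction rule: rtrancl_induct)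
  case (step y z)
  then show ?case using relabI[OF step(2), of f] by (meson rtrancl.rtrancl_into_rtrancl)
qed blast

lemma relab_rtrancl_iff: "inj f \<Longrightarrow> (f u, f v) \<in> (relab f E)\<^sup>* \<longleftrightarrow> (u, v) \<in> E\<^sup>*"
  using relab_rtranclE[of f u "f v" E] relab_rtranclI[of u v E f] by (auto simp: inj_eq)

lemma relab_Un: "relab f (A \<union> B) = relab f A \<union> relab f B"
  by (simp add: relab_def image_Un)

lemma relab_relab: "relab f (relab g E) = relab (\<lambda>v. f (g v)) E"
  by (simp add: relab_def image_image map_prod_def case_prod_beta)

lemma inj_lift: "inj lift"
  by (auto simp: inj_def lift_def prod_eq_iff)

lemma inj_skip: "inj (skip k)"
  by (auto simp: inj_def skip_def prod_eq_iff split: if_splits)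

lemma range_skip: "range (skip k) = {v. snd v \<noteq> k}"
proof
  show "range (skip k) \<subseteq> {v. snd v \<noteq> k}" by (auto simp: skip_def split: if_splits)
  show "{v. snd v \<noteq> k} \<subseteq> range (skip k)"
  proof
    fix v :: vertex assume v: "v \<in> {v. snd v \<noteq> k}"
    then have "v = skip k (fst v, if snd v < k then snd v else snd v - 1)"
      by (cases v) (auto simp: skip_def)
    then show "v \<in> range (skip k)" by (rule range_eqI)
  qed
qed

definition flat :: "diagram \<Rightarrow> bool" where
  "flat D \<longleftrightarrow> edges D \<subseteq> {v. snd v \<le> 1} \<times> {v. snd v \<le> 1}"

definition translation_invariant :: "nat \<Rightarrow> (vertex \<times> vertex) set \<Rightarrow> bool" where
  "translation_invariant m E \<longleftrightarrow> (\<forall>d u v. int m dvd d \<longrightarrow> (u, v) \<in> E \<longrightarrow> (translate d u, translate d v) \<in> E)"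

definition triple_edges :: "diagram \<Rightarrow> diagram \<Rightarrow> diagram \<Rightarrow> (vertex \<times> vertex) set" where
  "triple_edges D1 D2 D3 = edges D3 \<union> relab lift (edges D2) \<union> relab lift (relab lift (edges D1))"

lemma flat_stack:
  assumes "flat D" "flat D'"
  shows "stack_edges D D' \<subseteq> {v. snd v \<le> 2} \<times> {v. snd v \<le> 2}"
proof -
  have "relab lift (edges D) \<subseteq> {v. snd v \<le> 2} \<times> {v. snd v \<le> 2}"
    using assms(1) unfolding flat_def relab_def by (auto simp: lift_def)
  moreover have "edges D' \<subseteq> {v. snd v \<le> 2} \<times> {v. snd v \<le> 2}"
    using assms(2) unfolding flat_def by auto
  ultimately show ?thesis unfolding stack_edges_def by blast
qed

lemma rtrancl_field:
  assumes "(u, v) \<in> E\<^sup>*" "E \<subseteq> S \<times> S" "u \<noteq> v"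
  shows "u \<in> S \<and> v \<in> S"
  using assms by (metis mem_Sigma_iff converse_rtranclE rtranclE subset_iff)

text \<open>
  In the triple stack \<open>D2\<close> and \<open>D3\<close> meet at height \<open>1\<close>.
  Contracting the paths through this layer turns \<open>D2\<close> and \<open>D3\<close> into
  their composite.
\<close>

lemma connected_lower:
  assumes flat: "flat D2" "flat D3"
  shows "(u, v) \<in> connected_rel D1 (composite D2 D3) \<longleftrightarrow> (skip 1 u, skip 1 v) \<in> (triple_edges D1 D2 D3)\<^sup>*"
proof -
  let ?A = "stack_edges D2 D3" and ?B = "relab lift (relab lift (edges D1))"
  let ?Z = "{v. snd v \<noteq> 1} :: vertex set"
  let ?E = "relab (skip 1) (edges (composite D2 D3))"
  let ?N = "?A\<^sup>* \<inter> ?Z \<times> ?Z"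
  have B: "?B \<subseteq> ?Z \<times> ?Z" by (auto simp: relab_def lift_def)
  have Z: "skip 1 w \<in> ?Z" for w using range_skip[of 1] by auto
  have sk: "skip 1 w = outer w" if "snd w \<in> {0, 1}" for w
    using that by (auto simp: skip_def outer_def)
  have B': "?B = relab (skip 1) (relab lift (edges D1))"
    by (simp add: relab_relab lift_def skip_def)
  have 1: "?E \<subseteq> ?N"
  proof clarify
    fix a b c d assume "((a, b), c, d) \<in> ?E"
    then obtain x y where xy: "(a, b) = skip 1 x" "(c, d) = skip 1 y" "(x, y) \<in> edges (composite D2 D3)"
      by (rule relabE)
    then have "snd x \<in> {0, 1}" "snd y \<in> {0, 1}" "(outer x, outer y) \<in> ?A\<^sup>*"
      unfolding edges_composite connected_rel_eq by blast+
    then show "((a, b), c, d) \<in> ?N"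
      unfolding xy(1,2) using Z[of x] Z[of y] by (simp only: sk Int_iff mem_Sigma_iff)
  qed
  have 2: "?N \<subseteq> ?E \<union> Id"
  proof (rule subsetI, rule UnCI)
    fix p assume p: "p \<in> ?N" "p \<notin> Id"
    obtain a b c d where pe: "p = ((a, b), (c, d))" by (metis surj_pair)
    have N: "((a, b), c, d) \<in> ?A\<^sup>*" "(a, b) \<in> ?Z" "(c, d) \<in> ?Z" "(a, b) \<noteq> (c, d)"
      using p unfolding pe by auto
    have le: "b \<le> 2 \<and> d \<le> 2" using rtrancl_field[OF N(1) flat_stack[OF flat]] N(4) by auto
    let ?x = "(a, b div 2)" and ?y = "(c, d div 2)"
    have h: "b \<in> {0, 2}" "d \<in> {0, 2}" using le N(2,3) by auto
    then have o: "outer ?x = (a, b)" "outer ?y = (c, d)" "b div 2 \<in> {0, 1}" "d div 2 \<in> {0, 1}"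
      by (auto simp: outer_def)
    then have "(?x, ?y) \<in> edges (composite D2 D3)"
      using N(1) unfolding edges_composite connected_rel_eq by simp
    then have "(skip 1 ?x, skip 1 ?y) \<in> ?E" by (rule relabI)
    then show "p \<in> ?E" using sk[of ?x] sk[of ?y] o unfolding pe by simp
  qed
  have eq: "(?N \<union> ?B)\<^sup>* = (?E \<union> ?B)\<^sup>*"
  proof (rule rtrancl_subset)
    show "?E \<union> ?B \<subseteq> ?N \<union> ?B" using 1 by blast
    show "?N \<union> ?B \<subseteq> (?E \<union> ?B)\<^sup>*" using 2 by blast
  qed
  have T: "triple_edges D1 D2 D3 = ?A \<union> ?B" by (simp add: triple_edges_def stack_edges_def)
  have E: "?E \<union> ?B = relab (skip 1) (stack_edges D1 (composite D2 D3))"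
    unfolding B' stack_edges_def relab_Un ..
  have c: "(skip 1 u, skip 1 v) \<in> (?A \<union> ?B)\<^sup>* \<longleftrightarrow> (skip 1 u, skip 1 v) \<in> (?E \<union> ?B)\<^sup>*"
    unfolding eq[symmetric] by (rule contract[OF B Z Z])
  show ?thesis
    unfolding connected_rel_eq T c unfolding E relab_rtrancl_iff[OF inj_skip] ..
qed

text \<open>
  The same for the layer at height \<open>2\<close>, where \<open>D1\<close> and
  \<open>D2\<close> meet.
\<close>

lemma connected_upper:
  assumes flat: "flat D1" "flat D2" "flat D3"
  shows "(u, v) \<in> connected_rel (composite D1 D2) D3 \<longleftrightarrow> (skip 2 u, skip 2 v) \<in> (triple_edges D1 D2 D3)\<^sup>*"
proof -
  let ?A = "relab lift (stack_edges D1 D2)" and ?B = "edges D3"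
  let ?Z = "{v. snd v \<noteq> 2} :: vertex set"
  let ?E = "relab (skip 2) (relab lift (edges (composite D1 D2)))"
  let ?N = "?A\<^sup>* \<inter> ?Z \<times> ?Z"
  have B: "?B \<subseteq> ?Z \<times> ?Z" using flat(3) unfolding flat_def by auto
  have Z: "skip 2 w \<in> ?Z" for w using range_skip[of 2] by auto
  have sk: "skip 2 (lift w) = lift (outer w)" if "snd w \<in> {0, 1}" for w
    using that by (auto simp: skip_def outer_def lift_def)
  have B': "?B = relab (skip 2) (edges D3)"
  proof -
    have *: "skip 2 w = w" if "snd w \<le> 1" for w using that by (simp add: skip_def)
    have "map_prod (skip 2) (skip 2) p = p" if "p \<in> edges D3" for p
      using that flat(3) * unfolding flat_def by (cases p) auto
    then show ?thesis unfolding relab_def by simp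
  qed
  have 1: "?E \<subseteq> ?N"
  proof clarify
    fix a b c d assume "((a, b), c, d) \<in> ?E"
    then obtain x y where xy: "(a, b) = skip 2 (lift x)" "(c, d) = skip 2 (lift y)"
      "(x, y) \<in> edges (composite D1 D2)"
      by (metis relabE)
    then have h: "snd x \<in> {0, 1}" "snd y \<in> {0, 1}" "(outer x, outer y) \<in> (stack_edges D1 D2)\<^sup>*"
      unfolding edges_composite connected_rel_eq by blast+
    then show "((a, b), c, d) \<in> ?N"
      unfolding xy(1,2) using Z[of "lift x"] Z[of "lift y"] relab_rtranclI[OF h(3), of lift]
      by (simp only: sk Int_iff mem_Sigma_iff)
  qed
  have 2: "?N \<subseteq> ?E \<union> Id"
  proof (rule subsetI, rule UnCI)
    fix p assume p: "p \<in> ?N" "p \<notin> Id"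
    obtain a b c d where pe: "p = ((a, b), (c, d))" by (metis surj_pair)
    have N: "((a, b), c, d) \<in> ?A\<^sup>*" "(a, b) \<in> ?Z" "(c, d) \<in> ?Z" "(a, b) \<noteq> (c, d)"
      using p unfolding pe by auto
    have "(a, b) \<in> range lift"
    proof -
      have "?A \<subseteq> range lift \<times> range lift" by (auto simp: relab_def)
      then show ?thesis using rtrancl_field[OF N(1)] N(4) by blast
    qed
    then obtain p' where p': "(a, b) = lift p'" by blast
    have "\<exists>q. (c, d) = lift q \<and> (p', q) \<in> (stack_edges D1 D2)\<^sup>*"
      using N(1) unfolding p' by (rule relab_rtranclE[OF inj_lift])
    then obtain q where q: "(c, d) = lift q" "(p', q) \<in> (stack_edges D1 D2)\<^sup>*" by blast
    have "p' \<noteq> q" using N(4) p' q by auto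
    then have le: "snd p' \<le> 2 \<and> snd q \<le> 2"
      using rtrancl_field[OF q(2) flat_stack[OF flat(1,2)]] by auto
    moreover have "snd p' \<noteq> 1" "snd q \<noteq> 1" using N(2,3) p' q by (auto simp: lift_def)
    ultimately have h: "snd p' \<in> {0, 2}" "snd q \<in> {0, 2}" by auto
    let ?x = "(fst p', snd p' div 2)" and ?y = "(fst q, snd q div 2)"
    from h have o: "outer ?x = p'" "outer ?y = q" "snd ?x \<in> {0, 1}" "snd ?y \<in> {0, 1}"
      by (auto simp: outer_def prod_eq_iff)
    then have "(?x, ?y) \<in> edges (composite D1 D2)"
      using q(2) unfolding edges_composite connected_rel_eq by simp
    then have "(skip 2 (lift ?x), skip 2 (lift ?y)) \<in> ?E" by (intro relabI)
    then show "p \<in> ?E" using sk[of ?x] sk[of ?y] o p' q unfolding pe by simp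
  qed
  have eq: "(?N \<union> ?B)\<^sup>* = (?E \<union> ?B)\<^sup>*"
  proof (rule rtrancl_subset)
    show "?E \<union> ?B \<subseteq> ?N \<union> ?B" using 1 by blast
    show "?N \<union> ?B \<subseteq> (?E \<union> ?B)\<^sup>*" using 2 by blast
  qed
  have T: "triple_edges D1 D2 D3 = ?A \<union> ?B"
    unfolding triple_edges_def stack_edges_def relab_Un by blast
  have E: "?E \<union> ?B = relab (skip 2) (stack_edges (composite D1 D2) D3)"
    unfolding stack_edges_def relab_Un B'[symmetric] by blast
  have c: "(skip 2 u, skip 2 v) \<in> (?A \<union> ?B)\<^sup>* \<longleftrightarrow> (skip 2 u, skip 2 v) \<in> (?E \<union> ?B)\<^sup>*"
    unfolding eq[symmetric] by (rule contract[OF B Z Z])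
  show ?thesis
    unfolding connected_rel_eq T c unfolding E relab_rtrancl_iff[OF inj_skip] ..
qed

text \<open>The two embeddings of a stack of two into the triple stack agree on the boundary.\<close>

lemma composite_assoc_flat:
  assumes "flat D1" "flat D2" "flat D3"
  shows "composite (composite D1 D2) D3 = composite D1 (composite D2 D3)"
proof -
  have sk: "skip 1 (outer x) = skip 2 (outer x)" if "snd x \<in> {0, 1}" for x
    using that by (auto simp: skip_def outer_def)
  have "(outer x, outer y) \<in> connected_rel (composite D1 D2) D3 \<longleftrightarrow>
      (outer x, outer y) \<in> connected_rel D1 (composite D2 D3)"
    if "snd x \<in> {0, 1}" "snd y \<in> {0, 1}" for x y
    using that sk[of x] sk[of y]
    by (simp add: connected_lower[OF assms(2,3)] connected_upper[OF assms])
  then have "{y. snd y \<in> {0, 1} \<and> (outer x, outer y) \<in> connected_rel (composite D1 D2) D3} =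
      {y. snd y \<in> {0, 1} \<and> (outer x, outer y) \<in> connected_rel D1 (composite D2 D3)}"
    if "snd x \<in> {0, 1}" for x using that by blast
  then show ?thesis
    unfolding composite_eq_classes[of "composite D1 D2"] composite_eq_classes[of D1 "composite D2 D3"]
      setcompr_eq_image by (intro image_cong) simp_all
qed

section \<open>Counting loops\<close>

definition orbit :: "nat \<Rightarrow> vertex set \<Rightarrow> vertex set set" where
  "orbit m C = {translate (d * int m) ` C | d. True}"

text \<open>
  For the connectedness of a stack and its middle layer these are the loops on the cylinder; in
  a triple stack the loops lie in two layers.
\<close>

definition class_orbits :: "nat \<Rightarrow> (vertex \<times> vertex) set \<Rightarrow> vertex set \<Rightarrow> vertex set set set" where
  "class_orbits m R S = (\<lambda>v. orbit m (R `` {v})) ` {v. R `` {v} \<subseteq> S}"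

lemma loops_eq: "loops m D D' = class_orbits m (connected_rel D D') {v. snd v = 1}"
proof -
  have 1: "UNIV \<times> {1} = {v :: vertex. snd v = 1}" by (auto simp: Set.set_eq_iff split_paired_All)
  have self: "v \<in> connected_rel D D' `` {v}" for v by (simp add: connected_rel_eq)
  show ?thesis
  proof
    show "loops m D D' \<subseteq> class_orbits m (connected_rel D D') {v. snd v = 1}"
      unfolding loops_def components_def 1 class_orbits_def orbit_def by blast
    show "class_orbits m (connected_rel D D') {v. snd v = 1} \<subseteq> loops m D D'"
    proof
      fix L assume "L \<in> class_orbits m (connected_rel D D') {v. snd v = 1}"
      then obtain v where v: "L = orbit m (connected_rel D D' `` {v})"
        "connected_rel D D' `` {v} \<subseteq> {v. snd v = 1}"
        unfolding class_orbits_def by (elim imageE CollectE)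
      then have "snd v = 1" using self[of v] by blast
      then have "v \<in> UNIV \<times> {0, 1, 2}" by (cases v) simp
      then have "connected_rel D D' `` {v} \<in> components D D'"
        unfolding components_def by (intro CollectI exI[of _ v] conjI refl)
      then show "L \<in> loops m D D'" using v(2) unfolding loops_def 1 v(1) orbit_def
        by (intro CollectI exI[of _ "connected_rel D D' `` {v}"] conjI refl)
    qed
  qed
qed

lemma translation_invariant_rtrancl:
  assumes "translation_invariant m E"
  shows "translation_invariant m (E\<^sup>*)"
proof -
  have "(translate d u, translate d v) \<in> E\<^sup>*" if "int m dvd d" "(u, v) \<in> E\<^sup>*" for d u v
    using that(2)
  proof (induction rule: rtrancl_induct)
    case (step y z)
    then have "(translate d y, translate d z) \<in> E"
      using assms that(1) unfolding translation_invariant_def by blast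
    then show ?case using step(3) by (rule rtrancl.rtrancl_into_rtrancl[rotated])
  qed simp
  then show ?thesis unfolding translation_invariant_def by blast
qed

lemma translation_invariant_Un:
  "translation_invariant m A \<Longrightarrow> translation_invariant m B \<Longrightarrow> translation_invariant m (A \<union> B)"
  unfolding translation_invariant_def by blast

lemma translation_invariant_lift:
  assumes "translation_invariant m E"
  shows "translation_invariant m (relab lift E)"
proof -
  have "(translate d u, translate d v) \<in> relab lift E" if uv: "int m dvd d" "(u, v) \<in> relab lift E" for d u v
  proof -
    obtain p q where pq: "u = lift p" "v = lift q" "(p, q) \<in> E" using uv(2) by (rule relabE)
    have "(translate d p, translate d q) \<in> E"
      using assms uv(1) pq(3) unfolding translation_invariant_def by blast
    then have "(lift (translate d p), lift (translate d q)) \<in> relab lift E" by (rule relabI)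
    then show ?thesis unfolding pq by (simp add: lift_def translate_def case_prod_beta)
  qed
  then show ?thesis unfolding translation_invariant_def by blast
qed

lemma class_translate:
  assumes R: "translation_invariant m R" and d: "int m dvd d"
  shows "R `` {translate d v} = translate d ` (R `` {v})"
proof
  show "R `` {translate d v} \<subseteq> translate d ` (R `` {v})"
  proof
    fix w assume "w \<in> R `` {translate d v}"
    then have "(translate (- d) (translate d v), translate (- d) w) \<in> R"
      using R d unfolding translation_invariant_def by (metis Image_singleton_iff dvd_minus_iff)
    then have "translate (- d) w \<in> R `` {v}" by simp
    moreover have "w = translate d (translate (- d) w)" by simp
    ultimately show "w \<in> translate d ` (R `` {v})" by (rule image_eqI[rotated])
  qed
  show "translate d ` (R `` {v}) \<subseteq> R `` {translate d v}"
    using R d unfolding translation_invariant_def by blast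
qed

lemma orbit_translate: "orbit m (translate (d * int m) ` C) = orbit m C"
proof -
  have 1: "translate (e * int m) ` translate (d * int m) ` C = translate ((e + d) * int m) ` C" for e
    by (simp add: algebra_simps)
  have 2: "translate (e * int m) ` C = translate ((e - d) * int m) ` translate (d * int m) ` C" for e
    by (simp add: algebra_simps)
  show ?thesis unfolding orbit_def
    apply (rule Set.set_eqI)
    apply (unfold mem_Collect_eq)
    using 1 2 by metis
qed

lemma self_in_orbit: "C \<in> orbit m C"
  unfolding orbit_def by (intro CollectI exI[of _ 0]) simp

text \<open>Up to translation a class has a representative in a fundamental domain.\<close>

lemma finite_class_orbits:
  assumes m: "m \<ge> 1" and R: "translation_invariant m R" "refl R" and S: "S \<subseteq> {v. snd v \<le> N}"
  shows "finite (class_orbits m R S)"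
proof (rule finite_subset)
  show "finite ((\<lambda>v. orbit m (R `` {v})) ` ({0..<int m} \<times> {..N}))" by simp
  show "class_orbits m R S \<subseteq> (\<lambda>v. orbit m (R `` {v})) ` ({0..<int m} \<times> {..N})"
  proof
    fix L assume "L \<in> class_orbits m R S"
    then obtain v where v: "L = orbit m (R `` {v})" "R `` {v} \<subseteq> S"
      unfolding class_orbits_def by (elim imageE CollectE)
    have "(v, v) \<in> R" using R(2) by (simp add: refl_on_def)
    then have sv: "snd v \<le> N" using v(2) S by blast
    let ?v = "(fst v mod int m, snd v)"
    have tr: "v = translate (fst v div int m * int m) ?v" by (cases v) simp
    have "L = orbit m (R `` {translate (fst v div int m * int m) ?v})" using v(1) tr by metis
    also have "\<dots> = orbit m (R `` {?v})"
      by (subst class_translate[OF R(1)]) (simp_all add: orbit_translate del: translate_simps)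
    finally show "L \<in> (\<lambda>v. orbit m (R `` {v})) ` ({0..<int m} \<times> {..N})"
      using m sv by (intro image_eqI) auto
  qed
qed

lemma image_orbit:
  assumes "\<And>d C. f (translate (d * int m) ` C) = translate (d * int m) ` f C"
  shows "f ` orbit m C = orbit m (f C)"
  unfolding orbit_def setcompr_eq_image image_image using assms by simp

text \<open>
  A class inside \<open>- Z \<union> Y\<close> that misses \<open>Z\<close> contains no edge of
  \<open>B\<close>, so it is a class of \<open>A\<close>. One that meets \<open>Z\<close> is
  determined by its trace on \<open>Z\<close>, which lies in \<open>Y\<close>. When
  \<open>A\<close> is a pair of diagrams in a triple stack and \<open>- Z\<close> the layer
  where they meet, these are the loops of the first and of the second multiplication.
\<close>

lemma card_class_orbits_split:
  fixes A B :: "(vertex \<times> vertex) set"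
  defines "R \<equiv> (A \<union> B)\<^sup>*"
  assumes sym: "sym A" "sym B" and BZ: "B \<subseteq> Z \<times> Z" and YZ: "Y \<subseteq> Z"
    and fin: "finite (class_orbits m R (- Z \<union> Y))"
    and inv: "translation_invariant m R"
    and f: "inj f" "range f = Z" "\<And>d v. f (translate d v) = translate d (f v)"
  shows "card (class_orbits m R (- Z \<union> Y)) =
    card (class_orbits m (A\<^sup>*) (- Z)) + card (class_orbits m {(u, v). (f u, f v) \<in> R} (f -` Y))"
proof -
  let ?C = "{(u, v). (f u, f v) \<in> R}"
  have symR: "sym (A \<union> B)" using sym by (simp add: sym_Un)
  have self: "v \<in> R `` {v}" for v by (simp add: R_def)
  have cls: "R `` {u} = R `` {v}" if "(u, v) \<in> R" for u v
    using rtrancl_class_eq[OF symR] that unfolding R_def by blast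
  have trZ: "translate d v \<in> Z \<longleftrightarrow> v \<in> Z" for d v
  proof -
    have "translate e w \<in> Z" if w: "w \<in> Z" for e w
    proof -
      obtain x where "w = f x" using w f(2) by blast
      then have "translate e w = f (translate e x)" using f(3) by simp
      then show ?thesis using f(2) by blast
    qed
    from this[of v d] this[of "translate d v" "- d"] show ?thesis by auto
  qed
  \<comment> \<open>\<open>L1\<close> comes from the classes that miss \<open>Z\<close>, \<open>L2\<close> from those that meet it\<close>
  define L1 where "L1 = (\<lambda>v. orbit m (R `` {v})) ` {v. R `` {v} \<subseteq> - Z \<union> Y \<and> R `` {v} \<inter> Z = {}}"
  define L2 where "L2 = (\<lambda>v. orbit m (R `` {v})) ` {v. R `` {v} \<subseteq> - Z \<union> Y \<and> R `` {v} \<inter> Z \<noteq> {}}"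
  have un: "class_orbits m R (- Z \<union> Y) = L1 \<union> L2"
    unfolding class_orbits_def L1_def L2_def image_Un[symmetric] by (rule arg_cong2[of _ _ _ _ "(`)"]) auto
  have disj: "L1 \<inter> L2 = {}"
  proof (rule ccontr)
    assume "L1 \<inter> L2 \<noteq> {}"
    then obtain X where X: "X \<in> L1" "X \<in> L2" by blast
    obtain v where v: "X = orbit m (R `` {v})" "R `` {v} \<inter> Z = {}"
      using X(1) unfolding L1_def by (elim imageE CollectE conjE)
    obtain w where w: "X = orbit m (R `` {w})" "R `` {w} \<inter> Z \<noteq> {}"
      using X(2) unfolding L2_def by (elim imageE CollectE conjE)
    have vw: "orbit m (R `` {v}) = orbit m (R `` {w})" "R `` {v} \<inter> Z = {}" "R `` {w} \<inter> Z \<noteq> {}"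
      using v w by simp_all
    have "R `` {w} \<in> orbit m (R `` {v})" unfolding vw(1) by (rule self_in_orbit)
    then obtain d where "R `` {w} = translate d ` (R `` {v})" unfolding orbit_def by auto
    then show False using vw(2,3) trZ by auto
  qed
  have hid: "R `` {v} = A\<^sup>* `` {v}" if "R `` {v} \<inter> Z = {} \<or> A\<^sup>* `` {v} \<inter> Z = {}" for v
  proof -
    have AR: "A\<^sup>* \<subseteq> R" unfolding R_def by (rule rtrancl_mono) simp
    have h: "A\<^sup>* `` {v} \<inter> Z = {}" using that AR by blast
    have "(v, w) \<in> A\<^sup>*" if "(v, w) \<in> R" for w
      using that unfolding R_def
    proof (induction rule: rtrancl_induct)
      case (step y z)
      then have "(y, z) \<notin> B" using h BZ by blast
      then have "(y, z) \<in> A" using step(2) by blast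
      then show ?case using step(3) by (rule rtrancl.rtrancl_into_rtrancl[rotated])
    qed simp
    then show ?thesis using AR by blast
  qed
  have L1: "L1 = class_orbits m (A\<^sup>*) (- Z)"
    unfolding L1_def class_orbits_def
  proof (rule image_cong)
    show "{v. R `` {v} \<subseteq> - Z \<union> Y \<and> R `` {v} \<inter> Z = {}} = {v. A\<^sup>* `` {v} \<subseteq> - Z}"
      using hid by (intro Collect_cong) blast
    show "orbit m (R `` {v}) = orbit m (A\<^sup>* `` {v})" if "v \<in> {v. A\<^sup>* `` {v} \<subseteq> - Z}" for v
      using hid[of v] that by (metis Collect_mem_eq disjoint_eq_subset_Compl mem_Collect_eq)
  qed
  have ftr: "f -` (translate d ` K) = translate d ` (f -` K)" for d K
  proof (rule Set.set_eqI)
    fix x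
    have tr: "y \<in> translate d ` M \<longleftrightarrow> translate (- d) y \<in> M" for y M
    proof
      assume "translate (- d) y \<in> M"
      then have "translate d (translate (- d) y) \<in> translate d ` M" by (rule imageI)
      then show "y \<in> translate d ` M" by simp
    qed auto
    show "x \<in> f -` (translate d ` K) \<longleftrightarrow> x \<in> translate d ` (f -` K)"
      unfolding tr vimage_eq by (simp add: tr f(3))
  qed
  have vR: "f -` (R `` {f u}) = ?C `` {u}" for u by auto
  let ?g = "\<lambda>X. (\<lambda>K. f -` K) ` X"
  have g: "?g (orbit m (R `` {f u})) = orbit m (?C `` {u})" for u
    using image_orbit[of "\<lambda>K. f -` K" m, OF ftr] by (simp only: vR)
  have L2': "L2 = (\<lambda>u. orbit m (R `` {f u})) ` {u. R `` {f u} \<subseteq> - Z \<union> Y}"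
  proof
    show "L2 \<subseteq> (\<lambda>u. orbit m (R `` {f u})) ` {u. R `` {f u} \<subseteq> - Z \<union> Y}"
    proof
      fix L assume "L \<in> L2"
      then obtain v where v: "L = orbit m (R `` {v})" "R `` {v} \<subseteq> - Z \<union> Y" "R `` {v} \<inter> Z \<noteq> {}"
        unfolding L2_def by (elim imageE CollectE conjE)
      then obtain u where u: "f u \<in> R `` {v}" using f(2) by blast
      then have "R `` {v} = R `` {f u}" using cls by blast
      then show "L \<in> (\<lambda>u. orbit m (R `` {f u})) ` {u. R `` {f u} \<subseteq> - Z \<union> Y}"
        using v by (intro image_eqI[of _ _ u]) simp_all
    qed
    show "(\<lambda>u. orbit m (R `` {f u})) ` {u. R `` {f u} \<subseteq> - Z \<union> Y} \<subseteq> L2"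
    proof (rule image_subsetI)
      fix u assume "u \<in> {u. R `` {f u} \<subseteq> - Z \<union> Y}"
      moreover have "f u \<in> R `` {f u} \<inter> Z" using self f(2) by blast
      ultimately show "orbit m (R `` {f u}) \<in> L2" unfolding L2_def
        by (intro image_eqI[of _ _ "f u"]) auto
    qed
  qed
  have gL2: "?g ` L2 = class_orbits m ?C (f -` Y)"
  proof -
    have "R `` {f u} \<subseteq> - Z \<union> Y \<longleftrightarrow> ?C `` {u} \<subseteq> f -` Y" for u
    proof
      assume "?C `` {u} \<subseteq> f -` Y"
      then have c: "f w \<in> Y" if "(f u, f w) \<in> R" for w using that by blast
      show "R `` {f u} \<subseteq> - Z \<union> Y"
      proof
        fix x assume x: "x \<in> R `` {f u}"
        show "x \<in> - Z \<union> Y"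
        proof (cases "x \<in> Z")
          case True
          then obtain w where "x = f w" using f(2) by blast
          then show ?thesis using c x by blast
        qed simp
      qed
    next
      assume a: "R `` {f u} \<subseteq> - Z \<union> Y"
      have "f w \<in> Y" if "(f u, f w) \<in> R" for w using a that f(2) by blast
      then show "?C `` {u} \<subseteq> f -` Y" by blast
    qed
    then show ?thesis unfolding L2' class_orbits_def image_image g by (simp only:)
  qed
  \<comment> \<open>a class that meets \<open>Z\<close> can be recovered from any point of its trace\<close>
  have inj: "inj_on ?g L2"
  proof (rule inj_on_image, rule inj_onI)
    have K: "\<exists>u. K = R `` {f u}" if KL: "K \<in> \<Union>L2" for K
    proof -
      obtain u d where "K = translate (d * int m) ` (R `` {f u})"
        using KL unfolding L2' orbit_def by auto
      then have "K = R `` {f (translate (d * int m) u)}"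
        using class_translate[OF inv, of "d * int m" "f u"] f(3) by simp
      then show ?thesis by blast
    qed
    fix K K' assume KK: "K \<in> \<Union>L2" "K' \<in> \<Union>L2" "f -` K = f -` K'"
    then obtain u where u: "K = R `` {f u}" using K by blast
    obtain u' where u': "K' = R `` {f u'}" using K KK by blast
    have "u \<in> f -` K" using self u by blast
    then have "(f u', f u) \<in> R" using KK(3) u' by blast
    then show "K = K'" unfolding u u' by (rule cls[symmetric])
  qed
  have "card L2 = card (class_orbits m ?C (f -` Y))"
    unfolding gL2[symmetric] by (rule card_image[OF inj, symmetric])
  moreover have "card (L1 \<union> L2) = card L1 + card L2"
    using fin disj unfolding un by (intro card_Un_disjoint) auto
  ultimately show ?thesis unfolding un L1 by simp
qed

lemma card_class_orbits_relab:
  assumes f: "inj f" "\<And>d v. f (translate d v) = translate d (f v)"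
  shows "card (class_orbits m ((relab f E)\<^sup>*) (f ` S)) = card (class_orbits m (E\<^sup>*) S)"
proof -
  have cls: "(relab f E)\<^sup>* `` {f v} = f ` (E\<^sup>* `` {v})" for v
  proof
    show "(relab f E)\<^sup>* `` {f v} \<subseteq> f ` (E\<^sup>* `` {v})" using relab_rtranclE[OF f(1)] by blast
    show "f ` (E\<^sup>* `` {v}) \<subseteq> (relab f E)\<^sup>* `` {f v}" using relab_rtranclI by blast
  qed
  have ftr: "f ` translate d ` C = translate d ` f ` C" for d C
    by (simp add: image_image f(2))
  have "{w. (relab f E)\<^sup>* `` {w} \<subseteq> f ` S} = f ` {v. E\<^sup>* `` {v} \<subseteq> S}"
  proof
    show "{w. (relab f E)\<^sup>* `` {w} \<subseteq> f ` S} \<subseteq> f ` {v. E\<^sup>* `` {v} \<subseteq> S}"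
    proof
      fix w assume w: "w \<in> {w. (relab f E)\<^sup>* `` {w} \<subseteq> f ` S}"
      then have "w \<in> f ` S" by blast
      then obtain v where v: "w = f v" by blast
      then have "f ` (E\<^sup>* `` {v}) \<subseteq> f ` S" using w cls by blast
      then show "w \<in> f ` {v. E\<^sup>* `` {v} \<subseteq> S}" using v inj_image_subset_iff[OF f(1)] by blast
    qed
    show "f ` {v. E\<^sup>* `` {v} \<subseteq> S} \<subseteq> {w. (relab f E)\<^sup>* `` {w} \<subseteq> f ` S}"
      by (rule image_subsetI) (simp add: cls image_mono)
  qed
  then have "class_orbits m ((relab f E)\<^sup>*) (f ` S) = (\<lambda>X. (\<lambda>K. f ` K) ` X) ` class_orbits m (E\<^sup>*) S"
    unfolding class_orbits_def by (simp only: image_image[of _ f] cls image_image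
      image_orbit[of "\<lambda>K. f ` K" m, OF ftr])
  moreover have "inj_on (\<lambda>X. (\<lambda>K. f ` K) ` X) M" for M
    by (rule inj_on_image, rule inj_onI) (simp add: inj_image_eq_iff[OF f(1)])
  ultimately show ?thesis by (simp add: card_image)
qed

lemma lift_translate: "lift (translate d v) = translate d (lift v)"
  by (simp add: lift_def translate_def case_prod_beta)

lemma skip_translate: "skip k (translate d v) = translate d (skip k v)"
  by (simp add: skip_def translate_def case_prod_beta)

text \<open>Both sides count the loops in the two middle layers of the triple stack.\<close>

lemma card_loops_assoc_flat:
  assumes m: "m \<ge> 1" and flat: "flat D1" "flat D2" "flat D3"
    and inv: "\<And>D. D \<in> {D1, D2, D3} \<Longrightarrow> translation_invariant m (edges D)"
  shows "card (loops m D1 D2) + card (loops m (composite D1 D2) D3) =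
    card (loops m D2 D3) + card (loops m D1 (composite D2 D3))"
proof -
  define T where "T = triple_edges D1 D2 D3"
  define L where "L = class_orbits m (T\<^sup>*) {v. snd v \<in> {1, 2}}"
  have tT: "translation_invariant m (T\<^sup>*)"
    unfolding T_def triple_edges_def
    by (intro translation_invariant_rtrancl translation_invariant_Un translation_invariant_lift inv) simp_all
  have fin: "finite L" unfolding L_def
    by (rule finite_class_orbits[OF m tT, of _ 2]) (auto simp: refl_rtrancl)
  have lower: "card L = card (loops m D2 D3) + card (loops m D1 (composite D2 D3))"
  proof -
    let ?A = "stack_edges D2 D3" and ?B = "relab lift (relab lift (edges D1))"
    let ?Z = "{v. snd v \<noteq> 1} :: vertex set" and ?Y = "{v. snd v = 2} :: vertex set"
    have T: "T = ?A \<union> ?B" by (simp add: T_def triple_edges_def stack_edges_def)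
    have S: "{v. snd v \<in> {1, 2}} = - ?Z \<union> ?Y" by auto
    have C: "{(u, v). (skip 1 u, skip 1 v) \<in> T\<^sup>*} = connected_rel D1 (composite D2 D3)"
      unfolding T_def connected_lower[OF flat(2,3), symmetric] by simp
    have Y: "skip 1 -` ?Y = {v. snd v = 1}" and Z: "- ?Z = {v. snd v = 1}"
      by (auto simp: skip_def split: if_splits)
    have "card L = card (class_orbits m (?A\<^sup>*) (- ?Z)) +
        card (class_orbits m {(u, v). (skip 1 u, skip 1 v) \<in> T\<^sup>*} (skip 1 -` ?Y))"
      unfolding L_def S T
    proof (rule card_class_orbits_split)
      show "sym ?A" "sym ?B" by (simp_all add: sym_stack sym_relab sym_edges)
      show "?B \<subseteq> ?Z \<times> ?Z" by (auto simp: relab_def lift_def)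
      show "?Y \<subseteq> ?Z" by auto
      show "finite (class_orbits m ((?A \<union> ?B)\<^sup>*) (- ?Z \<union> ?Y))" using fin unfolding L_def S T .
      show "translation_invariant m ((?A \<union> ?B)\<^sup>*)" using tT unfolding T .
    qed (simp_all add: inj_skip range_skip skip_translate)
    then show ?thesis unfolding C Y Z loops_eq connected_rel_eq .
  qed
  have upper: "card L = card (loops m D1 D2) + card (loops m (composite D1 D2) D3)"
  proof -
    let ?A = "relab lift (stack_edges D1 D2)" and ?B = "edges D3"
    let ?Z = "{v. snd v \<noteq> 2} :: vertex set" and ?Y = "{v. snd v = 1} :: vertex set"
    have T: "T = ?A \<union> ?B" unfolding T_def triple_edges_def stack_edges_def relab_Un by blast
    have S: "{v. snd v \<in> {1, 2}} = - ?Z \<union> ?Y" by auto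
    have C: "{(u, v). (skip 2 u, skip 2 v) \<in> T\<^sup>*} = connected_rel (composite D1 D2) D3"
      unfolding T_def connected_upper[OF flat, symmetric] by simp
    have Y: "skip 2 -` ?Y = {v. snd v = 1}"
      by (auto simp: skip_def split: if_splits)
    have Z: "- ?Z = lift ` {v. snd v = 1}"
    proof -
      have "v = lift (fst v, 1)" if "snd v = 2" for v using that by (simp add: lift_def prod_eq_iff)
      then have "v \<in> lift ` {v. snd v = 1}" if "snd v = 2" for v
        using that by (intro image_eqI[of _ _ "(fst v, 1)"]) simp_all
      then show ?thesis by (auto simp: lift_def)
    qed
    have "card L = card (class_orbits m (?A\<^sup>*) (- ?Z)) +
        card (class_orbits m {(u, v). (skip 2 u, skip 2 v) \<in> T\<^sup>*} (skip 2 -` ?Y))"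
      unfolding L_def S T
    proof (rule card_class_orbits_split)
      show "sym ?A" "sym ?B" by (simp_all add: sym_stack sym_relab sym_edges)
      show "?B \<subseteq> ?Z \<times> ?Z" using flat(3) unfolding flat_def by auto
      show "?Y \<subseteq> ?Z" by auto
      show "finite (class_orbits m ((?A \<union> ?B)\<^sup>*) (- ?Z \<union> ?Y))" using fin unfolding L_def S T .
      show "translation_invariant m ((?A \<union> ?B)\<^sup>*)" using tT unfolding T .
    qed (simp_all add: inj_skip range_skip skip_translate)
    then show ?thesis
      unfolding C Y Z card_class_orbits_relab[OF inj_lift lift_translate] loops_eq connected_rel_eq .
  qed
  show ?thesis using lower upper by simp
qed

lemma affine_flat: 
  assumes "D \<in> affine_diagrams m"
  shows "flat D"
proof -
  have D: "\<Union>D = UNIV \<times> {0, 1}" using assms by (simp add: affine_diagrams_def partition_on_def)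
  have *: "snd u \<le> 1" if "u \<in> B" "B \<in> D" for u B
  proof -
    have "u \<in> \<Union>D" using that by (rule UnionI[rotated])
    then have "u \<in> UNIV \<times> {0, 1}" unfolding D .
    then have "snd u \<in> {0, 1}" by (rule mem_Times_iff[THEN iffD1, THEN conjunct2])
    then show ?thesis by auto
  qed
  show ?thesis unfolding flat_def
  proof (rule subsetI)
    fix p assume p: "p \<in> edges D"
    then obtain B where "B \<in> D" "fst p \<in> B" "snd p \<in> B" by (auto simp: edges_def case_prod_beta)
    then show "p \<in> {v. snd v \<le> 1} \<times> {v. snd v \<le> 1}" using * by (simp add: mem_Times_iff)
  qed
qed

lemma affine_translation_invariant:
  assumes "D \<in> affine_diagrams m"
  shows "translation_invariant m (edges D)"
proof -
  have "(translate d u, translate d v) \<in> edges D" if "int m dvd d" "(u, v) \<in> edges D" for d u v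
  proof -
    have "\<exists>B\<in>D. u \<in> B \<and> v \<in> B" using that(2) by (simp add: edges_def)
    then obtain B where B: "B \<in> D" "u \<in> B" "v \<in> B" by blast
    have "\<exists>B\<in>D. translate d u \<in> B \<and> translate d v \<in> B"
      using block_translate[OF assms that(1) B(1)] imageI[OF B(2)] imageI[OF B(3)] by (intro bexI conjI)
    then show ?thesis by (simp add: edges_def)
  qed
  then show ?thesis unfolding translation_invariant_def by blast
qed

lemma composite_assoc:
  assumes "D1 \<in> affine_diagrams m" "D2 \<in> affine_diagrams m" "D3 \<in> affine_diagrams m"
  shows "composite (composite D1 D2) D3 = composite D1 (composite D2 D3)"
  using assms by (intro composite_assoc_flat affine_flat)

lemma card_loops_assoc:
  assumes "m \<ge> 1" "D1 \<in> affine_diagrams m" "D2 \<in> affine_diagrams m" "D3 \<in> affine_diagrams m"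
  shows "card (loops m D1 D2) + card (loops m (composite D1 D2) D3) =
    card (loops m D2 D3) + card (loops m D1 (composite D2 D3))"
  using assms by (intro card_loops_assoc_flat) (auto intro: affine_flat affine_translation_invariant)

section \<open>Products with strands and with cup-caps\<close>

lemma edges_arc: "{x, y} \<in> D \<Longrightarrow> (x, y) \<in> edges D"
  by (auto simp: edges_def)

lemma edges_affine_iff:
  assumes "D \<in> affine_diagrams m"
  shows "(x, y) \<in> edges D \<longleftrightarrow> (x = y \<and> snd x \<in> {0, 1}) \<or> {x, y} \<in> D"
proof
  assume "(x, y) \<in> edges D"
  then have "\<exists>B\<in>D. x \<in> B \<and> y \<in> B" by (simp add: edges_def)
  then obtain B where B: "B \<in> D" "x \<in> B" "y \<in> B" by blast
  obtain u v where uv: "B = {u, v}" using affine_block[OF assms B(1)] by blast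
  have "snd u \<in> {0, 1}" "snd v \<in> {0, 1}" using arc_height[OF assms, of u v] B(1) uv by auto
  moreover have "(x = u \<or> x = v) \<and> (y = u \<or> y = v)" using B uv by simp
  moreover have "{v, u} \<in> D" "{u, v} \<in> D" using B(1) uv by (simp_all add: insert_commute)
  ultimately show "(x = y \<and> snd x \<in> {0, 1}) \<or> {x, y} \<in> D" by metis
next
  assume "(x = y \<and> snd x \<in> {0, 1}) \<or> {x, y} \<in> D"
  moreover have "(x, x) \<in> edges D" if h: "snd x \<in> {0, 1}"
  proof -
    obtain v where "{x, v} \<in> D" using arc_exists[OF assms h] by blast
    then show ?thesis by (auto simp: edges_def)
  qed
  ultimately show "(x, y) \<in> edges D" using edges_arc by blast
qed

definition block_at :: "diagram \<Rightarrow> vertex \<Rightarrow> vertex set" where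
  "block_at D x = edges D `` {x}"

lemma block_at_eq:
  assumes "D \<in> affine_diagrams m" "{x, y} \<in> D"
  shows "block_at D x = {x, y}"
proof -
  have h: "snd x \<in> {0, 1}" using arc_height[OF assms] by blast
  have "z \<in> block_at D x \<longleftrightarrow> z \<in> {x, y}" for z
    unfolding block_at_def using edges_affine_iff[OF assms(1), of x z] arc_unique[OF assms(1,2), of z] h assms(2)
    by auto
  then show ?thesis by blast
qed

lemma block_at_iff:
  assumes "D \<in> affine_diagrams m" "snd x \<in> {0, 1}" "snd y \<in> {0, 1}"
  shows "block_at D x = block_at D y \<longleftrightarrow> (x, y) \<in> edges D"
proof -
  obtain x' y' where x: "{x, x'} \<in> D" and y: "{y, y'} \<in> D"
    using arc_exists[OF assms(1)] assms(2,3) by blast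
  have "(x, y) \<in> edges D \<longleftrightarrow> y \<in> {x, x'}"
    using edges_affine_iff[OF assms(1), of x y] arc_unique[OF assms(1) x, of y] assms(2) x by auto
  moreover have "{x, x'} = {y, y'} \<longleftrightarrow> y \<in> {x, x'}"
  proof
    assume "y \<in> {x, x'}"
    then show "{x, x'} = {y, y'}" using block_unique[OF assms(1) x y] by simp
  qed (metis insertI1)
  ultimately show ?thesis unfolding block_at_eq[OF assms(1) x] block_at_eq[OF assms(1) y] by simp
qed

lemma affine_eq_blocks:
  assumes "D \<in> affine_diagrams m"
  shows "D = {edges D `` {x} | x. snd x \<in> {0, 1}}"
proof
  show "D \<subseteq> {edges D `` {x} | x. snd x \<in> {0, 1}}"
  proof
    fix B assume B: "B \<in> D"
    obtain x y where xy: "B = {x, y}" using affine_block[OF assms B] by blast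
    have "B = edges D `` {x}" "snd x \<in> {0, 1}"
      using block_at_eq[OF assms, of x y] arc_height[OF assms, of x y] B xy by (simp_all add: block_at_def)
    then show "B \<in> {edges D `` {x} | x. snd x \<in> {0, 1}}" by blast
  qed
  show "{edges D `` {x} | x. snd x \<in> {0, 1}} \<subseteq> D"
  proof clarify
    fix j h assume "snd (j :: int, h :: nat) \<in> {0, 1}"
    then obtain y where "{(j, h), y} \<in> D" using arc_exists[OF assms] by blast
    then show "edges D `` {(j, h)} \<in> D" using block_at_eq[OF assms] by (simp add: block_at_def)
  qed
qed

text \<open>
  A product is computed by exhibiting a labelling of the vertices of the stack that is constant on
  connected components and whose restriction to the outer vertices is the expected diagram.
\<close>

lemma composite_eqI:
  fixes lab :: "vertex \<Rightarrow> 'l"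
  assumes D: "D \<in> affine_diagrams m" "D' \<in> affine_diagrams m" and C: "C \<in> affine_diagrams m"
    and below: "\<And>p q. {p, q} \<in> D' \<Longrightarrow> lab p = lab q"
    and above: "\<And>p q. {p, q} \<in> D \<Longrightarrow> lab (lift p) = lab (lift q)"
    and outer: "\<And>x y. snd x \<in> {0, 1} \<Longrightarrow> snd y \<in> {0, 1} \<Longrightarrow> lab (outer x) = lab (outer y) \<Longrightarrow> (x, y) \<in> edges C"
    and conn: "\<And>x y. {x, y} \<in> C \<Longrightarrow> (outer x, outer y) \<in> connected_rel D D'"
  shows "composite D D' = C" and "(u, v) \<in> connected_rel D D' \<Longrightarrow> lab u = lab v"
proof -
  have step: "lab x = lab y" if s: "(x, y) \<in> stack_edges D D'" for x y
  proof (cases "(x, y) \<in> edges D'")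
    case True
    then have "x = y \<or> {x, y} \<in> D'" unfolding edges_affine_iff[OF D(2)] by blast
    then show ?thesis using below by metis
  next
    case False
    then have "(x, y) \<in> relab lift (edges D)" using s unfolding stack_edges_def by blast
    then obtain p q where "x = lift p" "y = lift q" and pq: "(p, q) \<in> edges D" by (rule relabE)
    from pq have "p = q \<or> {p, q} \<in> D" unfolding edges_affine_iff[OF D(1)] by blast
    then have "lab (lift p) = lab (lift q)" using above by metis
    then show ?thesis using \<open>x = lift p\<close> \<open>y = lift q\<close> by simp
  qed
  have inv: "lab u = lab v" if "(u, v) \<in> connected_rel D D'" for u v
    using that unfolding connected_rel_eq by (induction rule: rtrancl_induct) (simp_all add: step)
  then show "(u, v) \<in> connected_rel D D' \<Longrightarrow> lab u = lab v" .
  have "snd y \<in> {0, 1} \<and> (outer x, outer y) \<in> connected_rel D D' \<longleftrightarrow> (x, y) \<in> edges C"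
    if "snd x \<in> {0, 1}" for x y
  proof
    assume "snd y \<in> {0, 1} \<and> (outer x, outer y) \<in> connected_rel D D'"
    then show "(x, y) \<in> edges C" using outer that inv by blast
  next
    assume "(x, y) \<in> edges C"
    then consider "x = y" | "{x, y} \<in> C" using edges_affine_iff[OF C] by blast
    then show "snd y \<in> {0, 1} \<and> (outer x, outer y) \<in> connected_rel D D'"
    proof cases
      case 1
      then show ?thesis using that by (simp add: connected_rel_eq)
    next
      case 2
      then show ?thesis using conn arc_height[OF C 2] by blast
    qed
  qed
  then have "{y. snd y \<in> {0, 1} \<and> (outer x, outer y) \<in> connected_rel D D'} = edges C `` {x}"
    if "snd x \<in> {0, 1}" for x using that by blast
  then have "composite D D' = {edges C `` {x} | x. snd x \<in> {0, 1}}"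
    unfolding composite_eq_classes setcompr_eq_image by (intro image_cong) simp_all
  then show "composite D D' = C" using affine_eq_blocks[OF C] by simp
qed

lemma connected_below: "{x, y} \<in> D' \<Longrightarrow> (x, y) \<in> connected_rel D D'"
  unfolding connected_rel_eq stack_edges_def by (intro r_into_rtrancl UnI1 edges_arc)

lemma connected_above: "{x, y} \<in> D \<Longrightarrow> (lift x, lift y) \<in> connected_rel D D'"
  unfolding connected_rel_eq stack_edges_def by (intro r_into_rtrancl UnI2 relabI edges_arc)

lemma connected_translate:
  assumes "D \<in> affine_diagrams m" "D' \<in> affine_diagrams m"
  shows "translation_invariant m (connected_rel D D')"
  unfolding connected_rel_eq stack_edges_def
  by (intro translation_invariant_rtrancl translation_invariant_Un translation_invariant_lift
      affine_translation_invariant assms)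

lemma loops_empty:
  assumes "\<And>v. snd v = 1 \<Longrightarrow> \<exists>w. (v, w) \<in> connected_rel D D' \<and> snd w \<noteq> 1"
  shows "loops m D D' = {}"
proof -
  have "\<not> connected_rel D D' `` {v} \<subseteq> {v. snd v = 1}" for v
  proof
    assume a: "connected_rel D D' `` {v} \<subseteq> {v. snd v = 1}"
    have "(v, v) \<in> connected_rel D D'" by (simp add: connected_rel_eq)
    then have "snd v = 1" using a by blast
    then obtain w where "(v, w) \<in> connected_rel D D'" "snd w \<noteq> 1" using assms by blast
    then show False using a by blast
  qed
  then show ?thesis unfolding loops_eq class_orbits_def by simp
qed

lemma identity_diagram_affine: "strand_diagram (\<lambda>j. j) \<in> affine_diagrams m"
proof -
  have "partition_on (UNIV \<times> {0, 1}) ({{(j, 0), (j, 1)} | j. True} :: diagram)" (is "partition_on _ ?P")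
  proof (rule partition_onI)
    show "\<Union> ?P = UNIV \<times> {0, 1}"
    proof (rule Set.set_eqI)
      fix v :: vertex
      obtain j h where "v = (j, h)" by (cases v)
      then show "v \<in> \<Union> ?P \<longleftrightarrow> v \<in> UNIV \<times> {0, 1}" by auto
    qed
    show "disjnt p q" if "p \<in> ?P" "q \<in> ?P" "p \<noteq> q" for p q
      using that by (auto simp: disjnt_def)
  qed auto
  moreover have "translate d ` {(j, 0), (j, 1)} \<in> {{(j, 0), (j, 1)} | j. True}" for d j
    by (simp, rule exI[of _ "j + d"], simp)
  ultimately show ?thesis unfolding affine_diagrams_def strand_diagram_def by auto
qed

lemma strand_eq_act: "strand_diagram p = act (on_top p) (strand_diagram (\<lambda>j. j))"
  unfolding strand_diagram_def act_def setcompr_eq_image image_image by (simp add: on_top_def)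

lemma strand_affine [simp]: "p \<in> periodic_perms m \<Longrightarrow> strand_diagram p \<in> affine_diagrams m"
  by (subst strand_eq_act) (intro act_affine identity_diagram_affine on_top_perm)

lemma act_strand: "act (on_top p) (strand_diagram q) = strand_diagram (p \<circ> q)"
  by (subst (1 2) strand_eq_act) (simp add: act_act on_top_comp)

lemma strand_arc: "{(j, 0), (p j, 1)} \<in> strand_diagram p"
  by (auto simp: strand_diagram_def)

lemma strand_arcD:
  assumes "p \<in> periodic_perms m" "{(j, 0), y} \<in> strand_diagram p"
  shows "y = (p j, 1)"
  using arc_unique[OF strand_affine[OF assms(1)] assms(2) strand_arc] .

text \<open>
  Each vertex is labelled by the block that the product should have there; a middle vertex takes
  the label of the top vertex to which its strand leads.
\<close>

lemma composite_strand:
  assumes p: "p \<in> periodic_perms m" and D: "D \<in> affine_diagrams m"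
  shows "composite (strand_diagram p) D = act (on_top p) D" and "loops m (strand_diagram p) D = {}"
proof -
  let ?P = "strand_diagram p" and ?C = "act (on_top p) D"
  let ?r = "\<lambda>v. (if snd v = 0 then v else if snd v = 1 then (p (fst v), 1) else (fst v, 1)) :: vertex"
  have C: "?C \<in> affine_diagrams m" by (intro act_affine D on_top_perm p)
  have up: "(x, outer (on_top p x)) \<in> connected_rel ?P D" if "snd x \<in> {0, 1}" for x
  proof (cases "snd x = 0")
    case True
    then have "outer (on_top p x) = x" by (simp add: outer_def on_top_def prod_eq_iff)
    then show ?thesis by (simp add: connected_rel_eq)
  next
    case False
    then have "snd x = 1" using that by simp
    then have "x = lift (fst x, 0)" "outer (on_top p x) = lift (p (fst x), 1)"
      by (simp_all add: lift_def outer_def on_top_def prod_eq_iff)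
    then show ?thesis using connected_above[OF strand_arc[of "fst x" p]] by simp
  qed
  have r: "?r x = on_top p x" if "snd x \<in> {0, 1}" for x using that by (auto simp: on_top_def)
  have ro: "?r (outer x) = x" if "snd x \<in> {0, 1}" for x using that by (auto simp: outer_def prod_eq_iff)
  show "composite ?P D = ?C"
  proof (rule composite_eqI(1)[OF strand_affine[OF p] D C, of "\<lambda>v. block_at ?C (?r v)"])
    fix x y assume xy: "{x, y} \<in> D"
    then have h: "snd x \<in> {0, 1}" "snd y \<in> {0, 1}" using arc_height[OF D] by blast+
    have a: "{on_top p x, on_top p y} \<in> ?C" by (rule act_arc[OF D xy])
    show "block_at ?C (?r x) = block_at ?C (?r y)"
      unfolding r[OF h(1)] r[OF h(2)] using edges_arc[OF a] arc_height[OF C a]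
      by (subst block_at_iff[OF C]) blast+
  next
    fix x y assume "{x, y} \<in> ?P"
    then obtain j where "{x, y} = {(j, 0), (p j, 1)}" by (auto simp: strand_diagram_def)
    then have "x = (j, 0) \<and> y = (p j, 1) \<or> x = (p j, 1) \<and> y = (j, 0)" by (simp add: doubleton_eq_iff)
    then have "?r (lift x) = ?r (lift y)" by (auto simp: lift_def)
    then show "block_at ?C (?r (lift x)) = block_at ?C (?r (lift y))" by simp
  next
    fix x y :: vertex assume h: "snd x \<in> {0, 1}" "snd y \<in> {0, 1}"
      and "block_at ?C (?r (outer x)) = block_at ?C (?r (outer y))"
    then show "(x, y) \<in> edges ?C" unfolding ro[OF h(1)] ro[OF h(2)] block_at_iff[OF C h] by simp
  next
    fix x y assume "{x, y} \<in> ?C"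
    then obtain B where B: "B \<in> D" "{x, y} = on_top p ` B" unfolding act_def by (rule imageE)
    obtain u v where uv: "B = {u, v}" using affine_block[OF D B(1)] by blast
    have *: "(outer (on_top p u), outer (on_top p v)) \<in> connected_rel ?P D" if uv: "{u, v} \<in> D" for u v
    proof -
      have h: "snd u \<in> {0, 1}" "snd v \<in> {0, 1}" using arc_height[OF D uv] by blast+
      show ?thesis using up[OF h(1)] up[OF h(2)] connected_below[OF uv] connected_sym connected_trans by blast
    qed
    have "x = on_top p u \<and> y = on_top p v \<or> x = on_top p v \<and> y = on_top p u"
      using B(2) uv by (simp add: doubleton_eq_iff)
    then show "(outer x, outer y) \<in> connected_rel ?P D"
      using *[of u v] *[of v u] B(1) uv by (auto simp: insert_commute)
  qed
  show "loops m ?P D = {}"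
  proof (rule loops_empty)
    fix v :: vertex assume v: "snd v = 1"
    then have "snd (outer (on_top p v)) \<noteq> 1" by (simp add: outer_def on_top_def)
    then show "\<exists>w. (v, w) \<in> connected_rel ?P D \<and> snd w \<noteq> 1" using up[of v] v by blast
  qed
qed

section \<open>Multiplication by a cup-cap\<close>

text \<open>
  Exchange the bottom end of the strand \<open>i\<close> with the top end of the strand \<open>i
  + 1\<close>.
\<close>

lemma e_diagram_eq_act:
  assumes "i \<in> {1..<m}"
  shows "e_diagram m i = act (vexch m (int i, 0) (int i + 1, 1)) (strand_diagram (\<lambda>j. j))"
    (is "_ = act ?\<sigma> _")
    and "e_diagram m i \<in> affine_diagrams m"
proof -
  have m: "\<not> int m dvd 1" "\<not> int m dvd - 1" using assms by auto
  have ab: "(j - (int i + 1)) mod int m \<noteq> 0" if "int m dvd j - int i" for j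
    using that m dvd_diff[OF that, of "j - (int i + 1)"] by (auto simp: mod_eq_0_iff_dvd)
  have aff: "act ?\<sigma> (strand_diagram (\<lambda>j. j)) \<in> affine_diagrams m"
    by (intro act_affine identity_diagram_affine vexch_perm) simp_all
  have b: "?\<sigma> ` {(j, 0), (j, 1)} =
     (if int m dvd j - int i then {(j + 1, 1), (j, 1)}
      else if int m dvd j - (int i + 1) then {(j, 0), (j - 1, 0)} else {(j, 0), (j, 1)})" for j
    using ab[of j] m by (auto simp: vexch_def cls_def mod_eq_dvd_iff mod_eq_0_iff_dvd)
  have "act ?\<sigma> (strand_diagram (\<lambda>j. j)) = (\<lambda>j. ?\<sigma> ` {(j, 0), (j, 1)}) ` UNIV"
    unfolding act_def strand_diagram_def setcompr_eq_image image_image by simp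
  also have "\<dots> = e_diagram m i"
  proof
    show "(\<lambda>j. ?\<sigma> ` {(j, 0), (j, 1)}) ` UNIV \<subseteq> e_diagram m i"
    proof (rule image_subsetI)
      fix j
      consider "int m dvd j - int i" | "\<not> int m dvd j - int i" "int m dvd j - (int i + 1)"
        | "\<not> int m dvd j - int i" "\<not> int m dvd j - (int i + 1)" by blast
      then show "?\<sigma> ` {(j, 0), (j, 1)} \<in> e_diagram m i"
      proof cases
        case 1
        then have "?\<sigma> ` {(j, 0), (j, 1)} = {(j, 1), (j + 1, 1)}" unfolding b by auto
        then show ?thesis unfolding e_diagram_def using 1 by blast
      next
        case 2
        then have "?\<sigma> ` {(j, 0), (j, 1)} = {(j - 1, 0), (j - 1 + 1, 0)}" unfolding b by auto
        moreover have "int m dvd (j - 1) - int i" using 2 by (simp add: algebra_simps)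
        ultimately show ?thesis unfolding e_diagram_def by blast
      next
        case 3
        then have "?\<sigma> ` {(j, 0), (j, 1)} = {(j, 0), (j, 1)}" unfolding b by auto
        then show ?thesis unfolding e_diagram_def using 3 by blast
      qed
    qed
    show "e_diagram m i \<subseteq> (\<lambda>j. ?\<sigma> ` {(j, 0), (j, 1)}) ` UNIV"
    proof
      fix X assume "X \<in> e_diagram m i"
      then consider j where "X = {(j, 1), (j + 1, 1)}" "int m dvd j - int i"
        | j where "X = {(j, 0), (j + 1, 0)}" "int m dvd j - int i"
        | j where "X = {(j, 0), (j, 1)}" "\<not> int m dvd j - int i" "\<not> int m dvd j - (int i + 1)"
        unfolding e_diagram_def by auto
      then show "X \<in> (\<lambda>j. ?\<sigma> ` {(j, 0), (j, 1)}) ` UNIV"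
      proof cases
        case 1
        then have "X = ?\<sigma> ` {(j, 0), (j, 1)}" unfolding b by auto
        then show ?thesis by (rule image_eqI) simp
      next
        case 2
        then have "\<not> int m dvd (j + 1) - int i" using m(1) dvd_diff[OF _ 2(2), of "j + 1 - int i"] by auto
        then have "X = ?\<sigma> ` {(j + 1, 0), (j + 1, 1)}" unfolding b using 2 by auto
        then show ?thesis by (rule image_eqI) simp
      next
        case 3
        then have "X = ?\<sigma> ` {(j, 0), (j, 1)}" unfolding b by auto
        then show ?thesis by (rule image_eqI) simp
      qed
    qed
  qed
  finally show "e_diagram m i = act ?\<sigma> (strand_diagram (\<lambda>j. j))" ..
  then show "e_diagram m i \<in> affine_diagrams m" using aff by simp
qed

text \<open>
  The lower arc of \<open>e\<^sub>i\<close> connects the partners of the top vertices \<open>i\<close> and \<open>i + 1\<close> of \<open>D\<close>, and its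
  upper arc becomes an arc of the product. Exchanging the partner \<open>u\<close> of \<open>i\<close> with the top vertex
  \<open>i + 1\<close> has the same effect: \<open>i\<close> becomes joined to \<open>i + 1\<close>, and \<open>u\<close> to the former partner of
  \<open>i + 1\<close>.
\<close>

context
  fixes m i :: nat and D :: diagram and u :: vertex
  assumes i: "i \<in> {1..<m}" and D: "D \<in> affine_diagrams m" and u: "{(int i, 1), u} \<in> D"
begin

private abbreviation "a \<equiv> (int i, Suc 0) :: vertex"
private abbreviation "b \<equiv> (int i + 1, Suc 0) :: vertex"
private abbreviation "E \<equiv> e_diagram m i"
private abbreviation "C \<equiv> act (vexch m u b) D"
private abbreviation "conn \<equiv> connected_rel E D"

private lemma ab: "cls m a \<noteq> cls m b"
proof -
  have "\<not> int m dvd int i - (int i + 1)" using i by simp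
  then show ?thesis by (simp only: cls_def fst_conv prod.inject mod_eq_dvd_iff simp_thms)
qed

private lemma au: "{a, u} \<in> D"
  using u by simp

private lemma ua: "cls m u \<noteq> cls m a"
  using arc_cls_neq[OF D au] by simp

private lemma uh: "snd u \<in> {0, 1}"
  using arc_height[OF D au] by blast

private lemma C: "C \<in> affine_diagrams m"
  by (intro act_affine D vexch_perm uh) simp

private lemma E: "E \<in> affine_diagrams m"
  by (rule e_diagram_eq_act(2)[OF i])

private lemma arc_ab: "{a, b} \<in> C"
  using act_arc[OF D au, of "vexch m u b"] ua ab by simp

private lemma arc_rest:
  assumes "{x, y} \<in> D" "cls m x \<notin> {cls m a, cls m b}" "cls m y \<notin> {cls m a, cls m b}"
  shows "{x, y} \<in> C"
proof -
  have "cls m x \<noteq> cls m u" "cls m y \<noteq> cls m u"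
    using arc_cls_iff[OF D au, of y x] arc_cls_iff[OF D au, of x y] assms by (auto simp: insert_commute)
  then show ?thesis using act_arc[OF D assms(1), of "vexch m u b"] assms(2,3) by simp
qed

private lemma arc_b:
  assumes "{b, w} \<in> D" "cls m u \<noteq> cls m b"
  shows "{u, w} \<in> C" "cls m w \<notin> {cls m a, cls m b}"
proof -
  have w: "cls m w \<noteq> cls m b" using arc_cls_neq[OF D assms(1)] by simp
  have wu: "cls m w \<noteq> cls m u" using arc_cls_iff[OF D, of u a w b] au assms(1) ab by (auto simp: insert_commute)
  show "{u, w} \<in> C" using act_arc[OF D assms(1), of "vexch m u b"] assms(2) w wu by simp
  have "cls m w \<noteq> cls m a" using arc_cls_iff[OF D au, of w b] assms by (auto simp: insert_commute)
  then show "cls m w \<notin> {cls m a, cls m b}" using w by simp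
qed

private lemma E_cup: "int m dvd d \<Longrightarrow> h \<in> {0, 1} \<Longrightarrow> {(int i + d, h), (int i + d + 1, h)} \<in> E"
  unfolding e_diagram_def by (rule UnI1, rule CollectI, rule exI[of _ "int i + d"], rule exI[of _ h]) simp

private lemma E_vertical: "cls m (j, 1) \<notin> {cls m a, cls m b} \<Longrightarrow> {(j, 0), (j, 1)} \<in> E"
  unfolding e_diagram_def by (auto simp: cls_def mod_eq_dvd_iff)

private lemma conn_ab:
  assumes "int m dvd d"
  shows "(translate d a, translate d b) \<in> conn"
  using connected_above[OF E_cup[OF assms, of 0]] by (simp add: lift_def algebra_simps)

private lemma conn_outer_ab:
  assumes "int m dvd d"
  shows "(outer (translate d a), outer (translate d b)) \<in> conn"
  using connected_above[OF E_cup[OF assms, of 1]] by (simp add: lift_def outer_def algebra_simps numeral_2_eq_2)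

private lemma conn_outer:
  assumes "snd x \<in> {0, 1}" "cls m x \<notin> {cls m a, cls m b}"
  shows "(x, outer x) \<in> conn"
proof (cases "snd x = 0")
  case True
  then have "outer x = x" by (simp add: outer_def prod_eq_iff)
  then show ?thesis by (simp add: connected_rel_eq)
next
  case False
  then have x: "x = (fst x, 1)" using assms(1) by (simp add: prod_eq_iff)
  then have "{(fst x, 0), (fst x, 1)} \<in> E" using assms(2) by (intro E_vertical) simp
  moreover have "lift (fst x, 0) = x" "lift (fst x, 1) = outer x"
    using False assms(1) by (auto simp: lift_def outer_def prod_eq_iff)
  ultimately show ?thesis using connected_above[of "(fst x, 0)" "(fst x, 1)" E D] by simp
qed

text \<open>
  The middle vertices at the lower arcs of \<open>e\<^sub>i\<close> are connected to a translate
  of \<open>u\<close> and get the label of its block. If \<open>u\<close> is a translate of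
  \<open>b\<close>, these vertices form the closed components, which are labelled
  \<open>None\<close>.
\<close>

private definition lab :: "vertex \<Rightarrow> vertex set option" where
  "lab v = (if snd v = 1 \<and> (cls m v = cls m a \<or> cls m v = cls m b)
     then if cls m u = cls m b then None
       else if cls m v = cls m a then Some (block_at C (translate (fst v - int i) u))
       else Some (block_at C (translate (fst v - int i - 1) u))
     else if snd v \<le> 1 then Some (block_at C v)
     else Some (block_at C (fst v, 1)))"

private lemma same_block: "{x, y} \<in> C \<Longrightarrow> block_at C x = block_at C y"
  using block_at_iff[OF C] arc_height[OF C] edges_arc by blast

private lemma lab_rest: "cls m v \<notin> {cls m a, cls m b} \<Longrightarrow> snd v \<in> {0, 1} \<Longrightarrow> lab v = Some (block_at C v)"
  by (auto simp: lab_def)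

private lemma lab_a:
  assumes "{x, y} \<in> D" "cls m x = cls m a"
  shows "lab x = lab y"
proof -
  let ?d = "fst x - int i"
  have y: "y = translate ?d u" using arc_same_cls[OF D au assms] by simp
  have dv: "int m dvd ?d" using assms(2) by (simp add: cls_def mod_eq_dvd_iff)
  have cy: "cls m y = cls m u" unfolding y using dv by simp
  have x: "snd x = 1" using assms(2) by (simp add: cls_def)
  show ?thesis
  proof (cases "cls m u = cls m b")
    case True
    then have "snd y = 1" using cy by (simp add: cls_def)
    then show ?thesis using True cy x assms(2) by (simp add: lab_def)
  next
    case False
    have "lab y = Some (block_at C y)" using arc_height[OF D assms(1)] cy False ua by (intro lab_rest) auto
    then show ?thesis using False x assms(2) y by (simp add: lab_def)
  qed
qed

private lemma lab_b:
  assumes "{x, y} \<in> D" "cls m x = cls m b" "cls m y \<noteq> cls m a"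
  shows "lab x = lab y"
proof -
  let ?d = "fst x - fst b"
  have dv: "int m dvd ?d" using assms(2) by (simp add: cls_def mod_eq_dvd_iff)
  have x: "snd x = 1" "x = translate ?d b" using assms(2) by (simp_all add: cls_def prod_eq_iff)
  have nb: "cls m u \<noteq> cls m b"
    using arc_cls_iff[OF D, of u a x y] au assms by (auto simp: insert_commute)
  obtain w where w: "{b, w} \<in> D" using arc_exists[OF D, of b] by auto
  have y: "y = translate ?d w" using arc_same_cls[OF D w assms(1,2)] .
  have cy: "cls m y \<notin> {cls m a, cls m b}" unfolding y using dv arc_b(2)[OF w nb] by simp
  have "{translate ?d u, y} \<in> C" unfolding y by (rule arc_translate[OF C dv arc_b(1)[OF w nb]])
  then have "block_at C (translate ?d u) = block_at C y" by (rule same_block)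
  moreover have "lab y = Some (block_at C y)" using arc_height[OF D assms(1)] cy by (intro lab_rest) auto
  moreover have "lab x = Some (block_at C (translate ?d u))"
    using x(1) assms(2) nb ab by (simp add: lab_def algebra_simps)
  ultimately show ?thesis by simp
qed

private lemma lab_below:
  assumes "{x, y} \<in> D"
  shows "lab x = lab y"
proof -
  have yx: "{y, x} \<in> D" using assms by (simp add: insert_commute)
  consider "cls m x = cls m a" | "cls m y = cls m a"
    | "cls m x = cls m b" "cls m y \<noteq> cls m a" | "cls m y = cls m b" "cls m x \<noteq> cls m a"
    | "cls m x \<notin> {cls m a, cls m b}" "cls m y \<notin> {cls m a, cls m b}" by blast
  then show ?thesis
  proof cases
    case 1
    then show ?thesis by (rule lab_a[OF assms])
  next
    case 2
    then show ?thesis by (rule lab_a[OF yx, symmetric])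
  next
    case 3
    then show ?thesis by (rule lab_b[OF assms])
  next
    case 4
    then show ?thesis by (rule lab_b[OF yx, symmetric])
  next
    case 5
    then show ?thesis using lab_rest same_block[OF arc_rest[OF assms 5]] arc_height[OF D assms] by simp
  qed
qed

private lemma lab_above:
  assumes "{x, y} \<in> E"
  shows "lab (lift x) = lab (lift y)"
proof -
  consider j h where "{x, y} = {(j, h), (j + 1, h)}" "int m dvd j - int i" "h \<in> {0, 1}"
    | j where "{x, y} = {(j, 0), (j, 1)}" "\<not> int m dvd j - int i" "\<not> int m dvd j - (int i + 1)"
    using assms unfolding e_diagram_def Un_iff mem_Collect_eq by meson
  then show ?thesis
  proof cases
    case 1
    have "lab (lift (j, h)) = lab (lift (j + 1, h))"
    proof (cases "h = 0")
      case True
      have "cls m (j, 1) = cls m a" "cls m (j + 1, 1) = cls m b"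
        using 1(2) by (simp_all add: cls_def mod_eq_dvd_iff)
      then show ?thesis using True ab by (simp add: lab_def lift_def)
    next
      case False
      then have h: "h = 1" using 1(3) by simp
      have "{translate (j - int i) a, translate (j - int i) b} \<in> C"
        by (rule arc_translate[OF C 1(2) arc_ab])
      then have "{(j, 1), (j + 1, 1)} \<in> C" by (simp add: algebra_simps)
      then show ?thesis unfolding h using same_block by (simp add: lab_def lift_def)
    qed
    then show ?thesis using 1(1) by (auto simp: doubleton_eq_iff)
  next
    case 2
    have "cls m (j, 1) \<notin> {cls m a, cls m b}" using 2 by (simp add: cls_def mod_eq_dvd_iff)
    then have "lab (lift (j, 0)) = lab (lift (j, 1))" by (simp add: lab_def lift_def)
    then show ?thesis using 2(1) by (auto simp: doubleton_eq_iff)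
  qed
qed

private lemma lab_outer: "snd x \<in> {0, 1} \<Longrightarrow> lab (outer x) = Some (block_at C x)"
  by (auto simp: lab_def outer_def prod_eq_iff intro!: arg_cong[of _ _ "block_at C"])

private lemma conn_C_special:
  assumes "{x, y} \<in> C" "cls m x \<in> {cls m a, cls m u}"
  shows "(outer x, outer y) \<in> conn"
proof (cases "cls m x = cls m a")
  case True
  let ?d = "fst x - fst a"
  have dv: "int m dvd ?d" using True by (simp add: cls_def mod_eq_dvd_iff)
  have "x = translate ?d a" using True by (simp add: cls_def prod_eq_iff)
  moreover have "y = translate ?d b" using arc_same_cls[OF C arc_ab assms(1) True] .
  ultimately show ?thesis using conn_outer_ab[OF dv] by metis
next
  case False
  then have xu: "cls m x = cls m u" using assms(2) by simp
  show ?thesis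
  proof (cases "cls m u = cls m b")
    case True
    then have xb: "cls m x = cls m b" using xu by simp
    let ?d = "fst x - fst b"
    have dv: "int m dvd ?d" using xb by (simp add: cls_def mod_eq_dvd_iff)
    have "x = translate ?d b" using xb by (simp add: cls_def prod_eq_iff)
    moreover have "y = translate ?d a"
      using arc_same_cls[OF C _ assms(1) xb] arc_ab by (simp add: insert_commute)
    ultimately show ?thesis using connected_sym[OF conn_outer_ab[OF dv]] by metis
  next
    case nb: False
    let ?d = "fst x - fst u"
    have dv: "int m dvd ?d" using xu by (simp add: cls_def mod_eq_dvd_iff)
    have x: "x = translate ?d u" using xu by (simp add: cls_def prod_eq_iff)
    obtain w where w: "{b, w} \<in> D" using arc_exists[OF D, of b] by auto
    have y: "y = translate ?d w" using arc_same_cls[OF C arc_b(1)[OF w nb] assms(1) xu] .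
    have cx: "cls m x \<notin> {cls m a, cls m b}" using xu ua nb by simp
    have cy: "cls m y \<notin> {cls m a, cls m b}" unfolding y using dv arc_b(2)[OF w nb] by simp
    have h: "snd x \<in> {0, 1}" "snd y \<in> {0, 1}" using arc_height[OF C assms(1)] by blast+
    have "{translate ?d a, translate ?d u} \<in> D" "{translate ?d b, translate ?d w} \<in> D"
      by (intro arc_translate[OF D dv] au w)+
    then have "{translate ?d a, x} \<in> D" "{translate ?d b, y} \<in> D" using x y by metis+
    then have "(translate ?d a, x) \<in> conn" "(translate ?d b, y) \<in> conn"
      using connected_below by blast+
    then have "(x, y) \<in> conn" using conn_ab[OF dv] connected_sym connected_trans by blast
    then show ?thesis using conn_outer[OF h(1) cx] conn_outer[OF h(2) cy] connected_sym connected_trans by blast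
  qed
qed

private lemma conn_C:
  assumes "{x, y} \<in> C"
  shows "(outer x, outer y) \<in> conn"
proof -
  have yx: "{y, x} \<in> C" using assms by (simp add: insert_commute)
  consider "cls m x \<in> {cls m a, cls m u}" | "cls m y \<in> {cls m a, cls m u}"
    | "cls m x \<notin> {cls m a, cls m u}" "cls m y \<notin> {cls m a, cls m u}" by blast
  then show ?thesis
  proof cases
    case 1
    then show ?thesis by (rule conn_C_special[OF assms])
  next
    case 2
    then show ?thesis by (rule conn_C_special[OF yx, THEN connected_sym])
  next
    case 3
    have nb: "cls m x \<noteq> cls m b" "cls m y \<noteq> cls m b"
      using arc_cls_iff[OF C, of b a x y] arc_cls_iff[OF C, of b a y x] arc_ab assms yx 3
      by (auto simp: insert_commute)
    have "{vexch m u b x, vexch m u b y} \<in> C" using 3 nb assms by simp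
    then have xy: "{x, y} \<in> D" using act_arc_iff[OF D vexch_perm[OF uh, of b m], of x y] by simp
    have h: "snd x \<in> {0, 1}" "snd y \<in> {0, 1}" using arc_height[OF D xy] by blast+
    show ?thesis using conn_outer[OF h(1)] conn_outer[OF h(2)] connected_below[OF xy, of E] 3 nb
      connected_sym connected_trans by blast
  qed
qed

lemma composite_e: "composite E D = C"
  by (rule composite_eqI(1)[OF E D C, of lab])
    (auto simp: lab_below lab_above lab_outer block_at_iff[OF C] conn_C)

private lemma conn_lab: "(v, w) \<in> conn \<Longrightarrow> lab v = lab w"
  by (rule composite_eqI(2)[OF E D C, of lab])
    (auto simp: lab_below lab_above lab_outer block_at_iff[OF C] conn_C)

text \<open>
  The components labelled \<open>None\<close> form a single orbit, whether the closed curve on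
  the cylinder is contractible or winds around it.
\<close>

lemma card_loops_e: "card (loops m E D) = (if cls m u = cls m b then 1 else 0)"
proof (cases "cls m u = cls m b")
  case True
  have inv: "translation_invariant m conn" by (rule connected_translate[OF E D])
  have o: "orbit m (conn `` {v}) = orbit m (conn `` {a})" if "cls m v \<in> {cls m a, cls m b}" for v
  proof -
    have *: "orbit m (conn `` {translate d w}) = orbit m (conn `` {w})" if dv: "int m dvd d" for d w
    proof -
      obtain k where "d = k * int m" using dv by (metis dvd_def mult.commute)
      then show ?thesis unfolding class_translate[OF inv dv] by (simp only: orbit_translate)
    qed
    have "(a, b) \<in> conn" using conn_ab[of 0] by simp
    then have "conn `` {a} = conn `` {b}"
      unfolding connected_rel_eq by (rule rtrancl_class_eq[OF sym_stack])
    moreover have "\<exists>w d. w \<in> {a, b} \<and> v = translate d w \<and> int m dvd d"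
      using that by (metis cls_eqE insertE insertI1 insertI2 singletonD)
    ultimately show ?thesis using * by auto
  qed
  have sub: "conn `` {v} \<subseteq> {v. snd v = 1} \<longleftrightarrow> cls m v \<in> {cls m a, cls m b}" for v
  proof
    assume "cls m v \<in> {cls m a, cls m b}"
    then have "lab v = None" using True by (auto simp: lab_def cls_def)
    then have "lab w = None" if "(v, w) \<in> conn" for w using conn_lab[OF that] by simp
    then show "conn `` {v} \<subseteq> {v. snd v = 1}" by (force simp: lab_def split: if_splits)
  next
    assume s: "conn `` {v} \<subseteq> {v. snd v = 1}"
    have "(v, v) \<in> conn" by (simp add: connected_rel_eq)
    then have v: "snd v = 1" using s by blast
    show "cls m v \<in> {cls m a, cls m b}"
    proof (rule ccontr)
      assume "cls m v \<notin> {cls m a, cls m b}"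
      then have "(v, outer v) \<in> conn" using v by (intro conn_outer) simp_all
      then have "snd (outer v) = 1" using s by blast
      then show False using v by (simp add: outer_def)
    qed
  qed
  have "loops m E D = (\<lambda>v. orbit m (conn `` {v})) ` {v. cls m v \<in> {cls m a, cls m b}}"
    unfolding loops_eq class_orbits_def sub ..
  also have "\<dots> = (\<lambda>v. orbit m (conn `` {a})) ` {v. cls m v \<in> {cls m a, cls m b}}"
    by (rule image_cong[OF refl]) (simp only: o mem_Collect_eq)
  also have "\<dots> = {orbit m (conn `` {a})}" by auto
  finally show ?thesis using True by simp
next
  case nb: False
  have out: "\<exists>w. (v, w) \<in> conn \<and> snd w \<noteq> 1" if "snd v \<in> {0, 1}" "cls m v \<notin> {cls m a, cls m b}" for v
    using conn_outer[OF that] that(1) by (intro exI[of _ "outer v"]) (auto simp: outer_def)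
  have A: "\<exists>w. (v, w) \<in> conn \<and> snd w \<noteq> 1" if v: "cls m v = cls m a" for v
  proof -
    obtain y where y: "{v, y} \<in> D" using arc_exists[OF D, of v] v by (auto simp: cls_def)
    have "cls m y = cls m u" using arc_cls_iff[OF D au y] v by simp
    then obtain w where "(y, w) \<in> conn" "snd w \<noteq> 1"
      using out[of y] arc_height[OF D y] ua nb by auto
    then show ?thesis using connected_below[OF y, of E] connected_trans by blast
  qed
  have "loops m E D = {}"
  proof (rule loops_empty)
    fix v :: vertex assume v: "snd v = 1"
    show "\<exists>w. (v, w) \<in> conn \<and> snd w \<noteq> 1"
    proof (cases "cls m v = cls m b")
      case True
      then obtain d where d: "int m dvd d" "v = translate d b" by (elim cls_eqE)
      have "cls m (translate d a) = cls m a" by (rule cls_translate[OF d(1)])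
      then show ?thesis using A[of "translate d a"] connected_sym[OF conn_ab[OF d(1)]] connected_trans
        unfolding d(2) by blast
    next
      case False
      then show ?thesis using A[of v] out[of v] v by auto
    qed
  qed
  then show ?thesis using nb by simp
qed

end

section \<open>The extended affine symmetric group by generators and relations\<close>

text \<open>
  Self-maps form a monoid in the sense of type classes, so that calculations with periodic
  permutations, and with a ring that acts on itself by left multiplication, become instances of
  calculations in \<open>monoid_mult\<close>.
\<close>

datatype 'a endo = Endo (app: "'a \<Rightarrow> 'a")

instantiation endo :: (type) monoid_mult
begin

definition one_endo :: "'a endo" where "one_endo = Endo id"

definition times_endo :: "'a endo \<Rightarrow> 'a endo \<Rightarrow> 'a endo" where
  "times_endo f g = Endo (app f \<circ> app g)"

instance by standard (simp_all add: one_endo_def times_endo_def comp_assoc)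

end

lemma app_simps [simp]: "app (f * g) = app f \<circ> app g" "app 1 = id"
  by (simp_all add: one_endo_def times_endo_def)

lemma power_intertwine:
  fixes g x y :: "'a::monoid_mult"
  assumes "g * x = y * g"
  shows "g * x ^ n = y ^ n * g"
proof (induction n)
  case (Suc n)
  have "g * x ^ Suc n = g * x * x ^ n" by (simp add: mult.assoc)
  also have "\<dots> = y * (g * x ^ n)" by (simp add: assms mult.assoc)
  also have "\<dots> = y ^ Suc n * g" by (simp add: Suc mult.assoc)
  finally show ?case .
qed simp

definition gen_pow :: "(nat \<Rightarrow> 'a::monoid_mult) \<Rightarrow> (nat \<Rightarrow> 'a) \<Rightarrow> nat \<Rightarrow> int \<Rightarrow> 'a" where
  "gen_pow t t' i a = (if a \<ge> 0 then t i ^ nat a else t' i ^ nat (- a))"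

text \<open>The relations without cup-caps, in an arbitrary monoid.\<close>

locale affine_symmetric =
  fixes m :: nat and s t t' :: "nat \<Rightarrow> 'a::monoid_mult"
  assumes m_pos: "1 \<le> m"
    and t_t': "i \<in> {1..m} \<Longrightarrow> t i * t' i = 1"
    and t'_t: "i \<in> {1..m} \<Longrightarrow> t' i * t i = 1"
    and s_sq: "i \<in> {1..<m} \<Longrightarrow> s i * s i = 1"
    and s_comm: "i \<in> {1..<m} \<Longrightarrow> j \<in> {1..<m} \<Longrightarrow> far i j \<Longrightarrow> s i * s j = s j * s i"
    and s_braid: "i \<in> {1..<m} \<Longrightarrow> i + 1 \<in> {1..<m} \<Longrightarrow> s i * s (i + 1) * s i = s (i + 1) * s i * s (i + 1)"
    and st_far: "i \<in> {1..<m} \<Longrightarrow> j \<in> {1..m} \<Longrightarrow> far i j \<Longrightarrow> s i * t j = t j * s i"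
    and tt_comm: "i \<in> {1..m} \<Longrightarrow> j \<in> {1..m} \<Longrightarrow> t i * t j = t j * t i"
    and st: "i \<in> {1..<m} \<Longrightarrow> s i * t i = t (i + 1) * s i"
begin

lemma s_cancel: "i \<in> {1..<m} \<Longrightarrow> s i * (s i * x) = x"
  by (simp add: s_sq mult.assoc[symmetric])

lemma st_next:
  assumes "i \<in> {1..<m}"
  shows "s i * t (i + 1) = t i * s i"
proof -
  have "s i * t (i + 1) = s i * (t (i + 1) * (s i * s i))" using s_sq[OF assms] by simp
  also have "\<dots> = s i * (s i * t i) * s i" using st[OF assms] by (simp add: mult.assoc)
  also have "\<dots> = t i * s i" using s_sq[OF assms] by (simp add: mult.assoc[symmetric])
  finally show ?thesis .
qed

text \<open>
  Conjugating the relation between \<open>s\<^sub>k\<close> and \<open>t\<^sub>k\<^sub>+\<^sub>2\<close> by \<open>s\<^sub>k s\<^sub>k\<^sub>+\<^sub>1\<close> gives the case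
  of \<open>s\<^sub>k\<^sub>+\<^sub>1\<close> and \<open>t\<^sub>k\<close>, which is not among the relations.
\<close>

lemma st_other:
  assumes i: "i \<in> {1..<m}" and j: "j \<in> {1..m}" "j \<noteq> i" "j \<noteq> i + 1"
  shows "s i * t j = t j * s i"
proof (cases "far i j")
  case True
  then show ?thesis using st_far i j by blast
next
  case False
  then have ij: "i = j + 1" using j by auto
  define x where "x = t j"
  define y where "y = t (j + 2)"
  define p where "p = s j"
  define q where "q = s (j + 1)"
  have jm: "j \<in> {1..<m}" "j + 1 \<in> {1..<m}" using i j ij by auto
  have py: "p * y = y * p" using st_far[OF jm(1), of "j + 2"] jm unfolding p_def y_def by simp
  have sq: "p * p = 1" "q * q = 1" unfolding p_def q_def using s_sq jm by blast+
  have br: "p * q * p = q * p * q" unfolding p_def q_def using s_braid jm by blast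
  have 1: "q * y = t (j + 1) * q" using st_next[OF jm(2)] unfolding q_def y_def by (simp add: numeral_2_eq_2)
  have 2: "p * t (j + 1) = x * p" using st_next[OF jm(1)] unfolding p_def x_def .
  have x: "p * q * y * q * p = x"
  proof -
    have "p * q * y * q * p = p * (q * y) * q * p" by (simp add: mult.assoc)
    also have "\<dots> = (p * t (j + 1)) * (q * q) * p" unfolding 1 by (simp add: mult.assoc)
    also have "\<dots> = x" unfolding 2 by (simp add: sq mult.assoc)
    finally show ?thesis .
  qed
  have "q * x = (q * p * q) * y * q * p" unfolding x[symmetric] by (simp add: mult.assoc)
  also have "\<dots> = p * q * (p * y) * q * p" unfolding br[symmetric] by (simp add: mult.assoc)
  also have "\<dots> = p * q * y * (p * q * p)" unfolding py by (simp add: mult.assoc)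
  also have "\<dots> = x * q" unfolding br x[symmetric] by (simp add: mult.assoc)
  finally show ?thesis unfolding ij x_def q_def .
qed

lemma t'_intertwine:
  assumes "i \<in> {1..m}" "j \<in> {1..m}" "g * t i = t j * g"
  shows "g * t' i = t' j * g"
proof -
  have "g * t' i = (t' j * t j) * g * t' i" using t'_t[OF assms(2)] by simp
  also have "\<dots> = t' j * (g * t i) * t' i" unfolding assms(3) by (simp add: mult.assoc)
  also have "\<dots> = t' j * g * (t i * t' i)" by (simp add: mult.assoc)
  finally show ?thesis using t_t'[OF assms(1)] by simp
qed

definition lt :: "bool \<Rightarrow> nat \<Rightarrow> 'a" where
  "lt \<epsilon> i = (if \<epsilon> then t i else t' i)"

lemma lt_intertwine:
  "i \<in> {1..m} \<Longrightarrow> j \<in> {1..m} \<Longrightarrow> g * t i = t j * g \<Longrightarrow> g * lt \<epsilon> i = lt \<epsilon> j * g"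
  using t'_intertwine by (simp add: lt_def)

lemma s_lt: "i \<in> {1..<m} \<Longrightarrow> s i * lt \<epsilon> i = lt \<epsilon> (i + 1) * s i"
  by (rule lt_intertwine) (auto simp: st)

lemma s_lt_other:
  "i \<in> {1..<m} \<Longrightarrow> j \<in> {1..m} \<Longrightarrow> j \<noteq> i \<Longrightarrow> j \<noteq> i + 1 \<Longrightarrow> s i * lt \<epsilon> j = lt \<epsilon> j * s i"
  by (rule lt_intertwine) (auto simp: st_other)

lemma lt_comm:
  assumes "i \<in> {1..m}" "j \<in> {1..m}"
  shows "lt \<epsilon> i * lt \<delta> j = lt \<delta> j * lt \<epsilon> i"
proof (rule lt_intertwine[OF assms(2,2)])
  have "t j * lt \<epsilon> i = lt \<epsilon> i * t j" by (rule lt_intertwine[OF assms(1,1) tt_comm[OF assms(2,1)]])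
  then show "lt \<epsilon> i * t j = t j * lt \<epsilon> i" ..
qed

abbreviation tpow :: "nat \<Rightarrow> int \<Rightarrow> 'a" where
  "tpow \<equiv> gen_pow t t'"

lemma tpow_intertwine:
  assumes "i \<in> {1..m}" "j \<in> {1..m}" "g * t i = t j * g"
  shows "g * tpow i a = tpow j a * g"
  unfolding gen_pow_def using power_intertwine[OF assms(3)] power_intertwine[OF t'_intertwine[OF assms]] by simp

lemma lt_tpow:
  assumes i: "i \<in> {1..m}"
  shows "lt \<epsilon> i * tpow i a = tpow i (if \<epsilon> then a + 1 else a - 1)"
proof -
  have c: "t i * (t' i * x) = x" "t' i * (t i * x) = x" for x
    using t_t'[OF i] t'_t[OF i] by (simp_all add: mult.assoc[symmetric])
  have 1: "nat (- a) = Suc (nat (- (a + 1)))" if "a < 0" using that by simp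
  have 2: "nat a = Suc (nat (a - 1))" if "a > 0" using that by simp
  have 3: "nat (a + 1) = Suc (nat a)" if "a \<ge> 0" using that by simp
  have 4: "nat (- (a - 1)) = Suc (nat (- a))" if "a \<le> 0" using that by simp
  show ?thesis
  proof (cases "a < 0")
    case True
    then show ?thesis using 1[OF True] 4 by (cases "a = - 1") (auto simp: lt_def gen_pow_def c t_t'[OF i] power2_eq_square)
  next
    case False
    then show ?thesis using 2 3 4 by (cases "a = 0") (auto simp: lt_def gen_pow_def c t'_t[OF i] power2_eq_square)
  qed
qed

definition chain :: "nat \<Rightarrow> nat \<Rightarrow> 'a" where
  "chain k n = prod_list (map s [k..<n])"

lemma chain_rec: "k < n \<Longrightarrow> chain k n = s k * chain (k + 1) n"
  by (simp add: chain_def upt_conv_Cons)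

lemma chain_same [simp]: "chain n n = 1"
  by (simp add: chain_def)

lemma lt_chain:
  assumes "1 \<le> k" "k \<le> n" "n \<le> m" "i \<in> {1..n}" "i \<noteq> k"
  shows "lt \<epsilon> i * chain k n = chain k n * lt \<epsilon> (if i < k then i else i - 1)"
  using assms(2,1,3-)
proof (induction k arbitrary: i rule: inc_induct)
  case (step k)
  have k: "k \<in> {1..<m}" using step by auto
  have i: "i \<in> {1..m}" using step by auto
  have c: "chain k n = s k * chain (k + 1) n" using step by (intro chain_rec) simp
  show ?case
  proof (cases "i = k + 1")
    case True
    have "lt \<epsilon> i * chain k n = (lt \<epsilon> (k + 1) * s k) * chain (k + 1) n"
      unfolding c True by (simp add: mult.assoc)
    also have "\<dots> = s k * (lt \<epsilon> k * chain (k + 1) n)"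
      unfolding s_lt[OF k, symmetric] by (simp add: mult.assoc)
    also have "lt \<epsilon> k * chain (k + 1) n = chain (k + 1) n * lt \<epsilon> k"
      using step.IH[of k] step.prems step.hyps by simp
    finally show ?thesis unfolding c True by (simp add: mult.assoc)
  next
    case False
    have "lt \<epsilon> i * chain k n = (lt \<epsilon> i * s k) * chain (k + 1) n"
      unfolding c by (simp add: mult.assoc)
    also have "\<dots> = s k * (lt \<epsilon> i * chain (k + 1) n)"
      unfolding s_lt_other[OF k i step.prems(4) False, symmetric] by (simp add: mult.assoc)
    also have "lt \<epsilon> i * chain (k + 1) n = chain (k + 1) n * lt \<epsilon> (if i < k then i else i - 1)"
      using step.IH[of i] step.prems False by (auto simp: less_Suc_eq)
    finally show ?thesis unfolding c by (simp add: mult.assoc)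
  qed
qed simp

lemma s_chain_far:
  assumes "1 \<le> k" "k \<le> n" "n \<le> m" "1 \<le> i" "i + 1 < k"
  shows "s i * chain k n = chain k n * s i"
  using assms(2,1,3-)
proof (induction k rule: inc_induct)
  case (step k)
  have c: "chain k n = s k * chain (k + 1) n" using step by (intro chain_rec) simp
  have "s i * chain k n = (s i * s k) * chain (k + 1) n" unfolding c by (simp add: mult.assoc)
  also have "s i * s k = s k * s i" using step.prems step.hyps by (intro s_comm) auto
  also have "s k * s i * chain (k + 1) n = s k * (s i * chain (k + 1) n)" by (simp add: mult.assoc)
  also have "s i * chain (k + 1) n = chain (k + 1) n * s i" using step by simp
  finally show ?case unfolding c by (simp add: mult.assoc)
qed simp

lemma s_chain_inner:
  assumes "1 \<le> k" "k \<le> n" "n \<le> m" "k < i" "i < n"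
  shows "s i * chain k n = chain k n * s (i - 1)"
  using assms(2,1,3-)
proof (induction k rule: inc_induct)
  case (step k)
  have c: "chain k n = s k * chain (k + 1) n" using step by (intro chain_rec) simp
  show ?case
  proof (cases "i = k + 1")
    case True
    have c2: "chain (k + 1) n = s (k + 1) * chain (k + 2) n"
      using chain_rec[of "k + 1" n] step True by (simp add: numeral_2_eq_2)
    have "s i * chain k n = (s (k + 1) * s k * s (k + 1)) * chain (k + 2) n"
      unfolding c c2 True by (simp add: mult.assoc)
    also have "\<dots> = (s k * s (k + 1) * s k) * chain (k + 2) n"
      using s_braid[of k] step True by simp
    also have "\<dots> = s k * s (k + 1) * (s k * chain (k + 2) n)" by (simp add: mult.assoc)
    also have "s k * chain (k + 2) n = chain (k + 2) n * s k"
      using step True by (intro s_chain_far) auto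
    finally show ?thesis unfolding c c2 True by (simp add: mult.assoc)
  next
    case False
    have "s i * chain k n = (s i * s k) * chain (k + 1) n" unfolding c by (simp add: mult.assoc)
    also have "s i * s k = s k * s i" using step False by (intro s_comm) auto
    also have "s k * s i * chain (k + 1) n = s k * (s i * chain (k + 1) n)" by (simp add: mult.assoc)
    also have "s i * chain (k + 1) n = chain (k + 1) n * s (i - 1)" using step False by simp
    finally show ?thesis unfolding c by (simp add: mult.assoc)
  qed
qed simp

text \<open>
  A set of representatives for the periodic permutations on \<open>n\<close> strands modulo
  those on \<open>n - 1\<close>: as a permutation, \<open>coset n k a\<close> sends
  \<open>n\<close> to \<open>k + a m\<close>.
\<close>

definition coset :: "nat \<Rightarrow> nat \<Rightarrow> int \<Rightarrow> 'a" where
  "coset n k a = tpow k a * chain k n"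

lemma s_tpow_other:
  assumes "i \<in> {1..<m}" "j \<in> {1..m}" "j \<noteq> i" "j \<noteq> i + 1"
  shows "s i * tpow j a = tpow j a * s i"
  by (rule tpow_intertwine[OF assms(2,2) st_other[OF assms]])

text \<open>
  A letter on the left either changes the representative or passes through it and becomes a
  letter on \<open>n - 1\<close> strands. In the second case an index beyond \<open>k\<close>
  drops by one, since the chain shifts the strands between \<open>k\<close> and
  \<open>n\<close>.
\<close>

lemma coset_steps:
  assumes n: "n \<le> m" and k: "k \<in> {1..n}"
  shows "1 \<le> i \<Longrightarrow> i + 1 = k \<Longrightarrow> s i * coset n k a = coset n i a"
    and "i = k \<Longrightarrow> i < n \<Longrightarrow> s i * coset n k a = coset n (k + 1) a"
    and "1 \<le> i \<Longrightarrow> i + 1 < k \<Longrightarrow> s i * coset n k a = coset n k a * s i"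
    and "k < i \<Longrightarrow> i < n \<Longrightarrow> s i * coset n k a = coset n k a * s (i - 1)"
    and "lt \<epsilon> k * coset n k a = coset n k (if \<epsilon> then a + 1 else a - 1)"
    and "i \<in> {1..n} \<Longrightarrow> i \<noteq> k \<Longrightarrow> lt \<epsilon> i * coset n k a = coset n k a * lt \<epsilon> (if i < k then i else i - 1)"
proof -
  have km: "k \<in> {1..m}" using n k by auto
  show "s i * coset n k a = coset n i a" if "1 \<le> i" "i + 1 = k"
  proof -
    have i: "i \<in> {1..<m}" using that n k by auto
    have "s i * tpow k a = tpow i a * s i"
      using st_next[OF i] that i by (intro tpow_intertwine) auto
    then have "s i * coset n k a = tpow i a * (s i * chain k n)"
      unfolding coset_def by (simp add: mult.assoc[symmetric])
    also have "s i * chain k n = chain i n" using chain_rec[of i n] that k by auto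
    finally show ?thesis unfolding coset_def .
  qed
  show "s i * coset n k a = coset n (k + 1) a" if "i = k" "i < n"
  proof -
    have i: "k \<in> {1..<m}" using that n k by auto
    have "s k * tpow k a = tpow (k + 1) a * s k"
      using st[OF i] i by (intro tpow_intertwine) auto
    then have "s k * coset n k a = tpow (k + 1) a * (s k * chain k n)"
      unfolding coset_def by (simp add: mult.assoc[symmetric])
    also have "s k * chain k n = chain (k + 1) n" using chain_rec[of k n] that s_cancel[OF i] by simp
    finally show ?thesis unfolding coset_def that .
  qed
  show "s i * coset n k a = coset n k a * s i" if "1 \<le> i" "i + 1 < k"
  proof -
    have i: "i \<in> {1..<m}" using that n k by auto
    have "s i * coset n k a = tpow k a * (s i * chain k n)"
      using s_tpow_other[OF i km, of a] that unfolding coset_def by (simp add: mult.assoc[symmetric])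
    also have "s i * chain k n = chain k n * s i" using that k n by (intro s_chain_far) auto
    finally show ?thesis unfolding coset_def by (simp add: mult.assoc)
  qed
  show "s i * coset n k a = coset n k a * s (i - 1)" if "k < i" "i < n"
  proof -
    have i: "i \<in> {1..<m}" using that n k by auto
    have "s i * coset n k a = tpow k a * (s i * chain k n)"
      using s_tpow_other[OF i km, of a] that unfolding coset_def by (simp add: mult.assoc[symmetric])
    also have "s i * chain k n = chain k n * s (i - 1)" using that k n by (intro s_chain_inner) auto
    finally show ?thesis unfolding coset_def by (simp add: mult.assoc)
  qed
  show "lt \<epsilon> k * coset n k a = coset n k (if \<epsilon> then a + 1 else a - 1)"
    unfolding coset_def using lt_tpow[OF km] by (simp add: mult.assoc[symmetric])
  show "lt \<epsilon> i * coset n k a = coset n k a * lt \<epsilon> (if i < k then i else i - 1)" if "i \<in> {1..n}" "i \<noteq> k"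
  proof -
    have i: "i \<in> {1..m}" using that n by auto
    have "lt \<epsilon> i * t k = t k * lt \<epsilon> i" using lt_comm[OF i km, of \<epsilon> True] by (simp add: lt_def)
    then have "lt \<epsilon> i * tpow k a = tpow k a * lt \<epsilon> i" by (rule tpow_intertwine[OF km km])
    then have "lt \<epsilon> i * coset n k a = tpow k a * (lt \<epsilon> i * chain k n)"
      unfolding coset_def by (simp add: mult.assoc[symmetric])
    also have "lt \<epsilon> i * chain k n = chain k n * lt \<epsilon> (if i < k then i else i - 1)"
      using that k n by (intro lt_chain) auto
    finally show ?thesis unfolding coset_def by (simp add: mult.assoc)
  qed
qed

end

section \<open>Faithfulness of the presentation\<close>

definition perm_s :: "nat \<Rightarrow> nat \<Rightarrow> int endo" where
  "perm_s m i = Endo (exch m (int i) (int i + 1))"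

definition perm_t :: "nat \<Rightarrow> nat \<Rightarrow> int endo" where
  "perm_t m i = Endo (exch m (int i) (int i + int m))"

definition perm_t' :: "nat \<Rightarrow> nat \<Rightarrow> int endo" where
  "perm_t' m i = Endo (exch m (int i) (int i - int m))"

lemma exch_shift:
  assumes "int m dvd d"
  shows "exch m a (a + d) j = (if j mod int m = a mod int m then j + d else j)"
  using mod_add_dvd[OF assms, of a] by (auto simp: exch_def)

lemma residue_eq_iff:
  assumes "i \<in> {1..m}" "j \<in> {1..m}"
  shows "int i mod int m = int j mod int m \<longleftrightarrow> i = j"
proof
  assume "int i mod int m = int j mod int m"
  then have "int m dvd int i - int j" by (simp add: mod_eq_dvd_iff)
  moreover have "\<bar>int i - int j\<bar> < int m" using assms by auto
  ultimately show "i = j" using zdvd_not_zless[of "\<bar>int i - int j\<bar>" "int m"] by fastforce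
qed simp

lemma exch_conj: "p \<in> periodic_perms m \<Longrightarrow> p \<circ> exch m a b = exch m (p a) (p b) \<circ> p"
  by (simp add: fun_eq_iff periodic_exch)

lemma exch_translation_conj:
  "p \<in> periodic_perms m \<Longrightarrow> p \<circ> exch m a (a + int m) = exch m (p a) (p a + int m) \<circ> p"
  by (simp add: exch_conj periodic_add)

text \<open>The intended model.\<close>

lemma perm_affine_symmetric:
  assumes m: "1 \<le> m"
  shows "affine_symmetric m (perm_s m) (perm_t m) (perm_t' m)"
proof
  note defs = perm_s_def perm_t_def perm_t'_def times_endo_def one_endo_def
  have R: "int i mod int m = int j mod int m \<longleftrightarrow> i = j" if "i \<in> {1..m}" "j \<in> {1..m}" for i j
    using residue_eq_iff that .
  have R1: "(int i + 1) mod int m = int j mod int m \<longleftrightarrow> Suc i = j" if "i \<in> {1..<m}" "j \<in> {1..m}" for i j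
    using residue_eq_iff[of "Suc i" m j] that by (simp add: add.commute)
  have R2: "(int i + 1) mod int m = (int j + 1) mod int m \<longleftrightarrow> i = j" if "i \<in> {1..<m}" "j \<in> {1..<m}" for i j
    using residue_eq_iff[of "Suc i" m "Suc j"] that by (simp add: add.commute)
  show "1 \<le> m" by (rule m)
  show "perm_t m i * perm_t' m i = 1" "perm_t' m i * perm_t m i = 1" for i
  proof -
    have "exch m (int i) (int i + - int m) (exch m (int i) (int i + int m) j) = j"
      "exch m (int i) (int i + int m) (exch m (int i) (int i + - int m) j) = j" for j
      by (auto simp: exch_shift mod_add_dvd simp del: add_uminus_conv_diff)
    then show "perm_t m i * perm_t' m i = 1" "perm_t' m i * perm_t m i = 1"
      by (simp_all add: defs fun_eq_iff)
  qed
  fix i assume i: "i \<in> {1..<m}"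
  have i1: "exch m (int i) (int i + 1) (int i) = int i + 1"
    "exch m (int i) (int i + 1) (int i + 1) = int i"
    using R1[OF i, of i] i by (auto intro!: exch_snd)
  show "perm_s m i * perm_s m i = 1"
    using exch_inverse[of m "int i" "int i + 1"] exch_commute[of "int i" m "int i + 1"] R1[OF i, of i] i
    by (auto simp: defs fun_eq_iff)
  show "perm_s m i * perm_s m j = perm_s m j * perm_s m i" if j: "j \<in> {1..<m}" "far i j" for j
  proof -
    have "exch m (int i) (int i + 1) (int j) = int j" "exch m (int i) (int i + 1) (int j + 1) = int j + 1"
    proof -
      have mem: "i \<in> {1..m}" "j \<in> {1..m}" using i j by auto
      have "j \<noteq> i" "Suc i \<noteq> j" "Suc j \<noteq> i" using j(2) by auto
      then have "int j mod int m \<noteq> int i mod int m" "int j mod int m \<noteq> (int i + 1) mod int m"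
        "(int j + 1) mod int m \<noteq> int i mod int m" "(int j + 1) mod int m \<noteq> (int i + 1) mod int m"
        using R[OF mem(2,1)] R1[OF i mem(2)] R1[OF j(1) mem(1)] R2[OF j(1) i] by metis+
      then show "exch m (int i) (int i + 1) (int j) = int j"
        "exch m (int i) (int i + 1) (int j + 1) = int j + 1" using exch_other by metis+
    qed
    then show ?thesis
      using exch_conj[of "exch m (int i) (int i + 1)" m "int j" "int j + 1"] by (simp add: defs)
  qed
  show "perm_s m i * perm_s m (i + 1) * perm_s m i = perm_s m (i + 1) * perm_s m i * perm_s m (i + 1)"
    if j: "i + 1 \<in> {1..<m}"
  proof -
    let ?x = "int i" and ?y = "int i + 1" and ?z = "int i + 2"
    have r: "?y mod int m \<noteq> ?x mod int m" "?z mod int m \<noteq> ?x mod int m" "?z mod int m \<noteq> ?y mod int m"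
    proof -
      have mem: "i \<in> {1..m}" "i + 2 \<in> {1..m}" "i + 1 \<in> {1..m}" using i j by auto
      have e: "int (i + 2) = ?z" "int (i + 1) = ?y" by simp_all
      show "?y mod int m \<noteq> ?x mod int m" "?z mod int m \<noteq> ?x mod int m" "?z mod int m \<noteq> ?y mod int m"
        using R[OF mem(3,1)] R[OF mem(2,1)] R[OF mem(2,3)] unfolding e by simp_all
    qed
    have sq: "exch m ?x ?y \<circ> exch m ?x ?y = id" "exch m ?y ?z \<circ> exch m ?y ?z = id"
      using exch_inverse[of m ?x ?y] exch_inverse[of m ?y ?z] exch_commute[of ?x m ?y] exch_commute[of ?y m ?z] r
      by (auto simp: fun_eq_iff)
    have "exch m ?x ?y \<circ> exch m ?y ?z = exch m ?x ?z \<circ> exch m ?x ?y"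
      using exch_conj[of "exch m ?x ?y" m ?y ?z] r by simp
    then have 1: "exch m ?x ?y \<circ> exch m ?y ?z \<circ> exch m ?x ?y = exch m ?x ?z"
      using sq by (simp add: comp_assoc)
    have "exch m ?y ?z \<circ> exch m ?x ?y = exch m ?x ?z \<circ> exch m ?y ?z"
      using exch_conj[of "exch m ?y ?z" m ?x ?y] r by auto
    then have 2: "exch m ?y ?z \<circ> exch m ?x ?y \<circ> exch m ?y ?z = exch m ?x ?z"
      using sq by (simp add: comp_assoc)
    have yz: "int (i + 1) = ?y" "?y + 1 = ?z" by simp_all
    show ?thesis unfolding defs yz endo.sel 1 2 by (rule refl)
  qed
  show "perm_s m i * perm_t m j = perm_t m j * perm_s m i" if j: "j \<in> {1..m}" "far i j" for j
  proof -
    have "exch m (int i) (int i + 1) (int j) = int j"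
    proof -
      have mem: "i \<in> {1..m}" using i by auto
      have "j \<noteq> i" "Suc i \<noteq> j" using j(2) by auto
      then have "int j mod int m \<noteq> int i mod int m" "int j mod int m \<noteq> (int i + 1) mod int m"
        using R[OF j(1) mem] R1[OF i j(1)] by metis+
      then show ?thesis using exch_other by metis
    qed
    then show ?thesis
      using exch_translation_conj[of "exch m (int i) (int i + 1)" m "int j"] by (simp add: defs)
  qed
  show "perm_s m i * perm_t m i = perm_t m (i + 1) * perm_s m i"
    using exch_translation_conj[of "exch m (int i) (int i + 1)" m "int i"] i1
    by (simp add: defs add.commute add.left_commute)
next
  fix i j assume i: "i \<in> {1..m}" and j: "j \<in> {1..m}"
  show "perm_t m i * perm_t m j = perm_t m j * perm_t m i"
  proof (cases "i = j")
    case False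
    then have "exch m (int i) (int i + int m) (int j) = int j"
      using residue_eq_iff[OF j i] by (simp add: exch_shift)
    then show ?thesis
      using exch_translation_conj[of "exch m (int i) (int i + int m)" m "int j"]
      by (simp add: perm_t_def times_endo_def)
  qed simp
qed

lemma app_perm_s: "app (perm_s m i) = exch m (int i) (int i + 1)"
  by (simp add: perm_s_def)

definition perm_lt :: "nat \<Rightarrow> bool \<Rightarrow> nat \<Rightarrow> int endo" where
  "perm_lt m \<epsilon> i = (if \<epsilon> then perm_t m i else perm_t' m i)"

lemma app_perm_lt:
  "app (perm_lt m \<epsilon> i) = exch m (int i) (int i + (if \<epsilon> then int m else - int m))"
  by (simp add: perm_lt_def perm_t_def perm_t'_def)

context affine_symmetric
begin

interpretation perm: affine_symmetric m "perm_s m" "perm_t m" "perm_t' m"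
  by (rule perm_affine_symmetric[OF m_pos])

text \<open>
  Words on \<open>n\<close> strands, seen through the permutation that they describe and the
  element that they denote.
\<close>

inductive represents :: "nat \<Rightarrow> int endo \<Rightarrow> 'a \<Rightarrow> bool" for n where
  one: "represents n 1 1"
| s: "i \<in> {1..<n} \<Longrightarrow> represents n p x \<Longrightarrow> represents n (perm_s m i * p) (s i * x)"
| t: "i \<in> {1..n} \<Longrightarrow> represents n p x \<Longrightarrow> represents n (perm_lt m \<epsilon> i * p) (lt \<epsilon> i * x)"

lemma perm_lt_eq: "perm_lt m = perm.lt"
  by (simp add: fun_eq_iff perm_lt_def perm.lt_def)

text \<open>
  The steps that bring a word into the form of a representative times a shorter word are the
  same for the permutation and for the element.
\<close>

lemma represents_coset:
  assumes "represents n p x" "1 \<le> n" "n \<le> m"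
  shows "\<exists>k\<in>{1..n}. \<exists>a p' x'. represents (n - 1) p' x' \<and> p = perm.coset n k a * p' \<and> x = coset n k a * x'"
  using assms(1)
proof induction
  case one
  show ?case
    using assms by (intro bexI[of _ n] exI[of _ 0] exI[of _ 1])
      (simp_all add: coset_def perm.coset_def gen_pow_def represents.one)
next
  case (s i p x)
  then obtain k a p' x' where k: "k \<in> {1..n}" and r: "represents (n - 1) p' x'"
    and eq: "p = perm.coset n k a * p'" "x = coset n k a * x'" by blast
  note C = coset_steps[OF assms(3) k] and P = perm.coset_steps[OF assms(3) k]
  consider "i + 1 = k" | "i = k" | "i + 1 < k" | "k < i" by linarith
  then show ?case
  proof cases
    case 1
    then have "perm_s m i * p = perm.coset n i a * p'" "s i * x = coset n i a * x'"
      using C(1) P(1) s(1) unfolding eq by (simp_all add: mult.assoc[symmetric])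
    then show ?thesis using r s(1) by (intro bexI[of _ i]) auto
  next
    case 2
    then have "perm_s m i * p = perm.coset n (k + 1) a * p'" "s i * x = coset n (k + 1) a * x'"
      using C(2) P(2) s(1) unfolding eq by (simp_all add: mult.assoc[symmetric])
    then show ?thesis using r s(1) 2 by (intro bexI[of _ "k + 1"]) auto
  next
    case 3
    then have "perm_s m i * p = perm.coset n k a * (perm_s m i * p')" "s i * x = coset n k a * (s i * x')"
      using C(3) P(3) s(1) unfolding eq by (simp_all add: mult.assoc[symmetric])
    moreover have "represents (n - 1) (perm_s m i * p') (s i * x')"
      using 3 s(1) k by (intro represents.s r) auto
    ultimately show ?thesis using k by blast
  next
    case 4
    then have "perm_s m i * p = perm.coset n k a * (perm_s m (i - 1) * p')"
      "s i * x = coset n k a * (s (i - 1) * x')"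
      using C(4) P(4) s(1) unfolding eq by (simp_all add: mult.assoc[symmetric])
    moreover have "represents (n - 1) (perm_s m (i - 1) * p') (s (i - 1) * x')"
      using 4 s(1) k by (intro represents.s r) auto
    ultimately show ?thesis using k by blast
  qed
next
  case (t i p x \<epsilon>)
  then obtain k a p' x' where k: "k \<in> {1..n}" and r: "represents (n - 1) p' x'"
    and eq: "p = perm.coset n k a * p'" "x = coset n k a * x'" by blast
  note C = coset_steps[OF assms(3) k] and P = perm.coset_steps[OF assms(3) k]
  show ?case
  proof (cases "i = k")
    case True
    let ?a = "if \<epsilon> then a + 1 else a - 1"
    have "perm_lt m \<epsilon> i * p = perm.coset n k ?a * p'" "lt \<epsilon> i * x = coset n k ?a * x'"
      using C(5)[of \<epsilon>] P(5)[of \<epsilon>] unfolding eq True perm_lt_eq by (simp_all add: mult.assoc[symmetric])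
    then show ?thesis using r k by blast
  next
    case False
    let ?i = "if i < k then i else i - 1"
    have "perm_lt m \<epsilon> i * p = perm.coset n k a * (perm_lt m \<epsilon> ?i * p')"
      "lt \<epsilon> i * x = coset n k a * (lt \<epsilon> ?i * x')"
      using C(6)[OF t(1) False, of \<epsilon>] P(6)[OF t(1) False, of \<epsilon>] unfolding eq perm_lt_eq
      by (simp_all only: mult.assoc[symmetric])
    moreover have "represents (n - 1) (perm_lt m \<epsilon> ?i * p') (lt \<epsilon> ?i * x')"
      using t(1) k False by (intro represents.t r) auto
    ultimately show ?thesis using k by blast
  qed
qed

lemma represents_perm: "represents n p x \<Longrightarrow> app p \<in> periodic_perms m"
  by (induction rule: represents.induct) (simp_all add: app_perm_s app_perm_lt del: o_apply)

lemma represents_fixes: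
  assumes "represents n p x" "n < j" "j \<le> m"
  shows "app p (int j) = int j"
  using assms(1)
proof induction
  case (s i p x)
  have "exch m (int i) (int i + 1) (int j) = int j"
    using residue_eq_iff[of j m i] residue_eq_iff[of j m "i + 1"] s(1) assms
    by (intro exch_other) (auto simp: add.commute)
  then show ?case using s by (simp add: app_perm_s)
next
  case (t i p x \<epsilon>)
  have "int m dvd (if \<epsilon> then int m else - int m)" by simp
  then have "app (perm_lt m \<epsilon> i) (int j) = int j"
    using residue_eq_iff[of j m i] t(1) assms unfolding app_perm_lt by (subst exch_shift) auto
  then show ?case using t by simp
qed simp

lemma represents_mono: "represents n p x \<Longrightarrow> n \<le> n' \<Longrightarrow> represents n' p x"
  by (induction rule: represents.induct) (auto intro: represents.intros)

lemma represents_mult: "represents n p x \<Longrightarrow> represents n q y \<Longrightarrow> represents n (p * q) (x * y)"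
  by (induction rule: represents.induct) (auto simp: mult.assoc intro: represents.intros)

lemma represents_gen_pow:
  assumes "i \<in> {1..n}"
  shows "represents n (perm.tpow i a) (tpow i a)"
proof -
  have "represents n (perm_lt m \<epsilon> i) (lt \<epsilon> i)" for \<epsilon>
    using represents.t[OF assms represents.one, of \<epsilon>] by simp
  then have "represents n (perm_lt m \<epsilon> i ^ k) (lt \<epsilon> i ^ k)" for \<epsilon> k
    by (induction k) (auto intro: represents.one represents_mult)
  from this[of True "nat a"] this[of False "nat (- a)"] show ?thesis
    by (simp add: gen_pow_def lt_def perm_lt_def)
qed

lemma represents_chain:
  assumes "1 \<le> k" "k \<le> n"
  shows "represents n (perm.chain k n) (chain k n)"
  using assms(2,1)
proof (induction k rule: inc_induct)
  case (step k)
  then show ?case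
    using represents.s[of k n] chain_rec[of k n] perm.chain_rec[of k n] by simp
qed (auto simp: represents.one)

lemma coset_perm:
  assumes "k \<in> {1..n}" "n \<le> m"
  shows "represents n (perm.coset n k a) (coset n k a)"
    and "app (perm.coset n k a) (int n) = int k + a * int m"
proof -
  show "represents n (perm.coset n k a) (coset n k a)"
    unfolding coset_def perm.coset_def using assms
    by (intro represents_mult represents_gen_pow represents_chain) auto
  have "k \<le> n" "1 \<le> k" using assms by auto
  then have "app (perm.chain k n) (int n) = int k"
  proof (induction k rule: inc_induct)
    case (step k)
    have "(int k + 1) mod int m \<noteq> int k mod int m"
      using residue_eq_iff[of "k + 1" m k] step assms by (auto simp: add.commute)
    then show ?case using step perm.chain_rec[of k n] by (simp add: app_perm_s add.commute[of 1])
  qed simp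
  moreover have "app (perm.tpow k a) (int k) = int k + a * int m"
  proof -
    have pow: "app (perm_lt m \<epsilon> k ^ j) (int k) = int k + int j * (if \<epsilon> then int m else - int m)" for \<epsilon> j
    proof (induction j)
      case (Suc j)
      have d: "int m dvd (if \<epsilon> then int m else - int m)" by simp
      then have "(int k + int j * (if \<epsilon> then int m else - int m)) mod int m = int k mod int m"
        by (intro mod_add_dvd dvd_mult)
      then show ?case using Suc unfolding power_Suc app_simps o_apply app_perm_lt
        by (simp add: exch_shift[OF d] algebra_simps)
    qed simp
    show ?thesis
      using pow[of True "nat a"] pow[of False "nat (- a)"]
      by (simp add: gen_pow_def perm_lt_def)
  qed
  ultimately show "app (perm.coset n k a) (int n) = int k + a * int m"
    by (simp add: perm.coset_def)
qed

text \<open>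
  The image of \<open>n\<close> determines the coset representative, which can then be cancelled: a
  permutation is represented by at most one element.
\<close>

lemma represents_unique:
  "n \<le> m \<Longrightarrow> represents n p x \<Longrightarrow> represents n p y \<Longrightarrow> x = y"
proof (induction n arbitrary: p x y)
  case 0
  have "z = 1" if "represents 0 p z" for p z
    using that by induction auto
  then show ?case using 0 by blast
next
  case (Suc n)
  have n: "1 \<le> Suc n" by simp
  obtain k a p' x' where k: "k \<in> {1..Suc n}" "represents n p' x'"
    "p = perm.coset (Suc n) k a * p'" "x = coset (Suc n) k a * x'"
    using represents_coset[OF Suc.prems(2) n Suc.prems(1)] by auto
  obtain l b q' y' where l: "l \<in> {1..Suc n}" "represents n q' y'"
    "p = perm.coset (Suc n) l b * q'" "y = coset (Suc n) l b * y'"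
    using represents_coset[OF Suc.prems(3) n Suc.prems(1)] by auto
  have "app p (int (Suc n)) = int k + a * int m"
    unfolding k(3) using represents_fixes[OF k(2), of "Suc n"] coset_perm(2)[OF k(1) Suc.prems(1)] Suc.prems(1)
    by simp
  moreover have "app p (int (Suc n)) = int l + b * int m"
    unfolding l(3) using represents_fixes[OF l(2), of "Suc n"] coset_perm(2)[OF l(1) Suc.prems(1)] Suc.prems(1)
    by simp
  ultimately have kl: "int k + a * int m = int l + b * int m" by simp
  then have "int k mod int m = int l mod int m" by (metis mod_mult_self1)
  then have "k = l" using residue_eq_iff[of k m l] k(1) l(1) Suc.prems(1) by auto
  moreover have "a = b" using kl \<open>k = l\<close> m_pos by simp
  ultimately have c: "perm.coset (Suc n) k a * p' = perm.coset (Suc n) k a * q'" using k(3) l(3) by simp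
  have "inj (app (perm.coset (Suc n) k a))"
    using represents_perm[OF coset_perm(1)[OF k(1) Suc.prems(1)]] periodic_bij bij_is_inj by blast
  then have "app p' = app q'"
    using arg_cong[OF c, of app] by (simp add: fun_eq_iff inj_eq)
  then have "p' = q'" by (simp add: endo.expand)
  then have "x' = y'" using Suc.IH k(2) l(2) Suc.prems(1) by auto
  then show ?case using k l \<open>k = l\<close> \<open>a = b\<close> by simp
qed

text \<open>
  The image of \<open>n\<close> has the form \<open>k + a m\<close>. Splitting off the
  representative for \<open>k\<close> and \<open>a\<close> leaves a permutation that fixes
  \<open>n\<close>.
\<close>

lemma represents_exists:
  assumes "n \<le> m" "p \<in> periodic_perms m" "\<And>j. n < j \<Longrightarrow> j \<le> m \<Longrightarrow> p (int j) = int j"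
  shows "\<exists>x. represents n (Endo p) x"
  using assms
proof (induction n arbitrary: p)
  case 0
  have "p z = z" for z
  proof -
    define r where "r = (z - 1) mod int m + 1"
    have r: "1 \<le> r" "r \<le> int m"
      using pos_mod_bound[of "int m" "z - 1"] pos_mod_sign[of "int m" "z - 1"] m_pos
      unfolding r_def by linarith+
    have "z - r = (z - 1) - (z - 1) mod int m" unfolding r_def by simp
    then have d: "int m dvd z - r" by (simp only: dvd_minus_mod)
    have "p r = r" using 0(3)[of "nat r"] r by simp
    then show ?thesis using periodic_add[OF 0(2) d, of r] by simp
  qed
  then have "Endo p = 1" by (simp add: one_endo_def fun_eq_iff)
  then show ?case using represents.one by metis
next
  case (Suc n)
  let ?N = "Suc n"
  define v where "v = p (int ?N)"
  \<comment> \<open>strands are numbered from \<open>1\<close> to \<open>m\<close>, hence the shift by one in the residue\<close>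
  define r where "r = (v - 1) mod int m + 1"
  define k where "k = nat r"
  define a where "a = (v - 1) div int m"
  have r: "1 \<le> r" "r \<le> int m"
    using pos_mod_bound[of "int m" "v - 1"] pos_mod_sign[of "int m" "v - 1"] m_pos
    unfolding r_def by linarith+
  have v: "v = int k + a * int m" using r unfolding k_def a_def
    using div_mult_mod_eq[of "v - 1" "int m"] by (simp add: r_def)
  have "k \<le> ?N"
  proof (rule ccontr)
    assume k: "\<not> k \<le> ?N"
    have "p (int k) = int k" using Suc.prems(3)[of k] k r by (simp add: k_def)
    then have "p (int k + a * int m) = p (int ?N)"
      using periodic_add[OF Suc.prems(2), of "a * int m" "int k"] v unfolding v_def by simp
    then have eq: "int k + a * int m = int ?N"
      using periodic_bij[OF Suc.prems(2)] by (simp add: bij_def inj_eq)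
    then have "int k mod int m = int ?N mod int m" by (metis mod_mult_self1)
    then show False using residue_eq_iff[of k m ?N] k r Suc.prems(1) by (auto simp: k_def)
  qed
  then have k: "k \<in> {1..?N}" using r by (auto simp: k_def)
  let ?c = "app (perm.coset ?N k a)"
  note C = coset_perm[OF k Suc.prems(1), of a]
  have c: "?c \<in> periodic_perms m" by (rule represents_perm[OF C(1)])
  define q where "q = perm_inv ?c \<circ> p"
  have q: "q \<in> periodic_perms m" unfolding q_def using c Suc.prems(2) by simp
  have "q (int j) = int j" if j: "n < j" "j \<le> m" for j
  proof (cases "j = ?N")
    case True
    have "perm_inv ?c (?c (int ?N)) = int ?N" by (rule periodic_inv_simps[OF c])
    then show ?thesis unfolding True q_def using C(2) v v_def by simp
  next
    case False
    then have "p (int j) = int j" "?c (int j) = int j"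
      using Suc.prems(3)[of j] represents_fixes[OF C(1), of j] j by auto
    then show ?thesis unfolding q_def using periodic_inv_simps(1)[OF c, of "int j"] by simp
  qed
  then obtain x where "represents n (Endo q) x" using Suc.IH[OF _ q] Suc.prems(1) by auto
  then have "represents ?N (Endo q) x" by (rule represents_mono) simp
  then have "represents ?N (perm.coset ?N k a * Endo q) (coset ?N k a * x)" by (rule represents_mult[OF C(1)])
  moreover have "perm.coset ?N k a * Endo q = Endo p"
    unfolding q_def by (simp add: times_endo_def fun_eq_iff periodic_inv_simps[OF c])
  ultimately show ?case by auto
qed

text \<open>
  The homomorphism from the periodic permutations to the monoid, well defined because every
  periodic permutation is represented by exactly one element.
\<close>

definition rho :: "(int \<Rightarrow> int) \<Rightarrow> 'a" where
  "rho p = (THE x. represents m (Endo p) x)"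

lemma rho_eqI:
  assumes "represents n p x" "n \<le> m"
  shows "rho (app p) = x"
proof -
  have r: "represents m (Endo (app p)) x" using represents_mono[OF assms] by (simp only: endo.collapse)
  show ?thesis
    unfolding rho_def by (rule the_equality[of "represents m (Endo (app p))", OF r]) (rule represents_unique[OF order_refl _ r])
qed

lemma rho_represents: "p \<in> periodic_perms m \<Longrightarrow> represents m (Endo p) (rho p)"
proof -
  assume p: "p \<in> periodic_perms m"
  obtain x where x: "represents m (Endo p) x" using represents_exists[OF order_refl p] by auto
  then show ?thesis using rho_eqI[OF x] by simp
qed

lemma rho_comp:
  "p \<in> periodic_perms m \<Longrightarrow> q \<in> periodic_perms m \<Longrightarrow> rho (p \<circ> q) = rho p * rho q"
  using rho_eqI[OF represents_mult[OF rho_represents rho_represents], of p q] by simp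

lemma rho_id [simp]: "rho id = 1" "rho (\<lambda>j. j) = 1"
  using rho_eqI[OF represents.one[of m]] by (simp_all add: id_def)

lemma rho_s: "i \<in> {1..<m} \<Longrightarrow> rho (exch m (int i) (int i + 1)) = s i"
  using rho_eqI[OF represents.s[OF _ represents.one], of i m] by (simp add: app_perm_s)

lemma rho_lt:
  "i \<in> {1..m} \<Longrightarrow> rho (exch m (int i) (int i + (if \<epsilon> then int m else - int m))) = lt \<epsilon> i"
  using rho_eqI[OF represents.t[OF _ represents.one], of i m \<epsilon>] by (simp add: app_perm_lt)

lemma rho_inv:
  assumes "p \<in> periodic_perms m"
  shows "rho p * rho (perm_inv p) = 1" "rho (perm_inv p) * rho p = 1"
  using rho_comp[OF assms inv_periodic[OF assms]] rho_comp[OF inv_periodic[OF assms] assms]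
    periodic_inv_simps[OF assms] by (simp_all add: comp_def)

lemma rho_tpow:
  assumes "i \<in> {1..m}"
  shows "rho (exch m (int i) (int i + a * int m)) = tpow i a"
proof -
  have pow: "app (perm_lt m \<epsilon> i ^ n) = exch m (int i) (int i + int n * (if \<epsilon> then int m else - int m))" for \<epsilon> n
  proof (induction n)
    case 0
    have "exch m (int i) (int i + 0) j = j" for j by (subst exch_shift) simp_all
    then show ?case by (simp add: fun_eq_iff)
  next
    case (Suc n)
    define D where "D = (if \<epsilon> then int m else - int m)"
    have D: "int m dvd D" by (simp add: D_def)
    have d: "int m dvd int k * D" for k using D by simp
    show ?case
      unfolding power_Suc app_simps Suc app_perm_lt fun_eq_iff o_apply D_def[symmetric]
        exch_shift[OF d] exch_shift[OF D]
      using mod_add_dvd[OF d] by (auto simp: distrib_right)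
  qed
  have "app (perm.tpow i a) = exch m (int i) (int i + a * int m)"
    using pow[of True "nat a"] pow[of False "nat (- a)"] by (simp add: gen_pow_def perm_lt_def)
  then show ?thesis using rho_eqI[OF represents_gen_pow[OF assms] order_refl, of a] by simp
qed

text \<open>
  A permutation that fixes the strands after \<open>n\<close> is represented by a word on the
  first \<open>n\<close> strands.
\<close>

lemma rho_commute:
  assumes n: "n \<le> m" and p: "p \<in> periodic_perms m" "\<And>j. n < j \<Longrightarrow> j \<le> m \<Longrightarrow> p (int j) = int j"
    and z: "\<And>i. i \<in> {1..<n} \<Longrightarrow> s i * z = z * s i" "\<And>i. i \<in> {1..n} \<Longrightarrow> t i * z = z * t i"
  shows "rho p * z = z * rho p"
proof -
  have t': "t' i * z = z * t' i" if i: "i \<in> {1..n}" for i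
  proof -
    have im: "i \<in> {1..m}" using i n by auto
    have "z * t i = t i * z" using z(2)[OF i] ..
    then show ?thesis using t'_intertwine[OF im im] by metis
  qed
  obtain x where x: "represents n (Endo p) x" using represents_exists[OF n p] by blast
  have "x * z = z * x"
    using x
  proof induction
    case (s i p x)
    then show ?case using z(1) by (metis mult.assoc)
  next
    case (t i p x \<epsilon>)
    then have "lt \<epsilon> i * z = z * lt \<epsilon> i" using z(2) t' by (simp add: lt_def)
    then show ?case using t by (metis mult.assoc)
  qed simp
  then show ?thesis using rho_eqI[OF x n] by simp
qed

end

lemma periodic_induct [consumes 2, case_names id s t]:
  assumes m: "1 \<le> m" and p: "p \<in> periodic_perms m"
    and id: "P id"
    and s: "\<And>i p. i \<in> {1..<m} \<Longrightarrow> p \<in> periodic_perms m \<Longrightarrow> P p \<Longrightarrow> P (exch m (int i) (int i + 1) \<circ> p)"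
    and t: "\<And>i p d. i \<in> {1..m} \<Longrightarrow> d \<in> {int m, - int m} \<Longrightarrow> p \<in> periodic_perms m \<Longrightarrow> P p \<Longrightarrow>
      P (exch m (int i) (int i + d) \<circ> p)"
  shows "P p"
proof -
  interpret perm: affine_symmetric m "perm_s m" "perm_t m" "perm_t' m"
    by (rule perm_affine_symmetric[OF m])
  have "P (app q)" if "perm.represents m q x" for q x
    using that
  proof induction
    case one
    then show ?case using assms(3) by (simp add: id_def)
  next
    case (s i q x)
    then show ?case using assms(4)[OF s(1) perm.represents_perm[OF s(2)]] by (simp add: app_perm_s del: o_apply)
  next
    case (t i q x \<epsilon>)
    let ?d = "if \<epsilon> then int m else - int m"
    have "P (exch m (int i) (int i + ?d) \<circ> app q)"
      by (rule assms(5)[OF t(1) _ perm.represents_perm[OF t(2)] t(3)]) simp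
    then show ?case by (simp only: app_simps app_perm_lt)
  qed
  from this[OF perm.rho_represents[OF p]] show ?thesis by simp
qed

lemma extend_perm:
  assumes p: "p \<in> periodic_perms m"
  shows "\<exists>q\<in>periodic_perms m. q x = x' \<and>
    (\<forall>y. y mod int m \<noteq> x mod int m \<and> p y mod int m \<noteq> x' mod int m \<longrightarrow> q y = p y)"
proof (intro bexI conjI allI impI)
  let ?q = "exch m (p x) x' \<circ> p"
  show "?q \<in> periodic_perms m" using p by simp
  show "?q x = x'" by simp
  show "?q y = p y" if "y mod int m \<noteq> x mod int m \<and> p y mod int m \<noteq> x' mod int m" for y
    using that periodic_mod[OF p] by simp
qed

lemma apart_last: "2 \<le> m \<Longrightarrow> (int m - 1) mod int m \<noteq> int m mod int m"
  using residue_eq_iff[of "m - 1" m m] by (simp add: of_nat_diff)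

lemma pair_frame:
  assumes m_pos: "1 \<le> m" and ac: "a mod int m \<noteq> c mod int m"
  shows "2 \<le> m" "\<exists>p\<in>periodic_perms m. p (int m - 1) = a \<and> p (int m) = c"
proof -
  show m: "2 \<le> m" using assms by (cases "m = 1") auto
  obtain p where p: "p \<in> periodic_perms m" "p (int m) = c"
    using extend_perm[OF id_periodic(1)] by blast
  obtain q where q: "q \<in> periodic_perms m" "q (int m - 1) = a"
    "\<And>y. y mod int m \<noteq> (int m - 1) mod int m \<and> p y mod int m \<noteq> a mod int m \<Longrightarrow> q y = p y"
    using extend_perm[OF p(1)] by blast
  have "q (int m) = c" using q(3)[of "int m"] apart_last[OF m] ac p(2) by metis
  then show "\<exists>p\<in>periodic_perms m. p (int m - 1) = a \<and> p (int m) = c" using q by blast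
qed

section \<open>Conjugates of a cup-cap\<close>

text \<open>
  The relations of the presentation apart from those for \<open>\<tau>\<close>, which is a word
  in the other generators. Multiplication by the coefficient \<open>\<beta>\<close> becomes
  multiplication by \<open>b\<close>,
  which commutes with all generators.
\<close>

locale affine_brauer = affine_symmetric m s t t'
  for m :: nat and s t t' :: "nat \<Rightarrow> 'a::monoid_mult" +
  fixes e :: "nat \<Rightarrow> 'a" and b :: 'a
  assumes b_s: "i \<in> {1..<m} \<Longrightarrow> s i * b = b * s i"
    and b_t: "i \<in> {1..m} \<Longrightarrow> t i * b = b * t i"
    and b_e: "i \<in> {1..<m} \<Longrightarrow> e i * b = b * e i"
    and ete: "i \<in> {1..<m} \<Longrightarrow> e i * gen_pow t t' i a * e i = b * e i"
    and ee_far: "i \<in> {1..<m} \<Longrightarrow> j \<in> {1..<m} \<Longrightarrow> far i j \<Longrightarrow> e i * e j = e j * e i"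
    and se_far: "i \<in> {1..<m} \<Longrightarrow> j \<in> {1..<m} \<Longrightarrow> far i j \<Longrightarrow> s i * e j = e j * s i"
    and sse: "i \<in> {1..<m} \<Longrightarrow> j \<in> {1..<m} \<Longrightarrow> adj i j \<Longrightarrow> s i * s j * e i = e j * e i"
    and ess: "i \<in> {1..<m} \<Longrightarrow> j \<in> {1..<m} \<Longrightarrow> adj i j \<Longrightarrow> e i * s j * s i = e i * e j"
    and se: "i \<in> {1..<m} \<Longrightarrow> s i * e i = e i"
    and es: "i \<in> {1..<m} \<Longrightarrow> e i * s i = e i"
    and et_far: "i \<in> {1..<m} \<Longrightarrow> j \<in> {1..m} \<Longrightarrow> far i j \<Longrightarrow> e i * t j = t j * e i"
    and ett: "i \<in> {1..<m} \<Longrightarrow> e i * t i * t (i + 1) = e i"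
    and tte: "i \<in> {1..<m} \<Longrightarrow> t i * t (i + 1) * e i = e i"
begin

abbreviation sw :: "int \<Rightarrow> int \<Rightarrow> int \<Rightarrow> int" where "sw \<equiv> exch m"

abbreviation apart :: "int \<Rightarrow> int \<Rightarrow> bool" where "apart x y \<equiv> x mod int m \<noteq> y mod int m"

lemma rho_cancel_left: "p \<in> periodic_perms m \<Longrightarrow> rho p * x = rho p * y \<Longrightarrow> x = y"
  using rho_inv(2)[of p] by (metis mult.assoc mult_1_left)

lemma rho_cancel_right: "p \<in> periodic_perms m \<Longrightarrow> x * rho p = y * rho p \<Longrightarrow> x = y"
  using rho_inv(1)[of p] by (metis mult.assoc mult_1_right)

lemma rho_b: "p \<in> periodic_perms m \<Longrightarrow> rho p * b = b * rho p"
  by (rule rho_commute[of m]) (auto simp: b_s b_t)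

lemma sse_conj:
  assumes "i \<in> {1..<m}" "i + 1 \<in> {1..<m}"
  shows "s i * s (i + 1) * e i = e (i + 1) * (s i * s (i + 1))"
  using sse[OF assms] ess[OF assms(2,1)] by (simp add: mult.assoc)

text \<open>
  Commutation of \<open>e\<^sub>k\<^sub>+\<^sub>1\<close> with \<open>t\<^sub>k\<close> is obtained from that of \<open>e\<^sub>k\<close> with
  \<open>t\<^sub>k\<^sub>+\<^sub>2\<close> by conjugation with \<open>s\<^sub>k s\<^sub>k\<^sub>+\<^sub>1\<close>.
\<close>

lemma et_left:
  assumes "k \<in> {1..<m}" "k + 1 \<in> {1..<m}"
  shows "e (k + 1) * t k = t k * e (k + 1)"
proof -
  let ?q = "s k * s (k + 1)"
  have 1: "t k * ?q = ?q * t (k + 2)"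
  proof -
    have "t k * ?q = (s k * t (k + 1)) * s (k + 1)"
      unfolding st_next[OF assms(1)] by (simp add: mult.assoc)
    also have "\<dots> = s k * (s (k + 1) * t (k + 1 + 1))"
      unfolding st_next[OF assms(2)] by (simp add: mult.assoc)
    finally show ?thesis by (simp add: mult.assoc numeral_2_eq_2)
  qed
  have 2: "e k * t (k + 2) = t (k + 2) * e k" using assms by (intro et_far) auto
  have "e (k + 1) * t k * ?q = (e (k + 1) * ?q) * t (k + 2)" using 1 by (simp add: mult.assoc)
  also have "\<dots> = ?q * (e k * t (k + 2))" unfolding sse_conj[OF assms, symmetric] by (simp add: mult.assoc)
  also have "\<dots> = (?q * t (k + 2)) * e k" unfolding 2 by (simp add: mult.assoc)
  also have "\<dots> = t k * (?q * e k)" unfolding 1[symmetric] by (simp add: mult.assoc)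
  also have "\<dots> = t k * e (k + 1) * ?q" unfolding sse_conj[OF assms] by (simp add: mult.assoc)
  finally have "e (k + 1) * t k * ?q * (s (k + 1) * s k) = t k * e (k + 1) * ?q * (s (k + 1) * s k)" by simp
  moreover have "x * ?q * (s (k + 1) * s k) = x" for x
  proof -
    have "x * ?q * (s (k + 1) * s k) = x * (s k * (s (k + 1) * (s (k + 1) * s k)))" by (simp add: mult.assoc)
    then show ?thesis unfolding s_cancel[OF assms(2)] using s_sq[OF assms(1)] by simp
  qed
  ultimately show ?thesis by simp
qed

abbreviation e0 :: 'a where "e0 \<equiv> e (m - 1)"

text \<open>
  A periodic permutation that fixes the last two strands is a product of generators on the first
  \<open>m - 2\<close> strands, and these commute with the last cup-cap.
\<close>

lemma e0_commute:
  assumes m: "2 \<le> m" and p: "p \<in> periodic_perms m" "p (int m - 1) = int m - 1" "p (int m) = int m"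
  shows "rho p * e0 = e0 * rho p"
proof (rule rho_commute[of "m - 2", OF _ p(1)])
  fix j assume "m - 2 < j" "j \<le> m"
  then have "j = m - 1 \<or> j = m" by auto
  then show "p (int j) = int j" using p m by (auto simp: of_nat_diff)
next
  fix i assume "i \<in> {1..<m - 2}"
  then show "s i * e0 = e0 * s i" by (intro se_far) auto
next
  fix i assume i: "i \<in> {1..m - 2}"
  show "t i * e0 = e0 * t i"
  proof (cases "i = m - 2")
    case True
    then have "i \<in> {1..<m}" "i + 1 \<in> {1..<m}" "m - 1 = i + 1" using i by auto
    then show ?thesis using et_left[of i] by simp
  next
    case False
    then show ?thesis using i by (intro et_far[symmetric]) auto
  qed
qed simp

definition frame :: "int \<Rightarrow> int \<Rightarrow> int \<Rightarrow> int" where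
  "frame a c = (SOME p. p \<in> periodic_perms m \<and> p (int m - 1) = a \<and> p (int m) = c)"

lemma frame:
  assumes "apart a c"
  shows "frame a c \<in> periodic_perms m" "frame a c (int m - 1) = a" "frame a c (int m) = c"
  using someI_ex[of "\<lambda>p. p \<in> periodic_perms m \<and> p (int m - 1) = a \<and> p (int m) = c"] pair_frame(2)[OF m_pos assms]
  unfolding frame_def by blast+

text \<open>
  The cup-cap on the strands \<open>a\<close> and \<open>c\<close>, as a conjugate of the last
  one; by \<open>rho_e0\<close> it does not depend on the chosen permutation.
\<close>

definition E :: "int \<Rightarrow> int \<Rightarrow> 'a" where
  "E a c = rho (frame a c) * e0 * rho (perm_inv (frame a c))"

text \<open>Any other conjugating permutation differs by one that fixes both strands.\<close>

lemma rho_e0: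
  assumes m: "2 \<le> m" and p: "p \<in> periodic_perms m"
  shows "rho p * e0 = E (p (int m - 1)) (p (int m)) * rho p"
proof -
  let ?a = "p (int m - 1)" and ?c = "p (int m)"
  have ac: "apart ?a ?c" using periodic_mod[OF p] apart_last[OF m] by simp
  note f = frame[OF ac]
  let ?f = "frame ?a ?c"
  let ?r = "perm_inv ?f \<circ> p"
  have r: "?r \<in> periodic_perms m" using f(1) p by simp
  have "?r (int m - 1) = int m - 1" "?r (int m) = int m"
    using periodic_inv_simps(1)[OF f(1)] f(2,3) by (metis o_apply)+
  then have c: "rho ?r * e0 = e0 * rho ?r" by (rule e0_commute[OF m r])
  have p_eq: "p = ?f \<circ> ?r" by (simp add: fun_eq_iff periodic_inv_simps(2)[OF f(1)])
  have "rho p * e0 = rho ?f * (rho ?r * e0)"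
    using rho_comp[OF f(1) r] p_eq by (simp only: mult.assoc)
  also have "\<dots> = rho ?f * e0 * rho ?r" unfolding c by (simp add: mult.assoc)
  also have "\<dots> = rho ?f * e0 * (rho (perm_inv ?f) * rho p)"
    using rho_comp[OF inv_periodic[OF f(1)] p] by simp
  finally show ?thesis unfolding E_def by (simp only: mult.assoc)
qed

lemma rho_E:
  assumes p: "p \<in> periodic_perms m" and ac: "apart a c"
  shows "rho p * E a c = E (p a) (p c) * rho p"
proof -
  note f = frame[OF ac] and m = pair_frame(1)[OF m_pos ac]
  let ?f = "frame a c"
  have pf: "p \<circ> ?f \<in> periodic_perms m" using p f(1) by simp
  have "rho p * E a c * rho ?f = rho p * (rho ?f * e0)"
    unfolding rho_e0[OF m f(1)] f by (simp add: mult.assoc)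
  also have "\<dots> = rho (p \<circ> ?f) * e0" using rho_comp[OF p f(1)] by (simp add: mult.assoc)
  also have "\<dots> = E (p a) (p c) * rho (p \<circ> ?f)" unfolding rho_e0[OF m pf] by (simp add: f)
  also have "\<dots> = E (p a) (p c) * rho p * rho ?f" using rho_comp[OF p f(1)] by (simp add: mult.assoc)
  finally show ?thesis by (rule rho_cancel_right[OF f(1)])
qed

lemma rho_E_assoc:
  assumes "p \<in> periodic_perms m" "apart a c"
  shows "rho p * (E a c * x) = E (p a) (p c) * (rho p * x)"
  using rho_E[OF assms] by (simp add: mult.assoc[symmetric])

lemma E_last: "2 \<le> m \<Longrightarrow> E (int m - 1) (int m) = e0"
  using rho_e0[OF _ id_periodic(1)] by simp

lemma int_apart: "i \<in> {1..m} \<Longrightarrow> j \<in> {1..m} \<Longrightarrow> i \<noteq> j \<Longrightarrow> apart (int i) (int j)"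
  using residue_eq_iff by blast

text \<open>
  Conjugation by \<open>s\<^sub>i s\<^sub>i\<^sub>+\<^sub>1\<close> carries
  \<open>e\<^sub>i\<close> to \<open>e\<^sub>i\<^sub>+\<^sub>1\<close>, so one can descend from
  the last cup-cap.
\<close>

lemma E_gen:
  assumes "i \<in> {1..<m}"
  shows "E (int i) (int i + 1) = e i"
proof -
  have "1 \<le> i" "i \<le> m - 1" using assms by auto
  from this(2,1) show ?thesis
  proof (induction i rule: inc_induct)
    case base
    then show ?case using E_last by (simp add: of_nat_diff)
  next
    case (step i)
    have i: "i \<in> {1..<m}" "i + 1 \<in> {1..<m}" using step by auto
    let ?p = "sw (int i) (int i + 1)" and ?q = "sw (int (i + 1)) (int (i + 1) + 1)"
    have ap: "apart (int i) (int (i + 1))" "apart (int i) (int (i + 2))" "apart (int (i + 1)) (int (i + 2))"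
      by (rule int_apart; use i in force)+
    have e: "int (i + 1) = int i + 1" "int (i + 2) = int i + 2" by simp_all
    have pq: "rho (?p \<circ> ?q) = s i * s (i + 1)"
      using rho_comp[of ?p ?q] rho_s[OF i(1)] rho_s[OF i(2)] by simp
    have per: "?p \<circ> ?q \<in> periodic_perms m" by simp
    have im: "(?p \<circ> ?q) (int i) = int (i + 1)" "(?p \<circ> ?q) (int i + 1) = int (i + 1) + 1"
    proof -
      have qe: "int i + 1 + 1 = int i + 2" by simp
      have "sw (int i + 1) (int i + 2) (int i) = int i" using ap unfolding e by (intro exch_other)
      then have "?q (int i) = int i" "?q (int i + 1) = int i + 2" unfolding e qe by simp_all
      moreover have "?p (int i + 2) = int i + 2" using ap unfolding e by (intro exch_other) auto
      ultimately show "(?p \<circ> ?q) (int i) = int (i + 1)" "(?p \<circ> ?q) (int i + 1) = int (i + 1) + 1" by simp_all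
    qed
    have "rho (?p \<circ> ?q) * E (int i) (int i + 1) = E (int (i + 1)) (int (i + 1) + 1) * rho (?p \<circ> ?q)"
      using rho_E[OF per ap(1)[unfolded e]] unfolding im .
    also have "E (int (i + 1)) (int (i + 1) + 1) = e (i + 1)" using step by simp
    also have "e (i + 1) * rho (?p \<circ> ?q) = rho (?p \<circ> ?q) * e i" unfolding pq using sse_conj[OF i] by simp
    finally show ?case by (rule rho_cancel_left[OF per])
  qed
qed

text \<open>Relations for conjugates follow from those for the last cup-cap by transport.\<close>

lemma E_absorb_right:
  assumes "2 \<le> m" "p \<in> periodic_perms m" "w0 \<in> periodic_perms m" "w \<in> periodic_perms m"
    and "p \<circ> w0 = w \<circ> p" "e0 * rho w0 = e0"
  shows "E (p (int m - 1)) (p (int m)) * rho w = E (p (int m - 1)) (p (int m))" (is "?E * _ = _")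
proof (rule rho_cancel_right[OF assms(2)])
  have "?E * rho w * rho p = ?E * rho p * rho w0"
    using rho_comp[OF assms(4,2)] rho_comp[OF assms(2,3)] assms(5) by (simp add: mult.assoc)
  also have "\<dots> = ?E * rho p" unfolding rho_e0[OF assms(1,2), symmetric] using assms(6) by (simp add: mult.assoc)
  finally show "?E * rho w * rho p = ?E * rho p" .
qed

lemma E_absorb_left:
  assumes "2 \<le> m" "p \<in> periodic_perms m" "w0 \<in> periodic_perms m" "w \<in> periodic_perms m"
    and "p \<circ> w0 = w \<circ> p" "rho w0 * e0 = e0"
  shows "rho w * E (p (int m - 1)) (p (int m)) = E (p (int m - 1)) (p (int m))" (is "_ * ?E = _")
proof (rule rho_cancel_right[OF assms(2)])
  have "rho w * ?E * rho p = rho w * rho p * e0"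
    unfolding mult.assoc rho_e0[OF assms(1,2)] ..
  also have "\<dots> = rho p * (rho w0 * e0)"
    using rho_comp[OF assms(4,2)] rho_comp[OF assms(2,3)] assms(5) by (simp add: mult.assoc)
  also have "\<dots> = ?E * rho p" unfolding assms(6) rho_e0[OF assms(1,2)] ..
  finally show "rho w * ?E * rho p = ?E * rho p" .
qed

lemma E_swap:
  assumes ac: "apart a c"
  shows "E a c * rho (sw a c) = E a c" "rho (sw a c) * E a c = E a c" "E c a = E a c"
proof -
  have abs: "E a c * rho (sw a c) = E a c \<and> rho (sw a c) * E a c = E a c" if ac: "apart a c" for a c
  proof -
    note f = frame[OF ac] and m = pair_frame(1)[OF m_pos ac]
    have i: "m - 1 \<in> {1..<m}" "int (m - 1) = int m - 1" using m by auto
    have s: "rho (sw (int m - 1) (int m)) = s (m - 1)" using rho_s[OF i(1)] unfolding i(2) by simp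
    have c: "frame a c \<circ> sw (int m - 1) (int m) = sw a c \<circ> frame a c" using exch_conj[OF f(1)] f by simp
    show ?thesis
      using E_absorb_right[OF m f(1) exch_periodic exch_periodic c] E_absorb_left[OF m f(1) exch_periodic exch_periodic c]
        se[OF i(1)] es[OF i(1)] unfolding s f by simp
  qed
  show 1: "E a c * rho (sw a c) = E a c" "rho (sw a c) * E a c = E a c" using abs[OF ac] by auto
  have "E c a * rho (sw a c) = rho (sw a c) * E a c"
    using rho_E[OF exch_periodic ac, of a c] ac by simp
  moreover have "E c a * rho (sw a c) = E c a" using abs[of c a] ac exch_commute[of a m c] by simp
  ultimately show "E c a = E a c" using 1 by simp
qed

definition shift2 :: "int \<Rightarrow> int \<Rightarrow> int \<Rightarrow> int \<Rightarrow> int" where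
  "shift2 a c k = sw a (a + k * int m) \<circ> sw c (c + k * int m)"

lemma shift2_periodic [simp]: "shift2 a c k \<in> periodic_perms m"
  by (simp add: shift2_def)

lemma shift2_apply:
  assumes "apart a c"
  shows "shift2 a c k j = (if j mod int m = a mod int m \<or> j mod int m = c mod int m then j + k * int m else j)"
  using assms by (auto simp: shift2_def exch_shift)

text \<open>
  The relation \<open>e\<^sub>i t\<^sub>i t\<^sub>i\<^sub>+\<^sub>1 = e\<^sub>i\<close> and its
  mirror image, conjugated: translating both strands of a cup-cap has no effect. Invertibility
  of the translation extends this to negative \<open>k\<close>.
\<close>

lemma E_shift:
  assumes ac: "apart a c"
  shows "E a c * rho (shift2 a c k) = E a c" "E (a + k * int m) (c + k * int m) = E a c"
proof -
  have one: "E a c * rho (shift2 a c 1) = E a c \<and> rho (shift2 a c 1) * E a c = E a c" if ac: "apart a c" for a c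
  proof -
    note f = frame[OF ac] and m = pair_frame(1)[OF m_pos ac]
    have i: "m - 1 \<in> {1..<m}" "m - 1 \<in> {1..m}" "m \<in> {1..m}" "int (m - 1) = int m - 1" "m - 1 + 1 = m" using m by auto
    have "rho (shift2 (int m - 1) (int m) 1) = t (m - 1) * t m"
      unfolding shift2_def mult_1 rho_comp[OF exch_periodic exch_periodic]
      using rho_lt[OF i(2), of True] rho_lt[OF i(3), of True] unfolding i(4) by (simp only: lt_def if_True)
    then have s: "e0 * rho (shift2 (int m - 1) (int m) 1) = e0" "rho (shift2 (int m - 1) (int m) 1) * e0 = e0"
      using ett[OF i(1)] tte[OF i(1)] unfolding i(5) by (simp_all add: mult.assoc)
    have c: "frame a c \<circ> shift2 (int m - 1) (int m) 1 = shift2 a c 1 \<circ> frame a c"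
      unfolding shift2_def using exch_translation_conj[OF f(1), of "int m - 1"] exch_translation_conj[OF f(1), of "int m"] f
      by (simp add: fun_eq_iff)
    show ?thesis
      using E_absorb_right[OF m f(1) shift2_periodic shift2_periodic c s(1)]
        E_absorb_left[OF m f(1) shift2_periodic shift2_periodic c s(2)] unfolding f by simp
  qed
  have add: "shift2 a c (k + 1) = shift2 a c k \<circ> shift2 a c 1" for k
    by (simp add: fun_eq_iff shift2_apply[OF ac] algebra_simps)
  have z: "shift2 a c 0 = id" by (simp add: fun_eq_iff shift2_apply[OF ac])
  have st: "E a c * rho (shift2 a c (k + 1)) = E a c \<longleftrightarrow> E a c * rho (shift2 a c k) = E a c"
    "rho (shift2 a c (k + 1)) * E a c = E a c \<longleftrightarrow> rho (shift2 a c k) * E a c = E a c" for k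
  proof -
    have r: "rho (shift2 a c (k + 1)) = rho (shift2 a c k) * rho (shift2 a c 1)"
      unfolding add by (rule rho_comp) simp_all
    show "E a c * rho (shift2 a c (k + 1)) = E a c \<longleftrightarrow> E a c * rho (shift2 a c k) = E a c"
    proof
      assume "E a c * rho (shift2 a c (k + 1)) = E a c"
      then have "E a c * rho (shift2 a c k) * rho (shift2 a c 1) = E a c * rho (shift2 a c 1)"
        unfolding r using one[OF ac] by (simp add: mult.assoc)
      then show "E a c * rho (shift2 a c k) = E a c" by (rule rho_cancel_right[OF shift2_periodic])
    next
      assume "E a c * rho (shift2 a c k) = E a c"
      then show "E a c * rho (shift2 a c (k + 1)) = E a c"
        unfolding r using one[OF ac] by (simp add: mult.assoc[symmetric])
    qed
    show "rho (shift2 a c (k + 1)) * E a c = E a c \<longleftrightarrow> rho (shift2 a c k) * E a c = E a c"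
      unfolding r using one[OF ac] by (simp add: mult.assoc)
  qed
  have all: "E a c * rho (shift2 a c k) = E a c \<and> rho (shift2 a c k) * E a c = E a c" for k
  proof (induction k rule: int_induct[of _ 0])
    case base
    then show ?case by (simp add: z)
  next
    case (step1 k)
    then show ?case using st[of k] by simp
  next
    case (step2 k)
    then show ?case using st[of "k - 1"] by simp
  qed
  show "E a c * rho (shift2 a c k) = E a c" using all by blast
  let ?a = "a + k * int m" and ?c = "c + k * int m"
  have "E ?a ?c * rho (shift2 a c k) = rho (shift2 a c k) * E a c"
    using rho_E[OF shift2_periodic ac, of a c k] by (simp add: shift2_apply[OF ac])
  then have 1: "E ?a ?c * rho (shift2 a c k) = E a c" using all by simp
  have ac': "apart ?a ?c" using ac by simp
  have sh: "shift2 ?a ?c 1 = shift2 a c 1" by (simp add: fun_eq_iff shift2_apply[OF ac] shift2_apply[OF ac'])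
  have gen: "E ?a ?c * rho (shift2 ?a ?c j) = E ?a ?c" for j
  proof (induction j rule: int_induct[of _ 0])
    case base
    have "shift2 ?a ?c 0 = id" by (simp add: fun_eq_iff shift2_apply[OF ac'])
    then show ?case by simp
  next
    case (step1 j)
    have "shift2 ?a ?c (j + 1) = shift2 ?a ?c j \<circ> shift2 ?a ?c 1"
      by (simp add: fun_eq_iff shift2_apply[OF ac'] algebra_simps)
    then have "rho (shift2 ?a ?c (j + 1)) = rho (shift2 ?a ?c j) * rho (shift2 ?a ?c 1)"
      using rho_comp[OF shift2_periodic shift2_periodic] by simp
    then show ?case using step1 one[OF ac'] by (simp add: mult.assoc[symmetric])
  next
    case (step2 j)
    have "shift2 ?a ?c j = shift2 ?a ?c (j - 1) \<circ> shift2 ?a ?c 1"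
      by (simp add: fun_eq_iff shift2_apply[OF ac'] algebra_simps)
    then have "rho (shift2 ?a ?c j) = rho (shift2 ?a ?c (j - 1)) * rho (shift2 ?a ?c 1)"
      using rho_comp[OF shift2_periodic shift2_periodic] by simp
    then have "E ?a ?c * rho (shift2 ?a ?c (j - 1)) * rho (shift2 ?a ?c 1) = E ?a ?c * rho (shift2 ?a ?c 1)"
      using step2 one[OF ac'] by (simp add: mult.assoc)
    then show ?case by (rule rho_cancel_right[OF shift2_periodic])
  qed
  have "shift2 ?a ?c k = shift2 a c k" by (simp add: fun_eq_iff shift2_apply[OF ac] shift2_apply[OF ac'])
  then show "E ?a ?c = E a c" using gen[of k] 1 by simp
qed

text \<open>
  The relation \<open>e\<^sub>i t\<^sub>i\<^sup>k e\<^sub>i = \<beta> e\<^sub>i\<close>,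
  conjugated.
\<close>

lemma E_loop:
  assumes ac: "apart a c"
  shows "E a c * rho (sw a (a + k * int m)) * E a c = b * E a c"
proof -
  note f = frame[OF ac] and m = pair_frame(1)[OF m_pos ac]
  have i: "m - 1 \<in> {1..<m}" "m - 1 \<in> {1..m}" "int (m - 1) = int m - 1" using m by auto
  let ?f = "frame a c" and ?w = "sw (int m - 1) (int m - 1 + k * int m)"
  have w: "e0 * rho ?w * e0 = b * e0" using ete[OF i(1), of k] rho_tpow[OF i(2), of k] unfolding i(3) by simp
  have "?f (int m - 1 + k * int m) = a + k * int m" using periodic_add[OF f(1), of "k * int m"] f by simp
  then have c: "?f \<circ> ?w = sw a (a + k * int m) \<circ> ?f" using exch_conj[OF f(1)] f by simp
  have fe: "rho ?f * e0 = E a c * rho ?f" using rho_e0[OF m f(1)] unfolding f .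
  have "rho ?f * (e0 * rho ?w * e0) = (rho ?f * e0) * rho ?w * e0" by (simp only: mult.assoc)
  also have "\<dots> = E a c * (rho ?f * rho ?w) * e0" unfolding fe by (simp only: mult.assoc)
  also have "rho ?f * rho ?w = rho (sw a (a + k * int m)) * rho ?f"
    using rho_comp[OF f(1) exch_periodic] rho_comp[OF exch_periodic f(1)] c by metis
  also have "E a c * (rho (sw a (a + k * int m)) * rho ?f) * e0 =
      E a c * rho (sw a (a + k * int m)) * E a c * rho ?f"
    by (simp only: mult.assoc fe)
  finally have "E a c * rho (sw a (a + k * int m)) * E a c * rho ?f = rho ?f * (b * e0)" unfolding w ..
  also have "\<dots> = b * (rho ?f * e0)" by (simp only: mult.assoc[symmetric] rho_b[OF f(1)])
  also have "\<dots> = b * E a c * rho ?f" unfolding fe by (simp only: mult.assoc)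
  finally show ?thesis by (rule rho_cancel_right[OF f(1)])
qed

lemma triple_frame:
  assumes "apart x a" "apart x c" "apart a c"
  shows "3 \<le> m \<and> (\<exists>p\<in>periodic_perms m. p (int m - 2) = x \<and> p (int m - 1) = a \<and> p (int m) = c)"
proof -
  have m: "3 \<le> m"
  proof (rule ccontr)
    assume "\<not> 3 \<le> m"
    then have "int m \<le> 2" by simp
    moreover have "0 \<le> z mod int m \<and> z mod int m < int m" for z using m_pos by simp
    ultimately have "z mod int m = 0 \<or> z mod int m = 1" for z by (smt (verit))
    then show False using assms by metis
  qed
  obtain p where p: "p \<in> periodic_perms m" "p (int m - 1) = a" "p (int m) = c"
    using pair_frame(2)[OF m_pos assms(3)] by blast
  obtain q where q: "q \<in> periodic_perms m" "q (int m - 2) = x"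
    "\<And>y. apart y (int m - 2) \<and> apart (p y) x \<Longrightarrow> q y = p y"
    using extend_perm[OF p(1)] by blast
  have r: "apart (int m - 1) (int m - 2)" "apart (int m) (int m - 2)"
    using int_apart[of "m - 1" "m - 2"] int_apart[of m "m - 2"] m by (auto simp: of_nat_diff)
  have "q (int m - 1) = a" "q (int m) = c" using q(3) r p assms by metis+
  then show ?thesis using q m by blast
qed

lemma quad_frame:
  assumes "apart y x" "apart y a" "apart y c" "apart x a" "apart x c" "apart a c"
  shows "4 \<le> m \<and> (\<exists>p\<in>periodic_perms m. p (int m - 3) = y \<and> p (int m - 2) = x \<and> p (int m - 1) = a \<and> p (int m) = c)"
proof -
  obtain p where m3: "3 \<le> m" and p: "p \<in> periodic_perms m" "p (int m - 2) = x" "p (int m - 1) = a" "p (int m) = c"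
    using triple_frame[OF assms(4,5,6)] by blast
  have m: "4 \<le> m"
  proof (rule ccontr)
    assume "\<not> 4 \<le> m"
    then have "int m = 3" using m3 by simp
    moreover have "0 \<le> z mod int m \<and> z mod int m < int m" for z using m_pos by simp
    ultimately have "z mod int m = 0 \<or> z mod int m = 1 \<or> z mod int m = 2" for z by (smt (verit))
    then show False using assms by metis
  qed
  obtain q where q: "q \<in> periodic_perms m" "q (int m - 3) = y"
    "\<And>z. apart z (int m - 3) \<and> apart (p z) y \<Longrightarrow> q z = p z"
    using extend_perm[OF p(1)] by blast
  have r: "apart (int m - 1) (int m - 3)" "apart (int m) (int m - 3)" "apart (int m - 2) (int m - 3)"
    using int_apart[of "m - 1" "m - 3"] int_apart[of m "m - 3"] int_apart[of "m - 2" "m - 3"] m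
    by (auto simp: of_nat_diff)
  have "q (int m - 2) = x" "q (int m - 1) = a" "q (int m) = c" using q(3) r p assms by metis+
  then show ?thesis using q m by blast
qed

lemma E_commute:
  assumes "apart y x" "apart y a" "apart y c" "apart x a" "apart x c" "apart a c"
  shows "E y x * E a c = E a c * E y x"
proof -
  obtain p where m: "4 \<le> m" and p: "p \<in> periodic_perms m" "p (int m - 3) = y" "p (int m - 2) = x"
    "p (int m - 1) = a" "p (int m) = c"
    using quad_frame[OF assms] by blast
  have r: "apart (int m - 3) (int m - 2)" "apart (int m - 1) (int m)"
    using periodic_mod[OF p(1)] assms p by metis+
  have i: "m - 3 \<in> {1..<m}" "m - 1 \<in> {1..<m}" "int (m - 3) = int m - 3" "int m - 3 + 1 = int m - 2" using m by auto
  have g: "E (int m - 3) (int m - 2) = e (m - 3)" using E_gen[OF i(1)] unfolding i(3,4) .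
  have l: "E (int m - 1) (int m) = e0" using E_last m by simp
  have "E (int m - 3) (int m - 2) * E (int m - 1) (int m) = E (int m - 1) (int m) * E (int m - 3) (int m - 2)"
    unfolding g l using i m by (intro ee_far) auto
  from arg_cong[OF this, of "\<lambda>z. rho p * z"]
  have "E y x * E a c * rho p = E a c * E y x * rho p"
    unfolding rho_E_assoc[OF p(1) r(1)] rho_E_assoc[OF p(1) r(2)] rho_E[OF p(1) r(1)] rho_E[OF p(1) r(2)] p
    by (simp add: mult.assoc)
  then show ?thesis by (rule rho_cancel_right[OF p(1)])
qed

text \<open>
  On the last three strands this is the relation \<open>e\<^sub>i e\<^sub>i\<^sub>-\<^sub>1 =
  e\<^sub>i s\<^sub>i\<^sub>-\<^sub>1 s\<^sub>i\<close>, and any three strands can be moved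
  there.
\<close>

lemma E_adjacent:
  assumes "apart x a" "apart x c" "apart a c"
  shows "E a c * E a x = E a c * rho (sw c x)"
proof -
  obtain p where m: "3 \<le> m" and p: "p \<in> periodic_perms m" "p (int m - 2) = x"
    "p (int m - 1) = a" "p (int m) = c"
    using triple_frame[OF assms] by blast
  let ?x = "int m - 2" and ?a = "int m - 1" and ?c = "int m"
  have r: "apart ?x ?a" "apart ?x ?c" "apart ?a ?c"
    using periodic_mod[OF p(1)] assms p by metis+
  have i: "m - 2 \<in> {1..<m}" "m - 1 \<in> {1..<m}" "int (m - 2) = ?x" "int (m - 1) = ?a" "?x + 1 = ?a" "?a + 1 = ?c"
    using m by auto
  have g: "E ?x ?a = e (m - 2)" using E_gen[OF i(1)] unfolding i .
  have l: "E ?a ?c = e0" using E_last m by simp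
  have s1: "rho (sw ?x ?a) = s (m - 2)" using rho_s[OF i(1)] unfolding i .
  have s2: "rho (sw ?a ?c) = s (m - 1)" using rho_s[OF i(2)] unfolding i .
  have "sw ?a ?c \<circ> sw ?x ?a = sw ?x ?c \<circ> sw ?a ?c"
    using exch_conj[OF exch_periodic, of m ?a ?c ?x ?a] r by simp
  then have "sw ?a ?c \<circ> sw ?x ?a \<circ> sw ?a ?c = sw ?x ?c \<circ> (sw ?a ?c \<circ> sw ?a ?c)" by (simp add: comp_assoc)
  also have "sw ?a ?c \<circ> sw ?a ?c = id"
    using exch_inverse[of m ?a ?c] exch_commute[OF r(3)] by (simp add: fun_eq_iff)
  finally have "sw ?c ?x = sw ?a ?c \<circ> sw ?x ?a \<circ> sw ?a ?c"
    unfolding exch_commute[OF r(2)] comp_id ..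
  then have cx: "rho (sw ?c ?x) = s (m - 1) * s (m - 2) * s (m - 1)"
    using rho_comp[OF comp_periodic[OF exch_periodic exch_periodic] exch_periodic]
      rho_comp[OF exch_periodic exch_periodic] s1 s2 by simp
  have "E ?a ?c * E ?a ?x = e0 * e (m - 2)" using E_swap(3)[OF r(1)] g l by simp
  also have "\<dots> = e0 * s (m - 2) * s (m - 1)" using i m by (intro ess[symmetric]) auto
  also have "\<dots> = E ?a ?c * rho (sw ?c ?x)" unfolding cx l using es[OF i(2)] by (simp add: mult.assoc[symmetric])
  finally have base: "E ?a ?c * E ?a ?x = E ?a ?c * rho (sw ?c ?x)" .
  have r': "apart ?a ?x" using r by simp
  have "rho p * (E ?a ?c * rho (sw ?c ?x)) = E a c * (rho p * rho (sw ?c ?x))"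
    unfolding rho_E_assoc[OF p(1) r(3)] p ..
  also have "rho p * rho (sw ?c ?x) = rho (sw c x) * rho p"
    using exch_conj[OF p(1), of ?c ?x] rho_comp[OF p(1) exch_periodic] rho_comp[OF exch_periodic p(1)] p by metis
  finally have 2: "rho p * (E ?a ?c * rho (sw ?c ?x)) = E a c * rho (sw c x) * rho p" by (simp add: mult.assoc)
  have 1: "rho p * (E ?a ?c * E ?a ?x) = E a c * E a x * rho p"
    unfolding rho_E_assoc[OF p(1) r(3)] rho_E[OF p(1) r'] p by (simp add: mult.assoc)
  have "E a c * E a x * rho p = E a c * rho (sw c x) * rho p" using 1 2 base by simp
  then show ?thesis by (rule rho_cancel_right[OF p(1)])
qed

text \<open>
  In \<open>E a c * E y x * E y c\<close> the last factor shares a strand with each of the other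
  two. By \<open>E_adjacent\<close> it can be replaced by the transposition of \<open>c\<close>
  and \<open>x\<close>, and, after commuting the first two factors, by that of \<open>a\<close>
  and \<open>y\<close>. The two transpositions thus have the same effect, and their product has
  none.
\<close>

lemma E_pair_swap:
  assumes ap: "apart y x" "apart y a" "apart y c" "apart x a" "apart x c" "apart a c"
  shows "E a c * E y x * rho (sw a y \<circ> sw c x) = E a c * E y x"
proof -
  have ap': "apart x y" "apart a y" "apart c y" "apart a x" "apart c x" "apart c a" using ap by auto
  have "E a c * (E y x * E y c) = E a c * E y x * rho (sw x c)"
    using E_adjacent[of c y x] ap ap' by (simp add: mult.assoc)
  moreover have "E a c * (E y x * E y c) = E y x * (E c a * E c y)"
    unfolding E_swap(3)[OF ap(6)] E_swap(3)[OF ap(3)] mult.assoc[symmetric] E_commute[OF ap] ..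
  moreover have "E y x * (E c a * E c y) = E a c * E y x * rho (sw a y)"
  proof -
    have "E c a * E c y = E a c * rho (sw a y)"
      using E_adjacent[of y c a] E_swap(3)[OF ap(6)] ap ap' by simp
    then show ?thesis by (simp only: mult.assoc[symmetric] E_commute[OF ap])
  qed
  ultimately have 1: "E a c * E y x * rho (sw a y) = E a c * E y x * rho (sw c x)"
    using exch_commute[OF ap(5)] by simp
  have "sw c x \<circ> sw c x = id" using exch_inverse[of m c x] exch_commute[OF ap'(5)] by (simp add: fun_eq_iff)
  then have 2: "rho (sw c x) * rho (sw c x) = 1" using rho_comp[of "sw c x" "sw c x"] by simp
  have "E a c * E y x * rho (sw a y \<circ> sw c x) = E a c * E y x * rho (sw a y) * rho (sw c x)"
    using rho_comp[of "sw a y" "sw c x"] by (simp add: mult.assoc)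
  also have "\<dots> = E a c * E y x * (rho (sw c x) * rho (sw c x))" unfolding 1 by (simp add: mult.assoc)
  finally show ?thesis unfolding 2 by simp
qed

end

section \<open>Rearranging arcs\<close>

lemma arcs_apart:
  assumes D: "D \<in> affine_diagrams m" and pu: "{p, u} \<in> D" and qw: "{q, w} \<in> D"
    and "cls m p \<noteq> cls m q" "cls m p \<noteq> cls m w"
  shows "cls m u \<noteq> cls m w" "cls m u \<noteq> cls m q" "cls m p \<noteq> cls m u" "cls m q \<noteq> cls m w"
proof -
  have wq: "{w, q} \<in> D" using qw by (simp add: insert_commute)
  show "cls m u \<noteq> cls m w" "cls m u \<noteq> cls m q"
    using arc_cls_iff[OF D qw pu] arc_cls_iff[OF D wq pu] assms(4,5) by simp_all
  show "cls m p \<noteq> cls m u" "cls m q \<noteq> cls m w" using arc_cls_neq[OF D] pu qw by blast+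
qed

lemma act_swap_ends:
  assumes D: "D \<in> affine_diagrams m" and pq: "{p, q} \<in> D"
  shows "act (vexch m p q) D = D"
proof (rule act_stabilizes[OF D, of _ "{(p, q)}"])
  have h: "snd p \<in> {0, 1}" "snd q \<in> {0, 1}" using arc_height[OF D pq] by blast+
  then show "vexch m p q \<in> vertex_perms m" by simp
  show "{u, v} \<in> D \<and> {vexch m p q u, vexch m p q v} \<in> D" if "(u, v) \<in> {(p, q)}" for u v
    using that pq arc_cls_neq[OF D pq] by (simp add: insert_commute)
qed simp

lemma act_shift_arc:
  assumes D: "D \<in> affine_diagrams m" and pq: "{p, q} \<in> D" and d: "int m dvd d"
  shows "act (vexch m p (translate d p) \<circ> vexch m q (translate d q)) D = D"
proof (rule act_stabilizes[OF D, of _ "{(p, q)}"])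
  have h: "snd p \<in> {0, 1}" "snd q \<in> {0, 1}" using arc_height[OF D pq] by blast+
  then show "vexch m p (translate d p) \<circ> vexch m q (translate d q) \<in> vertex_perms m"
    by (intro comp_perm vexch_perm) (simp_all only: translate_simps)
  have n: "cls m p \<noteq> cls m q" using arc_cls_neq[OF D pq] .
  have "(vexch m p (translate d p) \<circ> vexch m q (translate d q)) p = translate d p"
    "(vexch m p (translate d p) \<circ> vexch m q (translate d q)) q = translate d q"
    using n d by simp_all
  then show "{u, v} \<in> D \<and> {(vexch m p (translate d p) \<circ> vexch m q (translate d q)) u,
      (vexch m p (translate d p) \<circ> vexch m q (translate d q)) v} \<in> D" if "(u, v) \<in> {(p, q)}" for u v
    using that pq arc_translate[OF D d pq] by (simp only: singleton_iff prod.inject)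
  show "(vexch m p (translate d p) \<circ> vexch m q (translate d q)) w = w"
    if "\<And>u v. (u, v) \<in> {(p, q)} \<Longrightarrow> cls m w \<noteq> cls m u \<and> cls m w \<noteq> cls m v" for w
    using that d by simp
qed

lemma act_swap_arcs:
  assumes D: "D \<in> affine_diagrams m" and pq: "{p, q} \<in> D" and pq': "{p', q'} \<in> D"
    and n: "cls m p \<noteq> cls m p'" "cls m p \<noteq> cls m q'"
  shows "act (vexch m p p' \<circ> vexch m q q') D = D"
proof (rule act_stabilizes[OF D, of _ "{(p, q), (p', q')}"])
  note a = arcs_apart[OF D pq pq' n]
  have h: "snd p \<in> {0, 1}" "snd q \<in> {0, 1}" "snd p' \<in> {0, 1}" "snd q' \<in> {0, 1}"
    using arc_height[OF D pq] arc_height[OF D pq'] by blast+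
  then show "vexch m p p' \<circ> vexch m q q' \<in> vertex_perms m" by (intro comp_perm vexch_perm)
  have "(vexch m p p' \<circ> vexch m q q') p = p'" "(vexch m p p' \<circ> vexch m q q') q = q'"
    "(vexch m p p' \<circ> vexch m q q') p' = p" "(vexch m p p' \<circ> vexch m q q') q' = q"
    using a n a[symmetric] n[symmetric] by simp_all
  then show "{u, v} \<in> D \<and> {(vexch m p p' \<circ> vexch m q q') u, (vexch m p p' \<circ> vexch m q q') v} \<in> D"
    if "(u, v) \<in> {(p, q), (p', q')}" for u v
    using that pq pq' by auto
  show "(vexch m p p' \<circ> vexch m q q') w = w"
    if "\<And>u v. (u, v) \<in> {(p, q), (p', q')} \<Longrightarrow> cls m w \<noteq> cls m u \<and> cls m w \<noteq> cls m v" for w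
    using that[of p q] that[of p' q'] by simp
qed

text \<open>
  The two exchanges differ by a permutation that maps each of the two arcs to the other one. Thus
  joining two arcs at one end of each does not depend on which of the two ends is moved.
\<close>

lemma act_join_sym:
  assumes D: "D \<in> affine_diagrams m" and pu: "{p, u} \<in> D" and qw: "{q, w} \<in> D"
    and n: "cls m p \<noteq> cls m q" "cls m p \<noteq> cls m w"
  shows "act (vexch m u q) D = act (vexch m w p) D"
proof -
  note a = arcs_apart[OF D pu qw n]
  have h: "snd p \<in> {0, 1}" "snd q \<in> {0, 1}" "snd u \<in> {0, 1}" "snd w \<in> {0, 1}"
    using arc_height[OF D pu] arc_height[OF D qw] by blast+
  let ?\<sigma> = "vexch m w p \<circ> vexch m u q"
  have "act ?\<sigma> D = D"
  proof (rule act_stabilizes[OF D, of _ "{(p, u), (q, w)}"])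
    show "?\<sigma> \<in> vertex_perms m" using h by (intro comp_perm vexch_perm)
    have "?\<sigma> p = w" "?\<sigma> u = q" "?\<sigma> q = u" "?\<sigma> w = p"
      using a n a[symmetric] n[symmetric] by simp_all
    then show "{x, y} \<in> D \<and> {?\<sigma> x, ?\<sigma> y} \<in> D" if "(x, y) \<in> {(p, u), (q, w)}" for x y
      using that pu qw by (auto simp: insert_commute)
    show "?\<sigma> x = x"
      if "\<And>u' v'. (u', v') \<in> {(p, u), (q, w)} \<Longrightarrow> cls m x \<noteq> cls m u' \<and> cls m x \<noteq> cls m v'" for x
      using that[of p u] that[of q w] by simp
  qed
  then have "act (vexch m p w) (act (vexch m w p) (act (vexch m u q) D)) = act (vexch m p w) D"
    by (simp only: act_act comp_assoc)
  then have "act (vexch m u q) D = act (vexch m p w) D" unfolding act_vexch_inverse .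
  then show ?thesis by (simp only: vexch_commute[OF n(2)])
qed

lemma act_vexch_commute:
  assumes "snd u \<in> {0, 1}" "snd w \<in> {0, 1}"
    and "cls m u' \<noteq> cls m u" "cls m u' \<noteq> cls m w" "cls m w' \<noteq> cls m u" "cls m w' \<noteq> cls m w"
  shows "act (vexch m u w) (act (vexch m u' w') D) = act (vexch m u' w') (act (vexch m u w) D)"
  using act_vexch[OF vexch_perm[OF assms(1,2)], of m u' w' D] assms(3-) by simp

lemma cls_height_neq [simp]: "h \<noteq> h' \<Longrightarrow> cls m (a, h) \<noteq> cls m (x, h')"
  by (simp add: cls_def)

lemma cls_same_height [simp]: "cls m (a, h) = cls m (c, h) \<longleftrightarrow> a mod int m = c mod int m"
  by (simp add: cls_def)

lemma through_map:
  assumes D: "D \<in> affine_diagrams m" and h: "h \<in> {0, 1}" "h' \<in> {0, 1}" "h \<noteq> h'"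
    and no: "\<And>x y. {(x, h), (y, h)} \<notin> D" and m: "m \<ge> 1"
  shows "\<exists>p\<in>periodic_perms m. \<forall>x. {(x, h), (p x, h')} \<in> D"
proof -
  have "\<exists>y. {(x, h), (y, h')} \<in> D" for x
  proof -
    obtain v where v: "{(x, h), v} \<in> D" using arc_exists[OF D, of "(x, h)"] h by auto
    obtain y k where y: "v = (y, k)" by (cases v)
    have "k \<in> {0, 1}" "k \<noteq> h" using arc_height[OF D v] no[of x y] v y by auto
    then have "k = h'" using h by auto
    then show ?thesis using v y by blast
  qed
  then obtain p where p: "\<And>x. {(x, h), (p x, h')} \<in> D" by metis
  have add: "p (x + d) = p x + d" if "int m dvd d" for x d
  proof -
    have "{(x + d, h), (p x + d, h')} \<in> D" using arc_translate[OF D that p[of x]] by simp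
    from arc_unique[OF D p[of "x + d"] this] show ?thesis by simp
  qed
  have inj: "inj p"
  proof (rule injI)
    fix x y assume "p x = p y"
    then have "{(p x, h'), (x, h)} \<in> D" "{(p x, h'), (y, h)} \<in> D"
      using p[of x] p[of y] by (simp_all add: insert_commute)
    then show "x = y" using arc_unique[OF D] by blast
  qed
  have "surj p" by (rule periodic_inj_surj[OF m add inj])
  then have "p \<in> periodic_perms m" using inj add by (simp add: periodic_perms_def bij_def)
  then show ?thesis using p by blast
qed

text \<open>
  Without arcs at height \<open>h\<close> every vertex there is joined to height
  \<open>h'\<close> by an injective periodic map. Such a map is onto and leaves no vertices for
  arcs at height \<open>h'\<close>.
\<close>

lemma arc_at_other_height:
  assumes D: "D \<in> affine_diagrams m" and h: "h \<in> {0, 1}" "h' \<in> {0, 1}" "h \<noteq> h'"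
    and arc: "{(a, h'), (c, h')} \<in> D" and m: "m \<ge> 1"
  shows "\<exists>x y. {(x, h), (y, h)} \<in> D"
proof (rule ccontr)
  assume "\<not> ?thesis"
  then obtain p where p: "p \<in> periodic_perms m" "\<And>x. {(x, h), (p x, h')} \<in> D"
    using through_map[OF D h _ m] by blast
  have "{(a, h'), (perm_inv p a, h)} \<in> D"
    using p(2)[of "perm_inv p a"] periodic_inv_simps(2)[OF p(1)] by (simp add: insert_commute)
  then show False using arc_unique[OF D arc] h(3) by blast
qed

lemma strand_no_arc:
  assumes "{(a, h), (c, h)} \<in> strand_diagram p"
  shows False
  using assms by (auto simp: strand_diagram_def doubleton_eq_iff)

lemma strand_inj:
  assumes "p \<in> periodic_perms m" "strand_diagram p = strand_diagram q"
  shows "p = q"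
proof
  fix j
  have "{(j, 0), (q j, 1)} \<in> strand_diagram p" unfolding assms(2) by (rule strand_arc)
  then show "p j = q j" using strand_arcD[OF assms(1)] by fastforce
qed

text \<open>
  A diagram that is not a strand diagram has an arc at the top and one at the bottom.
  Reconnecting their ends by two through strands reduces the number of top arcs in a fundamental
  domain, and joining these strands again restores the diagram. A relabelling of the top moves
  the strands to the last two positions.
\<close>

lemma affine_diagram_induct [consumes 2, case_names strand join relabel]:
  assumes m: "m \<ge> 1" and D: "D \<in> affine_diagrams m"
    and strand: "\<And>p. p \<in> periodic_perms m \<Longrightarrow> P (strand_diagram p)"
    and join: "\<And>D x y. D \<in> affine_diagrams m \<Longrightarrow> P D \<Longrightarrow> m \<ge> 2 \<Longrightarrow> {(int m - 1, 1), (x, 0)} \<in> D \<Longrightarrow>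
      {(int m, 1), (y, 0)} \<in> D \<Longrightarrow> P (act (vexch m (x, 0) (int m, 1)) D)"
    and relabel: "\<And>D p. D \<in> affine_diagrams m \<Longrightarrow> P D \<Longrightarrow> p \<in> periodic_perms m \<Longrightarrow> P (act (on_top p) D)"
  shows "P D"
  using D
proof (induction "card {r \<in> {0..<int m}. \<exists>k. {(r, 1), (k, 1)} \<in> D}" arbitrary: D rule: less_induct)
  case less
  note D = \<open>D \<in> affine_diagrams m\<close>
  let ?T = "\<lambda>D. {r \<in> {0..<int m}. \<exists>k. {(r, Suc 0), (k, Suc 0)} \<in> D}"
  show ?case
  proof (cases "\<exists>a c. {(a, 1), (c, 1)} \<in> D")
    case False
    then have no: "{(x, 0), (y, 0)} \<notin> D" for x y
      using arc_at_other_height[OF D _ _ _ _ m, of 1 0] by auto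
    obtain p where p: "p \<in> periodic_perms m" "\<And>x. {(x, 0), (p x, 1)} \<in> D"
      using through_map[OF D _ _ _ no m, of 1] by auto
    have "strand_diagram p = D"
    proof (rule diagram_eqI[OF strand_affine[OF p(1)] D])
      fix u v assume "{u, v} \<in> strand_diagram p"
      then have "\<exists>j. {u, v} = {(j, 0), (p j, 1)}" unfolding strand_diagram_def by simp
      then show "{u, v} \<in> D" using p(2) by metis
    qed
    then show ?thesis using strand[OF p(1)] by simp
  next
    case True
    then obtain a c where ac: "{(a, 1), (c, 1)} \<in> D" by blast
    then obtain x y where xy: "{(x, 0), (y, 0)} \<in> D"
      using arc_at_other_height[OF D _ _ _ ac m, of 0] by auto
    have n: "a mod int m \<noteq> c mod int m" "x mod int m \<noteq> y mod int m"
      using arc_cls_neq[OF D ac] arc_cls_neq[OF D xy] by simp_all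
    let ?\<sigma> = "vexch m (x, 0) (c, 1)"
    have \<sigma>: "?\<sigma> \<in> vertex_perms m" by simp
    define D0 where "D0 = act ?\<sigma> D"
    have D0: "D0 \<in> affine_diagrams m" unfolding D0_def by (rule act_affine[OF D \<sigma>])
    have arcs: "{(a, 1), (x, 0)} \<in> D0" "{(c, 1), (y, 0)} \<in> D0"
      using act_arc[OF D ac, of ?\<sigma>] act_arc[OF D xy, of ?\<sigma>] n n[symmetric] by (simp_all add: D0_def)
    have undo: "act ?\<sigma> D0 = D"
      unfolding D0_def using act_vexch_inverse[of m "(x, 0)" "(c, 1)" D]
      by (subst vexch_commute) simp_all
    have keep: "r mod int m \<noteq> a mod int m \<and> {(r, 1), (k, 1)} \<in> D" if rk: "{(r, 1), (k, 1)} \<in> D0" for r k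
    proof -
      have c: "r mod int m \<noteq> c mod int m" "k mod int m \<noteq> c mod int m" "r mod int m \<noteq> a mod int m"
        using arc_cls_iff[OF D0 arcs(2) rk] arc_cls_iff[OF D0 arcs(2), of "(k, 1)" "(r, 1)"]
          arc_cls_iff[OF D0 arcs(1) rk] rk by (auto simp: insert_commute)
      then show ?thesis using act_arc[OF D0 rk, of ?\<sigma>] unfolding undo by simp
    qed
    have "?T D0 \<subset> ?T D"
    proof
      show "?T D0 \<subseteq> ?T D" using keep by auto
      have "{(a mod int m, 1), (c + (a mod int m - a), 1)} \<in> D"
        using arc_translate[OF D _ ac, of "a mod int m - a"] by (simp add: mod_eq_dvd_iff[symmetric])
      then have "a mod int m \<in> ?T D" using m by auto
      moreover have "a mod int m \<notin> ?T D0" using keep by fastforce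
      ultimately show "?T D0 \<noteq> ?T D" by blast
    qed
    moreover have "finite (?T D)" by (rule finite_subset[of _ "{0..<int m}"]) auto
    ultimately have "card (?T D0) < card (?T D)" by (rule psubset_card_mono[rotated])
    then have P0: "P D0" using less.hyps[of D0] D0 by simp
    obtain p where m2: "2 \<le> m" and p: "p \<in> periodic_perms m" "p (int m - 1) = a" "p (int m) = c"
      using pair_frame[OF m n(1)] by blast
    let ?q = "perm_inv p"
    have q: "?q \<in> periodic_perms m" using p(1) by simp
    have qa: "?q a = int m - 1" "?q c = int m" using periodic_inv_simps(1)[OF p(1)] p by metis+
    have pq: "on_top p \<circ> on_top ?q = id"
      using periodic_inv_simps(2)[OF p(1)] by (simp add: fun_eq_iff on_top_def prod_eq_iff)
    let ?D1 = "act (on_top ?q) D0"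
    have D1: "?D1 \<in> affine_diagrams m" by (rule act_affine[OF D0 on_top_perm[OF q]])
    have arcs1: "{(int m - 1, 1), (x, 0)} \<in> ?D1" "{(int m, 1), (y, 0)} \<in> ?D1"
      using act_arc[OF D0 arcs(1), of "on_top ?q"] act_arc[OF D0 arcs(2), of "on_top ?q"] qa by simp_all
    have P2: "P (act (vexch m (x, 0) (int m, 1)) ?D1)"
      by (rule join[OF D1 relabel[OF D0 P0 q] m2 arcs1])
    have "P (act (on_top p) (act (vexch m (x, 0) (int m, 1)) ?D1))"
      by (rule relabel[OF act_affine[OF D1] P2 p(1)]) simp
    also have "act (on_top p) (act (vexch m (x, 0) (int m, 1)) ?D1) = act ?\<sigma> (act (on_top p) ?D1)"
      using act_vexch[OF on_top_perm[OF p(1)], of "(x, 0)" "(int m, 1)" ?D1] p(3) by simp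
    also have "act (on_top p) ?D1 = D0" unfolding act_act pq by simp
    finally show ?thesis unfolding undo .
  qed
qed

section \<open>Normal forms\<close>

context affine_brauer
begin

text \<open>
  The element that belongs to a diagram is built by joining pairs of through strands, with all
  choices of pairs and of their order left open.
\<close>

inductive normal :: "diagram \<Rightarrow> 'a \<Rightarrow> bool" where
  strand: "p \<in> periodic_perms m \<Longrightarrow> normal (strand_diagram p) (rho p)"
| join: "normal D z \<Longrightarrow> {(a, 1), (x, 0)} \<in> D \<Longrightarrow> {(c, 1), (y, 0)} \<in> D \<Longrightarrow> apart a c \<Longrightarrow>
    normal (act (vexch m (x, 0) (c, 1)) D) (E a c * z)"

lemma normal_affine: "normal D z \<Longrightarrow> D \<in> affine_diagrams m"
  by (induction rule: normal.induct) (simp_all add: act_affine)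

lemma normal_relabel:
  assumes "normal D z" "p \<in> periodic_perms m"
  shows "normal (act (on_top p) D) (rho p * z)"
  using assms(1)
proof induction
  case (strand q)
  then show ?case using normal.strand[of "p \<circ> q"] assms(2) by (simp add: act_strand rho_comp)
next
  case (join D z a x c y)
  note D = normal_affine[OF join(1)]
  have "{(p a, 1), (x, 0)} \<in> act (on_top p) D" "{(p c, 1), (y, 0)} \<in> act (on_top p) D"
    using act_arc[OF D join(2), of "on_top p"] act_arc[OF D join(3), of "on_top p"] by simp_all
  then have "normal (act (vexch m (x, 0) (p c, 1)) (act (on_top p) D)) (E (p a) (p c) * (rho p * z))"
    using join periodic_mod[OF assms(2)] by (intro normal.join) simp_all
  then show ?case
    using act_vexch[OF on_top_perm[OF assms(2)], of "(x, 0)" "(c, 1)" D] rho_E_assoc[OF assms(2) join(4)]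
    by simp
qed

lemma join_commute:
  assumes "apart x' x" "apart c' c"
  shows "act (vexch m (x, 0) (c, 1)) (act (vexch m (x', 0) (c', 1)) D) =
    act (vexch m (x', 0) (c', 1)) (act (vexch m (x, 0) (c, 1)) D)"
  by (rule act_vexch_commute) (simp_all add: assms)

text \<open>
  The normal form of \<open>D\<close> can be split so that the first factor accounts for the top
  arc at \<open>a\<close>, \<open>c\<close> and the bottom arc at \<open>x\<close>,
  \<open>y\<close>.
\<close>

definition joined :: "int \<Rightarrow> int \<Rightarrow> int \<Rightarrow> int \<Rightarrow> diagram \<Rightarrow> 'a \<Rightarrow> bool" where
  "joined a c x y D z \<longleftrightarrow> apart a c \<and> (\<exists>D0 z0. normal D0 z0 \<and> {(a, 1), (x, 0)} \<in> D0 \<and>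
     {(c, 1), (y, 0)} \<in> D0 \<and> D = act (vexch m (x, 0) (c, 1)) D0 \<and> z = E a c * z0)"

lemma joinedI:
  "apart a c \<Longrightarrow> normal D0 z0 \<Longrightarrow> {(a, 1), (x, 0)} \<in> D0 \<Longrightarrow> {(c, 1), (y, 0)} \<in> D0 \<Longrightarrow>
    D = act (vexch m (x, 0) (c, 1)) D0 \<Longrightarrow> z = E a c * z0 \<Longrightarrow> joined a c x y D z"
  unfolding joined_def by blast

lemma joinedE:
  assumes "joined a c x y D z"
  obtains D0 z0 where "apart a c" "normal D0 z0" "{(a, 1), (x, 0)} \<in> D0" "{(c, 1), (y, 0)} \<in> D0"
    "D = act (vexch m (x, 0) (c, 1)) D0" "z = E a c * z0" "D0 \<in> affine_diagrams m" "apart x y"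
proof -
  from assms obtain D0 z0 where *: "apart a c" "normal D0 z0" "{(a, 1), (x, 0)} \<in> D0" "{(c, 1), (y, 0)} \<in> D0"
    "D = act (vexch m (x, 0) (c, 1)) D0" "z = E a c * z0" unfolding joined_def by blast
  have D0: "D0 \<in> affine_diagrams m" by (rule normal_affine[OF *(2)])
  have "apart x y" using arc_cls_iff[OF D0 *(3,4)] *(1) by auto
  then show ?thesis using that * D0 by blast
qed

lemma join_arcs:
  assumes D: "D \<in> affine_diagrams m" and "{(a, 1), (x, 0)} \<in> D" "{(c, 1), (y, 0)} \<in> D" "apart a c"
  shows "{(a, 1), (c, 1)} \<in> act (vexch m (x, 0) (c, 1)) D"
    and "{(x, 0), (y, 0)} \<in> act (vexch m (x, 0) (c, 1)) D"
proof -
  let ?\<sigma> = "vexch m (x, 0) (c, 1)"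
  have "y mod int m \<noteq> x mod int m" using arc_cls_iff[OF D assms(2,3)] assms(4) by auto
  then have "?\<sigma> (a, 1) = (a, 1)" "?\<sigma> (x, 0) = (c, 1)" "?\<sigma> (c, 1) = (x, 0)" "?\<sigma> (y, 0) = (y, 0)"
    using assms(4) by simp_all
  then show "{(a, 1), (c, 1)} \<in> act ?\<sigma> D" "{(x, 0), (y, 0)} \<in> act ?\<sigma> D"
    using act_arc[OF D assms(2), of ?\<sigma>] act_arc[OF D assms(3), of ?\<sigma>] by simp_all
qed

lemma act_join_involution: "act (vexch m (x, 0) (c, 1)) (act (vexch m (x, 0) (c, 1)) D) = D"
  using act_vexch_inverse[of m "(x, 0)" "(c, 1)" D] by (subst vexch_commute) simp_all

lemma join_keeps:
  assumes D: "D \<in> affine_diagrams m" and "{p, q} \<in> act (vexch m (x, 0) (c, 1)) D"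
    and "cls m p \<noteq> cls m (x, 0)" "cls m p \<noteq> cls m (c, 1)" "cls m q \<noteq> cls m (x, 0)" "cls m q \<noteq> cls m (c, 1)"
  shows "{p, q} \<in> D"
proof -
  have "act (vexch m (x, 0) (c, 1)) D \<in> affine_diagrams m" by (intro act_affine D vexch_perm) simp_all
  from act_arc[OF this assms(2), of "vexch m (x, 0) (c, 1)"] show ?thesis
    using assms(3-) unfolding act_join_involution by simp
qed

lemma join_keeps':
  assumes D: "D \<in> affine_diagrams m" and "{p, q} \<in> D"
    and "cls m p \<noteq> cls m (x, 0)" "cls m p \<noteq> cls m (c, 1)" "cls m q \<noteq> cls m (x, 0)" "cls m q \<noteq> cls m (c, 1)"
  shows "{p, q} \<in> act (vexch m (x, 0) (c, 1)) D"
  using act_arc[OF D assms(2), of "vexch m (x, 0) (c, 1)"] assms(3-) by simp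

lemma joined_flip_top:
  assumes "joined a c x y D z"
  shows "joined c a y x D z"
proof -
  obtain D0 z0 where J: "apart a c" "normal D0 z0" "{(a, 1), (x, 0)} \<in> D0" "{(c, 1), (y, 0)} \<in> D0"
    "D = act (vexch m (x, 0) (c, 1)) D0" "z = E a c * z0" "D0 \<in> affine_diagrams m" "apart x y"
    using assms by (rule joinedE)
  have "D = act (vexch m (y, 0) (a, 1)) D0"
    unfolding J(5) using act_join_sym[OF J(7,3,4)] J(1) by simp
  then show ?thesis using J E_swap(3)[OF J(1)] by (intro joinedI[of _ _ D0 z0]) auto
qed

text \<open>
  Before the strands are joined, their bottom ends may be interchanged by interchanging the top
  ends instead, and the cup-cap absorbs that transposition.
\<close>

lemma joined_flip_bottom:
  assumes "joined a c x y D z"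
  shows "joined a c y x D z"
proof -
  obtain D0 z0 where J: "apart a c" "normal D0 z0" "{(a, 1), (x, 0)} \<in> D0" "{(c, 1), (y, 0)} \<in> D0"
    "D = act (vexch m (x, 0) (c, 1)) D0" "z = E a c * z0" "D0 \<in> affine_diagrams m" "apart x y"
    using assms by (rule joinedE)
  let ?\<sigma> = "vexch m (a, 1) (c, 1)"
  have st: "on_top (sw a c) = ?\<sigma>" by (rule on_top_exch)
  have n: "normal (act ?\<sigma> D0) (rho (sw a c) * z0)"
    using normal_relabel[OF J(2) exch_periodic, of a c] unfolding st .
  have \<sigma>: "?\<sigma> (a, 1) = (c, 1)" "?\<sigma> (c, 1) = (a, 1)" "\<And>w. ?\<sigma> (w, 0) = (w, 0)"
    using J(1) by simp_all
  have arcs: "{(a, 1), (y, 0)} \<in> act ?\<sigma> D0" "{(c, 1), (x, 0)} \<in> act ?\<sigma> D0"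
    using act_arc[OF J(7) J(4), of ?\<sigma>] act_arc[OF J(7) J(3), of ?\<sigma>] unfolding \<sigma> by simp_all
  have D: "D \<in> affine_diagrams m" unfolding J(5) by (intro act_affine J(7) vexch_perm) simp_all
  have ac: "{(a, 1), (c, 1)} \<in> D" unfolding J(5) by (rule join_arcs(1)[OF J(7,3,4,1)])
  have D': "D = act (vexch m (y, 0) (a, 1)) D0"
    unfolding J(5) using act_join_sym[OF J(7,3,4)] J(1) by simp
  have "D = act ?\<sigma> D" using act_swap_ends[OF D ac] by simp
  also have "act ?\<sigma> D = act ?\<sigma> (act (vexch m (y, 0) (a, 1)) D0)" by (rule arg_cong[OF D'])
  also have "act ?\<sigma> (act (vexch m (y, 0) (a, 1)) D0) = act (vexch m (y, 0) (c, 1)) (act ?\<sigma> D0)"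
    using act_vexch[of ?\<sigma> m "(y, 0)" "(a, 1)" D0] unfolding \<sigma> by simp
  finally have "D = act (vexch m (y, 0) (c, 1)) (act ?\<sigma> D0)" .
  moreover have "z = E a c * (rho (sw a c) * z0)"
    using E_swap(1)[OF J(1)] J(6) by (simp add: mult.assoc[symmetric])
  ultimately show ?thesis by (intro joinedI[OF J(1) n arcs])
qed

lemma joined_shift_top:
  assumes "joined a c x y D z"
  shows "joined (a + k * int m) (c + k * int m) (x + k * int m) (y + k * int m) D z"
proof -
  obtain D0 z0 where J: "apart a c" "normal D0 z0" "{(a, 1), (x, 0)} \<in> D0" "{(c, 1), (y, 0)} \<in> D0"
    "D = act (vexch m (x, 0) (c, 1)) D0" "z = E a c * z0" "D0 \<in> affine_diagrams m" "apart x y"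
    using assms by (rule joinedE)
  have d: "int m dvd k * int m" by simp
  have "{(a + k * int m, 1), (x + k * int m, 0)} \<in> D0" "{(c + k * int m, 1), (y + k * int m, 0)} \<in> D0"
    using arc_translate[OF J(7) d J(3)] arc_translate[OF J(7) d J(4)] by simp_all
  moreover have "vexch m (x + k * int m, 0) (c + k * int m, 1) = vexch m (x, 0) (c, 1)"
    using vexch_translate[OF d, of "(x, 0)" "(c, 1)"] by simp
  ultimately show ?thesis using J E_shift(2)[OF J(1), of k] by (intro joinedI[of _ _ D0 z0]) simp_all
qed

text \<open>
  Translating the bottom arc alone amounts to translating the top ends of the two strands back
  before they are joined, and the cup-cap absorbs this.
\<close>

lemma joined_shift_bottom:
  assumes "joined a c x y D z"
  shows "joined a c (x + k * int m) (y + k * int m) D z"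
proof -
  obtain D0 z0 where J: "apart a c" "normal D0 z0" "{(a, 1), (x, 0)} \<in> D0" "{(c, 1), (y, 0)} \<in> D0"
    "D = act (vexch m (x, 0) (c, 1)) D0" "z = E a c * z0" "D0 \<in> affine_diagrams m" "apart x y"
    using assms by (rule joinedE)
  let ?d = "k * int m"
  let ?\<tau> = "on_top (shift2 a c (- k))"
  have d: "int m dvd ?d" "int m dvd - ?d" by simp_all
  have n: "normal (act ?\<tau> D0) (rho (shift2 a c (- k)) * z0)" by (rule normal_relabel[OF J(2)]) simp
  have \<tau>: "?\<tau> (a, 1) = (a - ?d, 1)" "?\<tau> (c, 1) = (c - ?d, 1)" "\<And>w. ?\<tau> (w, 0) = (w, 0)"
    using J(1) by (simp_all add: shift2_apply)
  have "{(a - ?d, 1), (x, 0)} \<in> act ?\<tau> D0" "{(c - ?d, 1), (y, 0)} \<in> act ?\<tau> D0"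
    using act_arc[OF J(7) J(3), of ?\<tau>] act_arc[OF J(7) J(4), of ?\<tau>] unfolding \<tau> by simp_all
  then have arcs: "{(a, 1), (x + ?d, 0)} \<in> act ?\<tau> D0" "{(c, 1), (y + ?d, 0)} \<in> act ?\<tau> D0"
    using arc_translate[OF normal_affine[OF n] d(1), of "(a - ?d, 1)" "(x, 0)"]
      arc_translate[OF normal_affine[OF n] d(1), of "(c - ?d, 1)" "(y, 0)"] by simp_all
  have D: "D \<in> affine_diagrams m" unfolding J(5) by (intro act_affine J(7) vexch_perm) simp_all
  have ac: "{(a, 1), (c, 1)} \<in> D" unfolding J(5) by (rule join_arcs(1)[OF J(7,3,4,1)])
  have "?\<tau> = vexch m (a, 1) (translate (- ?d) (a, 1)) \<circ> vexch m (c, 1) (translate (- ?d) (c, 1))"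
    unfolding shift2_def on_top_comp[symmetric] on_top_exch by simp
  then have "D = act ?\<tau> D" using act_shift_arc[OF D ac d(2)] by simp
  also have "\<dots> = act (vexch m (x, 0) (c - ?d, 1)) (act ?\<tau> D0)"
    unfolding J(5) using act_vexch[of ?\<tau> m "(x, 0)" "(c, 1)" D0] unfolding \<tau> by simp
  also have "vexch m (x, 0) (c - ?d, 1) = vexch m (x + ?d, 0) (c, 1)"
    using vexch_translate[OF d(1), of "(x, 0)" "(c - ?d, 1)"] by simp
  finally have "D = act (vexch m (x + ?d, 0) (c, 1)) (act ?\<tau> D0)" .
  moreover have "z = E a c * (rho (shift2 a c (- k)) * z0)"
    using E_shift(1)[OF J(1), of "- k"] J(6) by (simp add: mult.assoc[symmetric])
  ultimately show ?thesis by (intro joinedI[OF J(1) n arcs])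
qed

lemma joined_affine:
  assumes "joined a c x y D z"
  shows "D \<in> affine_diagrams m" "{(a, 1), (c, 1)} \<in> D" "{(x, 0), (y, 0)} \<in> D"
proof -
  obtain D0 z0 where J: "apart a c" "normal D0 z0" "{(a, 1), (x, 0)} \<in> D0" "{(c, 1), (y, 0)} \<in> D0"
    "D = act (vexch m (x, 0) (c, 1)) D0" "z = E a c * z0" "D0 \<in> affine_diagrams m" "apart x y"
    using assms by (rule joinedE)
  show "D \<in> affine_diagrams m" unfolding J(5) by (intro act_affine J(7) vexch_perm) simp_all
  show "{(a, 1), (c, 1)} \<in> D" "{(x, 0), (y, 0)} \<in> D" unfolding J(5) using join_arcs[OF J(7,3,4,1)] by blast+
qed

lemma shift_exists:
  assumes "a' mod int m = a mod int m"
  shows "\<exists>k. a' = a + k * int m"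
proof -
  have "int m dvd a' - a" using assms by (simp add: mod_eq_dvd_iff)
  then obtain k where "a' - a = int m * k" by (auto simp: dvd_def)
  then have "a' = a + k * int m" by (simp add: algebra_simps)
  then show ?thesis by blast
qed

text \<open>The same arcs up to translation and orientation give the same factorizations.\<close>

lemma joined_bottom_match:
  assumes J: "joined a c x y D z" and xy: "{(x', 0), (y', 0)} \<in> D"
    and x': "x' mod int m = x mod int m \<or> x' mod int m = y mod int m"
  shows "joined a c x' y' D z"
proof -
  have *: "joined a c x' y' D z" if J: "joined a c x y D z" and x': "x' mod int m = x mod int m" for x y
  proof -
    obtain k where k: "x' = x + k * int m" using shift_exists[OF x'] by blast
    have "(y', 0) = translate (fst (x', 0 :: nat) - fst (x, 0 :: nat)) (y, 0)"
      using x' by (intro arc_same_cls[OF joined_affine(1)[OF J] joined_affine(3)[OF J] xy]) simp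
    then have "y' = y + k * int m" using k by simp
    then show ?thesis using joined_shift_bottom[OF J, of k] k by simp
  qed
  show ?thesis using x' *[OF J] *[OF joined_flip_bottom[OF J]] by blast
qed

lemma joined_match:
  assumes J: "joined a c x y D z" and ac: "{(a', 1), (c', 1)} \<in> D" and xy: "{(x', 0), (y', 0)} \<in> D"
    and a': "a' mod int m = a mod int m \<or> a' mod int m = c mod int m"
    and x': "x' mod int m = x mod int m \<or> x' mod int m = y mod int m"
  shows "joined a' c' x' y' D z"
proof -
  have *: "joined a' c' x' y' D z"
    if J: "joined a c x y D z" and a': "a' mod int m = a mod int m" and x':
      "x' mod int m = x mod int m \<or> x' mod int m = y mod int m" for a c x y
  proof -
    obtain k where k: "a' = a + k * int m" using shift_exists[OF a'] by blast
    have "(c', 1) = translate (fst (a', 1 :: nat) - fst (a, 1 :: nat)) (c, 1)"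
      using a' by (intro arc_same_cls[OF joined_affine(1)[OF J] joined_affine(2)[OF J] ac]) simp
    then have "c' = c + k * int m" using k by simp
    then have "joined a' c' (x + k * int m) (y + k * int m) D z" using joined_shift_top[OF J, of k] k by simp
    then show ?thesis using xy by (rule joined_bottom_match) (use x' in simp)
  qed
  show ?thesis using a' *[OF J _ x'] *[OF joined_flip_top[OF J]] x' by blast
qed

text \<open>
  For two top arcs and two bottom arcs it does not matter which of them come from the same pair
  of strands, because the two cup-caps absorb the permutation that interchanges them.
\<close>

lemma joined_exchange:
  assumes n2: "normal D2 z2"
    and arcs: "{(a, 1), (u, 0)} \<in> D2" "{(c, 1), (v, 0)} \<in> D2" "{(a', 1), (x, 0)} \<in> D2" "{(c', 1), (y, 0)} \<in> D2"
    and ap: "apart a' c'" "apart a' a" "apart a' c" "apart c' a" "apart c' c" "apart a c"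
  shows "joined a c x y (act (vexch m (u, 0) (c, 1)) (act (vexch m (x, 0) (c', 1)) D2)) (E a c * (E a' c' * z2))"
    (is "joined _ _ _ _ ?D ?z")
proof -
  note D2 = normal_affine[OF n2]
  let ?p = "sw a a' \<circ> sw c c'"
  let ?\<tau> = "on_top ?p"
  have p: "?p \<in> periodic_perms m" by simp
  have \<tau>: "?\<tau> (a, 1) = (a', 1)" "?\<tau> (c, 1) = (c', 1)" "?\<tau> (a', 1) = (a, 1)" "?\<tau> (c', 1) = (c, 1)"
    "\<And>w. ?\<tau> (w, 0) = (w, 0)"
  proof -
    have "sw c c' a = a" "sw c c' a' = a'" "sw a a' c = c" "sw a a' c' = c'"
      using ap exch_other by metis+
    moreover have "sw a a' a' = a" "sw c c' c' = c" using ap exch_snd by metis+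
    ultimately show "?\<tau> (a, 1) = (a', 1)" "?\<tau> (c, 1) = (c', 1)" "?\<tau> (a', 1) = (a, 1)"
      "?\<tau> (c', 1) = (c, 1)" "\<And>w. ?\<tau> (w, 0) = (w, 0)"
      by (simp_all only: One_nat_def on_top_simps o_apply exch_self)
  qed
  let ?V = "act ?\<tau> D2"
  have n2': "normal ?V (rho ?p * z2)" by (rule normal_relabel[OF n2 p])
  note D2' = normal_affine[OF n2']
  have arcs': "{(a', 1), (u, 0)} \<in> ?V" "{(c', 1), (v, 0)} \<in> ?V" "{(a, 1), (x, 0)} \<in> ?V" "{(c, 1), (y, 0)} \<in> ?V"
    using act_arc[OF D2 arcs(1), of ?\<tau>] act_arc[OF D2 arcs(2), of ?\<tau>] act_arc[OF D2 arcs(3), of ?\<tau>]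
      act_arc[OF D2 arcs(4), of ?\<tau>] unfolding \<tau> by simp_all
  have xu: "x mod int m \<noteq> u mod int m" "y mod int m \<noteq> u mod int m"
    using arc_cls_iff[OF D2 arcs(1,3)] arc_cls_iff[OF D2 arcs(1,4)] ap by auto
  let ?W = "act (vexch m (u, 0) (c', 1)) ?V"
  have n0: "normal ?W (E a' c' * (rho ?p * z2))" by (rule normal.join[OF n2' arcs'(1,2) ap(1)])
  have arcs0: "{(a, 1), (x, 0)} \<in> ?W" "{(c, 1), (y, 0)} \<in> ?W"
    using join_keeps'[OF D2' arcs'(3), of u c'] join_keeps'[OF D2' arcs'(4), of u c'] ap ap[symmetric] xu
    by simp_all
  have D: "?D \<in> affine_diagrams m" by (intro act_affine D2 vexch_perm) simp_all
  have D1: "act (vexch m (x, 0) (c', 1)) D2 \<in> affine_diagrams m" by (intro act_affine D2 vexch_perm) simp_all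
  have "{(a', 1), (c', 1)} \<in> ?D"
    using join_keeps'[OF D1 join_arcs(1)[OF D2 arcs(3,4) ap(1)], of u c] ap by simp
  moreover have "{(a, 1), (c, 1)} \<in> ?D"
  proof (rule join_arcs(1)[OF D1 _ _ ap(6), of u v])
    have "v mod int m \<noteq> x mod int m"
      using arc_cls_iff[OF D2 arcs(3,2)] ap by auto
    then show "{(a, 1), (u, 0)} \<in> act (vexch m (x, 0) (c', 1)) D2" "{(c, 1), (v, 0)} \<in> act (vexch m (x, 0) (c', 1)) D2"
      using join_keeps'[OF D2 arcs(1), of x c'] join_keeps'[OF D2 arcs(2), of x c'] ap ap[symmetric] xu xu[symmetric]
      by simp_all
  qed
  ultimately have "act (vexch m (a, 1) (a', 1) \<circ> vexch m (c, 1) (c', 1)) ?D = ?D"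
    using ap ap[symmetric] by (intro act_swap_arcs[OF D]) simp_all
  then have "?D = act ?\<tau> ?D" unfolding on_top_comp[symmetric] on_top_exch by simp
  also have "act ?\<tau> ?D = act ?\<tau> (act (vexch m (x, 0) (c', 1)) (act (vexch m (u, 0) (c, 1)) D2))"
    by (rule arg_cong[OF join_commute[OF xu(1) ap(5)]])
  also have "act ?\<tau> (act (vexch m (x, 0) (c', 1)) (act (vexch m (u, 0) (c, 1)) D2)) = act (vexch m (x, 0) (c, 1)) (act ?\<tau> (act (vexch m (u, 0) (c, 1)) D2))"
    using act_vexch[OF on_top_perm[OF p], of "(x, 0)" "(c', 1)"] unfolding \<tau> by simp
  also have "act ?\<tau> (act (vexch m (u, 0) (c, 1)) D2) = ?W"
    using act_vexch[OF on_top_perm[OF p], of "(u, 0)" "(c, 1)"] unfolding \<tau> by simp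
  finally have "?D = act (vexch m (x, 0) (c, 1)) ?W" .
  moreover have "?z = E a c * (E a' c' * (rho ?p * z2))"
    using E_pair_swap[OF ap] by (simp add: mult.assoc[symmetric])
  ultimately show ?thesis by (intro joinedI[OF ap(6) n0 arcs0])
qed

text \<open>
  The required pair of arcs is compared with the pair that belongs to the first factor of the
  normal form. If the pairs share no arc, the two cup-caps commute. If they share one arc, the
  other one is found in the remaining factor by induction, and \<open>joined_exchange\<close>
  pairs the arcs as required.
\<close>

lemma normal_factor:
  assumes "normal D z" "{(a, 1), (c, 1)} \<in> D" "{(x, 0), (y, 0)} \<in> D"
  shows "joined a c x y D z"
  using assms
proof (induction arbitrary: a c x y)
  case (strand p)
  then show ?case using strand_no_arc by blast
next
  case (join D1 z1 a1 x1 c1 y1)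
  let ?\<sigma> = "vexch m (x1, 0) (c1, 1)"
  let ?D = "act ?\<sigma> D1" and ?z = "E a1 c1 * z1"
  note D1 = normal_affine[OF join(1)]
  note arcs1 = join(2,3) and ap1 = join(4)
  have J: "joined a1 c1 x1 y1 ?D ?z" using ap1 join(1) arcs1 by (rule joinedI) simp_all
  note D = joined_affine[OF J]
  have ac: "{(a, 1), (c, 1)} \<in> ?D" and xy: "{(x, 0), (y, 0)} \<in> ?D" using join by blast+
  have ca: "{(c, 1), (a, 1)} \<in> ?D" and yx: "{(y, 0), (x, 0)} \<in> ?D"
    using ac xy by (simp_all add: insert_commute)
  have apac: "apart a c" using arc_cls_neq[OF D(1) ac] by simp
  let ?T = "a mod int m = a1 mod int m \<or> a mod int m = c1 mod int m"
  let ?B = "x mod int m = x1 mod int m \<or> x mod int m = y1 mod int m"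
  have T: "c mod int m = a1 mod int m \<longleftrightarrow> a mod int m = c1 mod int m"
    "c mod int m = c1 mod int m \<longleftrightarrow> a mod int m = a1 mod int m"
    using arc_cls_iff[OF D(1,2) ac] arc_cls_iff[OF D(1,2) ca] by simp_all
  have B: "y mod int m = x1 mod int m \<longleftrightarrow> x mod int m = y1 mod int m"
    "y mod int m = y1 mod int m \<longleftrightarrow> x mod int m = x1 mod int m"
    using arc_cls_iff[OF D(1,3) xy] arc_cls_iff[OF D(1,3) yx] by simp_all
  have ac1: "{(a, 1), (c, 1)} \<in> D1" if "\<not> ?T" using join_keeps[OF D1 ac] that T by simp
  have xy1: "{(x, 0), (y, 0)} \<in> D1" if "\<not> ?B" using join_keeps[OF D1 xy] that B by simp
  \<comment> \<open>\<open>?T\<close> and \<open>?B\<close> say that the top arc, resp. the bottom arc, belongs to the first factor\<close>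
  consider "?T" "?B" | "\<not> ?T" "\<not> ?B" | "?T" "\<not> ?B" | "\<not> ?T" "?B" by blast
  then show ?case
  proof cases
    case 1
    then show ?thesis by (intro joined_match[OF J ac xy])
  next
    case 2
    obtain D2 z2 where K: "apart a c" "normal D2 z2" "{(a, 1), (x, 0)} \<in> D2" "{(c, 1), (y, 0)} \<in> D2"
      "D1 = act (vexch m (x, 0) (c, 1)) D2" "z1 = E a c * z2" "D2 \<in> affine_diagrams m" "apart x y"
      using join.IH[OF ac1[OF 2(1)] xy1[OF 2(2)]] by (rule joinedE)
    have x1: "apart x1 x" "apart y1 x" "apart a1 c" "apart c1 c" "apart a1 a" "apart c1 a" "apart y x1"
      using 2 T B by auto
    have arcs2: "{(a1, 1), (x1, 0)} \<in> D2" "{(c1, 1), (y1, 0)} \<in> D2"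
      using join_keeps[OF K(7), of "(a1, 1)" "(x1, 0)" x c] join_keeps[OF K(7), of "(c1, 1)" "(y1, 0)" x c]
        arcs1 x1 unfolding K(5) by simp_all
    have n: "normal (act ?\<sigma> D2) (E a1 c1 * z2)" by (rule normal.join[OF K(2) arcs2 ap1])
    have arcs: "{(a, 1), (x, 0)} \<in> act ?\<sigma> D2" "{(c, 1), (y, 0)} \<in> act ?\<sigma> D2"
      using join_keeps'[OF K(7,3), of x1 c1] join_keeps'[OF K(7,4), of x1 c1] x1 x1[symmetric] by simp_all
    have "?D = act (vexch m (x, 0) (c, 1)) (act ?\<sigma> D2)"
      unfolding K(5) by (rule join_commute[OF x1(1)[symmetric] x1(4)[symmetric]])
    moreover have "?z = E a c * (E a1 c1 * z2)"
      unfolding K(6) mult.assoc[symmetric] using E_commute[of a1 c1 a c] ap1 apac x1 by simp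
    ultimately show ?thesis by (intro joinedI[OF apac n arcs])
  next
    case 3
    \<comment> \<open>any top arc of \<open>D1\<close> serves as the companion of the required bottom arc\<close>
    obtain a2 c2 where ac2: "{(a2, 1), (c2, 1)} \<in> D1"
      using arc_at_other_height[OF D1 _ _ _ xy1[OF 3(2)] m_pos, of 1] by auto
    obtain D2 z2 where K: "apart a2 c2" "normal D2 z2" "{(a2, 1), (x, 0)} \<in> D2" "{(c2, 1), (y, 0)} \<in> D2"
      "D1 = act (vexch m (x, 0) (c2, 1)) D2" "z1 = E a2 c2 * z2" "D2 \<in> affine_diagrams m" "apart x y"
      using join.IH[OF ac2 xy1[OF 3(2)]] by (rule joinedE)
    have ca2: "{(c2, 1), (a2, 1)} \<in> D1" using ac2 by (simp add: insert_commute)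
    have n: "apart a2 a1" "apart a2 c1" "apart c2 a1" "apart c2 c1"
      using arc_cls_iff[OF D1 arcs1(1) ac2] arc_cls_iff[OF D1 arcs1(2) ac2]
        arc_cls_iff[OF D1 arcs1(1) ca2] arc_cls_iff[OF D1 arcs1(2) ca2] by auto
    have x1: "apart x1 x" "apart y1 x" using 3(2) by auto
    have arcs2: "{(a1, 1), (x1, 0)} \<in> D2" "{(c1, 1), (y1, 0)} \<in> D2"
      using join_keeps[OF K(7), of "(a1, 1)" "(x1, 0)" x c2] join_keeps[OF K(7), of "(c1, 1)" "(y1, 0)" x c2]
        arcs1 x1 n n[symmetric] unfolding K(5) by simp_all
    have "joined a1 c1 x y ?D ?z"
      unfolding K(5,6) by (rule joined_exchange[OF K(2) arcs2 K(3,4) K(1) n ap1])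
    then show ?thesis using ac xy 3(1) by (rule joined_match) simp
  next
    case 4
    \<comment> \<open>any bottom arc of \<open>D1\<close> serves as the companion of the required top arc\<close>
    obtain x2 y2 where xy2: "{(x2, 0), (y2, 0)} \<in> D1"
      using arc_at_other_height[OF D1 _ _ _ ac1[OF 4(1)] m_pos, of 0] by auto
    obtain D2 z2 where K: "apart a c" "normal D2 z2" "{(a, 1), (x2, 0)} \<in> D2" "{(c, 1), (y2, 0)} \<in> D2"
      "D1 = act (vexch m (x2, 0) (c, 1)) D2" "z1 = E a c * z2" "D2 \<in> affine_diagrams m" "apart x2 y2"
      using join.IH[OF ac1[OF 4(1)] xy2] by (rule joinedE)
    have n: "apart a1 a" "apart a1 c" "apart c1 a" "apart c1 c" using 4(1) T by auto
    have x1: "apart x1 x2" "apart y1 x2"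
      using arc_cls_iff[OF D1, of "(x2, 0)" "(y2, 0)" "(x1, 0)" "(a1, 1)"]
        arc_cls_iff[OF D1, of "(x2, 0)" "(y2, 0)" "(y1, 0)" "(c1, 1)"] xy2 arcs1
      by (auto simp: insert_commute)
    have arcs2: "{(a1, 1), (x1, 0)} \<in> D2" "{(c1, 1), (y1, 0)} \<in> D2"
      using join_keeps[OF K(7), of "(a1, 1)" "(x1, 0)" x2 c] join_keeps[OF K(7), of "(c1, 1)" "(y1, 0)" x2 c]
        arcs1 x1 n unfolding K(5) by simp_all
    have "?D = act (vexch m (x2, 0) (c, 1)) (act ?\<sigma> D2)"
      unfolding K(5) by (rule join_commute[OF x1(1)[symmetric] n(4)[symmetric]])
    moreover have "?z = E a c * (E a1 c1 * z2)"
      unfolding K(6) mult.assoc[symmetric] using E_commute[of a1 c1 a c] ap1 apac n by simp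
    ultimately have "joined a c x1 y1 ?D ?z"
      using joined_exchange[OF K(2,3,4) arcs2 ap1 n K(1)] by simp
    then show ?thesis using xy 4(2) by (rule joined_bottom_match)
  qed
qed

text \<open>
  Both normal forms can be made to start with the same factor for the same pair of arcs; since
  joining strands is an involution on diagrams, the remaining diagrams agree.
\<close>

lemma normal_unique: "normal D z \<Longrightarrow> normal D z' \<Longrightarrow> z = z'"
proof (induction arbitrary: z' rule: normal.induct)
  case (strand p)
  from strand(2) show ?case
  proof cases
    case (strand q)
    then show ?thesis using strand_inj[OF \<open>p \<in> periodic_perms m\<close>] by blast
  next
    case (join D0 z0 a x c y)
    then show ?thesis
      using join_arcs(1)[OF normal_affine[OF join(3)] join(4-6)] strand_no_arc by metis
  qed
next
  case (join D z a x c y)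
  note D = normal_affine[OF join(1)]
  have "joined a c x y (act (vexch m (x, 0) (c, 1)) D) z'"
    using join_arcs[OF D join(2-4)] by (intro normal_factor join)
  then obtain D0 z0 where K: "normal D0 z0" "z' = E a c * z0"
    "act (vexch m (x, 0) (c, 1)) D = act (vexch m (x, 0) (c, 1)) D0"
    by (elim joinedE)
  have "D = D0" using arg_cong[OF K(3), of "act (vexch m (x, 0) (c, 1))"] unfolding act_join_involution .
  then show ?case using join.IH K by blast
qed

text \<open>
  The cup-cap on \<open>a\<close>, \<open>c\<close> meets the one on \<open>a\<close>,
  \<open>c'\<close> that can be split off; by \<open>E_adjacent\<close> the second one turns
  into a transposition.
\<close>

lemma normal_adjacent:
  assumes n: "normal D z" and ac: "{(a, 1), (c', 1)} \<in> D" and ap: "apart a c" "apart c c'"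
  shows "normal (act (vexch m (c', 1) (c, 1)) D) (E a c * z)"
proof -
  obtain x y where xy: "{(x, 0), (y, 0)} \<in> D"
    using arc_at_other_height[OF normal_affine[OF n] _ _ _ ac m_pos, of 0] by auto
  obtain D0 z0 where J: "apart a c'" "normal D0 z0" "{(a, 1), (x, 0)} \<in> D0" "{(c', 1), (y, 0)} \<in> D0"
    "D = act (vexch m (x, 0) (c', 1)) D0" "z = E a c' * z0" "D0 \<in> affine_diagrams m" "apart x y"
    using normal_factor[OF n ac xy] by (rule joinedE)
  let ?\<sigma> = "on_top (sw c' c)"
  have \<sigma>: "?\<sigma> (a, 1) = (a, 1)" "?\<sigma> (c', 1) = (c, 1)" "\<And>w. ?\<sigma> (w, 0) = (w, 0)" using ap J(1) by simp_all
  have n0: "normal (act ?\<sigma> D0) (rho (sw c' c) * z0)" by (rule normal_relabel[OF J(2) exch_periodic])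
  have "{(a, 1), (x, 0)} \<in> act ?\<sigma> D0" "{(c, 1), (y, 0)} \<in> act ?\<sigma> D0"
    using act_arc[OF J(7) J(3), of ?\<sigma>] act_arc[OF J(7) J(4), of ?\<sigma>] unfolding \<sigma> by simp_all
  from normal.join[OF n0 this ap(1)]
  have "normal (act (vexch m (x, 0) (c, 1)) (act ?\<sigma> D0)) (E a c * (rho (sw c' c) * z0))" .
  also have "act (vexch m (x, 0) (c, 1)) (act ?\<sigma> D0) = act ?\<sigma> D"
    unfolding J(5) using act_vexch[OF on_top_perm[OF exch_periodic], of m c' c "(x, 0)" "(c', 1)" D0] unfolding \<sigma> by simp
  also have "?\<sigma> = vexch m (c', 1) (c, 1)" by (rule on_top_exch)
  also have "E a c * (rho (sw c' c) * z0) = E a c * z"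
    unfolding J(6) mult.assoc[symmetric] using E_adjacent[of c' a c] ap J(1) exch_commute[OF ap(2)] by auto
  finally show ?thesis .
qed

text \<open>
  The cases are those of the product of diagrams. If \<open>i\<close> is joined to a translate
  of the top vertex \<open>i + 1\<close>, the cup-cap that can be split off yields a loop. If it
  is joined to another top vertex, that cup-cap shares a strand with \<open>e\<^sub>i\<close>.
  Otherwise \<open>i\<close> lies on a through strand, and \<open>i + 1\<close> may lie on a
  through strand or on a top arc.
\<close>

lemma normal_e:
  assumes n: "normal D z" and i: "i \<in> {1..<m}" and u: "{(int i, 1), u} \<in> D"
  shows "\<exists>z'. e i * z = (if cls m u = cls m (int i + 1, 1) then b else 1) * z' \<and>
    normal (act (vexch m u (int i + 1, 1)) D) z'"
proof -
  let ?a = "int i" and ?c = "int i + 1"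
  note D = normal_affine[OF n]
  have e: "e i = E ?a ?c" using E_gen[OF i] by simp
  have ap: "apart ?a ?c" using int_apart[of i "i + 1"] i by (simp add: add.commute)
  have au: "cls m (?a, 1) \<noteq> cls m u" using arc_cls_neq[OF D u] .
  obtain j h where jh: "u = (j, h)" by (cases u)
  have h: "h \<in> {0, 1}" using arc_height[OF D u] jh by simp
  consider "cls m u = cls m (?c, 1)" | "h = 1" "cls m u \<noteq> cls m (?c, 1)" | "h = 0" using h by blast
  then show ?thesis
  proof cases
    case 1
    then have h1: "h = 1" "j mod int m = ?c mod int m" using jh by (simp_all add: cls_def)
    obtain k where k: "j = ?c + k * int m" using shift_exists[OF h1(2)] by blast
    have aj: "{(?a, 1), (j, 1)} \<in> D" using u jh h1 by simp
    obtain x y where xy: "{(x, 0), (y, 0)} \<in> D"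
      using arc_at_other_height[OF D _ _ _ aj m_pos, of 0] by auto
    obtain D0 z0 where J: "apart ?a j" "normal D0 z0" "{(?a, 1), (x, 0)} \<in> D0" "{(j, 1), (y, 0)} \<in> D0"
      "D = act (vexch m (x, 0) (j, 1)) D0" "z = E ?a j * z0" "D0 \<in> affine_diagrams m" "apart x y"
      using normal_factor[OF n aj xy] by (rule joinedE)
    let ?\<sigma> = "on_top (sw j ?c)"
    have \<sigma>: "?\<sigma> (?a, 1) = (?a, 1)" "?\<sigma> (j, 1) = (?c, 1)" "\<And>w. ?\<sigma> (w, 0) = (w, 0)" using ap J(1) by simp_all
    have n0: "normal (act ?\<sigma> D0) (rho (sw j ?c) * z0)" by (rule normal_relabel[OF J(2) exch_periodic])
    have "{(?a, 1), (x, 0)} \<in> act ?\<sigma> D0" "{(?c, 1), (y, 0)} \<in> act ?\<sigma> D0"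
      using act_arc[OF J(7) J(3), of ?\<sigma>] act_arc[OF J(7) J(4), of ?\<sigma>] unfolding \<sigma> by simp_all
    from normal.join[OF n0 this ap]
    have "normal (act (vexch m (x, 0) (?c, 1)) (act ?\<sigma> D0)) (E ?a ?c * (rho (sw j ?c) * z0))" .
    also have "act (vexch m (x, 0) (?c, 1)) (act ?\<sigma> D0) = act ?\<sigma> D"
      unfolding J(5) using act_vexch[OF on_top_perm[OF exch_periodic], of m j ?c "(x, 0)" "(j, 1)" D0] unfolding \<sigma> by simp
    also have "?\<sigma> = vexch m u (?c, 1)" unfolding on_top_exch jh h1(1) ..
    finally have N: "normal (act (vexch m u (?c, 1)) D) (E ?a ?c * (rho (sw j ?c) * z0))" .
    let ?w = "sw ?c j"
    have inv: "rho ?w * rho (sw j ?c) = 1"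
    proof -
      have "?w \<circ> sw j ?c = id" by (simp add: fun_eq_iff exch_inverse)
      then show ?thesis using rho_comp[of ?w "sw j ?c"] by simp
    qed
    have wE: "rho ?w * E ?a ?c = E ?a j * rho ?w" using rho_E[OF exch_periodic ap, of ?c j] ap J(1) by simp
    have loop: "E ?a ?c * rho ?w * E ?a ?c = b * E ?a ?c"
      using E_loop[of ?c ?a k] ap E_swap(3)[OF ap] unfolding k by auto
    have "e i * z = E ?a ?c * E ?a j * (rho ?w * rho (sw j ?c)) * z0"
      unfolding e J(6) inv by (simp add: mult.assoc)
    also have "\<dots> = (E ?a ?c * (E ?a j * rho ?w)) * (rho (sw j ?c) * z0)" by (simp only: mult.assoc)
    also have "\<dots> = (E ?a ?c * rho ?w * E ?a ?c) * (rho (sw j ?c) * z0)"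
      unfolding wE[symmetric] by (simp only: mult.assoc)
    also have "\<dots> = b * (E ?a ?c * (rho (sw j ?c) * z0))" unfolding loop by (simp only: mult.assoc)
    finally show ?thesis using N 1 by auto
  next
    case 2
    then have "normal (act (vexch m u (?c, 1)) D) (E ?a ?c * z)"
      using normal_adjacent[OF n, of ?a j ?c] u jh ap by auto
    then show ?thesis using e 2 by auto
  next
    case 3
    then have ax: "{(?a, 1), (j, 0)} \<in> D" using u jh by simp
    obtain w where w: "{(?c, 1), w} \<in> D" using arc_exists[OF D, of "(?c, 1)"] by auto
    obtain k l where kl: "w = (k, l)" by (cases w)
    have l: "l = 0 \<or> l = 1" using arc_height[OF D w] kl by auto
    have "normal (act (vexch m u (?c, 1)) D) (E ?a ?c * z)"
    proof (cases "l = 0")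
      case True
      then have "{(?c, 1), (k, 0)} \<in> D" using w kl by simp
      then show ?thesis using normal.join[OF n ax _ ap] jh 3 by blast
    next
      case False
      then have ck: "{(?c, 1), (k, 1)} \<in> D" using w kl l by auto
      have ka: "apart ?a k"
        using arc_cls_iff[OF D ax, of "(k, 1)" "(?c, 1)"] ck by (auto simp: insert_commute)
      have "normal (act (vexch m (k, 1) (?a, 1)) D) (E ?c ?a * z)"
        using normal_adjacent[OF n ck, of ?a] ap ka by auto
      moreover have "act (vexch m (j, 0) (?c, 1)) D = act (vexch m (k, 1) (?a, 1)) D"
        using ap ka by (intro act_join_sym[OF D ax ck]) simp_all
      ultimately show ?thesis using E_swap(3)[OF ap] jh 3 by simp
    qed
    moreover have "cls m u \<noteq> cls m (?c, 1)" using jh 3 by simp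
    ultimately show ?thesis using e by auto
  qed
qed

end

section \<open>Words and their diagrams\<close>

primrec dia :: "nat \<Rightarrow> generator list \<Rightarrow> diagram" where
  "dia m [] = strand_diagram (\<lambda>j. j)"
| "dia m (g # w) = composite (generator_diagram m g) (dia m w)"

text \<open>
  The loops that arise while the diagram of a word is built from right to left; by
  \<open>dia_append\<close> other bracketings give as many.
\<close>

primrec loop_count :: "nat \<Rightarrow> generator list \<Rightarrow> nat" where
  "loop_count m [] = 0"
| "loop_count m (g # w) = card (loops m (generator_diagram m g) (dia m w)) + loop_count m w"

text \<open>The value at \<open>Gen_e i\<close>, which is not a strand diagram, is arbitrary.\<close>

primrec gen_perm :: "nat \<Rightarrow> generator \<Rightarrow> int \<Rightarrow> int" where
  "gen_perm m Gen_tau = (\<lambda>j. j + 1)"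
| "gen_perm m Gen_tau_inv = (\<lambda>j. j - 1)"
| "gen_perm m (Gen_e i) = id"
| "gen_perm m (Gen_s i) = exch m (int i) (int i + 1)"
| "gen_perm m (Gen_t i) = exch m (int i) (int i + int m)"
| "gen_perm m (Gen_t_inv i) = exch m (int i) (int i - int m)"

definition strand_gens :: "nat \<Rightarrow> generator set" where
  "strand_gens m = {Gen_tau, Gen_tau_inv} \<union> Gen_s ` {1..<m} \<union> Gen_t ` {1..m} \<union> Gen_t_inv ` {1..m}"

primrec word_perm :: "nat \<Rightarrow> generator list \<Rightarrow> int \<Rightarrow> int" where
  "word_perm m [] = id"
| "word_perm m (g # w) = gen_perm m g \<circ> word_perm m w"

lemma generators_eq: "generators m = strand_gens m \<union> Gen_e ` {1..<m}"
  by (auto simp: generators_def strand_gens_def)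

lemma strand_gens_subset: "lists (strand_gens m) \<subseteq> lists (generators m)"
  unfolding generators_eq by (intro lists_mono) simp

lemma translation_periodic: "(\<lambda>j. j + 1) \<in> periodic_perms m" "(\<lambda>j. j - 1) \<in> periodic_perms m"
  by (rule periodic_permsI[of "\<lambda>j. j - 1"], simp_all) (rule periodic_permsI[of "\<lambda>j. j + 1"], simp_all)

lemma strand_gen:
  assumes "g \<in> strand_gens m"
  shows "generator_diagram m g = strand_diagram (gen_perm m g)" "gen_perm m g \<in> periodic_perms m"
proof -
  have s: "s_diagram m i = strand_diagram (exch m (int i) (int i + 1))" for i
    unfolding s_diagram_def by (rule arg_cong[of _ _ strand_diagram]) (auto simp: exch_def mod_eq_dvd_iff)
  have t: "t_diagram m i = strand_diagram (exch m (int i) (int i + int m))" for i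
    unfolding t_diagram_def by (rule arg_cong[of _ _ strand_diagram]) (auto simp: exch_shift mod_eq_dvd_iff)
  have t': "t_inv_diagram m i = strand_diagram (exch m (int i) (int i - int m))" for i
    unfolding t_inv_diagram_def
    using exch_shift[of m "- int m" "int i"]
    by (intro arg_cong[of _ _ strand_diagram]) (auto simp: mod_eq_dvd_iff)
  show "generator_diagram m g = strand_diagram (gen_perm m g)"
    using assms by (auto simp: strand_gens_def s t t' tau_diagram_def tau_inv_diagram_def)
  show "gen_perm m g \<in> periodic_perms m"
    using assms by (auto simp: strand_gens_def translation_periodic)
qed

lemma generator_affine: "g \<in> generators m \<Longrightarrow> generator_diagram m g \<in> affine_diagrams m"
  unfolding generators_eq using strand_gen e_diagram_eq_act(2) by auto

lemma composite_generator_affine: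
  assumes "g \<in> generators m" "D \<in> affine_diagrams m"
  shows "composite (generator_diagram m g) D \<in> affine_diagrams m"
proof (cases "g \<in> strand_gens m")
  case True
  then show ?thesis
    using strand_gen[OF True] composite_strand(1)[OF strand_gen(2)[OF True] assms(2)]
    by (simp add: act_affine[OF assms(2)])
next
  case False
  then obtain i where i: "g = Gen_e i" "i \<in> {1..<m}" using assms(1) unfolding generators_eq by auto
  obtain u where u: "{(int i, 1), u} \<in> D" using arc_exists[OF assms(2), of "(int i, 1)"] by auto
  have "snd u \<in> {0, 1}" using arc_height[OF assms(2) u] by blast
  then show ?thesis unfolding i using composite_e[OF i(2) assms(2) u] by (simp add: act_affine[OF assms(2)])
qed

lemma dia_affine: "w \<in> lists (generators m) \<Longrightarrow> dia m w \<in> affine_diagrams m"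
proof (induction w)
  case Nil
  then show ?case by (simp add: identity_diagram_affine)
next
  case (Cons g w)
  then show ?case by (simp add: composite_generator_affine)
qed

lemma composite_identity:
  assumes "D \<in> affine_diagrams m"
  shows "composite (strand_diagram (\<lambda>j. j)) D = D" "loops m (strand_diagram (\<lambda>j. j)) D = {}"
proof -
  have "on_top (\<lambda>j. j) = (\<lambda>v. v)" by (simp add: fun_eq_iff on_top_def prod_eq_iff)
  then show "composite (strand_diagram (\<lambda>j. j)) D = D" "loops m (strand_diagram (\<lambda>j. j)) D = {}"
    using composite_strand[OF id_periodic(2) assms] by simp_all
qed

lemma dia_append:
  assumes m: "m \<ge> 1" and "u \<in> lists (generators m)" "v \<in> lists (generators m)"
  shows "dia m (u @ v) = composite (dia m u) (dia m v)"
    and "loop_count m (u @ v) = loop_count m u + loop_count m v + card (loops m (dia m u) (dia m v))"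
proof -
  have "dia m (u @ v) = composite (dia m u) (dia m v) \<and>
    loop_count m (u @ v) = loop_count m u + loop_count m v + card (loops m (dia m u) (dia m v))"
    using assms(2)
  proof (induction u)
    case Nil
    then show ?case using composite_identity[OF dia_affine[OF assms(3)]] by simp
  next
    case (Cons g u)
    then have g: "generator_diagram m g \<in> affine_diagrams m" and u: "dia m u \<in> affine_diagrams m"
      using generator_affine dia_affine by auto
    note v = dia_affine[OF assms(3)]
    show ?case
      using Cons composite_assoc[OF g u v] card_loops_assoc[OF m g u v] by simp
  qed
  then show "dia m (u @ v) = composite (dia m u) (dia m v)"
    "loop_count m (u @ v) = loop_count m u + loop_count m v + card (loops m (dia m u) (dia m v))" by blast+
qed

lemma dia_strand_Cons:
  assumes "g \<in> strand_gens m" "w \<in> lists (generators m)"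
  shows "dia m (g # w) = act (on_top (gen_perm m g)) (dia m w)" "loop_count m (g # w) = loop_count m w"
  using composite_strand[OF strand_gen(2)[OF assms(1)] dia_affine[OF assms(2)]] strand_gen(1)[OF assms(1)]
  by simp_all

lemma word_perm_periodic: "w \<in> lists (strand_gens m) \<Longrightarrow> word_perm m w \<in> periodic_perms m"
  by (induction w) (auto simp: strand_gen(2) simp del: o_apply)

lemma dia_strand_append:
  assumes "u \<in> lists (strand_gens m)" "w \<in> lists (generators m)"
  shows "dia m (u @ w) = act (on_top (word_perm m u)) (dia m w)" "loop_count m (u @ w) = loop_count m w"
proof -
  have "dia m (u @ w) = act (on_top (word_perm m u)) (dia m w) \<and> loop_count m (u @ w) = loop_count m w"
    using assms(1)
  proof (induction u)
    case Nil
    have "on_top (word_perm m []) = (\<lambda>v. v)" by (simp add: fun_eq_iff on_top_def prod_eq_iff)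
    then show ?case by (simp only: append_Nil act_id)
  next
    case (Cons g u)
    then have "g \<in> strand_gens m" "u @ w \<in> lists (generators m)"
      using strand_gens_subset assms(2) by auto
    note c = dia_strand_Cons[OF this]
    have eq: "on_top (word_perm m (g # u)) = on_top (gen_perm m g) \<circ> on_top (word_perm m u)"
      by (simp add: fun_eq_iff on_top_def)
    have IH: "dia m (u @ w) = act (on_top (word_perm m u)) (dia m w)" "loop_count m (u @ w) = loop_count m w"
      using Cons by blast+
    show ?case unfolding append_Cons c eq IH act_act by (intro conjI refl)
  qed
  then show "dia m (u @ w) = act (on_top (word_perm m u)) (dia m w)" "loop_count m (u @ w) = loop_count m w"
    by blast+
qed

lemma dia_strand_word:
  assumes "u \<in> lists (strand_gens m)"
  shows "dia m u = strand_diagram (word_perm m u)" "loop_count m u = 0"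
  using dia_strand_append[OF assms, of "[]"] by (simp_all add: act_strand comp_def)

lemma strand_word_exists:
  assumes m: "m \<ge> 1" and p: "p \<in> periodic_perms m"
  shows "\<exists>w\<in>lists (strand_gens m). word_perm m w = p"
  using m p
proof (induction rule: periodic_induct)
  case id
  show ?case by (rule bexI[of _ "[]"]) simp_all
next
  case (s i p)
  then obtain w where "w \<in> lists (strand_gens m)" "word_perm m w = p" by blast
  then show ?case using s(1) by (intro bexI[of _ "Gen_s i # w"]) (simp_all add: strand_gens_def)
next
  case (t i p d)
  then obtain w where w: "w \<in> lists (strand_gens m)" "word_perm m w = p" by blast
  show ?case
  proof (cases "d = int m")
    case True
    then show ?thesis using t(1) w by (intro bexI[of _ "Gen_t i # w"]) (simp_all add: strand_gens_def)
  next
    case False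
    then have "d = - int m" using t(2) by simp
    then show ?thesis using t(1) w by (intro bexI[of _ "Gen_t_inv i # w"]) (simp_all add: strand_gens_def)
  qed
qed

text \<open>
  The powers of \<open>t\<^sub>i\<close> in the relation \<open>e\<^sub>i t\<^sub>i\<^sup>a
  e\<^sub>i = \<beta> e\<^sub>i\<close>.
\<close>

lemma word_perm_powi:
  assumes "i \<in> {1..m}"
  shows "word_perm m (if a \<ge> 0 then replicate (nat a) (Gen_t i) else replicate (nat (- a)) (Gen_t_inv i)) =
    exch m (int i) (int i + a * int m)"
proof -
  have id: "exch m (int i) (int i) = id"
    using exch_shift[of m 0 "int i"] by (simp add: fun_eq_iff)
  have step: "exch m (int i) (int i + d) \<circ> exch m (int i) (int i + d') = exch m (int i) (int i + (d + d'))"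
    if "int m dvd d" "int m dvd d'" for d d'
    using that dvd_add[OF that] by (auto simp: fun_eq_iff exch_shift mod_add_dvd)
  have pow: "word_perm m (replicate n g) = exch m (int i) (int i + int n * d)"
    if g: "gen_perm m g = exch m (int i) (int i + d)" and d: "int m dvd d" for g d n
  proof (induction n)
    case (Suc n)
    have "word_perm m (replicate (Suc n) g) = exch m (int i) (int i + (d + int n * d))"
      unfolding replicate_Suc word_perm.simps Suc g by (rule step) (simp_all add: d)
    then show ?case by (simp add: algebra_simps)
  qed (simp add: id)
  have 1: "word_perm m (replicate n (Gen_t i)) = exch m (int i) (int i + int n * int m)" for n
    by (rule pow) simp_all
  have 2: "word_perm m (replicate n (Gen_t_inv i)) = exch m (int i) (int i + int n * - int m)" for n
    by (rule pow) simp_all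
  show ?thesis using 1[of "nat a"] 2[of "nat (- a)"] by simp
qed

section \<open>The relations hold for diagrams\<close>

context
  fixes m i :: nat
  assumes i: "i \<in> {1..<m}"
begin

private abbreviation "e \<equiv> e_diagram m i"

private lemma e: "e \<in> affine_diagrams m"
  by (rule e_diagram_eq_act(2)[OF i])

private lemma ii: "int i mod int m \<noteq> (int i + 1) mod int m" "(int i + 1) mod int m \<noteq> int i mod int m"
  using residue_eq_iff[of i m "i + 1"] i by (auto simp: add.commute)

lemma e_arc: "h \<in> {0, 1} \<Longrightarrow> {(int i, h), (int i + 1, h)} \<in> e_diagram m i"
  unfolding e_diagram_def by (rule UnI1, rule CollectI, rule exI[of _ "int i"], rule exI[of _ h]) simp

lemma e_through:
  assumes "j mod int m \<noteq> int i mod int m" "j mod int m \<noteq> (int i + 1) mod int m"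
  shows "{(j, 0), (j, 1)} \<in> e_diagram m i"
  unfolding e_diagram_def using assms by (intro UnI2 CollectI exI[of _ j]) (simp add: mod_eq_dvd_iff)

lemma e_swap: "act (on_top (exch m (int i) (int i + 1))) (e_diagram m i) = e_diagram m i"
  unfolding on_top_exch by (rule act_swap_ends[OF e e_arc]) simp

lemma e_shift:
  assumes "int m dvd d"
  shows "act (on_top (exch m (int i) (int i + d) \<circ> exch m (int i + 1) (int i + 1 + d))) (e_diagram m i) = e_diagram m i"
proof -
  have "act (vexch m (int i, 1) (translate d (int i, 1)) \<circ> vexch m (int i + 1, 1) (translate d (int i + 1, 1))) e = e"
    by (rule act_shift_arc[OF e e_arc assms]) simp
  then show ?thesis unfolding on_top_comp[symmetric] on_top_exch by simp
qed

text \<open>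
  Exchanging the bottom ends \<open>x\<close>, \<open>y\<close> of the strands of
  \<open>p\<close> that the cup-cap meets can be done before or after relabelling the top by
  \<open>p\<close>.
\<close>

lemma composite_e_strand:
  assumes p: "p \<in> periodic_perms m" and "p x = int i" "p y = int i + 1"
  shows "composite (e_diagram m i) (strand_diagram p) =
      act (on_top p) (act (vexch m (x, 0) (y, 1)) (strand_diagram (\<lambda>j. j)))"
    and "card (loops m (e_diagram m i) (strand_diagram p)) = 0"
proof -
  have u: "{(int i, 1), (x, 0)} \<in> strand_diagram p"
    using strand_arc[of x p] assms(2) by (simp add: insert_commute)
  note s = strand_affine[OF p]
  show "composite e (strand_diagram p) = act (on_top p) (act (vexch m (x, 0) (y, 1)) (strand_diagram (\<lambda>j. j)))"
    using composite_e[OF i s u] act_vexch[OF on_top_perm[OF p], of "(x, 0)" "(y, 1)"] assms(3)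
    by (simp add: act_strand comp_def)
  show "card (loops m e (strand_diagram p)) = 0" using card_loops_e[OF i s u] by simp
qed

lemma composite_e_conj:
  assumes p: "p \<in> periodic_perms m" and j: "j \<in> {1..<m}" and "p (int j) = int i" "p (int j + 1) = int i + 1"
  shows "composite (e_diagram m i) (strand_diagram p) = act (on_top p) (e_diagram m j)"
  using composite_e_strand(1)[OF p assms(3,4)] e_diagram_eq_act(1)[OF j] by simp

lemma composite_es:
  "composite (e_diagram m i) (strand_diagram (exch m (int i) (int i + 1))) = e_diagram m i"
  "card (loops m (e_diagram m i) (strand_diagram (exch m (int i) (int i + 1)))) = 0"
proof -
  let ?p = "exch m (int i) (int i + 1)"
  have x: "?p (int i + 1) = int i" "?p (int i) = int i + 1" using ii by simp_all
  have arc: "{(j, 1), (j, 0)} \<in> strand_diagram (\<lambda>j. j)" for j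
    using strand_arc[of j "\<lambda>j. j"] by (simp add: insert_commute)
  have "act (vexch m (int i + 1, 0) (int i, 1)) (strand_diagram (\<lambda>j. j)) = e"
    unfolding e_diagram_eq_act(1)[OF i] using ii
    by (intro act_join_sym[OF identity_diagram_affine arc arc]) simp_all
  then show "composite e (strand_diagram ?p) = e"
    using composite_e_strand(1)[OF exch_periodic x] e_swap by simp
  show "card (loops m e (strand_diagram ?p)) = 0" by (rule composite_e_strand(2)[OF exch_periodic x])
qed

lemma composite_e_shift:
  assumes d: "int m dvd d"
  defines "p \<equiv> exch m (int i) (int i + d) \<circ> exch m (int i + 1) (int i + 1 + d)"
  shows "composite (e_diagram m i) (strand_diagram p) = e_diagram m i"
    "card (loops m (e_diagram m i) (strand_diagram p)) = 0"
proof -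
  have p: "p \<in> periodic_perms m" by (simp add: p_def)
  have d': "int m dvd - d" using d by simp
  have "p (int i - d) = int i" "p (int i + 1 - d) = int i + 1"
    using mod_add_dvd[OF d', of "int i"] mod_add_dvd[OF d', of "int i + 1"] ii
    unfolding p_def o_apply exch_shift[OF d] by simp_all
  note c = composite_e_strand[OF p this]
  have v: "vexch m (int i - d, 0) (int i + 1 - d, 1) = vexch m (int i, 0) (int i + 1, 1)"
    using vexch_translate[OF d', of "(int i, 0)" "(int i + 1, 1)"] by simp
  show "composite e (strand_diagram p) = e"
    using c(1) unfolding v e_diagram_eq_act(1)[OF i, symmetric] unfolding p_def e_shift[OF d] .
  show "card (loops m e (strand_diagram p)) = 0" by (rule c(2))
qed

text \<open>
  The strand between the two cup-caps closes up; the translation by \<open>d\<close> only decides how often the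
  closed curve winds around the cylinder.
\<close>

lemma composite_e_wind_e:
  assumes d: "int m dvd d"
  defines "D \<equiv> act (on_top (exch m (int i) (int i + d))) (e_diagram m i)"
  shows "composite (e_diagram m i) D = e_diagram m i" "card (loops m (e_diagram m i) D) = 1"
proof -
  let ?p = "exch m (int i) (int i + d)"
  have D: "D \<in> affine_diagrams m" unfolding D_def by (intro act_affine e on_top_perm exch_periodic)
  have d': "int m dvd - d" using d by simp
  have "?p (int i) = int i + d" "?p (int i + 1) = int i + 1" using ii by (simp_all add: exch_shift[OF d])
  then have "{(int i + d, 1), (int i + 1, 1)} \<in> D"
    using act_arc[OF e e_arc[of 1], of "on_top ?p"] unfolding D_def by simp
  from arc_translate[OF D d' this] have u: "{(int i, 1), (int i + 1 - d, 1)} \<in> D" by simp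
  have c: "cls m (int i + 1 - d, 1) = cls m (int i + 1, 1)" using mod_add_dvd[OF d', of "int i + 1"] by simp
  show "card (loops m e D) = 1" using card_loops_e[OF i D u] c by simp
  have "vexch m (int i + 1 - d, 1) (int i + 1, 1) = on_top (exch m (int i + 1) (int i + 1 + d))"
    unfolding on_top_exch using vexch_translate[OF d, of "(int i + 1 - d, 1)" "(int i + 1, 1)"] by simp
  then have "composite e D = act (on_top (exch m (int i + 1) (int i + 1 + d) \<circ> ?p)) e"
    using composite_e[OF i D u] by (simp add: D_def act_act on_top_comp)
  also have "exch m (int i + 1) (int i + 1 + d) \<circ> ?p = ?p \<circ> exch m (int i + 1) (int i + 1 + d)"
    using ii by (auto simp: fun_eq_iff exch_shift[OF d] mod_add_dvd[OF d])
  finally show "composite e D = e" unfolding e_shift[OF d] .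
qed

end

lemma e_apart:
  assumes "i \<in> {1..<m}" "i + 1 \<in> {1..<m}"
  shows "(int i + 1) mod int m \<noteq> int i mod int m" "(int i + 2) mod int m \<noteq> int i mod int m"
    "(int i + 2) mod int m \<noteq> (int i + 1) mod int m"
proof -
  have m: "i \<in> {1..m}" "i + 1 \<in> {1..m}" "i + 2 \<in> {1..m}" using assms by auto
  have e: "int (i + 1) = int i + 1" "int (i + 2) = int i + 2" by simp_all
  show "(int i + 1) mod int m \<noteq> int i mod int m" "(int i + 2) mod int m \<noteq> int i mod int m"
    "(int i + 2) mod int m \<noteq> (int i + 1) mod int m"
    using residue_eq_iff[OF m(2,1)] residue_eq_iff[OF m(3,1)] residue_eq_iff[OF m(3,2)] unfolding e by simp_all
qed

text \<open>
  On top of \<open>e\<^sub>i\<close> the cup-cap \<open>e\<^sub>i\<^sub>+\<^sub>1\<close> has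
  the effect of \<open>s\<^sub>i s\<^sub>i\<^sub>+\<^sub>1\<close>, since
  \<open>e\<^sub>i\<close> is symmetric in its strands; \<open>e\<^sub>i\<close> on top of this
  undoes it.
\<close>

lemma composite_e_next:
  assumes i: "i \<in> {1..<m}" "i + 1 \<in> {1..<m}"
  defines "q \<equiv> exch m (int i) (int i + 1) \<circ> exch m (int i + 1) (int i + 2)"
  shows "composite (e_diagram m (i + 1)) (e_diagram m i) = act (on_top q) (e_diagram m i)"
    "card (loops m (e_diagram m (i + 1)) (e_diagram m i)) = 0"
    "composite (e_diagram m i) (act (on_top q) (e_diagram m i)) = e_diagram m i"
    "card (loops m (e_diagram m i) (act (on_top q) (e_diagram m i))) = 0"
proof -
  let ?e = "e_diagram m i"
  let ?x = "int i" and ?y = "int i + 1" and ?z = "int i + 2"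
  note r = e_apart[OF i] and e = e_diagram_eq_act(2)[OF i(1)]
  have y: "int (i + 1) = ?y" "?y + 1 = ?z" by simp_all
  have "exch m ?x ?y \<circ> exch m ?y ?z = exch m ?x ?z \<circ> exch m ?x ?y"
    using exch_conj[of "exch m ?x ?y" m ?y ?z] r by simp
  then have q: "q = exch m ?x ?z \<circ> exch m ?x ?y" unfolding q_def .
  have qe: "act (on_top q) ?e = act (vexch m (?x, 1) (?z, 1)) ?e"
    unfolding q on_top_comp[symmetric] act_act[symmetric] e_swap[OF i(1)] unfolding on_top_exch ..
  have u: "{(int (i + 1), 1), (?x, 1)} \<in> ?e" using e_arc[OF i(1), of 1] by (simp add: insert_commute add.commute)
  show "composite (e_diagram m (i + 1)) ?e = act (on_top q) ?e"
    using composite_e[OF i(2) e u] unfolding y qe by (simp only: One_nat_def)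
  show "card (loops m (e_diagram m (i + 1)) ?e) = 0"
    using card_loops_e[OF i(2) e u] r(2)[symmetric] unfolding y by simp
  define D where "D = act (on_top q) ?e"
  have D: "D \<in> affine_diagrams m" unfolding D_def q_def by (intro act_affine e on_top_perm) simp
  have "{(?z, 0), (?z, 1)} \<in> ?e" by (rule e_through[OF i(1)]) (use r in auto)
  from act_arc[OF e this, of "vexch m (?x, 1) (?z, 1)"]
  have u2: "{(?x, 1), (?z, 0)} \<in> D" unfolding D_def qe using r by (simp add: insert_commute)
  have "{(?z, 1), (?y, 1)} \<in> D"
    using act_arc[OF e e_arc[OF i(1), of 1], of "vexch m (?x, 1) (?z, 1)"] r unfolding D_def qe by simp
  then have w: "{(?y, 1), (?z, 1)} \<in> D" by (simp add: insert_commute)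
  have "composite ?e D = act (vexch m (?z, 0) (?y, 1)) D"
    using composite_e[OF i(1) D u2] by (simp only: One_nat_def)
  also have "\<dots> = act (vexch m (?z, 1) (?x, 1)) D"
    using r by (intro act_join_sym[OF D u2 w]) simp_all
  also have "\<dots> = ?e" unfolding D_def qe by (rule act_vexch_inverse)
  finally show "composite ?e (act (on_top q) ?e) = ?e" unfolding D_def .
  show "card (loops m ?e (act (on_top q) ?e)) = 0"
    using card_loops_e[OF i(1) D u2] unfolding D_def by simp
qed

text \<open>The mirror image of \<open>composite_e_next\<close>.\<close>

lemma composite_e_previous:
  assumes i: "i \<in> {1..<m}" "i + 1 \<in> {1..<m}"
  defines "q \<equiv> exch m (int i + 1) (int i + 2) \<circ> exch m (int i) (int i + 1)"
  shows "composite (e_diagram m i) (e_diagram m (i + 1)) = act (on_top q) (e_diagram m (i + 1))"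
    "card (loops m (e_diagram m i) (e_diagram m (i + 1))) = 0"
    "composite (e_diagram m (i + 1)) (act (on_top q) (e_diagram m (i + 1))) = e_diagram m (i + 1)"
    "card (loops m (e_diagram m (i + 1)) (act (on_top q) (e_diagram m (i + 1)))) = 0"
proof -
  let ?e = "e_diagram m (i + 1)"
  let ?x = "int i" and ?y = "int i + 1" and ?z = "int i + 2"
  note r = e_apart[OF i] and e = e_diagram_eq_act(2)[OF i(2)]
  have y: "int (i + 1) = ?y" "?y + 1 = ?z" by simp_all
  have "exch m ?y ?z \<circ> exch m ?x ?y = exch m ?x ?z \<circ> exch m ?y ?z"
    using exch_conj[of "exch m ?y ?z" m ?x ?y] r r[symmetric] by simp
  then have q: "q = exch m ?x ?z \<circ> exch m ?y ?z" unfolding q_def .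
  have sw: "act (on_top (exch m ?y ?z)) ?e = ?e" using e_swap[OF i(2)] unfolding y .
  have qe: "act (on_top q) ?e = act (vexch m (?x, 1) (?z, 1)) ?e"
    unfolding q on_top_comp[symmetric] act_act[symmetric] sw unfolding on_top_exch ..
  have arcs: "{(?y, h), (?z, h)} \<in> ?e" if "h \<in> {0, 1}" for h using e_arc[OF i(2) that] unfolding y .
  have "?x mod int m \<noteq> int (i + 1) mod int m" "?x mod int m \<noteq> (int (i + 1) + 1) mod int m"
    using r unfolding y by metis+
  then have t: "{(?x, 0), (?x, 1)} \<in> ?e" by (rule e_through[OF i(2)])
  then have u: "{(?x, 1), (?x, 0)} \<in> ?e" by (simp add: insert_commute)
  have yz: "{(?y, 1), (?z, 1)} \<in> ?e" by (rule arcs) simp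
  have "composite (e_diagram m i) ?e = act (vexch m (?x, 0) (?y, 1)) ?e"
    using composite_e[OF i(1) e u] by (simp only: One_nat_def)
  also have "\<dots> = act (vexch m (?z, 1) (?x, 1)) ?e" using r by (intro act_join_sym[OF e u yz]) simp_all
  also have "vexch m (?z, 1) (?x, 1) = vexch m (?x, 1) (?z, 1)" using r by (intro vexch_commute) simp
  finally show "composite (e_diagram m i) ?e = act (on_top q) ?e" unfolding qe .
  show "card (loops m (e_diagram m i) ?e) = 0" using card_loops_e[OF i(1) e u] by simp
  define D where "D = act (on_top q) ?e"
  have D: "D \<in> affine_diagrams m" unfolding D_def q_def by (intro act_affine e on_top_perm) simp
  have "{(?y, 1), (?x, 1)} \<in> D"
    using act_arc[OF e yz, of "vexch m (?x, 1) (?z, 1)"] r unfolding D_def qe by simp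
  then have u2: "{(int (i + 1), 1), (?x, 1)} \<in> D" unfolding y .
  have "composite ?e D = act (vexch m (?x, 1) (?z, 1)) D"
    using composite_e[OF i(2) D u2] unfolding y by (simp only: One_nat_def)
  also have "vexch m (?x, 1) (?z, 1) = vexch m (?z, 1) (?x, 1)" using r by (intro vexch_commute[symmetric]) simp
  also have "act (vexch m (?z, 1) (?x, 1)) D = ?e" unfolding D_def qe by (rule act_vexch_inverse)
  finally show "composite ?e (act (on_top q) ?e) = ?e" unfolding D_def .
  show "card (loops m ?e (act (on_top q) ?e)) = 0"
    using card_loops_e[OF i(2) D u2] r(2)[symmetric] unfolding y D_def by simp
qed

lemma composite_e_far:
  assumes i: "i \<in> {1..<m}" and j: "j \<in> {1..<m}" and far: "far i j"
  shows "composite (e_diagram m i) (e_diagram m j) = composite (e_diagram m j) (e_diagram m i)"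
    "card (loops m (e_diagram m i) (e_diagram m j)) = 0"
proof -
  have n: "int j mod int m \<noteq> int i mod int m" "int j mod int m \<noteq> (int i + 1) mod int m"
    "(int j + 1) mod int m \<noteq> int i mod int m" "(int j + 1) mod int m \<noteq> (int i + 1) mod int m"
  proof -
    have mem: "i \<in> {1..m}" "j \<in> {1..m}" "i + 1 \<in> {1..m}" "j + 1 \<in> {1..m}" using i j by auto
    have ne: "j \<noteq> i" "j \<noteq> i + 1" "j + 1 \<noteq> i" "j + 1 \<noteq> i + 1" using far by auto
    have e: "int (i + 1) = int i + 1" "int (j + 1) = int j + 1" by simp_all
    show "int j mod int m \<noteq> int i mod int m" "int j mod int m \<noteq> (int i + 1) mod int m"
      "(int j + 1) mod int m \<noteq> int i mod int m" "(int j + 1) mod int m \<noteq> (int i + 1) mod int m"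
      using residue_eq_iff[OF mem(2,1)] residue_eq_iff[OF mem(2,3)] residue_eq_iff[OF mem(4,1)]
        residue_eq_iff[OF mem(4,3)] ne unfolding e by blast+
  qed
  have calc: "composite (e_diagram m i) (e_diagram m j) =
      act (vexch m (int i, 0) (int i + 1, 1)) (act (vexch m (int j, 0) (int j + 1, 1)) (strand_diagram (\<lambda>j. j)))
      \<and> card (loops m (e_diagram m i) (e_diagram m j)) = 0"
    if i: "i \<in> {1..<m}" and j: "j \<in> {1..<m}" and n: "int i mod int m \<noteq> int j mod int m"
      "int i mod int m \<noteq> (int j + 1) mod int m" for i j
  proof -
    have u: "{(int i, 1), (int i, 0)} \<in> e_diagram m j"
      using e_through[OF j n] by (simp add: insert_commute)
    show ?thesis
      using composite_e[OF i e_diagram_eq_act(2)[OF j] u] card_loops_e[OF i e_diagram_eq_act(2)[OF j] u]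
        e_diagram_eq_act(1)[OF j] by simp
  qed
  have "act (vexch m (int i, 0) (int i + 1, 1)) (act (vexch m (int j, 0) (int j + 1, 1)) (strand_diagram (\<lambda>j. j))) =
    act (vexch m (int j, 0) (int j + 1, 1)) (act (vexch m (int i, 0) (int i + 1, 1)) (strand_diagram (\<lambda>j. j)))"
    by (rule act_vexch_commute) (simp_all add: n)
  then show "composite (e_diagram m i) (e_diagram m j) = composite (e_diagram m j) (e_diagram m i)"
    "card (loops m (e_diagram m i) (e_diagram m j)) = 0"
    using calc[OF i j n(1)[symmetric] n(3)[symmetric]] calc[OF j i n(1,2)] by simp_all
qed

section \<open>Linear extensions\<close>

lemma lookup_scale: "Poly_Mapping.lookup (scale c x) k = c * Poly_Mapping.lookup x k"
  by (simp add: scale_def map.rep_eq when_def)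

lemma scale_simps [simp]:
  "scale c (x + y) = scale c x + scale c y" "scale (c + d) x = scale c x + scale d x"
  "scale c (scale d x) = scale (c * d) x" "scale 1 x = x" "scale c 0 = 0" "scale 0 x = 0"
  "scale c (Poly_Mapping.single k d) = Poly_Mapping.single k (c * d)"
  by (auto simp: lookup_scale lookup_add lookup_single when_def algebra_simps intro!: poly_mapping_eqI)

lemma keys_scale: "Poly_Mapping.keys (scale c x) \<subseteq> Poly_Mapping.keys x"
  by (auto simp: in_keys_iff lookup_scale)

lemma scale_sum: "scale c (sum f A) = (\<Sum>a\<in>A. scale c (f a))"
  by (induction A rule: infinite_finite_induct) simp_all

definition lin_ext :: "('a \<Rightarrow> 'b \<Rightarrow>\<^sub>0 'k::comm_ring_1) \<Rightarrow> ('a \<Rightarrow>\<^sub>0 'k) \<Rightarrow> 'b \<Rightarrow>\<^sub>0 'k" where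
  "lin_ext f x = (\<Sum>a\<in>Poly_Mapping.keys x. scale (Poly_Mapping.lookup x a) (f a))"

lemma lin_ext_superset:
  assumes "finite A" "Poly_Mapping.keys x \<subseteq> A"
  shows "lin_ext f x = (\<Sum>a\<in>A. scale (Poly_Mapping.lookup x a) (f a))"
  unfolding lin_ext_def by (rule sum.mono_neutral_left[OF assms]) (auto simp: in_keys_iff)

lemma lin_ext_add: "lin_ext f (x + y) = lin_ext f x + lin_ext f y"
proof -
  let ?A = "Poly_Mapping.keys x \<union> Poly_Mapping.keys y"
  have "lin_ext f (x + y) = (\<Sum>a\<in>?A. scale (Poly_Mapping.lookup (x + y) a) (f a))"
    by (rule lin_ext_superset) (simp_all add: keys_add)
  also have "\<dots> = lin_ext f x + lin_ext f y"
    by (simp add: lin_ext_superset[of ?A] lookup_add sum.distrib)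
  finally show ?thesis .
qed

lemma lin_ext_scale: "lin_ext f (scale c x) = scale c (lin_ext f x)"
  unfolding lin_ext_superset[OF finite_keys keys_scale] lin_ext_def[of f x] scale_sum
  by (simp add: lookup_scale)

lemma lin_ext_single [simp]: "lin_ext f (Poly_Mapping.single a c) = scale c (f a)"
  by (simp add: lin_ext_superset[of "{a}"])

lemma lin_ext_zero [simp]: "lin_ext f 0 = 0"
  by (simp add: lin_ext_def)

lemma lin_ext_diff: "lin_ext f (x - y) = lin_ext f x - lin_ext f y"
  using lin_ext_add[of f "x - y" y] by simp

lemma keys_lin_ext: "(\<And>a. a \<in> Poly_Mapping.keys x \<Longrightarrow> Poly_Mapping.keys (f a) \<subseteq> S) \<Longrightarrow> Poly_Mapping.keys (lin_ext f x) \<subseteq> S"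
proof -
  assume f: "\<And>a. a \<in> Poly_Mapping.keys x \<Longrightarrow> Poly_Mapping.keys (f a) \<subseteq> S"
  show ?thesis unfolding lin_ext_def
    by (rule order_trans[OF keys_sum], rule UN_least) (rule order_trans[OF keys_scale f])
qed

lemma monomials_induct [consumes 1, case_names zero single add]:
  fixes x :: "'a \<Rightarrow>\<^sub>0 'b::comm_monoid_add"
  assumes "Poly_Mapping.keys x \<subseteq> S" and z: "P 0"
    and s: "\<And>a c. a \<in> S \<Longrightarrow> P (Poly_Mapping.single a c)"
    and add: "\<And>x y. P x \<Longrightarrow> P y \<Longrightarrow> P (x + y)"
  shows "P x"
proof -
  have "x = (\<Sum>a\<in>Poly_Mapping.keys x. Poly_Mapping.single a (Poly_Mapping.lookup x a))"
    by (rule poly_mapping_eqI) (simp add: lookup_sum lookup_single when_def in_keys_iff)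
  moreover have "P (\<Sum>a\<in>A. Poly_Mapping.single a (Poly_Mapping.lookup x a))" if "finite A" "A \<subseteq> S" for A
    using that by (induction rule: finite_induct) (auto simp: z s add)
  ultimately show ?thesis using assms(1) by (metis finite_keys)
qed

lemma scale_eq_mult: "scale c x = Poly_Mapping.single 0 c * x"
  unfolding scale_def by (rule mult_map_scale_conv_mult)

lemma diagram_mult_eq:
  "diagram_mult m \<beta> x y = lin_ext (\<lambda>D. lin_ext (\<lambda>D'. Poly_Mapping.single (composite D D')
     (\<beta> ^ card (loops m D D'))) y) x"
  by (simp add: diagram_mult_def lin_ext_def scale_sum mult_ac)

lemma diagram_mult_linear:
  "diagram_mult m \<beta> (x + x') y = diagram_mult m \<beta> x y + diagram_mult m \<beta> x' y"
  "diagram_mult m \<beta> x (y + y') = diagram_mult m \<beta> x y + diagram_mult m \<beta> x y'"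
  "diagram_mult m \<beta> 0 y = 0" "diagram_mult m \<beta> x 0 = 0"
  "diagram_mult m \<beta> (Poly_Mapping.single D c) (Poly_Mapping.single D' d) =
    Poly_Mapping.single (composite D D') (c * d * \<beta> ^ card (loops m D D'))"
proof -
  show "diagram_mult m \<beta> x (y + y') = diagram_mult m \<beta> x y + diagram_mult m \<beta> x y'"
    by (simp add: diagram_mult_eq lin_ext_add) (simp add: lin_ext_def sum.distrib)
qed (simp_all add: diagram_mult_eq lin_ext_add mult.assoc, simp add: lin_ext_def)

section \<open>The free algebra and its evaluation on diagrams\<close>

lemma free_algebra_simps [simp]:
  "carrier (free_algebra X) = {x. Poly_Mapping.keys x \<subseteq> lists X}"
  "x \<otimes>\<^bsub>free_algebra X\<^esub> y = x * y" "\<one>\<^bsub>free_algebra X\<^esub> = 1" "\<zero>\<^bsub>free_algebra X\<^esub> = 0"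
  "x \<oplus>\<^bsub>free_algebra X\<^esub> y = x + y" "c \<odot>\<^bsub>free_algebra X\<^esub> x = scale c x"
  by (simp_all add: free_algebra_def)

lemma aBr_simps [simp]:
  "carrier (aBr m \<beta>) = {x. Poly_Mapping.keys x \<subseteq> affine_diagrams m}"
  "x \<otimes>\<^bsub>aBr m \<beta>\<^esub> y = diagram_mult m \<beta> x y" "\<one>\<^bsub>aBr m \<beta>\<^esub> = Poly_Mapping.single (strand_diagram (\<lambda>j. j)) 1"
  "\<zero>\<^bsub>aBr m \<beta>\<^esub> = 0" "x \<oplus>\<^bsub>aBr m \<beta>\<^esub> y = x + y" "c \<odot>\<^bsub>aBr m \<beta>\<^esub> x = scale c x"
  by (simp_all add: aBr_def)

lemma keys_mult_lists:
  fixes x y :: "'g list \<Rightarrow>\<^sub>0 'k::comm_ring_1"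
  assumes "Poly_Mapping.keys x \<subseteq> lists X" "Poly_Mapping.keys y \<subseteq> lists X"
  shows "Poly_Mapping.keys (x * y) \<subseteq> lists X"
proof -
  have "u + v \<in> lists X" if "u \<in> lists X" "v \<in> lists X" for u v
    using that by (simp add: plus_list_def)
  then have "{u + v | u v. u \<in> Poly_Mapping.keys x \<and> v \<in> Poly_Mapping.keys y} \<subseteq> lists X"
    using assms by blast
  then show ?thesis using keys_mult[of x y] by (rule order_trans[rotated])
qed

lemma free_algebra_ring: "ring (free_algebra X :: ('k::comm_ring_1, 'g list \<Rightarrow>\<^sub>0 'k) module)"
proof (rule ringI)
  show "abelian_group (free_algebra X :: ('k, 'g list \<Rightarrow>\<^sub>0 'k) module)"
  proof (rule abelian_groupI)
    fix x y :: "'g list \<Rightarrow>\<^sub>0 'k" assume "x \<in> carrier (free_algebra X)" "y \<in> carrier (free_algebra X)"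
    then show "x \<oplus>\<^bsub>free_algebra X\<^esub> y \<in> carrier (free_algebra X)"
      using keys_add[of x y] by auto
  next
    fix x :: "'g list \<Rightarrow>\<^sub>0 'k" assume "x \<in> carrier (free_algebra X)"
    then show "\<exists>y\<in>carrier (free_algebra X). y \<oplus>\<^bsub>free_algebra X\<^esub> x = \<zero>\<^bsub>free_algebra X\<^esub>"
      by (intro bexI[of _ "- x"]) (simp_all add: keys_minus)
  qed (simp_all add: algebra_simps)
  show "monoid (free_algebra X :: ('k, 'g list \<Rightarrow>\<^sub>0 'k) module)"
    by (rule monoidI) (auto simp: keys_mult_lists mult.assoc zero_list_def)
qed (simp_all add: algebra_simps)

lemma free_algebra_minus:
  assumes "x \<in> carrier (free_algebra X)" "y \<in> carrier (free_algebra X)"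
  shows "x \<ominus>\<^bsub>free_algebra X\<^esub> y = x - (y :: 'g list \<Rightarrow>\<^sub>0 'k::comm_ring_1)"
proof -
  interpret F: ring "free_algebra X :: ('k, 'g list \<Rightarrow>\<^sub>0 'k) module" by (rule free_algebra_ring)
  have "\<ominus>\<^bsub>free_algebra X\<^esub> y = - y"
    by (rule F.minus_equality) (use assms in \<open>simp_all add: keys_minus\<close>)
  then show ?thesis by (simp add: a_minus_def)
qed

abbreviation monomial :: "'g list \<Rightarrow> 'g list \<Rightarrow>\<^sub>0 'k::comm_ring_1" where
  "monomial w \<equiv> Poly_Mapping.single w 1"

lemma mono_mult: "monomial u * monomial v = monomial (u @ v)"
  by (simp add: mult_single plus_list_def)

lemma mono_Nil: "monomial [] = 1"
  unfolding zero_list_def[symmetric] by simp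

lemma mono_Cons: "monomial (g # w) = var g * monomial w"
  by (simp add: var_def mono_mult)

lemma mono_power: "var g ^ n = monomial (replicate n g)"
  by (induction n) (simp_all add: mono_Nil mono_Cons)

lemma mono_prod_list: "prod_list (map (\<lambda>i. var (G i)) is) = monomial (map G is)"
  by (induction "is") (simp_all add: mono_Nil mono_Cons)

definition evaluate :: "nat \<Rightarrow> 'k \<Rightarrow> 'k words \<Rightarrow> diagram \<Rightarrow>\<^sub>0 'k::comm_ring_1" where
  "evaluate m \<beta> = lin_ext (\<lambda>w. Poly_Mapping.single (dia m w) (\<beta> ^ loop_count m w))"

lemma evaluate_mult:
  assumes m: "m \<ge> 1" and x: "Poly_Mapping.keys x \<subseteq> lists (generators m)"
    and y: "Poly_Mapping.keys y \<subseteq> lists (generators m)"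
  shows "evaluate m \<beta> (x * y) = diagram_mult m \<beta> (evaluate m \<beta> x) (evaluate m \<beta> y)"
  using x
proof (induction rule: monomials_induct)
  case zero
  show ?case by (simp add: evaluate_def diagram_mult_linear)
next
  case (add x x')
  then show ?case by (simp add: evaluate_def lin_ext_add diagram_mult_linear distrib_right)
next
  case (single u c)
  show ?case
    using y
  proof (induction rule: monomials_induct)
    case zero
    show ?case by (simp add: evaluate_def diagram_mult_linear)
  next
    case (add y y')
    then show ?case by (simp add: evaluate_def lin_ext_add diagram_mult_linear distrib_left)
  next
    case s: (single v d)
    show ?case
      using dia_append[OF m single s]
      by (simp add: evaluate_def diagram_mult_linear mult_single plus_list_def power_add mult_ac)
  qed
qed

lemma evaluate_hom:
  assumes m: "m \<ge> 1"
  shows "evaluate m \<beta> \<in> ring_hom (free_algebra (generators m)) (aBr m \<beta>)"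
proof (rule ring_hom_memI)
  fix x :: "'a words" assume "x \<in> carrier (free_algebra (generators m))"
  then have "dia m w \<in> affine_diagrams m" if "w \<in> Poly_Mapping.keys x" for w
    using that by (intro dia_affine) auto
  then show "evaluate m \<beta> x \<in> carrier (aBr m \<beta>)"
    unfolding evaluate_def aBr_simps
    by (intro CollectI keys_lin_ext) (auto split: if_splits)
next
  have "evaluate m \<beta> (monomial []) = Poly_Mapping.single (strand_diagram (\<lambda>j. j)) 1"
    by (simp add: evaluate_def)
  then show "evaluate m \<beta> \<one>\<^bsub>free_algebra (generators m)\<^esub> = \<one>\<^bsub>aBr m \<beta>\<^esub>" by (simp add: mono_Nil)
qed (simp_all add: evaluate_mult[OF m], simp add: evaluate_def lin_ext_add)

section \<open>The relations as relations between words\<close>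

text \<open>
  The chain \<open>s\<^sub>1 \<dots> s\<^sub>m\<^sub>-\<^sub>1\<close> moves \<open>1, \<dots>,
  m - 1\<close> up by one and sends \<open>m\<close> to \<open>1\<close>, which
  \<open>t\<^sub>1\<close> takes to \<open>m + 1\<close>.
\<close>

lemma tau_word_perm:
  assumes m: "m \<ge> 1"
  shows "word_perm m (Gen_t 1 # map Gen_s [1..<m]) = (\<lambda>j. j + 1)"
proof -
  let ?w = "Gen_t 1 # map Gen_s [1..<m]"
  have l: "?w \<in> lists (strand_gens m)" using m by (auto simp: strand_gens_def in_lists_conv_set)
  define S where "S = (\<lambda>i. exch m (int i) (int i + 1))"
  define T where "T = (\<lambda>i. exch m (int i) (int i + int m))"
  have c: "word_perm m (map Gen_s [k..<m]) (int j) = (if j = m then int k else if k \<le> j then int j + 1 else int j)"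
    if "1 \<le> k" "k \<le> m" "1 \<le> j" "j \<le> m" for k j
    using that(2,1,3,4)
  proof (induction k rule: inc_induct)
    case (step k)
    have w: "word_perm m (map Gen_s [k..<m]) = S k \<circ> word_perm m (map Gen_s [Suc k..<m])"
      using step by (simp add: upt_conv_Cons S_def)
    have k: "k \<in> {1..<m}" using step by auto
    have a: "S k (int i) = (if i = k then int k + 1 else if i = k + 1 then int k else int i)" if "i \<in> {1..m}" for i
      using residue_eq_iff[OF that, of k] residue_eq_iff[OF that, of "k + 1"] k
      unfolding S_def by (auto simp: exch_def add.commute)
    show ?case
      unfolding w o_apply using step a[of j] a[of "Suc k"] a[of "Suc j"] by (auto simp: add.commute)
  qed auto
  have nat: "word_perm m ?w (int j) = int j + 1" if "j \<in> {1..m}" for j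
  proof -
    have w: "word_perm m ?w = T 1 \<circ> word_perm m (map Gen_s [1..<m])" by (simp add: T_def)
    have a: "T 1 (int i) = (if i = 1 then 1 + int m else int i)" if "i \<in> {1..m}" for i
      using residue_eq_iff[OF that, of 1] m unfolding T_def by (auto simp: exch_def)
    show ?thesis
      unfolding w o_apply using c[of 1 j] a[of 1] a[of "Suc j"] that m by (auto simp: add.commute)
  qed
  have j: "word_perm m ?w z = z + 1" if "1 \<le> z" "z \<le> int m" for z
  proof -
    have "nat z \<in> {1..m}" "int (nat z) = z" using that by auto
    then show ?thesis using nat[of "nat z"] by (simp only:)
  qed
  have p: "word_perm m ?w \<in> periodic_perms m" by (rule word_perm_periodic[OF l])
  have "word_perm m ?w z = z + 1" for z
  proof -
    let ?r = "(z - 1) mod int m + 1"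
    have r: "1 \<le> ?r" "?r \<le> int m"
      using pos_mod_bound[of "int m" "z - 1"] pos_mod_sign[of "int m" "z - 1"] m by linarith+
    have "z - ?r = (z - 1) - (z - 1) mod int m" by simp
    then have "int m dvd z - ?r" by (simp only: dvd_minus_mod)
    then show ?thesis using periodic_add[OF p, of "z - ?r" ?r] j[OF r] by simp
  qed
  then show ?thesis by (rule ext)
qed

lemma dia_generator:
  assumes "g \<in> generators m"
  shows "dia m [g] = generator_diagram m g" "loop_count m [g] = 0"
proof -
  have "dia m [g] = generator_diagram m g \<and> loop_count m [g] = 0"
  proof (cases "g \<in> strand_gens m")
    case True
    then show ?thesis using dia_strand_word[of "[g]" m] strand_gen(1)[OF True] by (simp del: dia.simps loop_count.simps)
  next
    case False
    then obtain i where g: "g = Gen_e i" and i: "i \<in> {1..<m}" using assms unfolding generators_eq by auto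
    have "on_top (\<lambda>j. j) = (\<lambda>v. v)" by (simp add: fun_eq_iff on_top_def prod_eq_iff)
    then show ?thesis
      using composite_e_conj[OF i id_periodic(2) i] composite_e_strand(2)[OF i id_periodic(2), of "int i" "int i + 1"]
      unfolding g by simp
  qed
  then show "dia m [g] = generator_diagram m g" "loop_count m [g] = 0" by blast+
qed

text \<open>
  Both sides of every relation are words up to a power of \<open>\<beta>\<close>, so a relation
  holds under evaluation as soon as the diagrams and the numbers of loops match.
\<close>

lemma relation_words:
  fixes \<beta> :: "'k::comm_ring_1"
  assumes "relation m \<beta> l r" and m: "m \<ge> 1"
  shows "\<exists>w n w'. l = monomial w \<and> r = scale (\<beta> ^ n) (monomial w') \<and> w \<in> lists (generators m) \<and>
    w' \<in> lists (generators m) \<and> dia m w = dia m w' \<and> loop_count m w = n + loop_count m w'"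
proof -
  interpret perm: affine_symmetric m "perm_s m" "perm_t m" "perm_t' m"
    by (rule perm_affine_symmetric[OF m])
  define S where "S = (\<lambda>i. exch m (int i) (int i + 1))"
  define T where "T = (\<lambda>i. exch m (int i) (int i + int m))"
  define T' where "T' = (\<lambda>i. exch m (int i) (int i - int m))"
  have app: "app (perm_s m i) = S i" "app (perm_t m i) = T i" "app (perm_t' m i) = T' i" for i
    by (simp_all add: S_def T_def T'_def perm_s_def perm_t_def perm_t'_def)
  have per: "S i \<in> periodic_perms m" "T i \<in> periodic_perms m" for i by (simp_all add: S_def T_def)
  have gp: "gen_perm m (Gen_s i) = S i" "gen_perm m (Gen_t i) = T i" "gen_perm m (Gen_t_inv i) = T' i" for i
    by (simp_all add: S_def T_def T'_def)
  have strand: ?thesis if "l = monomial u" "r = monomial v" "u \<in> lists (strand_gens m)" "v \<in> lists (strand_gens m)"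
    "word_perm m u = word_perm m v" for u v
  proof -
    have "u \<in> lists (generators m)" "v \<in> lists (generators m)"
      using that(3,4) strand_gens_subset by blast+
    moreover have "dia m u = dia m v" "loop_count m u = 0 + loop_count m v"
      using dia_strand_word[OF that(3)] dia_strand_word[OF that(4)] that(5) by simp_all
    moreover have "r = scale (\<beta> ^ 0) (monomial v)" using that(2) by simp
    ultimately show ?thesis using that(1) by blast
  qed
  have word: ?thesis if "l = monomial u" "r = scale (\<beta> ^ n) (monomial v)" "u \<in> lists (generators m)" "v \<in> lists (generators m)"
    "dia m u = dia m v" "loop_count m u = n + loop_count m v" for u v n
    using that by blast
  have sg: "Gen_s i \<in> strand_gens m" "Gen_s i \<in> generators m" "Gen_e i \<in> generators m" if "i \<in> {1..<m}" for i
    using that by (auto simp: strand_gens_def generators_eq)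
  have tg: "Gen_t i \<in> strand_gens m" "Gen_t i \<in> generators m" "Gen_t_inv i \<in> strand_gens m" if "i \<in> {1..m}" for i
    using that by (auto simp: strand_gens_def generators_eq)
  have e: "dia m [Gen_e i] = e_diagram m i" "loop_count m [Gen_e i] = 0" if "i \<in> {1..<m}" for i
    using dia_generator[OF sg(3)[OF that]] by simp_all
  note mono_simps = var_def mono_mult power2_eq_square mult.assoc
  show ?thesis
    using assms(1)
  proof cases
    case tau_inv_right
    show ?thesis
      by (rule strand[of "[Gen_tau, Gen_tau_inv]" "[]"])
        (simp_all add: tau_inv_right mono_simps mono_Nil strand_gens_def fun_eq_iff)
  next
    case tau_inv_left
    show ?thesis
      by (rule strand[of "[Gen_tau_inv, Gen_tau]" "[]"])
        (simp_all add: tau_inv_left mono_simps mono_Nil strand_gens_def fun_eq_iff)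
  next
    case (t_inv_right i)
    have "T i \<circ> T' i = id" using arg_cong[OF perm.t_t'[OF t_inv_right(3)], of app] by (simp add: app)
    then show ?thesis
      by (intro strand[of "[Gen_t i, Gen_t_inv i]" "[]"])
        (simp_all add: t_inv_right(1,2) mono_simps mono_Nil tg[OF t_inv_right(3)] gp del: gen_perm.simps o_apply)
  next
    case (t_inv_left i)
    have "T' i \<circ> T i = id" using arg_cong[OF perm.t'_t[OF t_inv_left(3)], of app] by (simp add: app)
    then show ?thesis
      by (intro strand[of "[Gen_t_inv i, Gen_t i]" "[]"])
        (simp_all add: t_inv_left(1,2) mono_simps mono_Nil tg[OF t_inv_left(3)] gp del: gen_perm.simps o_apply)
  next
    case tau_word
    let ?w = "Gen_t 1 # map Gen_s [1..<m]"
    have l: "?w \<in> lists (strand_gens m)" using sg tg m by (auto simp: in_lists_conv_set)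
    show ?thesis
    proof (rule strand[of "[Gen_tau]" ?w])
      show "l = monomial [Gen_tau]" by (simp add: tau_word var_def)
      show "r = monomial ?w" by (simp only: tau_word mono_Cons mono_prod_list)
      show "[Gen_tau] \<in> lists (strand_gens m)" by (simp add: strand_gens_def)
      show "?w \<in> lists (strand_gens m)" by (rule l)
      show "word_perm m [Gen_tau] = word_perm m ?w" unfolding tau_word_perm[OF m] by simp
    qed
  next
    case (a_square i)
    have "S i \<circ> S i = id" using arg_cong[OF perm.s_sq[OF a_square(3)], of app] by (simp add: app)
    then show ?thesis
      by (intro strand[of "[Gen_s i, Gen_s i]" "[]"])
        (simp_all add: a_square(1,2) mono_simps mono_Nil sg[OF a_square(3)] gp del: gen_perm.simps o_apply)
  next
    case (a_comm i j)
    have "S i \<circ> S j = S j \<circ> S i"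
      using arg_cong[OF perm.s_comm[OF a_comm(3-5)], of app] by (simp add: app)
    then show ?thesis
      by (intro strand[of "[Gen_s i, Gen_s j]" "[Gen_s j, Gen_s i]"])
        (simp_all add: a_comm(1,2) mono_simps sg[OF a_comm(3)] sg[OF a_comm(4)] gp del: gen_perm.simps o_apply)
  next
    case (a_braid i)
    have "S i \<circ> S (i + 1) \<circ> S i = S (i + 1) \<circ> S i \<circ> S (i + 1)"
      using arg_cong[OF perm.s_braid[OF a_braid(3,4)], of app] by (simp add: app)
    then show ?thesis
      by (intro strand[of "[Gen_s i, Gen_s (i + 1), Gen_s i]" "[Gen_s (i + 1), Gen_s i, Gen_s (i + 1)]"])
        (simp_all add: a_braid(1,2) mono_simps sg[OF a_braid(3)] sg[OF a_braid(4), simplified] gp comp_assoc del: gen_perm.simps o_apply)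
  next
    case (b_square i)
    note i = b_square(3)
    have t: "exch m (int i) (int i + 0) = (\<lambda>j. j)" by (simp add: fun_eq_iff exch_shift[of m 0, simplified])
    have "on_top (\<lambda>j. j) = (\<lambda>v. v)" by (simp add: fun_eq_iff on_top_def prod_eq_iff)
    then have "composite (e_diagram m i) (e_diagram m i) = e_diagram m i"
      "card (loops m (e_diagram m i) (e_diagram m i)) = 1"
      using composite_e_wind_e[OF i, of 0] unfolding t by simp_all
    then show ?thesis
      using e[OF i] sg(3)[OF i]
      by (intro word[of "[Gen_e i, Gen_e i]" 1 "[Gen_e i]"]) (simp_all add: b_square mono_simps)
  next
    case (b_adj i j)
    note ij = b_adj(3-5)
    have "composite (e_diagram m i) (composite (e_diagram m j) (e_diagram m i)) = e_diagram m i \<and>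
      card (loops m (e_diagram m j) (e_diagram m i)) = 0 \<and>
      card (loops m (e_diagram m i) (composite (e_diagram m j) (e_diagram m i))) = 0"
    proof (cases "j = i + 1")
      case True
      then show ?thesis using composite_e_next[of i m] ij by simp
    next
      case False
      then have "i = j + 1" using ij by auto
      then show ?thesis using composite_e_previous[of j m] ij by simp
    qed
    then show ?thesis
      using e[OF ij(1)] sg(3)[OF ij(1)] sg(3)[OF ij(2)]
      by (intro word[of "[Gen_e i, Gen_e j, Gen_e i]" 0 "[Gen_e i]"]) (simp_all add: b_adj mono_simps)
  next
    case (c_ee i j)
    note ij = c_ee(3-5)
    have ji: "far j i" using ij by auto
    show ?thesis
      using e[OF ij(1)] e[OF ij(2)] sg(3)[OF ij(1)] sg(3)[OF ij(2)] composite_e_far[OF ij]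
        composite_e_far(2)[OF ij(2,1) ji]
      by (intro word[of "[Gen_e i, Gen_e j]" 0 "[Gen_e j, Gen_e i]"]) (simp_all add: c_ee(1,2) mono_simps)
  next
    case (c_se i j)
    note ij = c_se(3-5)
    have fx: "S i (int j) = int j" "S i (int j + 1) = int j + 1"
    proof -
      have mem: "i \<in> {1..m}" "j \<in> {1..m}" "i + 1 \<in> {1..m}" "j + 1 \<in> {1..m}" using ij by auto
      have ne: "j \<noteq> i" "j \<noteq> i + 1" "j + 1 \<noteq> i" "j + 1 \<noteq> i + 1" using ij(3) by auto
      have c: "int (i + 1) = int i + 1" "int (j + 1) = int j + 1" by simp_all
      show "S i (int j) = int j" "S i (int j + 1) = int j + 1"
        using residue_eq_iff[OF mem(2,1)] residue_eq_iff[OF mem(2,3)] residue_eq_iff[OF mem(4,1)]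
          residue_eq_iff[OF mem(4,3)] ne unfolding c S_def by (simp_all add: exch_def)
    qed
    have "dia m [Gen_s i, Gen_e j] = act (on_top (S i)) (e_diagram m j)" "loop_count m [Gen_s i, Gen_e j] = 0"
      using dia_strand_append[of "[Gen_s i]" m "[Gen_e j]"] sg(1,2)[OF ij(1)] sg(3)[OF ij(2)] e[OF ij(2)] gp(1)
      by (simp_all del: dia.simps loop_count.simps gen_perm.simps)
    moreover have "dia m [Gen_e j, Gen_s i] = act (on_top (S i)) (e_diagram m j)"
      "loop_count m [Gen_e j, Gen_s i] = 0"
      using dia_strand_word[of "[Gen_s i]" m] sg(1)[OF ij(1)] gp(1)[of i]
        composite_e_conj[OF ij(2) per(1) ij(2) fx] composite_e_strand(2)[OF ij(2) per(1) fx]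
      by (simp_all del: dia.simps(2) loop_count.simps(2) gen_perm.simps
          add: dia.simps(2)[of m "Gen_e j"] loop_count.simps(2)[of m "Gen_e j"])
    ultimately show ?thesis
      using sg(2)[OF ij(1)] sg(3)[OF ij(2)]
      by (intro word[of "[Gen_s i, Gen_e j]" 0 "[Gen_e j, Gen_s i]"]) (simp_all add: c_se(1,2) mono_simps del: dia.simps loop_count.simps)
  next
    case (f_et i j)
    note ij = f_et(3-5)
    have fx: "T j (int i) = int i" "T j (int i + 1) = int i + 1"
    proof -
      have mem: "i \<in> {1..m}" "i + 1 \<in> {1..m}" using ij by auto
      have ne: "i \<noteq> j" "i + 1 \<noteq> j" using ij(3) by auto
      have c: "int (i + 1) = int i + 1" by simp
      show "T j (int i) = int i" "T j (int i + 1) = int i + 1"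
        using residue_eq_iff[OF mem(1) ij(2)] residue_eq_iff[OF mem(2) ij(2)] ne
        unfolding c T_def by (simp_all add: exch_shift)
    qed
    have "dia m [Gen_t j, Gen_e i] = act (on_top (T j)) (e_diagram m i)" "loop_count m [Gen_t j, Gen_e i] = 0"
      using dia_strand_append[of "[Gen_t j]" m "[Gen_e i]"] tg(1,2)[OF ij(2)] sg(3)[OF ij(1)] e[OF ij(1)] gp(2)
      by (simp_all del: dia.simps loop_count.simps gen_perm.simps)
    moreover have "dia m [Gen_e i, Gen_t j] = act (on_top (T j)) (e_diagram m i)"
      "loop_count m [Gen_e i, Gen_t j] = 0"
      using dia_strand_word[of "[Gen_t j]" m] tg(1)[OF ij(2)] gp(2)[of j]
        composite_e_conj[OF ij(1) per(2) ij(1) fx] composite_e_strand(2)[OF ij(1) per(2) fx]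
      by (simp_all del: dia.simps(2) loop_count.simps(2) gen_perm.simps
          add: dia.simps(2)[of m "Gen_e i"] loop_count.simps(2)[of m "Gen_e i"])
    ultimately show ?thesis
      using tg(2)[OF ij(2)] sg(3)[OF ij(1)]
      by (intro word[of "[Gen_e i, Gen_t j]" 0 "[Gen_t j, Gen_e i]"]) (simp_all add: f_et(1,2) mono_simps del: dia.simps loop_count.simps)
  next
    case (d_left i j)
    note ij = d_left(3-5)
    have c: "composite (e_diagram m j) (e_diagram m i) = act (on_top (S i \<circ> S j)) (e_diagram m i) \<and>
      card (loops m (e_diagram m j) (e_diagram m i)) = 0"
    proof (cases "j = i + 1")
      case True
      then show ?thesis using composite_e_next(1,2)[of i m] ij by (simp add: S_def add.commute)
    next
      case False
      then have "i = j + 1" using ij by auto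
      then show ?thesis using composite_e_previous(1,2)[of j m] ij by (simp add: S_def add.commute)
    qed
    have "dia m [Gen_s i, Gen_s j, Gen_e i] = act (on_top (S i \<circ> S j)) (e_diagram m i)"
      "loop_count m [Gen_s i, Gen_s j, Gen_e i] = 0"
      using dia_strand_append[of "[Gen_s i, Gen_s j]" m "[Gen_e i]"] sg[OF ij(1)] sg[OF ij(2)] e[OF ij(1)] gp(1)
      by (simp_all del: dia.simps loop_count.simps gen_perm.simps o_apply)
    then show ?thesis
      using sg[OF ij(1)] sg[OF ij(2)] c e[OF ij(1)]
      by (intro word[of "[Gen_s i, Gen_s j, Gen_e i]" 0 "[Gen_e j, Gen_e i]"])
        (simp_all add: d_left(1,2) mono_simps)
  next
    case (d_right i j)
    note ij = d_right(3-5)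
    have fx: "(S j \<circ> S i) (int j) = int i" "(S j \<circ> S i) (int j + 1) = int i + 1"
      and c: "composite (e_diagram m i) (e_diagram m j) = act (on_top (S j \<circ> S i)) (e_diagram m j)"
        "card (loops m (e_diagram m i) (e_diagram m j)) = 0"
    proof -
      consider "j = i + 1" | "i = j + 1" using ij by fastforce
      then have "(S j \<circ> S i) (int j) = int i \<and> (S j \<circ> S i) (int j + 1) = int i + 1 \<and>
        composite (e_diagram m i) (e_diagram m j) = act (on_top (S j \<circ> S i)) (e_diagram m j) \<and>
        card (loops m (e_diagram m i) (e_diagram m j)) = 0"
      proof cases
        case 1
        then have i: "i \<in> {1..<m}" "i + 1 \<in> {1..<m}" using ij by auto
        note r = e_apart[OF i]
        have x: "int j = int i + 1" "int j + 1 = int i + 2" using 1 by simp_all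
        have "S i (int i + 1) = int i" "S i (int i + 2) = int i + 2" using r by (simp_all add: S_def)
        moreover have Sj: "S j = exch m (int i + 1) (int i + 2)" unfolding S_def x(2) unfolding x(1) ..
        moreover have "S j (int i) = int i" "S j (int i + 2) = int i + 1"
          unfolding Sj using exch_other[OF r(1)[symmetric] r(2)[symmetric]] exch_snd[OF r(3)] .
        ultimately show ?thesis using composite_e_previous(1,2)[OF i] 1 unfolding x o_apply by (simp add: S_def add.commute)
      next
        case 2
        then have i: "j \<in> {1..<m}" "j + 1 \<in> {1..<m}" using ij by auto
        note r = e_apart[OF i]
        have x: "int i = int j + 1" "int i + 1 = int j + 2" using 2 by simp_all
        have Si: "S i = exch m (int j + 1) (int j + 2)" unfolding S_def x(2) unfolding x(1) ..
        have "S i (int j) = int j" "S i (int j + 1) = int j + 2"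
          unfolding Si using exch_other[OF r(1)[symmetric] r(2)[symmetric]] exch_self .
        moreover have "S j (int j) = int j + 1" "S j (int j + 2) = int j + 2" using r by (simp_all add: S_def)
        ultimately show ?thesis using composite_e_next(1,2)[OF i] 2 unfolding x o_apply by (simp add: S_def add.commute)
      qed
      then show "(S j \<circ> S i) (int j) = int i" "(S j \<circ> S i) (int j + 1) = int i + 1"
        "composite (e_diagram m i) (e_diagram m j) = act (on_top (S j \<circ> S i)) (e_diagram m j)"
        "card (loops m (e_diagram m i) (e_diagram m j)) = 0" by blast+
    qed
    have p: "S j \<circ> S i \<in> periodic_perms m" using per by simp
    have "dia m [Gen_e i, Gen_s j, Gen_s i] = act (on_top (S j \<circ> S i)) (e_diagram m j)"
      "loop_count m [Gen_e i, Gen_s j, Gen_s i] = 0"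
      using dia_strand_word[of "[Gen_s j, Gen_s i]" m] sg(1)[OF ij(1)] sg(1)[OF ij(2)] gp(1)
        composite_e_conj[OF ij(1) p ij(2) fx] composite_e_strand(2)[OF ij(1) p fx]
      by (simp_all del: dia.simps(2) loop_count.simps(2) gen_perm.simps o_apply
          add: dia.simps(2)[of m "Gen_e i"] loop_count.simps(2)[of m "Gen_e i"])
    then show ?thesis
      using sg[OF ij(1)] sg[OF ij(2)] c e[OF ij(2)]
      by (intro word[of "[Gen_e i, Gen_s j, Gen_s i]" 0 "[Gen_e i, Gen_e j]"])
        (simp_all add: d_right(1,2) mono_simps del: dia.simps loop_count.simps,
          simp_all add: dia.simps(2)[of m "Gen_e i"] loop_count.simps(2)[of m "Gen_e i"] del: dia.simps loop_count.simps)
  next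
    case (d_se i)
    note i = d_se(3)
    have "dia m [Gen_s i, Gen_e i] = e_diagram m i" "loop_count m [Gen_s i, Gen_e i] = 0"
      using dia_strand_append[of "[Gen_s i]" m "[Gen_e i]"] sg[OF i] e[OF i] e_swap[OF i]
      by (simp_all del: dia.simps loop_count.simps)
    then show ?thesis
      using sg[OF i] e[OF i]
      by (intro word[of "[Gen_s i, Gen_e i]" 0 "[Gen_e i]"]) (simp_all add: d_se(1,2) mono_simps del: dia.simps loop_count.simps)
  next
    case (d_es i)
    note i = d_es(3)
    have "dia m [Gen_e i, Gen_s i] = e_diagram m i" "loop_count m [Gen_e i, Gen_s i] = 0"
      using dia_strand_word[of "[Gen_s i]" m] sg[OF i] composite_es[OF i]
      by (simp_all del: dia.simps(2) loop_count.simps(2)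
          add: dia.simps(2)[of m "Gen_e i"] loop_count.simps(2)[of m "Gen_e i"])
    then show ?thesis
      using sg[OF i] e[OF i]
      by (intro word[of "[Gen_e i, Gen_s i]" 0 "[Gen_e i]"]) (simp_all add: d_es(1,2) mono_simps del: dia.simps loop_count.simps)
  next
    case (e_st i j)
    have "S i \<circ> T j = T j \<circ> S i"
      using arg_cong[OF perm.st_far[OF e_st(3-5)], of app] by (simp add: app)
    then show ?thesis
      by (intro strand[of "[Gen_s i, Gen_t j]" "[Gen_t j, Gen_s i]"])
        (simp_all add: e_st(1,2) mono_simps sg[OF e_st(3)] tg[OF e_st(4)] gp del: gen_perm.simps o_apply)
  next
    case (g_tt i j)
    have "T i \<circ> T j = T j \<circ> T i"
      using arg_cong[OF perm.tt_comm[OF g_tt(3-4)], of app] by (simp add: app)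
    then show ?thesis
      by (intro strand[of "[Gen_t i, Gen_t j]" "[Gen_t j, Gen_t i]"])
        (simp_all add: g_tt(1,2) mono_simps tg[OF g_tt(3)] tg[OF g_tt(4)] gp del: gen_perm.simps o_apply)
  next
    case (h_st i)
    have mem: "i \<in> {1..m}" "i + 1 \<in> {1..m}" using h_st(3) by auto
    have "S i \<circ> T i = T (i + 1) \<circ> S i"
      using arg_cong[OF perm.st[OF h_st(3)], of app] by (simp add: app)
    then show ?thesis
      by (intro strand[of "[Gen_s i, Gen_t i]" "[Gen_t (i + 1), Gen_s i]"])
        (simp_all add: h_st(1,2) mono_simps sg[OF h_st(3)] tg[OF mem(1)] tg[OF mem(2), simplified] gp del: gen_perm.simps o_apply)
  next
    case (i_ett i)
    note i = i_ett(3)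
    have mem: "i \<in> {1..m}" "i + 1 \<in> {1..m}" using i by auto
    have T1: "T (i + 1) = exch m (int i + 1) (int i + 1 + int m)" by (simp add: T_def add.commute)
    have "dia m [Gen_e i, Gen_t i, Gen_t (i + 1)] = e_diagram m i"
      "loop_count m [Gen_e i, Gen_t i, Gen_t (i + 1)] = 0"
      using dia_strand_word[of "[Gen_t i, Gen_t (i + 1)]" m] tg[OF mem(1)] tg[OF mem(2)] gp(2)[of i] gp(2)[of "i + 1"]
        composite_e_shift[OF i, of "int m"] T1 T_def
      by (simp_all del: dia.simps(2) loop_count.simps(2) gen_perm.simps o_apply
          add: dia.simps(2)[of m "Gen_e i"] loop_count.simps(2)[of m "Gen_e i"])
    then show ?thesis
      using sg[OF i] tg[OF mem(1)] tg[OF mem(2)] e[OF i]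
      by (intro word[of "[Gen_e i, Gen_t i, Gen_t (i + 1)]" 0 "[Gen_e i]"])
        (simp_all add: i_ett(1,2) mono_simps del: dia.simps loop_count.simps)
  next
    case (i_tte i)
    note i = i_tte(3)
    have mem: "i \<in> {1..m}" "i + 1 \<in> {1..m}" using i by auto
    have T1: "T (i + 1) = exch m (int i + 1) (int i + 1 + int m)" by (simp add: T_def add.commute)
    have "dia m [Gen_t i, Gen_t (i + 1), Gen_e i] = e_diagram m i"
      "loop_count m [Gen_t i, Gen_t (i + 1), Gen_e i] = 0"
      using dia_strand_append[of "[Gen_t i, Gen_t (i + 1)]" m "[Gen_e i]"] tg[OF mem(1)] tg[OF mem(2)]
        sg[OF i] e[OF i] gp(2)[of i] gp(2)[of "i + 1"] e_shift[OF i, of "int m"] T1 T_def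
      by (simp_all del: dia.simps loop_count.simps gen_perm.simps o_apply)
    then show ?thesis
      using sg[OF i] tg[OF mem(1)] tg[OF mem(2)] e[OF i]
      by (intro word[of "[Gen_t i, Gen_t (i + 1), Gen_e i]" 0 "[Gen_e i]"])
        (simp_all add: i_tte(1,2) mono_simps del: dia.simps loop_count.simps)
  next
    case (j_ete i a)
    note i = j_ete(3)
    have mem: "i \<in> {1..m}" using i by auto
    let ?u = "if a \<ge> 0 then replicate (nat a) (Gen_t i) else replicate (nat (- a)) (Gen_t_inv i)"
    have u: "?u \<in> lists (strand_gens m)" using tg[OF mem] by (auto simp: in_lists_conv_set)
    have pw: "gt_powi i a = monomial ?u" by (simp add: gt_powi_def mono_power)
    have el: "[Gen_e i] \<in> lists (generators m)" using sg(3)[OF i] by simp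
    have ue: "?u @ [Gen_e i] \<in> lists (generators m)"
      unfolding append_in_lists_conv using subsetD[OF strand_gens_subset u] el by blast
    have d: "dia m (?u @ [Gen_e i]) = act (on_top (exch m (int i) (int i + a * int m))) (e_diagram m i)"
      "loop_count m (?u @ [Gen_e i]) = 0"
      using dia_strand_append[OF u el] e[OF i] word_perm_powi[OF mem, of a] by (simp_all only:)
    have "dia m (Gen_e i # ?u @ [Gen_e i]) = e_diagram m i" "loop_count m (Gen_e i # ?u @ [Gen_e i]) = 1"
      unfolding dia.simps(2)[of m "Gen_e i"] loop_count.simps(2)[of m "Gen_e i"] d generator_diagram.simps
      using composite_e_wind_e[OF i, of "a * int m"] by simp_all
    moreover have "l = monomial (Gen_e i # ?u @ [Gen_e i])"
      unfolding j_ete(1) pw by (simp add: var_def mono_mult)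
    ultimately show ?thesis
      using sg[OF i] e[OF i] ue
      by (intro word[of "Gen_e i # ?u @ [Gen_e i]" 1 "[Gen_e i]"])
        (simp_all add: j_ete(2) var_def del: dia.simps loop_count.simps)
  qed
qed

section \<open>The left regular representation\<close>

text \<open>
  Outside the carrier the map is the identity, so that the unit of the ring acts as the unit of
  the monoid.
\<close>

definition left_mult :: "('c, 'd) monoid_scheme \<Rightarrow> 'c \<Rightarrow> 'c endo" where
  "left_mult Q x = Endo (\<lambda>y. if y \<in> carrier Q then x \<otimes>\<^bsub>Q\<^esub> y else y)"

lemma (in monoid) left_mult_mult:
  "x \<in> carrier G \<Longrightarrow> y \<in> carrier G \<Longrightarrow> left_mult G (x \<otimes> y) = left_mult G x * left_mult G y"
  by (simp add: left_mult_def times_endo_def fun_eq_iff m_assoc)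

lemma (in monoid) left_mult_one: "left_mult G \<one> = 1"
  by (simp add: left_mult_def one_endo_def fun_eq_iff)

lemma (in monoid) left_mult_inj:
  assumes "x \<in> carrier G" "y \<in> carrier G" "left_mult G x = left_mult G y"
  shows "x = y"
  using arg_cong[OF assms(3), of "\<lambda>f. app f \<one>"] assms(1,2) by (simp add: left_mult_def)

section \<open>Normal words span the quotient\<close>

lemma mult_scale:
  fixes x y :: "'g list \<Rightarrow>\<^sub>0 'k::comm_ring_1"
  shows "x * scale c y = scale c (x * y)" "scale c x * y = scale c (x * y)"
proof -
  have "Poly_Mapping.keys x \<subseteq> UNIV" by simp
  then have "x * Poly_Mapping.single 0 c = Poly_Mapping.single 0 c * x"
  proof (induction rule: monomials_induct)
    case (single a d)
    show ?case by (simp add: mult_single mult.commute)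
  qed (simp_all add: distrib_left distrib_right)
  then show "x * scale c y = scale c (x * y)" "scale c x * y = scale c (x * y)"
    unfolding scale_eq_mult by (simp_all add: mult.assoc[symmetric])
qed

context
  fixes m :: nat and \<beta> :: "'k::comm_ring_1"
  assumes m: "1 \<le> m"
begin

private abbreviation "F \<equiv> free_algebra (generators m) :: ('k, 'k words) module"
private abbreviation "I \<equiv> relation_ideal m \<beta>"
private abbreviation "Q \<equiv> F Quot I"

private definition L :: "'k words \<Rightarrow> 'k words set endo" where
  "L x = left_mult Q (I +>\<^bsub>F\<^esub> x)"

private lemma F_ring: "ring F"
  by (rule free_algebra_ring)

lemma relation_closed:
  assumes "relation m \<beta> l r"
  shows "l \<in> carrier F" "r \<in> carrier F"
proof -
  obtain w n w' where w: "l = monomial w" "r = scale (\<beta> ^ n) (monomial w')"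
    "w \<in> lists (generators m)" "w' \<in> lists (generators m)"
    using relation_words[OF assms m] by blast
  show "l \<in> carrier F" using w by simp
  show "r \<in> carrier F" using w keys_scale[of "\<beta> ^ n" "monomial w'"] by auto
qed

private lemma gens_closed: "{l - r | l r. relation m \<beta> l r} \<subseteq> carrier F"
proof
  fix x assume "x \<in> {l - r | l r. relation m \<beta> l r}"
  then obtain l r where x: "x = l - r" "relation m \<beta> l r" by blast
  then show "x \<in> carrier F"
    using relation_closed[OF x(2)] keys_diff[of l r] by auto
qed

private lemma I_ideal: "ideal I F"
  unfolding relation_ideal_def by (rule ring.genideal_ideal[OF F_ring gens_closed])

private lemma Q_ring: "ring Q"
  by (rule ideal.quotient_is_ring[OF I_ideal])

private lemma coset_hom: "(+>\<^bsub>F\<^esub>) I \<in> ring_hom F Q"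
  by (rule ideal.rcos_ring_hom[OF I_ideal])

private lemma coset_closed: "x \<in> carrier F \<Longrightarrow> I +>\<^bsub>F\<^esub> x \<in> carrier Q"
  using ring_hom_closed[OF coset_hom] .

private lemma L_mult:
  assumes "x \<in> carrier F" "y \<in> carrier F"
  shows "L (x * y) = L x * L y"
proof -
  interpret Q: ring Q by (rule Q_ring)
  have "I +>\<^bsub>F\<^esub> (x * y) = (I +>\<^bsub>F\<^esub> x) \<otimes>\<^bsub>Q\<^esub> (I +>\<^bsub>F\<^esub> y)"
    using ring_hom_mult[OF coset_hom assms] by simp
  then show ?thesis unfolding L_def using Q.left_mult_mult coset_closed assms by metis
qed

private lemma L_one: "L 1 = 1"
proof -
  interpret Q: ring Q by (rule Q_ring)
  have "I +>\<^bsub>F\<^esub> 1 = \<one>\<^bsub>Q\<^esub>" using ring_hom_one[OF coset_hom] by simp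
  then show ?thesis unfolding L_def using Q.left_mult_one by metis
qed

private lemma L_eq_iff:
  assumes "x \<in> carrier F" "y \<in> carrier F"
  shows "L x = L y \<longleftrightarrow> x - y \<in> I"
proof -
  interpret Q: ring Q by (rule Q_ring)
  have "L x = L y \<longleftrightarrow> I +>\<^bsub>F\<^esub> x = I +>\<^bsub>F\<^esub> y"
    unfolding L_def using Q.left_mult_inj[OF coset_closed[OF assms(1)] coset_closed[OF assms(2)]] by metis
  then show ?thesis
    using ring.quotient_eq_iff_same_a_r_cos[OF F_ring I_ideal assms] free_algebra_minus[OF assms] by simp
qed

private lemma L_relation:
  assumes "relation m \<beta> l r"
  shows "L l = L r"
proof -
  have "l - r \<in> {l - r | l r. relation m \<beta> l r}" using assms by blast
  then have "l - r \<in> I"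
    unfolding relation_ideal_def using ring.genideal_self[OF F_ring gens_closed] by blast
  then show ?thesis using L_eq_iff relation_closed[OF assms] by blast
qed

private lemma var_closed: "g \<in> generators m \<Longrightarrow> var g \<in> carrier F"
  by (simp add: var_def)

private lemma mult_closed: "x \<in> carrier F \<Longrightarrow> y \<in> carrier F \<Longrightarrow> x * y \<in> carrier F"
  by (simp add: keys_mult_lists)

private lemma one_closed: "1 \<in> carrier F"
  using ring.ring_simprules(6)[OF F_ring] by simp

private lemma scale_closed: "x \<in> carrier F \<Longrightarrow> scale c x \<in> carrier F"
  unfolding free_algebra_simps mem_Collect_eq by (rule order_trans[OF keys_scale])

private lemma L_power:
  assumes "x \<in> carrier F"
  shows "x ^ n \<in> carrier F" "L (x ^ n) = L x ^ n"
proof -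
  have "x ^ n \<in> carrier F \<and> L (x ^ n) = L x ^ n"
    by (induction n) (use one_closed L_one mult_closed[OF assms] L_mult[OF assms] in auto)
  then show "x ^ n \<in> carrier F" "L (x ^ n) = L x ^ n" by blast+
qed

private definition bL :: "'k words set endo" where "bL = L (scale \<beta> 1)"

private lemma L_scale:
  assumes "x \<in> carrier F"
  shows "L (scale \<beta> x) = bL * L x"
  using L_mult[OF scale_closed[OF one_closed, of \<beta>] assms] mult_scale(2)[of \<beta> 1 x] by (simp add: bL_def)

private lemma L_scale_right:
  assumes "x \<in> carrier F"
  shows "L x * bL = bL * L x"
  using L_mult[OF assms scale_closed[OF one_closed, of \<beta>]] mult_scale(1)[of x \<beta> 1] L_scale[OF assms]
  by (simp add: bL_def)

private lemma L_scale_power: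
  assumes "x \<in> carrier F"
  shows "L (scale (\<beta> ^ n) x) = bL ^ n * L x"
proof (induction n)
  case (Suc n)
  have "L (scale (\<beta> ^ Suc n) x) = L (scale \<beta> (scale (\<beta> ^ n) x))" by simp
  also have "\<dots> = bL * (bL ^ n * L x)" unfolding L_scale[OF scale_closed[OF assms]] Suc ..
  finally show ?case by (simp add: mult.assoc)
qed simp

private abbreviation "s \<equiv> \<lambda>i. L (gs i)"
private abbreviation "t \<equiv> \<lambda>i. L (gt i)"
private abbreviation "t' \<equiv> \<lambda>i. L (gt_inv i)"
private abbreviation "eL \<equiv> \<lambda>i. L (ge i)"

private lemma gs_closed: "i \<in> {1..<m} \<Longrightarrow> gs i \<in> carrier F"
  by (rule var_closed) (simp add: generators_def)

private lemma ge_closed: "i \<in> {1..<m} \<Longrightarrow> ge i \<in> carrier F"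
  by (rule var_closed) (simp add: generators_def)

private lemma gt_closed: "i \<in> {1..m} \<Longrightarrow> gt i \<in> carrier F"
  by (rule var_closed) (simp add: generators_def)

private lemma gt_inv_closed: "i \<in> {1..m} \<Longrightarrow> gt_inv i \<in> carrier F"
  by (rule var_closed) (simp add: generators_def)

private lemmas closed = gs_closed ge_closed gt_closed gt_inv_closed mult_closed

private lemma L_mult3:
  assumes "x \<in> carrier F" "y \<in> carrier F" "z \<in> carrier F"
  shows "L (x * y * z) = L x * L y * L z"
  by (simp only: L_mult assms mult_closed)

private lemma L_gt_powi:
  assumes "i \<in> {1..m}"
  shows "gt_powi i a \<in> carrier F" "L (gt_powi i a) = gen_pow t t' i a"
  unfolding gt_powi_def gen_pow_def
  using L_power[OF gt_closed[OF assms]] L_power[OF gt_inv_closed[OF assms]] by simp_all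

text \<open>This makes normal forms available in the quotient.\<close>

private lemma quotient_affine_brauer: "affine_brauer m s t t' eL bL"
proof
  show "1 \<le> m" by (rule m)
next
  fix i assume i: "i \<in> {1..m}"
  show "t i * t' i = 1" using L_relation[OF t_inv_right[OF i]] L_mult[OF gt_closed[OF i] gt_inv_closed[OF i]] L_one by simp
  show "t' i * t i = 1" using L_relation[OF t_inv_left[OF i]] L_mult[OF gt_inv_closed[OF i] gt_closed[OF i]] L_one by simp
  show "t i * bL = bL * t i" by (rule L_scale_right[OF gt_closed[OF i]])
  fix j assume j: "j \<in> {1..m}"
  show "t i * t j = t j * t i"
    using L_relation[OF g_tt[OF i j]] L_mult[OF gt_closed[OF i] gt_closed[OF j]] L_mult[OF gt_closed[OF j] gt_closed[OF i]] by simp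
next
  fix i assume i: "i \<in> {1..<m}"
  note si = gs_closed[OF i] and ei = ge_closed[OF i]
  have i1: "i \<in> {1..m}" "i + 1 \<in> {1..m}" using i by auto
  note ti = gt_closed[OF i1(1)] and ti1 = gt_closed[OF i1(2)]
  show "s i * s i = 1" using L_relation[OF a_square[OF i]] L_mult[OF si si] L_one by (simp add: power2_eq_square)
  show "s i * bL = bL * s i" by (rule L_scale_right[OF si])
  show "eL i * bL = bL * eL i" by (rule L_scale_right[OF ei])
  show "s i * t i = t (i + 1) * s i"
    using L_relation[OF h_st[OF i]] unfolding L_mult[OF si ti] L_mult[OF ti1 si] .
  show "eL i * gen_pow t t' i a * eL i = bL * eL i" for a
    using L_relation[OF j_ete[OF i]]
    unfolding L_mult3[OF ei L_gt_powi(1)[OF i1(1)] ei] L_gt_powi(2)[OF i1(1)] L_scale[OF ei] .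
  show "s i * eL i = eL i" using L_relation[OF d_se[OF i]] unfolding L_mult[OF si ei] .
  show "eL i * s i = eL i" using L_relation[OF d_es[OF i]] unfolding L_mult[OF ei si] .
  show "eL i * t i * t (i + 1) = eL i" using L_relation[OF i_ett[OF i]] unfolding L_mult3[OF ei ti ti1] .
  show "t i * t (i + 1) * eL i = eL i" using L_relation[OF i_tte[OF i]] unfolding L_mult3[OF ti ti1 ei] .
  {
    assume j: "i + 1 \<in> {1..<m}"
    note sj = gs_closed[OF j]
    show "s i * s (i + 1) * s i = s (i + 1) * s i * s (i + 1)"
      using L_relation[OF a_braid[OF i j]] unfolding L_mult3[OF si sj si] L_mult3[OF sj si sj] .
  }
  {
    fix j assume j: "j \<in> {1..m}" "far i j"
    note tj = gt_closed[OF j(1)]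
    show "s i * t j = t j * s i"
      using L_relation[OF e_st[OF i j]] unfolding L_mult[OF si tj] L_mult[OF tj si] .
    show "eL i * t j = t j * eL i"
      using L_relation[OF f_et[OF i j]] unfolding L_mult[OF ei tj] L_mult[OF tj ei] .
  }
  fix j assume j: "j \<in> {1..<m}"
  note sj = gs_closed[OF j] and ej = ge_closed[OF j]
  show "far i j \<Longrightarrow> s i * s j = s j * s i"
    using L_relation[OF a_comm[OF i j]] unfolding L_mult[OF si sj] L_mult[OF sj si] .
  show "far i j \<Longrightarrow> eL i * eL j = eL j * eL i"
    using L_relation[OF c_ee[OF i j]] unfolding L_mult[OF ei ej] L_mult[OF ej ei] .
  show "far i j \<Longrightarrow> s i * eL j = eL j * s i"
    using L_relation[OF c_se[OF i j]] unfolding L_mult[OF si ej] L_mult[OF ej si] .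
  show "adj i j \<Longrightarrow> s i * s j * eL i = eL j * eL i"
    using L_relation[OF d_left[OF i j]] unfolding L_mult3[OF si sj ei] L_mult[OF ej ei] .
  show "adj i j \<Longrightarrow> eL i * s j * s i = eL i * eL j"
    using L_relation[OF d_right[OF i j]] unfolding L_mult3[OF ei sj si] L_mult[OF ei ej] .
qed

interpretation affine_brauer m s t t' eL bL
  by (rule quotient_affine_brauer)

private lemma monomial_closed: "w \<in> lists (generators m) \<Longrightarrow> monomial w \<in> carrier F"
  by simp

private lemma L_Cons:
  assumes "g \<in> generators m" "w \<in> lists (generators m)"
  shows "L (monomial (g # w)) = L (var g) * L (monomial w)"
  unfolding mono_Cons by (rule L_mult[OF var_closed[OF assms(1)] monomial_closed[OF assms(2)]])

private lemma L_st_word: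
  assumes "w \<in> lists (strand_gens m)" "\<And>g. g \<in> set w \<Longrightarrow> L (var g) = rho (gen_perm m g)"
  shows "L (monomial w) = rho (word_perm m w)"
  using assms
proof (induction w)
  case Nil
  then show ?case by (simp add: mono_Nil L_one)
next
  case (Cons g w)
  then have g: "g \<in> strand_gens m" "g \<in> generators m" "w \<in> lists (generators m)"
    using strand_gens_subset by (auto simp: generators_eq)
  have w: "w \<in> lists (strand_gens m)" using Cons by simp
  have "L (monomial w) = rho (word_perm m w)" "L (var g) = rho (gen_perm m g)" using Cons by simp_all
  then show ?case
    unfolding L_Cons[OF g(2,3)] word_perm.simps rho_comp[OF strand_gen(2)[OF g(1)] word_perm_periodic[OF w]]
    by (simp only:)
qed

private lemma L_strand_gen:
  assumes "g \<in> strand_gens m"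
  shows "L (var g) = rho (gen_perm m g)"
proof -
  have s: "L (var g) = rho (gen_perm m g)" if "g \<in> Gen_s ` {1..<m} \<union> Gen_t ` {1..m} \<union> Gen_t_inv ` {1..m}" for g
    using that rho_s rho_lt[of _ True] rho_lt[of _ False] by (auto simp: lt_def)
  have tau: "L gtau = rho (\<lambda>j. j + 1)"
  proof -
    let ?w = "Gen_t 1 # map Gen_s [1..<m]"
    have w: "?w \<in> lists (strand_gens m)" "set ?w \<subseteq> Gen_s ` {1..<m} \<union> Gen_t ` {1..m} \<union> Gen_t_inv ` {1..m}"
      using m by (auto simp: strand_gens_def in_lists_conv_set)
    have "L gtau = L (monomial ?w)"
      using L_relation[OF tau_word] by (simp only: mono_Cons mono_prod_list)
    also have "\<dots> = rho (word_perm m ?w)" using w s by (intro L_st_word) blast+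
    finally show ?thesis unfolding tau_word_perm[OF m] .
  qed
  have tau_inv: "L gtau_inv = rho (\<lambda>j. j - 1)"
  proof -
    have c: "gtau_inv \<in> carrier F" "gtau \<in> carrier F" by (simp_all add: var_def generators_def)
    have "L gtau_inv * L gtau = 1" using L_relation[OF tau_inv_left] L_mult[OF c] L_one by simp
    moreover have "rho (\<lambda>j. j - 1) * L gtau = 1"
      unfolding tau using rho_comp[OF translation_periodic(2,1)] by (simp add: comp_def)
    ultimately show ?thesis unfolding tau using rho_cancel_right[OF translation_periodic(1)] by metis
  qed
  show ?thesis using assms s tau tau_inv by (auto simp: strand_gens_def)
qed

text \<open>
  Read from right to left, the letters act on the normal form as they act on the diagram, and
  each removed loop contributes a factor.
\<close>

private lemma L_word_normal:
  assumes "w \<in> lists (generators m)"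
  shows "\<exists>z. normal (dia m w) z \<and> L (monomial w) = bL ^ loop_count m w * z"
  using assms
proof (induction w)
  case Nil
  have "normal (strand_diagram (\<lambda>j. j)) (rho (\<lambda>j. j))" by (rule normal.strand) simp
  then show ?case by (intro exI[of _ 1]) (simp add: mono_Nil L_one)
next
  case (Cons g w)
  then have g: "g \<in> generators m" and w: "w \<in> lists (generators m)" by simp_all
  obtain z where z: "normal (dia m w) z" "L (monomial w) = bL ^ loop_count m w * z" using Cons by auto
  have comm: "L (var g) * bL ^ n = bL ^ n * L (var g)" for n
    using power_intertwine[of bL "L (var g)" "L (var g)" 1] power_commuting_commutes[OF L_scale_right[OF var_closed[OF g], symmetric], of n]
    by simp
  have Lw: "L (monomial (g # w)) = bL ^ loop_count m w * (L (var g) * z)"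
    unfolding L_Cons[OF g w] z(2) using comm by (simp add: mult.assoc[symmetric])
  show ?case
  proof (cases "g \<in> strand_gens m")
    case True
    have "normal (dia m (g # w)) (L (var g) * z)"
      unfolding dia_strand_Cons[OF True w] L_strand_gen[OF True]
      by (rule normal_relabel[OF z(1) strand_gen(2)[OF True]])
    then show ?thesis using Lw dia_strand_Cons(2)[OF True w] by auto
  next
    case False
    then obtain i where i: "g = Gen_e i" "i \<in> {1..<m}" using g unfolding generators_eq by auto
    note D = dia_affine[OF w]
    obtain u where u: "{(int i, 1), u} \<in> dia m w" using arc_exists[OF D, of "(int i, 1)"] by auto
    obtain z' where z': "eL i * z = (if cls m u = cls m (int i + 1, 1) then bL else 1) * z'"
      "normal (act (vexch m u (int i + 1, 1)) (dia m w)) z'"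
      using normal_e[OF z(1) i(2) u] by blast
    have n: "normal (dia m (g # w)) z'" using z'(2) composite_e[OF i(2) D u] i(1) by simp
    have "L (monomial (g # w)) = bL ^ loop_count m (g # w) * z'"
    proof (cases "cls m u = cls m (int i + 1, 1)")
      case True
      then have "loop_count m (g # w) = Suc (loop_count m w)" using card_loops_e[OF i(2) D u] i(1) by simp
      then show ?thesis
        unfolding Lw using z'(1) True i(1) by (simp add: mult.assoc[symmetric] power_commutes)
    next
      case False
      then have "loop_count m (g # w) = loop_count m w" using card_loops_e[OF i(2) D u] i(1) by simp
      then show ?thesis unfolding Lw using z'(1) False i(1) by simp
    qed
    then show ?thesis using n by blast
  qed
qed

text \<open>
  Each step of the induction is a product with generators. It creates no loop, since the last
  cup-cap is only applied where it meets two through strands.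
\<close>

private lemma word_exists:
  assumes "D \<in> affine_diagrams m"
  shows "\<exists>w\<in>lists (generators m). dia m w = D \<and> loop_count m w = 0"
  using m assms
proof (induction rule: affine_diagram_induct)
  case (strand p)
  then obtain w where "w \<in> lists (strand_gens m)" "word_perm m w = p" using strand_word_exists[OF m] by blast
  then show ?case using dia_strand_word strand_gens_subset by blast
next
  case (join D x y)
  then obtain w where w: "w \<in> lists (generators m)" "dia m w = D" "loop_count m w = 0" by blast
  have i: "m - 1 \<in> {1..<m}" "int (m - 1) = int m - 1" using join.hyps(2) by auto
  have u: "{(int (m - 1), 1), (x, 0)} \<in> D" unfolding i(2) by (rule join.hyps(3))
  have "composite (e_diagram m (m - 1)) D = act (vexch m (x, 0) (int m, 1)) D"
    "card (loops m (e_diagram m (m - 1)) D) = 0"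
    using composite_e[OF i(1) join.hyps(1) u] card_loops_e[OF i(1) join.hyps(1) u] unfolding i(2) by simp_all
  then show ?case using w i(1) by (intro bexI[of _ "Gen_e (m - 1) # w"]) (simp_all add: generators_def)
next
  case (relabel D p)
  then obtain w where w: "w \<in> lists (generators m)" "dia m w = D" "loop_count m w = 0" by blast
  obtain v where v: "v \<in> lists (strand_gens m)" "word_perm m v = p" using strand_word_exists[OF m relabel.hyps(2)] by blast
  have "v @ w \<in> lists (generators m)" using v(1) w(1) strand_gens_subset by auto
  then show ?case using dia_strand_append[OF v(1) w(1)] v(2) w by (intro bexI[of _ "v @ w"]) simp_all
qed

private definition word_of :: "diagram \<Rightarrow> generator list" where
  "word_of D = (SOME w. w \<in> lists (generators m) \<and> dia m w = D \<and> loop_count m w = 0)"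

private lemma word_of:
  assumes "D \<in> affine_diagrams m"
  shows "word_of D \<in> lists (generators m)" "dia m (word_of D) = D" "loop_count m (word_of D) = 0"
proof -
  have "\<exists>w. w \<in> lists (generators m) \<and> dia m w = D \<and> loop_count m w = 0" using word_exists[OF assms] by blast
  from someI_ex[OF this] show "word_of D \<in> lists (generators m)" "dia m (word_of D) = D" "loop_count m (word_of D) = 0"
    unfolding word_of_def by blast+
qed

text \<open>
  A word and the chosen loop-free word for its diagram have normal forms for the same diagram;
  by uniqueness they differ only by a power of \<open>\<beta>\<close> modulo the relations.
\<close>

private lemma reduce_to_words:
  assumes "x \<in> carrier F"
  shows "x - lin_ext (\<lambda>D. monomial (word_of D)) (evaluate m \<beta> x) \<in> I"
proof -
  interpret I: ideal I F by (rule I_ideal)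
  note add_sub = ideal.axioms(1)[OF I_ideal]
  have keys: "Poly_Mapping.keys x \<subseteq> lists (generators m)" using assms by simp
  show ?thesis
    using keys
  proof (induction rule: monomials_induct)
    case zero
    show ?case using additive_subgroup.zero_closed[OF add_sub] by (simp add: evaluate_def)
  next
    case (add x y)
    then show ?case using additive_subgroup.a_closed[OF add_sub add] by (simp add: evaluate_def lin_ext_add algebra_simps)
  next
    case (single w c)
    note D = dia_affine[OF single]
    obtain z where z: "normal (dia m w) z" "L (monomial w) = bL ^ loop_count m w * z"
      using L_word_normal[OF single] by blast
    obtain z' where z': "normal (dia m w) z'" "L (monomial (word_of (dia m w))) = z'"
      using L_word_normal[OF word_of(1)[OF D]] word_of(2,3)[OF D] by auto
    let ?v = "scale (\<beta> ^ loop_count m w) (monomial (word_of (dia m w)))"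
    have cl: "monomial w \<in> carrier F" "monomial (word_of (dia m w)) \<in> carrier F"
      using monomial_closed single word_of(1)[OF D] by blast+
    have "L (monomial w) = L ?v"
      unfolding L_scale_power[OF cl(2)] z(2) z'(2) using normal_unique[OF z(1) z'(1)] by simp
    then have "monomial w - ?v \<in> I" using L_eq_iff[OF cl(1) scale_closed[OF cl(2)]] by blast
    moreover have "scale c 1 \<in> carrier F" by (rule scale_closed[OF one_closed])
    ultimately have "scale c 1 \<otimes>\<^bsub>F\<^esub> (monomial w - ?v) \<in> I" by (rule I.I_l_closed)
    moreover have "scale c 1 \<otimes>\<^bsub>F\<^esub> (monomial w - ?v) = scale c (monomial w) - scale c ?v"
      by (simp add: mult_scale(2) right_diff_distrib del: scale_simps)
    ultimately show ?case by (simp add: evaluate_def)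
  qed
qed

private lemma evaluate_relation:
  assumes "relation m \<beta> l r"
  shows "evaluate m \<beta> l = evaluate m \<beta> r"
proof -
  obtain w n w' where w: "l = monomial w" "r = scale (\<beta> ^ n) (monomial w')"
    "dia m w = dia m w'" "loop_count m w = n + loop_count m w'"
    using relation_words[OF assms m] by blast
  then show ?thesis by (simp add: evaluate_def power_add)
qed

private lemma evaluate_surj: "evaluate m \<beta> ` carrier F = carrier (aBr m \<beta>)"
proof
  show "evaluate m \<beta> ` carrier F \<subseteq> carrier (aBr m \<beta>)"
    using ring_hom_closed[OF evaluate_hom[OF m]] by blast
  show "carrier (aBr m \<beta>) \<subseteq> evaluate m \<beta> ` carrier F"
  proof
    fix y assume "y \<in> carrier (aBr m \<beta>)"
    then have y: "Poly_Mapping.keys y \<subseteq> affine_diagrams m" by simp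
    let ?x = "lin_ext (\<lambda>D. monomial (word_of D)) y"
    have "Poly_Mapping.keys ?x \<subseteq> lists (generators m)"
      by (rule keys_lin_ext) (use y word_of(1) in auto)
    moreover have "evaluate m \<beta> ?x = y"
      using y
    proof (induction rule: monomials_induct)
      case (single D c)
      then show ?case using word_of[OF single] by (simp add: evaluate_def)
    qed (simp_all add: evaluate_def lin_ext_add)
    ultimately show "y \<in> evaluate m \<beta> ` carrier F" by (intro image_eqI[of _ _ ?x]) simp_all
  qed
qed

text \<open>As an image of the free algebra the diagram algebra inherits the ring axioms.\<close>

private lemma aBr_ring: "ring (aBr m \<beta>)"
proof -
  have "ring (aBr m \<beta> \<lparr>carrier := evaluate m \<beta> ` carrier F, zero := evaluate m \<beta> \<zero>\<^bsub>F\<^esub>\<rparr>)"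
    by (rule ring.ring_hom_imp_img_ring[OF F_ring evaluate_hom[OF m]])
  moreover have "evaluate m \<beta> \<zero>\<^bsub>F\<^esub> = 0" by (simp add: evaluate_def)
  ultimately show ?thesis unfolding evaluate_surj by (simp add: aBr_def)
qed

private lemma evaluate_ring_hom: "ring_hom_ring F (aBr m \<beta>) (evaluate m \<beta>)"
  by (rule ring_hom_ringI2[OF F_ring aBr_ring evaluate_hom[OF m]])

private lemma mem_kernel:
  "x \<in> a_kernel F (aBr m \<beta>) (evaluate m \<beta>) \<longleftrightarrow> x \<in> carrier F \<and> evaluate m \<beta> x = 0"
  unfolding a_kernel_def' mem_Collect_eq aBr_simps(4) ..

private lemma kernel: "a_kernel F (aBr m \<beta>) (evaluate m \<beta>) = I"
proof
  interpret ring_hom_ring F "aBr m \<beta>" "evaluate m \<beta>" by (rule evaluate_ring_hom)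
  show "a_kernel F (aBr m \<beta>) (evaluate m \<beta>) \<subseteq> I"
  proof
    fix x assume "x \<in> a_kernel F (aBr m \<beta>) (evaluate m \<beta>)"
    then have x: "x \<in> carrier F" "evaluate m \<beta> x = 0" unfolding mem_kernel by blast+
    show "x \<in> I" using reduce_to_words[OF x(1)] unfolding x(2) lin_ext_zero diff_zero .
  qed
  have "{l - r | l r. relation m \<beta> l r} \<subseteq> a_kernel F (aBr m \<beta>) (evaluate m \<beta>)"
  proof
    fix x assume x: "x \<in> {l - r | l r. relation m \<beta> l r}"
    then obtain l r where "x = l - r" "relation m \<beta> l r" by blast
    then have "evaluate m \<beta> x = 0"
      using evaluate_relation[of l r] by (simp add: evaluate_def lin_ext_diff)
    moreover have "x \<in> carrier F" using x gens_closed by blast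
    ultimately show "x \<in> a_kernel F (aBr m \<beta>) (evaluate m \<beta>)" unfolding mem_kernel by blast
  qed
  then show "I \<subseteq> a_kernel F (aBr m \<beta>) (evaluate m \<beta>)"
    unfolding relation_ideal_def by (rule ring.genideal_minimal[OF F_ring kernel_is_ideal])
qed

lemma presentation_iso:
  "\<exists>\<phi> \<in> ring_iso Q (aBr m \<beta>). \<forall>x\<in>carrier F. \<phi> (I +>\<^bsub>F\<^esub> x) = evaluate m \<beta> x"
proof -
  interpret ring_hom_ring F "aBr m \<beta>" "evaluate m \<beta>" by (rule evaluate_ring_hom)
  show ?thesis
  proof (intro bexI ballI)
    show "(\<lambda>X. the_elem (evaluate m \<beta> ` X)) \<in> ring_iso Q (aBr m \<beta>)"
      using FactRing_iso_set[OF evaluate_surj] unfolding kernel .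
    show "the_elem (evaluate m \<beta> ` (I +>\<^bsub>F\<^esub> x)) = evaluate m \<beta> x" if "x \<in> carrier F" for x
      using the_elem_simp[OF that] unfolding kernel .
  qed
qed

end

theorem proposition2p3p4:
  fixes m :: nat and \<beta> :: "'k::comm_ring_1"
  assumes "m \<ge> 1"
  shows "let F = (free_algebra (generators m) :: ('k, 'k words) module);
             I = relation_ideal m \<beta>
    in \<exists>\<phi> \<in> ring_iso (F Quot I) (aBr m \<beta>).
      (\<forall>c. \<forall>x\<in>carrier F. \<phi> (I +>\<^bsub>F\<^esub> (c \<odot>\<^bsub>F\<^esub> x)) = c \<odot>\<^bsub>aBr m \<beta>\<^esub> \<phi> (I +>\<^bsub>F\<^esub> x)) \<and>
      (\<forall>g\<in>generators m. \<phi> (I +>\<^bsub>F\<^esub> var g) = Poly_Mapping.single (generator_diagram m g) 1)"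
proof -
  let ?F = "free_algebra (generators m) :: ('k, 'k words) module" and ?I = "relation_ideal m \<beta>"
  obtain \<phi> where \<phi>: "\<phi> \<in> ring_iso (?F Quot ?I) (aBr m \<beta>)"
    and ev: "\<And>x. x \<in> carrier ?F \<Longrightarrow> \<phi> (?I +>\<^bsub>?F\<^esub> x) = evaluate m \<beta> x"
    using presentation_iso[OF assms] by blast
  have "\<phi> (?I +>\<^bsub>?F\<^esub> (c \<odot>\<^bsub>?F\<^esub> x)) = c \<odot>\<^bsub>aBr m \<beta>\<^esub> \<phi> (?I +>\<^bsub>?F\<^esub> x)" if x: "x \<in> carrier ?F" for c x
  proof -
    have "c \<odot>\<^bsub>?F\<^esub> x \<in> carrier ?F" using x keys_scale[of c x] by auto
    then show ?thesis using ev x by (simp add: evaluate_def lin_ext_scale)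
  qed
  moreover have "\<phi> (?I +>\<^bsub>?F\<^esub> var g) = Poly_Mapping.single (generator_diagram m g) 1"
    if g: "g \<in> generators m" for g
  proof -
    have "var g \<in> carrier ?F" using g by (simp add: var_def)
    then show ?thesis using ev dia_generator[OF g] by (simp add: evaluate_def var_def del: dia.simps loop_count.simps)
  qed
  ultimately show ?thesis unfolding Let_def using \<phi> by blast
qed

end
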